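(* Let $M$ be an oriented biconservative hypersurface of index $2$ in the pseudo-Euclidean space $\mathbb E^5_2$. Assume that, with respect to an orthonormal frame field $\{e_1=\nabla H/\|\nabla H\|,e_2,e_3,e_4\}$ of principal directions, its shape operator has the form $$S=\mathrm{diag}(k_1,k_2,k_2,k_4),\qquad k_4\neq k_2,$$ for some non-vanishing smooth functions $k_1,k_2,k_4$. Then $M$ is (locally) congruent to one of the following eight types of hypersurfaces, for some smooth functions $\phi_1=\phi_1(s)$ and $\phi_2=\phi_2(s)$: (i) $x(s,t,u,v)=(\phi_2\sinh v,\phi_1\cosh t,\phi_1\sinh t\cos u,\phi_1\sinh t\sin u,\phi_2\cosh v)$, with $\phi_1'^2-\phi_2'^2=1$; (ii) $x(s,t,u,v)=(\phi_2\cos v,\phi_2\sin v,\phi_1\cos t,\phi_1\sin t\cos u,\phi_1\sin t\sin u)$, with $\phi_1'^2-\phi_2'^2=-1$; (iii) $x(s,t,u,v)=(\phi_1\cosh t\sin u,\phi_1\cosh t\cos u,\phi_1\sinh t,\phi_2\cos v,\phi_2\sin v)$, with $\phi_1'^2-\phi_2'^2=1$; (iv) $x(s,t,u,v)=(\phi_2\sinh v,\phi_1\sinh t,\phi_1\cosh t\cos u,\phi_1\cosh t\sin u,\phi_2\cosh v)$, with $\phi_1'^2+\phi_2'^2=1$; (v) $x(s,t,u,v)=(\phi_2\cosh v,\phi_1\sinh t,\phi_1\cosh t\cos u,\phi_1\cosh t\sin u,\phi_2\sinh v)$, with $\phi_1'^2-\phi_2'^2=-1$; (vi) $x(s,t,u,v)=(\phi_1\sinh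 t\cos u,\phi_1\sinh t\sin u,\phi_1\cosh t,\phi_2\cos v,\phi_2\sin v)$, with $\phi_1'^2+\phi_2'^2=1$; (vii) the hypersurface $$x(s,t,u,v)=\left(\tfrac s2(t^2+u^2-v^2)-av^2+\psi,\;v(2a+s),\;st,\;su,\;\tfrac s2(t^2+u^2-v^2)-av^2+\psi-s\right)$$ for a non-zero constant $a$ and a smooth function $\psi=\psi(s)$ such that $1-2\psi'<0$; (viii) the hypersurface $$x(s,t,u,v)=\left(\tfrac s2(t^2-u^2-v^2)+av^2+\psi,\;st,\;su,\;v(s-2a),\;\tfrac s2(t^2-u^2-v^2)+av^2+\psi+s\right)$$ for a non-zero constant $a$ and a smooth function $\psi=\psi(s)$ such that $1+2\psi'<0$.
   Context: $\mathbb E^5_2$ is $\mathbb R^5$ with the metric $\langle\cdot,\cdot\rangle=-dx_1^2-dx_2^2+dx_3^2+dx_4^2+dx_5^2$. Hypersurfaces are smooth and connected. A hypersurface $x:M\to\mathbb E^5_2$ of index $2$ is one whose induced metric is non-degenerate of index $2$; its unit normal $N$ then satisfies $\langle N,N\rangle=1$. The shape operator is $S(X)=-\widetilde\nabla_XN$, where $\widetilde\nabla$ is the flat connection of $\mathbb E^5_2$, and the mean curvature is $H=\frac14\operatorname{tr}S$. $\nabla H$ is the gradient of $H$ for the induced metric and $\|\nabla H\|=|\langle\nabla H,\nabla H\rangle|^{1/2}$. $M$ is biconservative if the tangential part of $\Delta^2x$ vanishes identically ($\Delta$ the Laplace operator of $M$); for these hypersurfaces this is equivalent to $S(\nabla H)=-2H\nabla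 H$. Standing assumptions: $\nabla H$ vanishes nowhere and is nowhere light-like, so that $e_1=\nabla H/\|\nabla H\|$ is a unit principal direction with principal curvature $k_1=-2H$; moreover $k_1$ differs everywhere from the other principal curvatures. The result is local: "congruent to one of" means that every point of $M$ has a neighbourhood which, up to an isometry of $\mathbb E^5_2$, is parametrized by one of the listed maps on some open set of parameters $(s,t,u,v)$. Primes denote $d/ds$. *)

theory Defs
  imports "HOL-Analysis.Analysis"
begin

section \<open>Smooth maps between open sets\<close>

text \<open>
  \<open>S\<close> is always open below.  The derivatives of order \<open>k\<close> are taken as iterated directional
  derivatives, so that all of them are functions into the same type.
\<close>

primrec Ck_on :: "nat \<Rightarrow> 'a::euclidean_space set \<Rightarrow> ('a \<Rightarrow> 'b::real_normed_vector) \<Rightarrow> bool" where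
  "Ck_on 0 S f \<longleftrightarrow> continuous_on S f"
| "Ck_on (Suc k) S f \<longleftrightarrow>
     (\<forall>y\<in>S. f differentiable (at y)) \<and>
     (\<forall>v. Ck_on k S (\<lambda>y. frechet_derivative f (at y) v))"

definition smooth_on :: "'a::euclidean_space set \<Rightarrow> ('a \<Rightarrow> 'b::real_normed_vector) \<Rightarrow> bool" where
  "smooth_on S f \<longleftrightarrow> (\<forall>k. Ck_on k S f)"


section \<open>The pseudo-Euclidean space of dimension 5 and index 2\<close>

definition sprod :: "real^5 \<Rightarrow> real^5 \<Rightarrow> real" where
  "sprod v w = - (v$1 * w$1) - v$2 * w$2 + v$3 * w$3 + v$4 * w$4 + v$5 * w$5"

definition pnorm :: "real^5 \<Rightarrow> real" where
  "pnorm v = sqrt \<bar>sprod v v\<bar>"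

definition lightlike :: "real^5 \<Rightarrow> bool" where
  "lightlike v \<longleftrightarrow> v \<noteq> 0 \<and> sprod v v = 0"

definition nondegenerate_on :: "(real^5) set \<Rightarrow> bool" where
  "nondegenerate_on T \<longleftrightarrow> (\<forall>v\<in>T. (\<forall>w\<in>T. sprod v w = 0) \<longrightarrow> v = 0)"

definition index_on :: "(real^5) set \<Rightarrow> nat" where
  "index_on T =
     Max {dim V | V. subspace V \<and> V \<subseteq> T \<and> (\<forall>v\<in>V. v \<noteq> 0 \<longrightarrow> sprod v v < 0)}"

definition isometry_E52 :: "(real^5 \<Rightarrow> real^5) \<Rightarrow> bool" where
  "isometry_E52 F \<longleftrightarrow>
     bij F \<and> smooth_on UNIV F \<and> smooth_on UNIV (inv F) \<and>
     (\<forall>y v w. sprod (frechet_derivative F (at y) v) (frechet_derivative F (at y) w) = sprod v w)"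


section \<open>Smooth manifolds of dimension 4\<close>

text \<open>
  A manifold is given by an atlas.  Its underlying set is the union of the chart domains, an open
  subset of a type whose class supplies the Hausdorff property and the second countability.
\<close>

type_synonym 'm chart4 = "'m set \<times> ('m \<Rightarrow> real^4)"

definition chart :: "'m::topological_space chart4 \<Rightarrow> bool" where
  "chart = (\<lambda>(U, \<phi>). open U \<and> open (\<phi> ` U) \<and> homeomorphism U (\<phi> ` U) \<phi> (inv_into U \<phi>))"

definition compatible :: "'m chart4 \<Rightarrow> 'm chart4 \<Rightarrow> bool" where
  "compatible = (\<lambda>(U, \<phi>) (V, \<psi>).
     smooth_on (\<phi> ` (U \<inter> V)) (\<psi> \<circ> inv_into U \<phi>) \<and>
     smooth_on (\<psi> ` (U \<inter> V)) (\<phi> \<circ> inv_into V \<psi>))"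

definition smooth_atlas :: "'m::topological_space chart4 set \<Rightarrow> bool" where
  "smooth_atlas A \<longleftrightarrow> (\<forall>c\<in>A. chart c) \<and> (\<forall>c\<in>A. \<forall>d\<in>A. compatible c d)"

definition points :: "'m chart4 set \<Rightarrow> 'm set" where
  "points A = (\<Union>c\<in>A. fst c)"

text \<open>The charts of the maximal atlas containing \<open>A\<close>.\<close>

definition smooth_chart :: "'m::topological_space chart4 set \<Rightarrow> 'm chart4 \<Rightarrow> bool" where
  "smooth_chart A c \<longleftrightarrow> chart c \<and> fst c \<subseteq> points A \<and> (\<forall>d\<in>A. compatible c d)"

text \<open>Smoothness on an open subset \<open>W\<close> of the manifold.\<close>

definition smooth_map :: "'m chart4 set \<Rightarrow> 'm set \<Rightarrow> ('m \<Rightarrow> 'b::real_normed_vector) \<Rightarrow> bool" where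
  "smooth_map A W f \<longleftrightarrow> (\<forall>(U, \<phi>)\<in>A. smooth_on (\<phi> ` (U \<inter> W)) (f \<circ> inv_into U \<phi>))"

definition chart_at :: "'m chart4 set \<Rightarrow> 'm \<Rightarrow> 'm chart4" where
  "chart_at A p = (SOME c. c \<in> A \<and> p \<in> fst c)"

text \<open>
  The differential of \<open>f\<close> at \<open>p\<close>, with the abstract tangent space at \<open>p\<close> identified with the
  coordinate space of one chosen chart.
\<close>

definition differential ::
    "'m chart4 set \<Rightarrow> ('m \<Rightarrow> 'b::real_normed_vector) \<Rightarrow> 'm \<Rightarrow> real^4 \<Rightarrow> 'b" where
  "differential A f p =
     (case chart_at A p of (U, \<phi>) \<Rightarrow> frechet_derivative (f \<circ> inv_into U \<phi>) (at (\<phi> p)))"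


section \<open>Hypersurfaces\<close>

text \<open>
  For an immersion \<open>x\<close>, tangent vectors at \<open>p\<close> are represented by their images in the ambient space
  under the differential of \<open>x\<close>, and vector fields by maps into the ambient space.  All notions
  below are independent of the chart that \<^const>\<open>chart_at\<close> selects.
\<close>

definition tangent_space :: "'m chart4 set \<Rightarrow> ('m \<Rightarrow> real^5) \<Rightarrow> 'm \<Rightarrow> (real^5) set" where
  "tangent_space A x p = range (differential A x p)"

text \<open>
  The derivative of \<open>f\<close> at \<open>p\<close> in the direction of the tangent vector \<open>v\<close>; when \<open>f\<close> has values in the
  ambient space, this is the flat connection.
\<close>

definition dir_deriv ::
    "'m chart4 set \<Rightarrow> ('m \<Rightarrow> real^5) \<Rightarrow> ('m \<Rightarrow> 'b::real_normed_vector) \<Rightarrow> 'm \<Rightarrow> real^5 \<Rightarrow> 'b" where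
  "dir_deriv A x f p v = differential A f p (inv (differential A x p) v)"

text \<open>The trace of an endomorphism of the tangent space at \<open>p\<close>.\<close>

definition tangent_trace ::
    "'m chart4 set \<Rightarrow> ('m \<Rightarrow> real^5) \<Rightarrow> 'm \<Rightarrow> (real^5 \<Rightarrow> real^5) \<Rightarrow> real" where
  "tangent_trace A x p L =
     trace (matrix (inv (differential A x p) \<circ> L \<circ> differential A x p))"

definition gradient ::
    "'m chart4 set \<Rightarrow> ('m \<Rightarrow> real^5) \<Rightarrow> ('m \<Rightarrow> real) \<Rightarrow> 'm \<Rightarrow> real^5" where
  "gradient A x f p =
     (THE v. v \<in> tangent_space A x p \<and>
             (\<forall>w\<in>tangent_space A x p. sprod v w = dir_deriv A x f p w))"

text \<open>
  A unit normal field \<open>N\<close> on the whole manifold is the datum of an orientation.  It has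
  \<open>sprod (N p) (N p) = 1\<close> because the index of the tangent spaces is already 2.
\<close>

definition oriented_hypersurface_index2 ::
    "'m::{t2_space,second_countable_topology} chart4 set \<Rightarrow>
     ('m \<Rightarrow> real^5) \<Rightarrow> ('m \<Rightarrow> real^5) \<Rightarrow> bool" where
  "oriented_hypersurface_index2 A x N \<longleftrightarrow>
     smooth_atlas A \<and> connected (points A) \<and>
     smooth_map A (points A) x \<and> smooth_map A (points A) N \<and>
     (\<forall>p\<in>points A.
        inj (differential A x p) \<and>
        nondegenerate_on (tangent_space A x p) \<and>
        index_on (tangent_space A x p) = 2 \<and>
        sprod (N p) (N p) = 1 \<and>
        (\<forall>v\<in>tangent_space A x p. sprod (N p) v = 0))"

definition shape_op ::
    "'m chart4 set \<Rightarrow> ('m \<Rightarrow> real^5) \<Rightarrow> ('m \<Rightarrow> real^5) \<Rightarrow> 'm \<Rightarrow> real^5 \<Rightarrow> real^5" where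
  "shape_op A x N p v = - dir_deriv A x N p v"

definition mean_curv ::
    "'m chart4 set \<Rightarrow> ('m \<Rightarrow> real^5) \<Rightarrow> ('m \<Rightarrow> real^5) \<Rightarrow> 'm \<Rightarrow> real" where
  "mean_curv A x N p = 1/4 * tangent_trace A x p (shape_op A x N p)"

definition tangential_part :: "('m \<Rightarrow> real^5) \<Rightarrow> 'm \<Rightarrow> real^5 \<Rightarrow> real^5" where
  "tangential_part N p v = v - sprod v (N p) *\<^sub>R N p"

text \<open>
  By the Gauss formula, the Levi-Civita connection of the induced metric is the tangential part of
  the flat connection; the divergence of a tangent vector field is the trace of its covariant
  derivative.
\<close>

definition divergence ::
    "'m chart4 set \<Rightarrow> ('m \<Rightarrow> real^5) \<Rightarrow> ('m \<Rightarrow> real^5) \<Rightarrow> ('m \<Rightarrow> real^5) \<Rightarrow> 'm \<Rightarrow> real" where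
  "divergence A x N Y p =
     tangent_trace A x p (\<lambda>v. tangential_part N p (dir_deriv A x Y p v))"

definition laplace ::
    "'m chart4 set \<Rightarrow> ('m \<Rightarrow> real^5) \<Rightarrow> ('m \<Rightarrow> real^5) \<Rightarrow> ('m \<Rightarrow> real) \<Rightarrow> 'm \<Rightarrow> real" where
  "laplace A x N f = divergence A x N (gradient A x f)"

definition vec_laplace ::
    "'m chart4 set \<Rightarrow> ('m \<Rightarrow> real^5) \<Rightarrow> ('m \<Rightarrow> real^5) \<Rightarrow> ('m \<Rightarrow> real^5) \<Rightarrow> 'm \<Rightarrow> real^5" where
  "vec_laplace A x N f p = (\<chi> i. laplace A x N (\<lambda>q. f q $ i) p)"

text \<open>The opposite sign convention for the Laplace operator gives the same notion.\<close>

definition biconservative ::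
    "'m chart4 set \<Rightarrow> ('m \<Rightarrow> real^5) \<Rightarrow> ('m \<Rightarrow> real^5) \<Rightarrow> bool" where
  "biconservative A x N \<longleftrightarrow>
     (\<forall>p\<in>points A. tangential_part N p (vec_laplace A x N (vec_laplace A x N x) p) = 0)"

definition orthonormal_tangent_frame ::
    "'m chart4 set \<Rightarrow> ('m \<Rightarrow> real^5) \<Rightarrow> 'm set \<Rightarrow> (nat \<Rightarrow> 'm \<Rightarrow> real^5) \<Rightarrow> bool" where
  "orthonormal_tangent_frame A x W e \<longleftrightarrow>
     (\<forall>i\<in>{1..4}. smooth_map A W (e i)) \<and>
     (\<forall>q\<in>W. \<forall>i\<in>{1..4}.
        e i q \<in> tangent_space A x q \<and>
        \<bar>sprod (e i q) (e i q)\<bar> = 1 \<and>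
        (\<forall>j\<in>{1..4}. i \<noteq> j \<longrightarrow> sprod (e i q) (e j q) = 0))"

text \<open>
  Near \<open>p\<close>, the hypersurface is, up to an isometry of the ambient space, parametrized by
  \<open>X s t u v\<close>, where \<open>(s, t, u, v)\<close> runs through an open set of parameters with \<open>s \<in> I\<close>.
  The parametrization is the inverse of the chart \<open>\<kappa>\<close>.
\<close>

definition congruent_near ::
    "'m::topological_space chart4 set \<Rightarrow> ('m \<Rightarrow> real^5) \<Rightarrow> 'm \<Rightarrow> real set \<Rightarrow>
     (real \<Rightarrow> real \<Rightarrow> real \<Rightarrow> real \<Rightarrow> real^5) \<Rightarrow> bool" where
  "congruent_near A x p I X \<longleftrightarrow>
     (\<exists>F W \<kappa>. isometry_E52 F \<and> smooth_chart A (W, \<kappa>) \<and> p \<in> W \<and>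
        (\<forall>q\<in>W. \<kappa> q $ 1 \<in> I \<and>
                F (x q) = X (\<kappa> q $ 1) (\<kappa> q $ 2) (\<kappa> q $ 3) (\<kappa> q $ 4)))"


section \<open>The eight families\<close>

definition family_i :: "(real \<Rightarrow> real) \<Rightarrow> (real \<Rightarrow> real) \<Rightarrow> real \<Rightarrow> real \<Rightarrow> real \<Rightarrow> real \<Rightarrow> real^5" where
  "family_i \<phi>1 \<phi>2 s t u v = vector
     [\<phi>2 s * sinh v, \<phi>1 s * cosh t, \<phi>1 s * sinh t * cos u, \<phi>1 s * sinh t * sin u, \<phi>2 s * cosh v]"

definition family_ii :: "(real \<Rightarrow> real) \<Rightarrow> (real \<Rightarrow> real) \<Rightarrow> real \<Rightarrow> real \<Rightarrow> real \<Rightarrow> real \<Rightarrow> real^5" where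
  "family_ii \<phi>1 \<phi>2 s t u v = vector
     [\<phi>2 s * cos v, \<phi>2 s * sin v, \<phi>1 s * cos t, \<phi>1 s * sin t * cos u, \<phi>1 s * sin t * sin u]"

definition family_iii :: "(real \<Rightarrow> real) \<Rightarrow> (real \<Rightarrow> real) \<Rightarrow> real \<Rightarrow> real \<Rightarrow> real \<Rightarrow> real \<Rightarrow> real^5" where
  "family_iii \<phi>1 \<phi>2 s t u v = vector
     [\<phi>1 s * cosh t * sin u, \<phi>1 s * cosh t * cos u, \<phi>1 s * sinh t, \<phi>2 s * cos v, \<phi>2 s * sin v]"

definition family_iv :: "(real \<Rightarrow> real) \<Rightarrow> (real \<Rightarrow> real) \<Rightarrow> real \<Rightarrow> real \<Rightarrow> real \<Rightarrow> real \<Rightarrow> real^5" where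
  "family_iv \<phi>1 \<phi>2 s t u v = vector
     [\<phi>2 s * sinh v, \<phi>1 s * sinh t, \<phi>1 s * cosh t * cos u, \<phi>1 s * cosh t * sin u, \<phi>2 s * cosh v]"

definition family_v :: "(real \<Rightarrow> real) \<Rightarrow> (real \<Rightarrow> real) \<Rightarrow> real \<Rightarrow> real \<Rightarrow> real \<Rightarrow> real \<Rightarrow> real^5" where
  "family_v \<phi>1 \<phi>2 s t u v = vector
     [\<phi>2 s * cosh v, \<phi>1 s * sinh t, \<phi>1 s * cosh t * cos u, \<phi>1 s * cosh t * sin u, \<phi>2 s * sinh v]"

definition family_vi :: "(real \<Rightarrow> real) \<Rightarrow> (real \<Rightarrow> real) \<Rightarrow> real \<Rightarrow> real \<Rightarrow> real \<Rightarrow> real \<Rightarrow> real^5" where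
  "family_vi \<phi>1 \<phi>2 s t u v = vector
     [\<phi>1 s * sinh t * cos u, \<phi>1 s * sinh t * sin u, \<phi>1 s * cosh t, \<phi>2 s * cos v, \<phi>2 s * sin v]"

definition family_vii :: "real \<Rightarrow> (real \<Rightarrow> real) \<Rightarrow> real \<Rightarrow> real \<Rightarrow> real \<Rightarrow> real \<Rightarrow> real^5" where
  "family_vii a \<psi> s t u v = vector
     [s / 2 * (t\<^sup>2 + u\<^sup>2 - v\<^sup>2) - a * v\<^sup>2 + \<psi> s,
      v * (2 * a + s),
      s * t,
      s * u,
      s / 2 * (t\<^sup>2 + u\<^sup>2 - v\<^sup>2) - a * v\<^sup>2 + \<psi> s - s]"

definition family_viii :: "real \<Rightarrow> (real \<Rightarrow> real) \<Rightarrow> real \<Rightarrow> real \<Rightarrow> real \<Rightarrow> real \<Rightarrow> real^5" where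
  "family_viii a \<psi> s t u v = vector
     [s / 2 * (t\<^sup>2 - u\<^sup>2 - v\<^sup>2) + a * v\<^sup>2 + \<psi> s,
      s * t,
      s * u,
      v * (s - 2 * a),
      s / 2 * (t\<^sup>2 - u\<^sup>2 - v\<^sup>2) + a * v\<^sup>2 + \<psi> s + s]"

end

theory Submission
  imports Defs
begin

text \<open>
  Write \<open>e1, ..., e4\<close> for the given frame, \<open>\<epsilon>1, ..., \<epsilon>4\<close> for the signs of its vectors and
  \<open>S = diag (k1, k2, k2, k4)\<close> for the shape operator.  The position vector has Laplacian
  \<open>4 H N\<close>, and the tangential part of the Laplacian of \<open>4 H N\<close> is \<open>- (2 S + 4 H) (grad (4 H))\<close>;
  so biconservativity says \<open>k1 = - 2 H\<close>, that is \<open>3 k1 + 2 k2 + k4 = 0\<close>, while \<open>k1\<close> is constant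
  along the leaves orthogonal to \<open>e1\<close> (lemmas \<open>lap_X\<close>, \<open>sprod_lap_trS_N\<close>, \<open>biconservative_frame\<close>).

  The equations of Codazzi leave three connection coefficients that matter: \<open>l2\<close> and \<open>l4\<close>, the
  rates of change of \<open>e1\<close> along \<open>e2, e3\<close> and along \<open>e4\<close>, and \<open>\<mu>\<close>, the rate of change of \<open>e4\<close> along
  \<open>e2, e3\<close>, which is proportional to \<open>e4 (k2)\<close>.  The heart of the proof is \<open>\<mu> = 0\<close> (lemma \<open>\<mu>_zero\<close>).
  Differentiating the linear relation between the curvatures twice along \<open>e1\<close> and then along
  \<open>e4\<close> gives polynomial relations between \<open>k1\<close>, \<open>k2\<close>, \<open>l2\<close>, \<open>l4\<close>; where \<open>\<mu>\<close> does not vanish they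
  reduce to \<open>(l4 - l2)^2 + 3 \<epsilon>1 (k1 + k2)^2 = 0\<close>, and one more derivative along \<open>e4\<close> leaves
  \<open>\<mu> (k1 + k2)^3 = 0\<close>.  But \<open>k1 + k2 = 0\<close> would mean \<open>k4 = k2\<close>.

  Hence all coefficients are functions of the arc length \<open>s\<close> of the integral curves of \<open>e1\<close>, and the
  Gauss equation for \<open>e2, e4\<close> says that \<open>C2 = k2 e1 + l2 N\<close> and \<open>C4 = k4 e1 + l4 N\<close> are orthogonal.
  The direction of \<open>C2\<close> varies only along \<open>e4\<close>, that of \<open>C4\<close> only along \<open>e2, e3\<close>, both at
  the rate \<open>w = k4 l2 - k2 l4\<close>, and \<open>w\<close> satisfies a linear homogeneous differential equation; so
  near a given point \<open>w\<close> either has no zero or vanishes identically.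

  If \<open>w \<noteq> 0\<close>, then \<open>C2\<close> and \<open>C4\<close> are not null, the ambient space is the orthogonal sum of the constant
  plane spanned by \<open>C2, e4\<close> and the constant 3-space spanned by \<open>C4, e2, e3\<close>, and
  \<open>x = c + f1 A + f2 B\<close>, where \<open>A\<close> and \<open>B\<close> are the normalised \<open>C4\<close> and \<open>C2\<close> and \<open>f1, f2\<close> depend
  on \<open>s\<close> only (lemma \<open>orthogonal_decomposition\<close>).  So \<open>A\<close> and \<open>B\<close> run through unit quadrics of the
  two summands.  The possible signatures give the families (i) to (vi), the
  condition on \<open>\<phi>1', \<phi>2'\<close> being \<open>\<langle>e1, e1\<rangle> = \<epsilon>1\<close> (lemma \<open>split_classified\<close>).

  If \<open>w = 0\<close>, then \<open>C2\<close> and \<open>C4\<close> are multiples of one null vector field of constant direction \<open>n\<close>.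
  In a basis containing \<open>n\<close> and a complementary null vector \<open>m\<close>, the coefficient of \<open>m\<close> in \<open>x - c\<close> serves,
  up to sign, as the parameter \<open>s\<close>; the three coefficients orthogonal to \<open>n\<close> and \<open>m\<close> are affine in \<open>s\<close>
  and linear in one parameter each, and the coefficient of \<open>n\<close> is quadratic in these plus a function
  \<open>\<psi>\<close> of \<open>s\<close>.  These are the families (vii) and (viii)
  (lemma \<open>null_classified\<close>).

  All this is done in one chart, where the frame vectors become vector fields on an open subset
  of \<open>real^4\<close>.  In each case the parameters are constructed as smooth functions of the
  point; that they form a chart follows from the inverse function theorem, because the immersion
  factors through them (lemma \<open>locally_parametrizedI\<close>).
\<close>

section \<open>Calculus of smooth maps\<close>

lemma Ck_on_cong:
  assumes "open S" "\<And>y. y \<in> S \<Longrightarrow> f y = g y" "Ck_on k S f"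
  shows "Ck_on k S g"
  using assms(2,3)
proof (induction k arbitrary: f g)
  case 0
  then show ?case using continuous_on_cong[of S S f g] by simp
next
  case (Suc k)
  have hd: "(g has_derivative frechet_derivative f (at y)) (at y)" if "y \<in> S" for y
  proof (rule has_derivative_transform_within_open[OF _ \<open>open S\<close> that])
    show "(f has_derivative frechet_derivative f (at y)) (at y)"
      using Suc.prems that by (simp flip: frechet_derivative_works)
  qed (use Suc.prems in simp)
  then have eq: "frechet_derivative f (at y) v = frechet_derivative g (at y) v" if "y \<in> S" for y v
    using frechet_derivative_at that by metis
  have "Ck_on k S (\<lambda>y. frechet_derivative g (at y) v)" for v
    by (rule Suc.IH[of "\<lambda>y. frechet_derivative f (at y) v"]) (use eq Suc.prems in auto)
  then show ?case using hd by (auto simp: differentiable_def)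
qed

lemma Ck_on_Suc_imp: "Ck_on (Suc k) S f \<Longrightarrow> Ck_on k S f"
proof (induction k arbitrary: f)
  case 0
  then show ?case
    using differentiable_imp_continuous_on[of f S] differentiable_at_withinI[of f _ S]
    by (auto simp: differentiable_on_def)
next
  case (Suc k)
  from Suc.prems have "\<forall>y\<in>S. f differentiable (at y)"
    and "\<And>v. Ck_on (Suc k) S (\<lambda>y. frechet_derivative f (at y) v)"
    by auto
  then show ?case using Suc.IH by auto
qed

lemma Ck_on_subset: "Ck_on k S f \<Longrightarrow> T \<subseteq> S \<Longrightarrow> Ck_on k T f"
  by (induction k arbitrary: f) (auto intro: continuous_on_subset)

lemma Ck_on_SucI:
  assumes "open S" "\<And>y. y \<in> S \<Longrightarrow> (f has_derivative f' y) (at y)"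
    and "\<And>v. Ck_on k S (\<lambda>y. f' y v)"
  shows "Ck_on (Suc k) S f"
proof -
  have *: "f' y = frechet_derivative f (at y)" if "y \<in> S" for y
    using frechet_derivative_at[OF assms(2)] that by blast
  have "Ck_on k S (\<lambda>y. frechet_derivative f (at y) v)" for v
    by (rule Ck_on_cong[OF assms(1) _ assms(3)[of v]]) (simp add: *)
  then show ?thesis using assms(2) by (auto simp: differentiable_def)
qed

lemma Ck_on_has_derivative:
  "Ck_on (Suc k) S f \<Longrightarrow> y \<in> S \<Longrightarrow> (f has_derivative frechet_derivative f (at y)) (at y)"
  by (auto simp: frechet_derivative_works)

lemma Ck_on_const: "open S \<Longrightarrow> Ck_on k S (\<lambda>y. c)"
proof (induction k arbitrary: c)
  case (Suc k)
  then show ?case by (intro Ck_on_SucI[where f'="\<lambda>_ _. 0"]) auto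
qed simp

lemma Ck_on_linear: "open S \<Longrightarrow> bounded_linear f \<Longrightarrow> Ck_on k S f"
proof (cases k)
  case 0
  then show "bounded_linear f \<Longrightarrow> ?thesis"
    by (simp add: linear_continuous_on)
next
  case (Suc m)
  show ?thesis if "open S" "bounded_linear f"
    unfolding Suc by (rule Ck_on_SucI[where f'="\<lambda>_. f"])
       (use that in \<open>auto intro: bounded_linear_imp_has_derivative Ck_on_const\<close>)
qed

lemma Ck_on_add: "open S \<Longrightarrow> Ck_on k S f \<Longrightarrow> Ck_on k S g \<Longrightarrow> Ck_on k S (\<lambda>y. f y + g y)"
proof (induction k arbitrary: f g)
  case 0
  then show ?case by (simp add: continuous_on_add)
next
  case (Suc k)
  show ?case
    by (rule Ck_on_SucI[OF \<open>open S\<close> has_derivative_add[OF Ck_on_has_derivative[OF Suc.prems(2)]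
            Ck_on_has_derivative[OF Suc.prems(3)]]])
       (use Suc in auto)
qed

lemma Ck_on_bilinear:
  assumes "bounded_bilinear B"
  shows "open S \<Longrightarrow> Ck_on k S f \<Longrightarrow> Ck_on k S g \<Longrightarrow> Ck_on k S (\<lambda>y. B (f y) (g y))"
proof (induction k arbitrary: f g)
  case 0
  then show ?case using bounded_bilinear.continuous_on[OF assms] by simp
next
  case (Suc k)
  show ?case
    by (rule Ck_on_SucI[OF \<open>open S\<close> bounded_bilinear.FDERIV[OF assms Ck_on_has_derivative[OF Suc.prems(2)]
            Ck_on_has_derivative[OF Suc.prems(3)]]])
       (use Suc Ck_on_Suc_imp[OF Suc.prems(2)] Ck_on_Suc_imp[OF Suc.prems(3)]
         in \<open>auto intro!: Ck_on_add\<close>)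
qed

lemma Ck_on_sum:
  "open S \<Longrightarrow> (\<And>i. i \<in> I \<Longrightarrow> Ck_on k S (f i)) \<Longrightarrow> Ck_on k S (\<lambda>y. \<Sum>i\<in>I. f i y)"
  by (induction I rule: infinite_finite_induct) (auto intro: Ck_on_const Ck_on_add)

text \<open>The derivatives of \<open>Ck_on\<close> are taken in fixed directions.  The expansion in a basis turns a
  derivative in a variable direction into a finite sum of those, which is what the chain rule and
  derivatives along vector fields need.\<close>

lemma has_derivative_basis_expansion:
  fixes f :: "'a::euclidean_space \<Rightarrow> 'b::real_normed_vector"
  assumes "(f has_derivative f') F"
  shows "f' v = (\<Sum>b\<in>Basis. (v \<bullet> b) *\<^sub>R f' b)"
proof -
  have l: "linear f'" using assms has_derivative_linear by blast
  have "f' v = f' (\<Sum>b\<in>Basis. (v \<bullet> b) *\<^sub>R b)" by (simp add: euclidean_representation)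
  then show ?thesis by (simp add: linear_sum[OF l] linear_scale[OF l])
qed

lemma Ck_on_compose:
  assumes "open S" "open T"
  shows "Ck_on k T f \<Longrightarrow> Ck_on k S g \<Longrightarrow> g ` S \<subseteq> T \<Longrightarrow> Ck_on k S (\<lambda>y. f (g y))"
proof (induction k arbitrary: f)
  case 0
  then show ?case using continuous_on_compose2 by auto
next
  case (Suc k)
  note g = Ck_on_has_derivative[OF Suc.prems(2)]
  note f = Ck_on_has_derivative[OF Suc.prems(1)]
  have "((\<lambda>y. f (g y)) has_derivative
      (\<lambda>v. \<Sum>b\<in>Basis. (frechet_derivative g (at y) v \<bullet> b) *\<^sub>R frechet_derivative f (at (g y)) b)) (at y)"
    if "y \<in> S" for y
  proof -
    have gy: "g y \<in> T" using that Suc.prems(3) by auto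
    show ?thesis
      using has_derivative_compose[OF g[OF that] f[OF gy]]
      by (subst (asm) has_derivative_basis_expansion[OF f[OF gy]])
  qed
  moreover have "Ck_on k S (\<lambda>y. \<Sum>b\<in>Basis. (frechet_derivative g (at y) v \<bullet> b) *\<^sub>R frechet_derivative f (at (g y)) b)" for v
  proof (intro Ck_on_sum Ck_on_bilinear[OF bounded_bilinear_scaleR] Ck_on_bilinear[OF bounded_bilinear_inner] Ck_on_const assms)
    show "Ck_on k S (\<lambda>y. frechet_derivative g (at y) v)" using Suc.prems by auto
    show "Ck_on k S (\<lambda>y. frechet_derivative f (at (g y)) b)" for b
      using Suc.prems Ck_on_Suc_imp[OF Suc.prems(2)] by (intro Suc.IH) auto
  qed
  ultimately show ?case by (rule Ck_on_SucI[OF \<open>open S\<close>])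
qed

named_theorems smooth_intros

lemma smooth_on_cong: "open S \<Longrightarrow> (\<And>y. y \<in> S \<Longrightarrow> f y = g y) \<Longrightarrow> smooth_on S f \<Longrightarrow> smooth_on S g"
  unfolding smooth_on_def by (intro allI, erule allE) (rule Ck_on_cong)

lemma smooth_on_subset: "smooth_on S f \<Longrightarrow> T \<subseteq> S \<Longrightarrow> smooth_on T f"
  unfolding smooth_on_def by (auto intro: Ck_on_subset)

lemma smooth_on_const [smooth_intros]: "open S \<Longrightarrow> smooth_on S (\<lambda>y. c)"
  unfolding smooth_on_def by (auto intro: Ck_on_const)

lemma smooth_on_linear: "open S \<Longrightarrow> bounded_linear f \<Longrightarrow> smooth_on S f"
  unfolding smooth_on_def by (auto intro: Ck_on_linear)

lemma smooth_on_id [smooth_intros]: "open S \<Longrightarrow> smooth_on S (\<lambda>y. y)"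
  using smooth_on_linear[OF _ bounded_linear_ident] by blast

lemma smooth_on_add [smooth_intros]:
  "open S \<Longrightarrow> smooth_on S f \<Longrightarrow> smooth_on S g \<Longrightarrow> smooth_on S (\<lambda>y. f y + g y)"
  unfolding smooth_on_def by (auto intro: Ck_on_add)

lemma smooth_on_bilinear:
  "bounded_bilinear B \<Longrightarrow> open S \<Longrightarrow> smooth_on S f \<Longrightarrow> smooth_on S g \<Longrightarrow> smooth_on S (\<lambda>y. B (f y) (g y))"
  unfolding smooth_on_def by (auto intro: Ck_on_bilinear)

lemmas smooth_on_scaleR [smooth_intros] = smooth_on_bilinear[OF bounded_bilinear_scaleR]
lemmas smooth_on_inner [smooth_intros] = smooth_on_bilinear[OF bounded_bilinear_inner]
lemmas smooth_on_mult [smooth_intros] =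
  smooth_on_bilinear[OF bounded_bilinear_mult[where 'a = real]]

lemma smooth_on_sum [smooth_intros]:
  "open S \<Longrightarrow> (\<And>i. i \<in> I \<Longrightarrow> smooth_on S (f i)) \<Longrightarrow> smooth_on S (\<lambda>y. \<Sum>i\<in>I. f i y)"
  unfolding smooth_on_def by (auto intro: Ck_on_sum)

lemma smooth_on_prod [smooth_intros]:
  fixes f :: "'i \<Rightarrow> 'a::euclidean_space \<Rightarrow> real"
  shows "open S \<Longrightarrow> (\<And>i. i \<in> I \<Longrightarrow> smooth_on S (f i)) \<Longrightarrow> smooth_on S (\<lambda>y. \<Prod>i\<in>I. f i y)"
  by (induction I rule: infinite_finite_induct) (simp_all add: smooth_intros)

lemma smooth_on_compose:
  "open S \<Longrightarrow> open T \<Longrightarrow> smooth_on T f \<Longrightarrow> smooth_on S g \<Longrightarrow> (\<And>y. y \<in> S \<Longrightarrow> g y \<in> T) \<Longrightarrow>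
    smooth_on S (\<lambda>y. f (g y))"
  using Ck_on_compose[of S T _ f g, OF _ _ _ _ image_subsetI] by (auto simp: smooth_on_def)

lemma smooth_on_compose_linear:
  "bounded_linear L \<Longrightarrow> open S \<Longrightarrow> smooth_on S f \<Longrightarrow> smooth_on S (\<lambda>y. L (f y))"
  for L :: "'b::euclidean_space \<Rightarrow> 'c::real_normed_vector"
  by (rule smooth_on_compose[OF _ open_UNIV smooth_on_linear]) auto

lemma smooth_on_minus [smooth_intros]:
  "open S \<Longrightarrow> smooth_on S f \<Longrightarrow> smooth_on S (\<lambda>y. - f y)"
  using smooth_on_scaleR[of S "\<lambda>_. -1" f] smooth_on_const[of S "-1::real"] by simp

lemma smooth_on_diff [smooth_intros]:
  "open S \<Longrightarrow> smooth_on S f \<Longrightarrow> smooth_on S g \<Longrightarrow> smooth_on S (\<lambda>y. f y - g y)"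
  using smooth_on_add[of S f "\<lambda>y. - g y"] smooth_on_minus[of S g] by simp

lemma smooth_on_power [smooth_intros]:
  fixes f :: "'a::euclidean_space \<Rightarrow> real"
  shows "open S \<Longrightarrow> smooth_on S f \<Longrightarrow> smooth_on S (\<lambda>y. f y ^ n)"
  by (induction n) (simp_all add: smooth_intros)

lemma smooth_on_nth [smooth_intros]:
  fixes f :: "'a::euclidean_space \<Rightarrow> real^'n"
  shows "open S \<Longrightarrow> smooth_on S f \<Longrightarrow> smooth_on S (\<lambda>y. f y $ i)"
  by (rule smooth_on_compose_linear[OF bounded_linear_vec_nth])

lemma smooth_on_vec_lambda [smooth_intros]:
  fixes f :: "'n::finite \<Rightarrow> 'a::euclidean_space \<Rightarrow> real"
  assumes "open S" "\<And>i. smooth_on S (f i)"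
  shows "smooth_on S (\<lambda>y. \<chi> i. f i y)"
proof -
  have "(\<chi> i. f i y) = (\<Sum>i\<in>UNIV. f i y *\<^sub>R axis i 1)" for y
    by (simp add: vec_eq_iff axis_def if_distrib cong: if_cong)
  then show ?thesis using assms by (simp add: smooth_intros)
qed

lemma smooth_on_continuous_on: "smooth_on S f \<Longrightarrow> continuous_on S f"
  using Ck_on.simps(1)[of S f] by (simp add: smooth_on_def del: Ck_on.simps)

lemma smooth_on_differentiable: "smooth_on S f \<Longrightarrow> y \<in> S \<Longrightarrow> f differentiable (at y)"
  using Ck_on.simps(2)[of _ S f] by (simp add: smooth_on_def del: Ck_on.simps)

lemma smooth_on_has_derivative:
  "smooth_on S f \<Longrightarrow> y \<in> S \<Longrightarrow> (f has_derivative frechet_derivative f (at y)) (at y)"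
  using smooth_on_differentiable frechet_derivative_works by metis

lemma smooth_on_frechet_const:
  "smooth_on S f \<Longrightarrow> smooth_on S (\<lambda>y. frechet_derivative f (at y) v)"
  using Ck_on.simps(2)[of _ S f] by (simp add: smooth_on_def del: Ck_on.simps)

lemma smooth_on_frechet:
  assumes "open S" "smooth_on S f" "smooth_on S V"
  shows "smooth_on S (\<lambda>y. frechet_derivative f (at y) (V y))"
proof (rule smooth_on_cong[OF assms(1)])
  show "smooth_on S (\<lambda>y. \<Sum>b\<in>Basis. (V y \<bullet> b) *\<^sub>R frechet_derivative f (at y) b)"
    by (intro smooth_intros smooth_on_frechet_const assms)
  show "(\<Sum>b\<in>Basis. (V y \<bullet> b) *\<^sub>R frechet_derivative f (at y) b) = frechet_derivative f (at y) (V y)" if "y \<in> S" for y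
    using has_derivative_basis_expansion[OF smooth_on_has_derivative[OF assms(2) that]] by metis
qed

lemma smooth_on_Pair [smooth_intros]:
  fixes f :: "'a::euclidean_space \<Rightarrow> 'b::euclidean_space" and g :: "'a \<Rightarrow> 'c::euclidean_space"
  assumes "open S" "smooth_on S f" "smooth_on S g"
  shows "smooth_on S (\<lambda>y. (f y, g y))"
proof -
  have "smooth_on S (\<lambda>y. (f y, 0::'c))" "smooth_on S (\<lambda>y. (0::'b, g y))"
    using assms
    by (auto intro!: smooth_on_compose_linear[where L="\<lambda>u. (u, 0)"] smooth_on_compose_linear[where L="\<lambda>u. (0, u)"]
        bounded_linear_Pair bounded_linear_ident bounded_linear_zero)
  from smooth_on_add[OF assms(1) this] show ?thesis by simp
qed

lemma smooth_on_fst: "open S \<Longrightarrow> smooth_on S f \<Longrightarrow> smooth_on S (\<lambda>y. fst (f y))"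
  for f :: "'a::euclidean_space \<Rightarrow> 'b::euclidean_space \<times> 'c::euclidean_space"
  by (rule smooth_on_compose_linear[OF bounded_linear_fst])

lemma smooth_on_snd: "open S \<Longrightarrow> smooth_on S f \<Longrightarrow> smooth_on S (\<lambda>y. snd (f y))"
  for f :: "'a::euclidean_space \<Rightarrow> 'b::euclidean_space \<times> 'c::euclidean_space"
  by (rule smooth_on_compose_linear[OF bounded_linear_snd])

lemma smooth_on_UNIV_component: "smooth_on UNIV (\<lambda>z::real^'n. z $ i)"
  using smooth_on_linear[OF open_UNIV bounded_linear_vec_nth] .

subsection \<open>Elementary functions\<close>

text \<open>For a function of one variable it suffices to know its ordinary derivative; since the derivatives
  of the elementary functions are built from elementary functions again, smoothness of each
  follows by induction on the order.\<close>

lemma Ck_on_real_SucI: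
  fixes f :: "real \<Rightarrow> real"
  assumes "open S" "\<And>y. y \<in> S \<Longrightarrow> (f has_real_derivative f' y) (at y)" "Ck_on k S f'"
  shows "Ck_on (Suc k) S f"
  using assms
  by (intro Ck_on_SucI[where f'="\<lambda>y v. f' y * v"])
     (auto simp: has_field_derivative_def intro!: Ck_on_bilinear[OF bounded_bilinear_mult] Ck_on_const)

lemma smooth_onI_real_derivative:
  fixes f :: "real \<Rightarrow> real"
  assumes "open S" "\<And>y. y \<in> S \<Longrightarrow> (f has_real_derivative f' y) (at y)" "smooth_on S f'"
  shows "smooth_on S f"
  unfolding smooth_on_def
  using Ck_on_Suc_imp[OF Ck_on_real_SucI[OF assms(1,2)]] assms(3) by (auto simp: smooth_on_def)

lemma smooth_on_inverse_real: "smooth_on (-{0}) (inverse :: real \<Rightarrow> real)"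
proof -
  have "Ck_on k (-{0}) (inverse :: real \<Rightarrow> real)" for k
  proof (induction k)
    case 0
    show ?case by (auto intro!: continuous_intros)
  next
    case (Suc k)
    have "Ck_on k (-{0}) (\<lambda>y::real. (-1) * (inverse y * inverse y))"
      by (intro Ck_on_bilinear[OF bounded_bilinear_mult] Ck_on_const Suc open_delete) auto
    then show ?case
      by (rule Ck_on_real_SucI[rotated 2]) (auto intro!: derivative_eq_intros)
  qed
  then show ?thesis by (simp add: smooth_on_def)
qed

lemma smooth_on_exp_real: "smooth_on UNIV (exp :: real \<Rightarrow> real)"
proof -
  have "Ck_on k UNIV (exp :: real \<Rightarrow> real)" for k
  proof (induction k)
    case 0
    show ?case by (auto intro!: continuous_intros)
  next
    case (Suc k)
    then show ?case
      by (intro Ck_on_real_SucI[where f'=exp]) auto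
  qed
  then show ?thesis by (simp add: smooth_on_def)
qed

lemma smooth_on_sin_cos_real: "smooth_on UNIV (sin :: real \<Rightarrow> real)" "smooth_on UNIV (cos :: real \<Rightarrow> real)"
proof -
  have "Ck_on k UNIV (sin :: real \<Rightarrow> real) \<and> Ck_on k UNIV (cos :: real \<Rightarrow> real)" for k
  proof (induction k)
    case 0
    show ?case by (auto intro!: continuous_intros)
  next
    case (Suc k)
    have "Ck_on k UNIV (\<lambda>x::real. (-1) * sin x)"
      using Suc by (intro Ck_on_bilinear[OF bounded_bilinear_mult] Ck_on_const) auto
    then show ?case
      using Suc Ck_on_real_SucI[of UNIV sin cos k] Ck_on_real_SucI[of UNIV cos "\<lambda>x. (-1) * sin x" k]
      by (auto intro!: derivative_eq_intros)
  qed
  then show "smooth_on UNIV (sin :: real \<Rightarrow> real)" "smooth_on UNIV (cos :: real \<Rightarrow> real)"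
    by (simp_all add: smooth_on_def)
qed

lemma smooth_on_inverse [smooth_intros]:
  fixes f :: "'a::euclidean_space \<Rightarrow> real"
  assumes "open S" "smooth_on S f" "\<And>y. y \<in> S \<Longrightarrow> f y \<noteq> 0"
  shows "smooth_on S (\<lambda>y. inverse (f y))"
  using smooth_on_compose[OF assms(1) _ smooth_on_inverse_real assms(2)] assms(3) by auto

lemma smooth_on_divide [smooth_intros]:
  fixes f :: "'a::euclidean_space \<Rightarrow> real"
  assumes "open S" "smooth_on S f" "smooth_on S g" "\<And>y. y \<in> S \<Longrightarrow> g y \<noteq> 0"
  shows "smooth_on S (\<lambda>y. f y / g y)"
  unfolding divide_inverse using assms by (intro smooth_intros)

lemma smooth_on_sqrt_real: "smooth_on {0<..} sqrt"
proof -
  have "Ck_on k {0<..} sqrt" for k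
  proof (induction k)
    case 0
    show ?case by (simp add: continuous_on_real_sqrt)
  next
    case (Suc k)
    have "Ck_on k {0<..} (\<lambda>x. inverse (sqrt x))"
      using Suc smooth_on_inverse_real
      by (intro Ck_on_compose[where T="-{0}" and f=inverse and g=sqrt]) (auto simp: smooth_on_def)
    then have "Ck_on k {0<..} (\<lambda>x. (1/2) * inverse (sqrt x))"
      by (intro Ck_on_bilinear[OF bounded_bilinear_mult] Ck_on_const) auto
    then show ?case
      by (rule Ck_on_real_SucI[rotated 2]) (auto intro!: derivative_eq_intros)
  qed
  then show ?thesis by (simp add: smooth_on_def)
qed

lemma smooth_on_sqrt [smooth_intros]:
  fixes f :: "'a::euclidean_space \<Rightarrow> real"
  assumes "open S" "smooth_on S f" "\<And>y. y \<in> S \<Longrightarrow> f y > 0"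
  shows "smooth_on S (\<lambda>y. sqrt (f y))"
  using smooth_on_compose[OF assms(1) _ smooth_on_sqrt_real assms(2)] assms(3) by auto

lemma smooth_on_ln_real: "smooth_on {0<..} (ln :: real \<Rightarrow> real)"
  by (rule smooth_onI_real_derivative[where f'=inverse])
     (auto intro!: derivative_eq_intros smooth_intros simp: field_simps)

lemma smooth_on_arctan_real: "smooth_on UNIV (arctan :: real \<Rightarrow> real)"
proof (rule smooth_onI_real_derivative[where f'="\<lambda>x. inverse (1 + x\<^sup>2)"])
  show "smooth_on UNIV (\<lambda>x::real. inverse (1 + x\<^sup>2))"
    by (intro smooth_intros) (auto simp: add_pos_nonneg less_imp_neq[symmetric])
qed (auto intro!: derivative_eq_intros)

lemma smooth_on_arctan [smooth_intros]:
  "open S \<Longrightarrow> smooth_on S f \<Longrightarrow> smooth_on S (\<lambda>y. arctan (f y))"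
  using smooth_on_compose[OF _ open_UNIV smooth_on_arctan_real] by auto

lemma smooth_on_arsinh [smooth_intros]:
  fixes f :: "'a::euclidean_space \<Rightarrow> real"
  assumes "open S" "smooth_on S f"
  shows "smooth_on S (\<lambda>y. arsinh (f y))"
proof -
  have p: "x + sqrt (x\<^sup>2 + 1) > 0" for x :: real
  proof -
    have "\<bar>x\<bar> < sqrt (x\<^sup>2 + 1)" by (rule real_less_rsqrt) simp
    then show ?thesis by linarith
  qed
  have "smooth_on UNIV (\<lambda>x::real. ln (x + sqrt (x\<^sup>2 + 1)))"
    by (rule smooth_on_compose[OF _ _ smooth_on_ln_real]) (auto intro!: smooth_intros p simp: add_nonneg_pos)
  then have "smooth_on UNIV (arsinh :: real \<Rightarrow> real)"
    by (simp add: arsinh_real_def[abs_def])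
  then show ?thesis
    using smooth_on_compose[OF assms(1) open_UNIV _ assms(2)] by auto
qed

lemma smooth_on_sin [smooth_intros]:
  "open S \<Longrightarrow> smooth_on S f \<Longrightarrow> smooth_on S (\<lambda>y. sin (f y :: real))"
  using smooth_on_compose[OF _ open_UNIV smooth_on_sin_cos_real(1)] by auto

lemma smooth_on_cos [smooth_intros]:
  "open S \<Longrightarrow> smooth_on S f \<Longrightarrow> smooth_on S (\<lambda>y. cos (f y :: real))"
  using smooth_on_compose[OF _ open_UNIV smooth_on_sin_cos_real(2)] by auto

lemma smooth_on_exp [smooth_intros]:
  "open S \<Longrightarrow> smooth_on S f \<Longrightarrow> smooth_on S (\<lambda>y. exp (f y :: real))"
  using smooth_on_compose[OF _ open_UNIV smooth_on_exp_real] by auto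

lemma smooth_on_sinh [smooth_intros]:
  "open S \<Longrightarrow> smooth_on S f \<Longrightarrow> smooth_on S (\<lambda>y. sinh (f y :: real))"
  unfolding sinh_def by (intro smooth_intros)

lemma smooth_on_cosh [smooth_intros]:
  "open S \<Longrightarrow> smooth_on S f \<Longrightarrow> smooth_on S (\<lambda>y. cosh (f y :: real))"
  unfolding cosh_def by (intro smooth_intros)

subsection \<open>Symmetry of second derivatives and the commutator of vector fields\<close>

text \<open>The second difference of \<open>f\<close> over a small parallelogram is symmetric in the two sides.  Two applications
  of the mean value theorem express it by a mixed second derivative at an intermediate point,
  in either order of differentiation; continuity then gives symmetry of the second derivative.\<close>

lemma mixed_difference_mvt:
  fixes f :: "'a::euclidean_space \<Rightarrow> real"
  assumes sm: "smooth_on S f" and h: "0 < h"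
    and in_S: "\<And>a b. 0 \<le> a \<Longrightarrow> a \<le> h \<Longrightarrow> 0 \<le> b \<Longrightarrow> b \<le> h \<Longrightarrow> y + a *\<^sub>R v + b *\<^sub>R w \<in> S"
  shows "\<exists>a b. 0 \<le> a \<and> a \<le> h \<and> 0 \<le> b \<and> b \<le> h \<and>
    f (y + h *\<^sub>R v + h *\<^sub>R w) - f (y + h *\<^sub>R v) - f (y + h *\<^sub>R w) + f y =
    h * h * frechet_derivative (\<lambda>z. frechet_derivative f (at z) v) (at (y + a *\<^sub>R v + b *\<^sub>R w)) w"
proof -
  let ?v = "\<lambda>z. frechet_derivative f (at z) v"
  have line: "((\<lambda>a. g (c + a *\<^sub>R u)) has_real_derivative frechet_derivative g (at (c + a *\<^sub>R u)) u) (at a)"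
    if "smooth_on S g" "c + a *\<^sub>R u \<in> S" for g :: "'a \<Rightarrow> real" and c u a
  proof -
    have g: "(g has_derivative frechet_derivative g (at (c + a *\<^sub>R u))) (at (c + a *\<^sub>R u))"
      using smooth_on_has_derivative that by blast
    have "((\<lambda>a. g (c + a *\<^sub>R u)) has_derivative (\<lambda>t. frechet_derivative g (at (c + a *\<^sub>R u)) (t *\<^sub>R u))) (at a)"
      by (rule has_derivative_compose[where f="\<lambda>a. c + a *\<^sub>R u", OF _ g]) (auto intro!: derivative_eq_intros)
    then show ?thesis
      using linear_scale[OF has_derivative_linear[OF g]]
      by (simp add: has_field_derivative_def mult.commute[of _ "frechet_derivative g _ u"])
  qed
  have "\<exists>a>0. a < h \<and>
     (f ((y + h *\<^sub>R w) + h *\<^sub>R v) - f (y + h *\<^sub>R v)) - (f ((y + h *\<^sub>R w) + 0 *\<^sub>R v) - f (y + 0 *\<^sub>R v)) =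
     (h - 0) * (?v ((y + h *\<^sub>R w) + a *\<^sub>R v) - ?v (y + a *\<^sub>R v))"
    using h in_S[of _ h] in_S[of _ 0] sm
    by (intro MVT2[where f="\<lambda>a. f ((y + h *\<^sub>R w) + a *\<^sub>R v) - f (y + a *\<^sub>R v)"] DERIV_diff line)
       (auto simp: algebra_simps)
  then obtain a where a: "0 < a" "a < h" and
    1: "f (y + h *\<^sub>R v + h *\<^sub>R w) - f (y + h *\<^sub>R v) - f (y + h *\<^sub>R w) + f y =
     h * (?v ((y + a *\<^sub>R v) + h *\<^sub>R w) - ?v ((y + a *\<^sub>R v) + 0 *\<^sub>R w))"
    by (auto simp: algebra_simps)
  have "\<exists>b>0. b < h \<and> ?v ((y + a *\<^sub>R v) + h *\<^sub>R w) - ?v ((y + a *\<^sub>R v) + 0 *\<^sub>R w) =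
     (h - 0) * frechet_derivative ?v (at ((y + a *\<^sub>R v) + b *\<^sub>R w)) w"
    using h a in_S[of a] smooth_on_frechet_const[OF sm]
    by (intro MVT2[where f="\<lambda>b. ?v ((y + a *\<^sub>R v) + b *\<^sub>R w)"] line) auto
  then obtain b where "0 < b" "b < h" and
    2: "?v ((y + a *\<^sub>R v) + h *\<^sub>R w) - ?v ((y + a *\<^sub>R v) + 0 *\<^sub>R w) =
      h * frechet_derivative ?v (at ((y + a *\<^sub>R v) + b *\<^sub>R w)) w"
    by auto
  show ?thesis
    using a \<open>0 < b\<close> \<open>b < h\<close> unfolding 1 2
    by (intro exI[of _ a] exI[of _ b]) simp
qed

lemma frechet_derivative_symmetric_real:
  fixes f :: "'a::euclidean_space \<Rightarrow> real"
  assumes "open S" "y \<in> S" and sm: "smooth_on S f"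
  shows "frechet_derivative (\<lambda>z. frechet_derivative f (at z) v) (at y) w =
         frechet_derivative (\<lambda>z. frechet_derivative f (at z) w) (at y) v"
proof (rule ccontr)
  let ?P = "\<lambda>v w x. frechet_derivative (\<lambda>z. frechet_derivative f (at z) v) (at x) w"
  assume neq: "?P v w y \<noteq> ?P w v y"
  define e where "e = \<bar>?P v w y - ?P w v y\<bar> / 2"
  have "e > 0" using neq by (simp add: e_def)
  have cont: "continuous_on S (?P v w)" for v w
    by (intro smooth_on_continuous_on smooth_on_frechet_const sm)
  obtain d1 where d1: "d1 > 0" "\<And>x. x \<in> S \<Longrightarrow> dist x y < d1 \<Longrightarrow> dist (?P v w x) (?P v w y) < e"
    using cont[of v w] \<open>y \<in> S\<close> \<open>e > 0\<close> unfolding continuous_on_iff by blast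
  obtain d2 where d2: "d2 > 0" "\<And>x. x \<in> S \<Longrightarrow> dist x y < d2 \<Longrightarrow> dist (?P w v x) (?P w v y) < e"
    using cont[of w v] \<open>y \<in> S\<close> \<open>e > 0\<close> unfolding continuous_on_iff by blast
  obtain d3 where d3: "d3 > 0" "ball y d3 \<subseteq> S"
    using assms by (meson open_contains_ball)
  define d where "d = min d1 (min d2 d3)"
  define h where "h = d / (2 * (norm v + norm w + 1))"
  have d: "d > 0" using d1 d2 d3 by (simp add: d_def)
  have n: "norm v + norm w + 1 > 0" by (simp add: add_nonneg_pos)
  have h: "h > 0" unfolding h_def using d n by simp
  have hd: "h * (norm v + norm w) < d"
  proof -
    have "h * (norm v + norm w) \<le> h * (norm v + norm w + 1)" using h by simp
    also have "\<dots> = d / 2" using n by (simp add: h_def field_simps)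
    finally show ?thesis using d by simp
  qed
  have near: "dist (y + a *\<^sub>R v' + b *\<^sub>R w') y < d"
    if "0 \<le> a" "a \<le> h" "0 \<le> b" "b \<le> h" "{v', w'} = {v, w}" for a b v' w'
  proof -
    have "dist (y + a *\<^sub>R v' + b *\<^sub>R w') y \<le> a * norm v' + b * norm w'"
      using norm_triangle_ineq[of "a *\<^sub>R v'" "b *\<^sub>R w'"] that by (simp add: dist_norm add.assoc)
    also have "\<dots> \<le> h * norm v' + h * norm w'"
      using that by (intro add_mono mult_right_mono) auto
    also have "\<dots> = h * (norm v + norm w)" using that(5) by (auto simp: doubleton_eq_iff algebra_simps)
    finally show ?thesis using hd by simp
  qed
  have inS: "y + a *\<^sub>R v' + b *\<^sub>R w' \<in> S"
    if "0 \<le> a" "a \<le> h" "0 \<le> b" "b \<le> h" "{v', w'} = {v, w}" for a b v' w'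
    using near[OF that] d3 by (auto simp: d_def dist_commute subset_eq)
  obtain a b where ab: "0 \<le> a" "a \<le> h" "0 \<le> b" "b \<le> h" and
    1: "f (y + h *\<^sub>R v + h *\<^sub>R w) - f (y + h *\<^sub>R v) - f (y + h *\<^sub>R w) + f y =
    h * h * ?P v w (y + a *\<^sub>R v + b *\<^sub>R w)"
    using mixed_difference_mvt[OF sm h inS[OF _ _ _ _ refl]] by blast
  obtain a' b' where ab': "0 \<le> a'" "a' \<le> h" "0 \<le> b'" "b' \<le> h" and
    2: "f (y + h *\<^sub>R w + h *\<^sub>R v) - f (y + h *\<^sub>R w) - f (y + h *\<^sub>R v) + f y =
    h * h * ?P w v (y + a' *\<^sub>R w + b' *\<^sub>R v)"
    using mixed_difference_mvt[OF sm h inS[OF _ _ _ _ insert_commute]] by blast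
  have "f (y + h *\<^sub>R w + h *\<^sub>R v) = f (y + h *\<^sub>R v + h *\<^sub>R w)" by (simp add: algebra_simps)
  then have "h * h * ?P v w (y + a *\<^sub>R v + b *\<^sub>R w) = h * h * ?P w v (y + a' *\<^sub>R w + b' *\<^sub>R v)"
    using 1 2 by linarith
  then have "?P v w (y + a *\<^sub>R v + b *\<^sub>R w) = ?P w v (y + a' *\<^sub>R w + b' *\<^sub>R v)" using h by simp
  moreover have "dist (?P v w (y + a *\<^sub>R v + b *\<^sub>R w)) (?P v w y) < e"
    using near[OF ab] inS[OF ab] by (intro d1) (auto simp: d_def)
  moreover have "dist (?P w v (y + a' *\<^sub>R w + b' *\<^sub>R v)) (?P w v y) < e"
    using near[OF ab'] inS[OF ab'] by (intro d2) (auto simp: d_def)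
  ultimately have "\<bar>?P v w y - ?P w v y\<bar> < 2 * e" by (simp add: dist_real_def)
  then show False by (simp add: e_def)
qed

lemma frechet_derivative_eqI: "(f has_derivative f') (at y) \<Longrightarrow> frechet_derivative f (at y) v = f' v"
  using frechet_derivative_at by metis

lemma frechet_derivative_inner:
  assumes "f differentiable (at y)"
  shows "frechet_derivative (\<lambda>z. f z \<bullet> b) (at y) v = frechet_derivative f (at y) v \<bullet> b"
  by (rule frechet_derivative_eqI)
     (use assms in \<open>auto intro!: derivative_eq_intros simp: frechet_derivative_works\<close>)

lemma frechet_derivative_symmetric:
  fixes f :: "'a::euclidean_space \<Rightarrow> 'b::euclidean_space"
  assumes "open S" "y \<in> S" and sm: "smooth_on S f"
  shows "frechet_derivative (\<lambda>z. frechet_derivative f (at z) v) (at y) w =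
         frechet_derivative (\<lambda>z. frechet_derivative f (at z) w) (at y) v"
proof (rule euclidean_eqI)
  fix b :: 'b
  let ?g = "\<lambda>z. f z \<bullet> b"
  have smg: "smooth_on S ?g" using sm assms(1) by (intro smooth_intros)
  have *: "frechet_derivative (\<lambda>z. frechet_derivative f (at z) v) (at y) w \<bullet> b =
        frechet_derivative (\<lambda>z. frechet_derivative ?g (at z) v) (at y) w" for v w
  proof -
    let ?fv = "\<lambda>z. frechet_derivative f (at z) v"
    have "((\<lambda>z. ?fv z \<bullet> b) has_derivative (\<lambda>w. frechet_derivative ?fv (at y) w \<bullet> b)) (at y)"
      using smooth_on_has_derivative[OF smooth_on_frechet_const[OF sm] assms(2)]
      by (auto intro!: derivative_eq_intros)
    then have "((\<lambda>z. frechet_derivative ?g (at z) v) has_derivative (\<lambda>w. frechet_derivative ?fv (at y) w \<bullet> b)) (at y)"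
      by (rule has_derivative_transform_within_open[OF _ assms(1,2)])
         (simp add: frechet_derivative_inner smooth_on_differentiable[OF sm])
    then show ?thesis by (simp add: frechet_derivative_eqI)
  qed
  show "frechet_derivative (\<lambda>z. frechet_derivative f (at z) v) (at y) w \<bullet> b =
         frechet_derivative (\<lambda>z. frechet_derivative f (at z) w) (at y) v \<bullet> b"
    unfolding * by (rule frechet_derivative_symmetric_real[OF assms(1,2) smg])
qed

definition along :: "('a::euclidean_space \<Rightarrow> 'a) \<Rightarrow> ('a \<Rightarrow> 'b::real_normed_vector) \<Rightarrow> 'a \<Rightarrow> 'b" where
  "along V f y = frechet_derivative f (at y) (V y)"

lemma smooth_on_along [smooth_intros]:
  "open S \<Longrightarrow> smooth_on S f \<Longrightarrow> smooth_on S V \<Longrightarrow> smooth_on S (along V f)"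
  unfolding along_def[abs_def] by (rule smooth_on_frechet)

lemma along_eqI: "(f has_derivative f') (at y) \<Longrightarrow> along V f y = f' (V y)"
  unfolding along_def by (rule frechet_derivative_eqI)

lemma along_cong:
  assumes "open S" "y \<in> S" "smooth_on S f" "\<And>z. z \<in> S \<Longrightarrow> f z = g z"
  shows "along V f y = along V g y"
  using has_derivative_transform_within_open[OF smooth_on_has_derivative[OF assms(3,2)] assms(1,2)] assms(4)
  by (metis along_def along_eqI)

text \<open>The second derivatives of \<open>f\<close> enter both iterated derivatives in the same way and cancel by symmetry;
  what is left is the derivative of \<open>f\<close> along the Lie bracket of the two fields.\<close>

lemma commutator:
  fixes f :: "'a::euclidean_space \<Rightarrow> 'b::euclidean_space"
  assumes "open S" "y \<in> S" and sm: "smooth_on S f" "smooth_on S V" "smooth_on S W"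
  shows "along V (along W f) y - along W (along V f) y =
         frechet_derivative f (at y) (along V W y - along W V y)"
proof -
  let ?D = "\<lambda>b z. frechet_derivative f (at z) b"
  have hf: "(f has_derivative (\<lambda>v. ?D v z)) (at z)" if "z \<in> S" for z
    using smooth_on_has_derivative[OF sm(1) that] .
  have hD: "(?D b has_derivative (\<lambda>v. frechet_derivative (?D b) (at z) v)) (at z)" if "z \<in> S" for z b
    using smooth_on_has_derivative[OF smooth_on_frechet_const[OF sm(1)] that] .
  have *: "along V (along W f) y = ?D (along V W y) y +
     (\<Sum>b\<in>Basis. \<Sum>c\<in>Basis. ((W y \<bullet> b) * (V y \<bullet> c)) *\<^sub>R frechet_derivative (?D b) (at y) c)"
    if sm: "smooth_on S V" "smooth_on S W" for V W
  proof -
    have hW: "(W has_derivative frechet_derivative W (at y)) (at y)"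
      using smooth_on_has_derivative[OF sm(2) assms(2)] .
    have "((\<lambda>z. \<Sum>b\<in>Basis. (W z \<bullet> b) *\<^sub>R ?D b z) has_derivative
      (\<lambda>v. \<Sum>b\<in>Basis. (W y \<bullet> b) *\<^sub>R frechet_derivative (?D b) (at y) v + (frechet_derivative W (at y) v \<bullet> b) *\<^sub>R ?D b y)) (at y)"
      by (auto intro!: derivative_eq_intros hW hD assms(2))
    then have "(along W f has_derivative
      (\<lambda>v. \<Sum>b\<in>Basis. (W y \<bullet> b) *\<^sub>R frechet_derivative (?D b) (at y) v + (frechet_derivative W (at y) v \<bullet> b) *\<^sub>R ?D b y)) (at y)"
      by (rule has_derivative_transform_within_open[OF _ assms(1,2)])
         (simp add: along_def has_derivative_basis_expansion[OF hf, symmetric])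
    then have "along V (along W f) y = (\<Sum>b\<in>Basis. (W y \<bullet> b) *\<^sub>R frechet_derivative (?D b) (at y) (V y)
        + (along V W y \<bullet> b) *\<^sub>R ?D b y)"
      by (simp add: along_eqI along_def[of V W])
    also have "\<dots> = ?D (along V W y) y + (\<Sum>b\<in>Basis. (W y \<bullet> b) *\<^sub>R frechet_derivative (?D b) (at y) (V y))"
      by (simp add: sum.distrib has_derivative_basis_expansion[OF hf[OF assms(2)], symmetric])
    also have "(\<Sum>b\<in>Basis. (W y \<bullet> b) *\<^sub>R frechet_derivative (?D b) (at y) (V y)) =
       (\<Sum>b\<in>Basis. \<Sum>c\<in>Basis. ((W y \<bullet> b) * (V y \<bullet> c)) *\<^sub>R frechet_derivative (?D b) (at y) c)"
      by (subst has_derivative_basis_expansion[OF hD[OF assms(2)]]) (simp add: scaleR_sum_right)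
    finally show ?thesis .
  qed
  have "(\<Sum>b\<in>Basis. \<Sum>c\<in>Basis. ((W y \<bullet> b) * (V y \<bullet> c)) *\<^sub>R frechet_derivative (?D b) (at y) c) =
     (\<Sum>b\<in>Basis. \<Sum>c\<in>Basis. ((V y \<bullet> b) * (W y \<bullet> c)) *\<^sub>R frechet_derivative (?D b) (at y) c)"
    by (subst sum.swap)
       (simp add: frechet_derivative_symmetric[OF assms(1,2) sm(1)] mult.commute)
  then show ?thesis
    using *[OF sm(2,3)] *[OF sm(3,2)] linear_diff[OF has_derivative_linear[OF hf[OF assms(2)]]] by simp
qed

subsection \<open>The inverse function theorem and functional dependence\<close>

lemma smooth_on_det:
  fixes A :: "'a::euclidean_space \<Rightarrow> real^'n^'n"
  assumes "open S" "\<And>i j. smooth_on S (\<lambda>y. A y $ i $ j)"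
  shows "smooth_on S (\<lambda>y. det (A y))"
  unfolding det_def by (intro smooth_on_sum smooth_on_mult smooth_on_const smooth_on_prod assms)

text \<open>Cramer's rule exhibits the solution as a quotient of smooth functions.\<close>

lemma smooth_on_linear_solution:
  fixes A :: "'a::euclidean_space \<Rightarrow> real^'n^'n"
  assumes "open S" and A: "\<And>i j. smooth_on S (\<lambda>y. A y $ i $ j)" and b: "\<And>i. smooth_on S (\<lambda>y. b y $ i)"
    and det: "\<And>y. y \<in> S \<Longrightarrow> det (A y) \<noteq> 0" and sol: "\<And>y. y \<in> S \<Longrightarrow> A y *v w y = b y"
  shows "smooth_on S w"
proof (rule smooth_on_cong[OF assms(1)])
  show "smooth_on S (\<lambda>y. \<chi> k. det (\<chi> i j. if j = k then b y $ i else A y $ i $ j) / det (A y))"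
  proof (rule smooth_on_vec_lambda[OF assms(1)],
      rule smooth_on_divide[OF assms(1) smooth_on_det[OF assms(1)] smooth_on_det[OF assms(1) A] det])
    fix k i j
    show "smooth_on S (\<lambda>y. (\<chi> i j. if j = k then b y $ i else A y $ i $ j) $ i $ j)"
      using A b by (cases "j = k") auto
  qed
  show "(\<chi> k. det (\<chi> i j. if j = k then b y $ i else A y $ i $ j) / det (A y)) = w y" if "y \<in> S" for y
    using cramer[OF det[OF that], of "w y" "b y"] sol[OF that] by simp
qed

text \<open>The inverse function theorem gives a differentiable local inverse \<open>g\<close>.  Its derivative at \<open>z\<close> is the
  inverse of the derivative of \<open>f\<close> at \<open>g z\<close>, and inverting a matrix is smooth.  So if \<open>g\<close> is \<open>k\<close> times continuously
  differentiable, then so is its derivative.\<close>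

lemma smooth_inverse_function:
  fixes f :: "real^'n \<Rightarrow> real^'n"
  assumes "open S" and sm: "smooth_on S f" and "y0 \<in> S" and inj: "inj (frechet_derivative f (at y0))"
  obtains U V g where "open U" "y0 \<in> U" "U \<subseteq> S" "open V" "f y0 \<in> V" "homeomorphism U V f g" "smooth_on V g"
proof -
  let ?F = "\<lambda>x. Blinfun (frechet_derivative f (at x))"
  have hf: "(f has_derivative frechet_derivative f (at x)) (at x)" if "x \<in> S" for x
    using smooth_on_has_derivative[OF sm that] .
  have F: "blinfun_apply (?F x) = frechet_derivative f (at x)" if "x \<in> S" for x
    using bounded_linear_Blinfun_apply has_derivative_bounded_linear[OF hf[OF that]] by blast
  have hF: "(f has_derivative blinfun_apply (?F x)) (at x)" if "x \<in> S" for x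
    using hf[OF that] by (simp add: F[OF that])
  have "continuous_on S (\<lambda>x. blinfun_apply (?F x) v)" for v
    using smooth_on_continuous_on[OF smooth_on_frechet_const[OF sm, of v]]
    by (rule continuous_on_eq) (simp add: F)
  then have contF: "continuous_on S ?F" by (intro continuous_on_blinfun_componentwise)
  obtain h where h: "linear h" "h \<circ> frechet_derivative f (at y0) = id"
    using linear_injective_left_inverse[OF has_derivative_linear[OF hf[OF \<open>y0 \<in> S\<close>]] inj] by blast
  have "blinfun_apply (Blinfun h) = h"
    using bounded_linear_Blinfun_apply h(1) linear_conv_bounded_linear by blast
  then have inv: "Blinfun h o\<^sub>L ?F y0 = id_blinfun"
    using h(2) by (intro blinfun_eqI) (simp add: F[OF \<open>y0 \<in> S\<close>] o_def fun_eq_iff)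
  obtain U V g g' where UV: "open U" "U \<subseteq> S" "y0 \<in> U" "open V" "f y0 \<in> V" "homeomorphism U V f g"
    and g': "\<And>y. y \<in> V \<Longrightarrow> (g has_derivative (g' y)) (at y)"
    and g'_inv: "\<And>y. y \<in> V \<Longrightarrow> g' y = inv (blinfun_apply (?F (g y)))"
    and bij: "\<And>y. y \<in> V \<Longrightarrow> bij (blinfun_apply (?F (g y)))"
    by (rule inverse_function_theorem[OF assms(1) hF contF assms(3) inv]) (assumption, rule that)
  define A where "A x = matrix (frechet_derivative f (at x))" for x
  define w where "w v x = inv (frechet_derivative f (at x)) v" for v x
  have bijU: "bij (frechet_derivative f (at x))" if "x \<in> U" for x
  proof -
    have "f x \<in> V" "g (f x) = x" using UV(6) that by (auto simp: homeomorphism_def)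
    then show ?thesis using bij[of "f x"] F UV(2) that by auto
  qed
  have lin: "linear (frechet_derivative f (at x))" if "x \<in> U" for x
    using has_derivative_linear[OF hf] UV(2) that by blast
  have w: "smooth_on U (w v)" for v
  proof (rule smooth_on_linear_solution[OF UV(1), where A=A and b="\<lambda>_. v"])
    show "smooth_on U (\<lambda>y. A y $ i $ j)" for i j
      unfolding A_def matrix_def
      using smooth_on_subset[OF smooth_on_frechet_const[OF sm] UV(2)] UV(1) by (auto intro: smooth_intros)
    show "det (A x) \<noteq> 0" if "x \<in> U" for x
      using bijU[OF that] lin[OF that] det_nz_iff_inj[of "frechet_derivative f (at x)"]
      by (simp add: A_def bij_is_inj linear_linear)
    show "A x *v w v x = v" if "x \<in> U" for x
      using bijU[OF that] lin[OF that] by (simp add: A_def w_def matrix_works bij_is_surj surj_f_inv_f)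
  qed (use UV(1) in \<open>auto intro: smooth_intros\<close>)
  have "Ck_on k V g" for k
  proof (induction k)
    case 0
    then show ?case using UV(6) by (simp add: homeomorphism_def)
  next
    case (Suc k)
    have gU: "g ` V \<subseteq> U" using UV(6) by (auto simp: homeomorphism_def)
    have eq: "w v (g y) = g' y v" if "y \<in> V" for y v
    proof -
      have "g y \<in> S" using gU UV(2) that by blast
      then show ?thesis using g'_inv[OF that] F[of "g y"] by (simp add: w_def)
    qed
    show ?case
    proof (rule Ck_on_SucI[OF UV(4) g'])
      have "Ck_on k V (\<lambda>y. w v (g y))" for v
        using Ck_on_compose[OF UV(4,1) _ Suc gU] w by (auto simp: smooth_on_def)
      from Ck_on_cong[OF UV(4) eq this] show "Ck_on k V (\<lambda>y. g' y v)" for v .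
    qed
  qed
  then show ?thesis using that[OF UV(1,3,2,4,5,6)] by (simp add: smooth_on_def)
qed

text \<open>Taking \<open>k\<close> as one of the coordinates near \<open>y0\<close>, the hypothesis says that \<open>g\<close> has no derivative in the
  other coordinates, so that on a ball of coordinates it is a function of \<open>k\<close> alone.\<close>

lemma functional_dependence:
  fixes k :: "real^'n \<Rightarrow> real" and g :: "real^'n \<Rightarrow> 'b::euclidean_space"
  assumes "open S" "y0 \<in> S" and k: "smooth_on S k" and g: "smooth_on S g"
    and nz: "frechet_derivative k (at y0) v0 \<noteq> 0"
    and dep: "\<And>y. y \<in> S \<Longrightarrow> \<exists>c. \<forall>v. frechet_derivative g (at y) v = frechet_derivative k (at y) v *\<^sub>R c"
  obtains I G U where "open I" "is_interval I" "open U" "y0 \<in> U" "U \<subseteq> S" "smooth_on I G"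
    "\<And>y. y \<in> U \<Longrightarrow> k y \<in> I \<and> g y = G (k y)" "\<And>s. s \<in> I \<Longrightarrow> \<exists>y\<in>U. k y = s"
proof -
  have hk: "(k has_derivative frechet_derivative k (at y)) (at y)" if "y \<in> S" for y
    using smooth_on_has_derivative[OF k that] .
  have hg: "(g has_derivative frechet_derivative g (at y)) (at y)" if "y \<in> S" for y
    using smooth_on_has_derivative[OF g that] .
  have "\<exists>j. frechet_derivative k (at y0) (axis j 1) \<noteq> 0"
  proof (rule ccontr)
    assume *: "\<not> ?thesis"
    have "frechet_derivative k (at y0) b = 0" if b: "b \<in> Basis" for b
    proof -
      obtain i where "b = axis i 1" using b by (auto simp: Basis_vec_def)
      then show ?thesis using * by simp
    qed
    then show False
      using nz has_derivative_basis_expansion[OF hk[OF assms(2)], of v0] by simp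
  qed
  then obtain j where j: "frechet_derivative k (at y0) (axis j 1) \<noteq> 0" ..
  \<comment> \<open>exchange the coordinate \<open>j\<close>, in which \<open>k\<close> has a non-zero derivative, for \<open>k\<close> itself\<close>
  define f where "f y = (\<chi> i. if i = j then k y else y $ i)" for y
  have smf: "smooth_on S f"
    unfolding f_def
  proof (rule smooth_on_vec_lambda[OF assms(1)])
    show "smooth_on S (\<lambda>y. if i = j then k y else y $ i)" for i
      using k smooth_on_nth[OF assms(1) smooth_on_id[OF assms(1)]] by (cases "i = j") auto
  qed
  have f': "frechet_derivative f (at y0) v = (\<chi> i. if i = j then frechet_derivative k (at y0) v else v $ i)" for v
  proof (rule frechet_derivative_eqI)
    show "(f has_derivative (\<lambda>v. \<chi> i. if i = j then frechet_derivative k (at y0) v else v $ i)) (at y0)"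
    proof (subst has_derivative_componentwise_within, clarsimp simp: Basis_vec_def f_def inner_axis)
      fix i show "((\<lambda>y. if i = j then k y else y $ i) has_derivative
         (\<lambda>v. if i = j then frechet_derivative k (at y0) v else v $ i)) (at y0)"
        using hk[OF assms(2)] by (cases "i = j") (auto intro!: bounded_linear_imp_has_derivative bounded_linear_vec_nth)
    qed
  qed
  have inj: "inj (frechet_derivative f (at y0))"
  proof (subst linear_injective_0[OF has_derivative_linear[OF smooth_on_has_derivative[OF smf assms(2)]]], intro allI impI)
    fix v assume "frechet_derivative f (at y0) v = 0"
    then have c: "(if i = j then frechet_derivative k (at y0) v else v $ i) = 0" for i
      unfolding f' by (simp add: vec_eq_iff)
    have 0: "frechet_derivative k (at y0) v = 0" "\<And>i. i \<noteq> j \<Longrightarrow> v $ i = 0"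
      using c[of j] by simp (use c in presburger)
    have v: "v = (v $ j) *\<^sub>R axis j 1"
      using 0(2) by (auto simp: vec_eq_iff axis_def)
    have "(v $ j) * frechet_derivative k (at y0) (axis j 1) = 0"
      using 0(1) linear_scale[OF has_derivative_linear[OF hk[OF assms(2)]], of "v $ j" "axis j 1"] v by simp
    then show "v = 0" using j v by simp
  qed
  obtain U' V h where UV: "open U'" "y0 \<in> U'" "U' \<subseteq> S" "open V" "f y0 \<in> V" "homeomorphism U' V f h"
    and smh: "smooth_on V h"
    using smooth_inverse_function[OF assms(1) smf assms(2) inj] by blast
  have h_in: "h z \<in> U'" "f (h z) = z" if "z \<in> V" for z
    using UV(6) that by (auto simp: homeomorphism_def)
  obtain r where r: "r > 0" "ball (f y0) r \<subseteq> V" using UV(4,5) by (meson open_contains_ball)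
  define z0 where "z0 = f y0"
  \<comment> \<open>\<open>P\<close> is the line through the base point in the new coordinate; \<open>G\<close> is \<open>g\<close> on that line\<close>
  define P where "P s = (\<chi> i. if i = j then s else z0 $ i)" for s :: real
  define I where "I = {z0 $ j - r <..< z0 $ j + r}"
  define G where "G s = g (h (P s))" for s
  define U where "U = U' \<inter> f -` ball z0 r"
  have P_ball: "P s \<in> ball z0 r" if "s \<in> I" for s
  proof -
    have "z0 - P s = (z0 $ j - s) *\<^sub>R axis j 1" by (auto simp: vec_eq_iff P_def axis_def)
    then have "norm (z0 - P s) = \<bar>z0 $ j - s\<bar>" by (simp add: norm_axis_1)
    then show ?thesis using that by (auto simp: dist_norm I_def)
  qed
  have "continuous_on U' f" using UV(6) by (simp add: homeomorphism_def)
  then have oU: "open U" unfolding U_def using UV(1) by (simp add: continuous_open_preimage)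
  have kh: "k (h z) = z $ j" if "z \<in> V" for z
    using arg_cong[OF h_in(2)[OF that], of "\<lambda>w. w $ j"] by (simp add: f_def)
  have smP: "smooth_on I P"
    unfolding P_def
  proof (rule smooth_on_vec_lambda)
    show "smooth_on I (\<lambda>s. if i = j then s else z0 $ i)" for i
      by (cases "i = j") (auto simp: I_def intro: smooth_intros)
  qed (simp add: I_def)
  have smG: "smooth_on I G"
    unfolding G_def
  proof (rule smooth_on_compose[OF _ UV(4) smooth_on_compose[OF UV(4) assms(1) g smh] smP])
    show "P y \<in> V" if "y \<in> I" for y using P_ball[OF that] r by (auto simp: z0_def)
  qed (use h_in UV in \<open>auto simp: I_def\<close>)
  have const: "g (h z) = G (z $ j)" if z: "z \<in> ball z0 r" for z
  proof -
    have zI: "z $ j \<in> I"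
      using z component_le_norm_cart[of "z0 - z" j] by (auto simp: I_def dist_norm abs_less_iff)
    define d where "d = z - P (z $ j)"
    have dj: "d $ j = 0" by (simp add: d_def P_def)
    define q where "q \<tau> = P (z $ j) + \<tau> *\<^sub>R d" for \<tau> :: real
    have qin: "q \<tau> \<in> V" if "0 \<le> \<tau>" "\<tau> \<le> 1" for \<tau>
    proof -
      have "q \<tau> = (1 - \<tau>) *\<^sub>R P (z $ j) + \<tau> *\<^sub>R z" by (simp add: q_def d_def algebra_simps)
      then have "q \<tau> \<in> ball z0 r"
        using convexD[OF convex_ball P_ball[OF zI] z, of "1 - \<tau>" \<tau>] that by simp
      then show ?thesis using r by (auto simp: z0_def)
    qed
    have der: "((\<lambda>\<tau>. g (h (q \<tau>))) has_derivative (\<lambda>t. 0)) (at \<tau>)" if \<tau>: "0 \<le> \<tau>" "\<tau> \<le> 1" for \<tau>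
    proof -
      have qV: "q \<tau> \<in> V" and hS: "h (q \<tau>) \<in> S" using qin \<tau> h_in UV(3) by auto
      let ?h' = "frechet_derivative h (at (q \<tau>))"
      have hh: "(h has_derivative ?h') (at (q \<tau>))" using smooth_on_has_derivative[OF smh qV] .
      have hq: "(q has_derivative (\<lambda>t. t *\<^sub>R d)) (at \<tau>)"
        unfolding q_def by (auto intro!: derivative_eq_intros)
      have "((\<lambda>z. k (h z)) has_derivative (\<lambda>v. frechet_derivative k (at (h (q \<tau>))) (?h' v))) (at (q \<tau>))"
        by (rule has_derivative_compose[OF hh hk[OF hS]])
      moreover have "((\<lambda>z. k (h z)) has_derivative (\<lambda>v. v $ j)) (at (q \<tau>))"
        by (rule has_derivative_transform_within_open[OF _ UV(4) qV, where f="\<lambda>z. z $ j"])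
           (auto simp: kh intro!: bounded_linear_imp_has_derivative bounded_linear_vec_nth)
      ultimately have k': "frechet_derivative k (at (h (q \<tau>))) (?h' v) = v $ j" for v
        using frechet_derivative_eqI by metis
      obtain c where c: "\<And>v. frechet_derivative g (at (h (q \<tau>))) v = frechet_derivative k (at (h (q \<tau>))) v *\<^sub>R c"
        using dep[OF hS] by blast
      have "((\<lambda>\<tau>. g (h (q \<tau>))) has_derivative (\<lambda>t. frechet_derivative g (at (h (q \<tau>))) (?h' (t *\<^sub>R d)))) (at \<tau>)"
        by (rule has_derivative_compose[OF has_derivative_compose[OF hq hh] hg[OF hS]])
      then show ?thesis by (simp add: c k' dj)
    qed
    have "g (h (q 0)) = g (h (q 1))"
    proof (rule has_derivative_zero_unique[of "{0..1}" "\<lambda>\<tau>. g (h (q \<tau>))" 0 1])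
      show "((\<lambda>\<tau>. g (h (q \<tau>))) has_derivative (\<lambda>h. 0)) (at \<tau> within {0..1})" if "\<tau> \<in> {0..1}" for \<tau>
        using der that by (auto intro: has_derivative_at_withinI)
    qed auto
    then show ?thesis by (simp add: G_def q_def d_def)
  qed
  show ?thesis
  proof (rule that[OF _ _ oU _ _ smG])
    show "y0 \<in> U" using UV(2) r by (simp add: U_def z0_def)
    show "U \<subseteq> S" using UV(3) by (auto simp: U_def)
    show "open I" "is_interval I" by (auto simp: I_def is_interval_oo)
    fix y assume y: "y \<in> U"
    then have fy: "f y \<in> ball z0 r" "h (f y) = y" using UV(6) by (auto simp: U_def homeomorphism_def)
    have fj: "f y $ j = k y" by (simp add: f_def)
    show "k y \<in> I \<and> g y = G (k y)"
      using const[OF fy(1)] fj fy(2) component_le_norm_cart[of "z0 - f y" j] fy(1)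
      by (auto simp: I_def dist_norm abs_less_iff)
  next
    fix s assume s: "s \<in> I"
    have "P s \<in> V" using P_ball[OF s] r by (auto simp: z0_def)
    then show "\<exists>y\<in>U. k y = s"
      using kh[of "P s"] h_in[of "P s"] P_ball[OF s] by (intro bexI[of _ "h (P s)"]) (auto simp: U_def P_def)
  qed
qed

section \<open>Orthonormal bases of the ambient space\<close>

lemma bounded_bilinear_sprod: "bounded_bilinear sprod"
  unfolding bilinear_conv_bounded_bilinear[symmetric]
  by (auto simp: bilinear_def linear_iff sprod_def algebra_simps)

lemma sprod_commute: "sprod v w = sprod w v"
  by (simp add: sprod_def algebra_simps)

lemma sprod_simps [simp]:
  "sprod (v + v') w = sprod v w + sprod v' w" "sprod v (w + w') = sprod v w + sprod v w'"
  "sprod (v - v') w = sprod v w - sprod v' w" "sprod v (w - w') = sprod v w - sprod v w'"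
  "sprod (c *\<^sub>R v) w = c * sprod v w" "sprod v (c *\<^sub>R w) = c * sprod v w"
  "sprod (- v) w = - sprod v w" "sprod v (- w) = - sprod v w"
  "sprod 0 w = 0" "sprod v 0 = 0"
  by (simp_all add: sprod_def algebra_simps)

lemma sprod_sum_left: "sprod (\<Sum>i\<in>A. f i) w = (\<Sum>i\<in>A. sprod (f i) w)"
  by (induction A rule: infinite_finite_induct) auto

lemmas smooth_on_sprod [smooth_intros] = smooth_on_bilinear[OF bounded_bilinear_sprod]

lemmas has_derivative_sprod [derivative_intros] = bounded_bilinear.FDERIV[OF bounded_bilinear_sprod]

definition sign5 :: "5 \<Rightarrow> real" where "sign5 i = (if i = 1 \<or> i = 2 then -1 else 1)"

lemma exhaust_5: "i = 1 \<or> i = 2 \<or> i = 3 \<or> i = 4 \<or> i = 5" for i :: 5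
proof (induct i)
  case (of_int z)
  then have "0 \<le> z" and "z < 5" by simp_all
  then have "z = 0 \<or> z = 1 \<or> z = 2 \<or> z = 3 \<or> z = 4" by arith
  then show ?case by auto
qed

lemma UNIV_5: "(UNIV :: 5 set) = {1, 2, 3, 4, 5}"
  using exhaust_5 by auto

lemma sum_5: "sum f (UNIV :: 5 set) = f 1 + f 2 + f 3 + f 4 + f 5"
  unfolding UNIV_5 by (simp add: ac_simps)

lemma prod_5: "prod f (UNIV :: 5 set) = f 1 * f 2 * f 3 * f 4 * f 5"
  unfolding UNIV_5 by (simp add: ac_simps)

lemma forall_5: "(\<forall>i::5. P i) \<longleftrightarrow> P 1 \<and> P 2 \<and> P 3 \<and> P 4 \<and> P 5"
  by (metis exhaust_5)

lemma sprod_eq_sum: "sprod v w = (\<Sum>i\<in>UNIV. sign5 i * v $ i * w $ i)"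
  by (simp add: sum_5 sprod_def sign5_def)

text \<open>Bases of the ambient space are families indexed by the type \<open>5\<close>, in which the numeral \<open>5\<close>
  denotes zero; spelling out the five values keeps them in the order of the coordinates.\<close>

definition tuple5 :: "'a \<Rightarrow> 'a \<Rightarrow> 'a \<Rightarrow> 'a \<Rightarrow> 'a \<Rightarrow> 5 \<Rightarrow> 'a" where
  "tuple5 a b c d e i = (if i = 1 then a else if i = 2 then b else if i = 3 then c else if i = 4 then d else e)"

lemma tuple5_simps [simp]:
  "tuple5 a b c d e 1 = a" "tuple5 a b c d e 2 = b" "tuple5 a b c d e 3 = c" "tuple5 a b c d e 4 = d" "tuple5 a b c d e 5 = e"
  by (simp_all add: tuple5_def)

definition orthonormal5 :: "(5 \<Rightarrow> real^5) \<Rightarrow> (5 \<Rightarrow> real) \<Rightarrow> bool" where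
  "orthonormal5 f s \<longleftrightarrow> (\<forall>i. (s i)\<^sup>2 = 1) \<and> (\<forall>i j. sprod (f i) (f j) = (if i = j then s i else 0))"

lemma orthonormal5_expansion:
  assumes "orthonormal5 f s"
  shows "w = (\<Sum>i\<in>UNIV. (s i * sprod w (f i)) *\<^sub>R f i)"
proof -
  have ss: "s i * s i = 1" and ff: "sprod (f i) (f j) = (if i = j then s i else 0)" for i j
    using assms by (auto simp: orthonormal5_def power2_eq_square)
  define T where "T c = (\<Sum>i\<in>UNIV. (c $ i) *\<^sub>R f i)" for c :: "real^5"
  have Tf: "sprod (T c) (f j) = c $ j * s j" for c j
    by (simp add: T_def sprod_sum_left ff if_distrib cong: if_cong)
  have "linear T" by (auto simp: T_def linear_iff sum.distrib scaleR_add_left scaleR_sum_right)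
  moreover have "inj T"
    unfolding linear_injective_0[OF \<open>linear T\<close>]
  proof (intro allI impI)
    fix c assume "T c = 0"
    then have "c $ j * s j * s j = 0" for j using Tf[of c j] by simp
    then show "c = 0" by (simp add: vec_eq_iff mult.assoc ss)
  qed
  ultimately obtain c where c: "w = T c"
    using linear_injective_imp_surjective by (metis surjD)
  have "s j * sprod w (f j) = c $ j" for j
    unfolding c Tf using ss[of j] by (simp add: mult.commute mult.left_commute)
  then show ?thesis using c by (simp add: T_def)
qed

lemma orthonormal5_sprod:
  assumes "orthonormal5 f s"
  shows "sprod v w = (\<Sum>i\<in>UNIV. s i * sprod v (f i) * sprod w (f i))"
proof -
  have "sprod v w = sprod (\<Sum>i\<in>UNIV. (s i * sprod v (f i)) *\<^sub>R f i) w"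
    using orthonormal5_expansion[OF assms] by metis
  also have "\<dots> = (\<Sum>i\<in>UNIV. s i * sprod v (f i) * sprod (f i) w)"
    by (simp only: sprod_sum_left sprod_simps)
  finally show ?thesis by (simp only: sprod_commute[of _ w])
qed

lemma sprod_eqI:
  assumes "orthonormal5 f s" "\<And>i. sprod v (f i) = sprod w (f i)"
  shows "v = w"
  using orthonormal5_expansion[OF assms(1), of v] orthonormal5_expansion[OF assms(1), of w] assms(2) by simp

text \<open>A case of Sylvester's law of inertia.  Comparing determinants shows that an even number
  of the four signs is negative.  If none were, the metric would be positive definite; if all were, it would
  be non-positive on the orthogonal complement of \<open>f 5\<close>, which contains a vector of positive norm in the span of
  the third and fourth axes.\<close>

lemma orthonormal5_signs:
  assumes "orthonormal5 f s" "s 5 = 1"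
  shows "s 1 * s 2 * s 3 * s 4 = 1" "s 1 + s 2 + s 3 + s 4 = 0"
proof -
  have ss: "s i = 1 \<or> s i = -1" for i
    using assms(1) by (auto simp: orthonormal5_def power2_eq_1_iff)
  define F :: "real^5^5" where "F = (\<chi> i. f i)"
  define J :: "real^5^5" where "J = (\<chi> i j. if i = j then sign5 i else 0)"
  define D :: "real^5^5" where "D = (\<chi> i j. if i = j then s i else 0)"
  have FJ: "(F ** J) $ i $ j = f i $ j * sign5 j" for i j
    by (simp add: F_def J_def matrix_matrix_mult_def if_distrib cong: if_cong)
  have "((F ** J) ** transpose F) $ i $ j = sprod (f i) (f j)" for i j
  proof -
    have "((F ** J) ** transpose F) $ i $ j = (\<Sum>k\<in>UNIV. (F ** J) $ i $ k * transpose F $ k $ j)"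
      by (simp only: matrix_matrix_mult_def vec_lambda_beta)
    then show ?thesis unfolding FJ by (simp add: transpose_def F_def sprod_eq_sum mult_ac)
  qed
  then have "(F ** J) ** transpose F = D"
    using assms(1) by (simp add: vec_eq_iff D_def orthonormal5_def)
  then have "det D = det F * det J * det F" by (metis det_mul det_transpose)
  moreover have "det D = (\<Prod>i\<in>UNIV. s i)" by (subst det_diagonal) (auto simp: D_def)
  moreover have "det J = 1" by (subst det_diagonal) (auto simp: J_def prod_5 sign5_def)
  ultimately have "s 1 * s 2 * s 3 * s 4 = (det F)\<^sup>2"
    using assms(2) by (simp add: prod_5 power2_eq_square)
  then have "s 1 * s 2 * s 3 * s 4 \<ge> 0" by simp
  then show prod: "s 1 * s 2 * s 3 * s 4 = 1"
    using ss[of 1] ss[of 2] ss[of 3] ss[of 4] by (elim disjE) simp_all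
  have not_pos: "\<not> (s 1 = 1 \<and> s 2 = 1 \<and> s 3 = 1 \<and> s 4 = 1)"
  proof
    assume "s 1 = 1 \<and> s 2 = 1 \<and> s 3 = 1 \<and> s 4 = 1"
    then have "sprod (axis 1 1) (axis 1 1) \<ge> 0"
      using orthonormal5_sprod[OF assms(1), of "axis 1 1" "axis 1 1"] assms(2) by (simp add: sum_5)
    then show False by (simp add: sprod_def axis_def)
  qed
  have not_neg: "\<not> (s 1 = -1 \<and> s 2 = -1 \<and> s 3 = -1 \<and> s 4 = -1)"
  proof
    assume s: "s 1 = -1 \<and> s 2 = -1 \<and> s 3 = -1 \<and> s 4 = -1"
    define w :: "real^5" where
      "w = (if f 5 $ 3 = 0 then axis 3 1 else axis 3 (f 5 $ 4) - axis 4 (f 5 $ 3))"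
    have "sprod w (f 5) = 0" by (simp add: w_def sprod_def axis_def)
    then have "sprod w w = - (sprod w (f 1) * sprod w (f 1)) - sprod w (f 2) * sprod w (f 2)
        - sprod w (f 3) * sprod w (f 3) - sprod w (f 4) * sprod w (f 4)"
      using s orthonormal5_sprod[OF assms(1), of w w] by (simp add: sum_5)
    then have "sprod w w \<le> 0"
      using zero_le_square[of "sprod w (f 1)"] zero_le_square[of "sprod w (f 2)"]
        zero_le_square[of "sprod w (f 3)"] zero_le_square[of "sprod w (f 4)"] by linarith
    moreover have "sprod w w > 0" by (simp add: w_def sprod_def axis_def add_nonneg_pos flip: power2_eq_square)
    ultimately show False by simp
  qed
  show "s 1 + s 2 + s 3 + s 4 = 0"
    using ss[of 1] ss[of 2] ss[of 3] ss[of 4] prod not_pos not_neg by (elim disjE) simp_all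
qed

text \<open>If \<open>f\<close> is orthonormal with the signs of the standard basis, these are the coefficients of \<open>w\<close>
  with respect to \<open>f\<close>.\<close>

definition coords :: "(5 \<Rightarrow> real^5) \<Rightarrow> real^5 \<Rightarrow> real^5" where
  "coords f w = (\<chi> i. sign5 i * sprod w (f i))"

lemma linear_coords: "linear (coords f)"
  by (auto simp: linear_iff coords_def vec_eq_iff algebra_simps)

lemma coords_eq_0:
  assumes "orthonormal5 f sign5" "coords f w = 0"
  shows "w = 0"
proof (rule sprod_eqI[OF assms(1)])
  show "sprod w (f i) = sprod 0 (f i)" for i
    using arg_cong[OF assms(2), of "\<lambda>v. v $ i"] by (simp add: coords_def sign5_def split: if_splits)
qed

lemma isometry_coords:
  assumes "orthonormal5 f sign5"
  shows "isometry_E52 (\<lambda>w. coords f (w - c))"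
proof -
  note lin = linear_coords[of f]
  have "inj (coords f)"
    unfolding linear_injective_0[OF lin] using coords_eq_0[OF assms] by blast
  obtain g where g: "linear g" and gf: "\<And>w. g (coords f w) = w" "\<And>w. coords f (g w) = w"
    using linear_injective_isomorphism[OF lin \<open>inj (coords f)\<close>] by blast
  let ?F = "\<lambda>w. coords f (w - c)"
  have inv: "inv ?F = (\<lambda>w. g w + c)"
    by (rule inv_equality) (simp_all add: gf)
  have "bij ?F" by (rule bij_betw_byWitness[where f'="\<lambda>w. g w + c"]) (auto simp: gf)
  moreover have "smooth_on UNIV ?F"
    using smooth_on_compose_linear[of "coords f" UNIV "\<lambda>w. w - c"] lin
    by (simp add: smooth_intros linear_conv_bounded_linear)
  moreover have "smooth_on UNIV (inv ?F)"
    unfolding inv using smooth_on_linear[of UNIV g] g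
    by (simp add: smooth_intros linear_conv_bounded_linear)
  moreover have "frechet_derivative ?F (at y) v = coords f v" for y v
  proof (rule frechet_derivative_eqI)
    have "(coords f has_derivative coords f) (at (y - c))"
      using lin by (intro bounded_linear_imp_has_derivative) (simp add: linear_conv_bounded_linear)
    moreover have "((\<lambda>w. w - c) has_derivative (\<lambda>v. v)) (at y)"
      by (auto intro!: derivative_eq_intros)
    ultimately show "(?F has_derivative coords f) (at y)"
      using has_derivative_compose[of "\<lambda>w. w - c" "\<lambda>v. v" y UNIV "coords f" "coords f"] by simp
  qed
  moreover have "sprod (coords f v) (coords f w) = sprod v w" for v w
    using orthonormal5_sprod[OF assms, of v w] sprod_eq_sum[of "coords f v" "coords f w"]
    by (simp add: coords_def sum_5 sign5_def)
  ultimately show ?thesis by (auto simp: isometry_E52_def)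
qed

section \<open>Moving frames on a parametrized hypersurface\<close>

lemma along_scaleR:
  assumes "smooth_on S f" "smooth_on S g" "y \<in> S"
  shows "along V (\<lambda>y. f y *\<^sub>R g y) y = along V f y *\<^sub>R g y + f y *\<^sub>R along V g y"
  using along_eqI[OF has_derivative_scaleR[OF smooth_on_has_derivative[OF assms(1,3)] smooth_on_has_derivative[OF assms(2,3)]]]
  by (simp add: along_def)

lemma along_mult:
  fixes f g :: "'a::euclidean_space \<Rightarrow> real"
  assumes "smooth_on S f" "smooth_on S g" "y \<in> S"
  shows "along V (\<lambda>y. f y * g y) y = along V f y * g y + f y * along V g y"
  using along_scaleR[OF assms] by simp

lemma along_sprod:
  assumes "smooth_on S f" "smooth_on S g" "y \<in> S"
  shows "along V (\<lambda>y. sprod (f y) (g y)) y = sprod (along V f y) (g y) + sprod (f y) (along V g y)"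
  using along_eqI[OF has_derivative_sprod[OF smooth_on_has_derivative[OF assms(1,3)] smooth_on_has_derivative[OF assms(2,3)]]]
  by (simp add: along_def)

lemma along_add:
  assumes "smooth_on S f" "smooth_on S g" "y \<in> S"
  shows "along V (\<lambda>y. f y + g y) y = along V f y + along V g y"
  using along_eqI[OF has_derivative_add[OF smooth_on_has_derivative[OF assms(1,3)] smooth_on_has_derivative[OF assms(2,3)]]]
  by (simp add: along_def)

lemma along_const [simp]: "along V (\<lambda>y. c) y = 0"
  by (rule along_eqI[OF has_derivative_const])

lemma along_linear:
  assumes "bounded_linear L" "smooth_on S f" "y \<in> S"
  shows "along V (\<lambda>y. L (f y)) y = L (along V f y)"
  using along_eqI[OF bounded_linear.has_derivative[OF assms(1) smooth_on_has_derivative[OF assms(2,3)]]]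
  by (simp add: along_def)

lemma along_minus:
  assumes "smooth_on S f" "y \<in> S"
  shows "along V (\<lambda>y. - f y) y = - along V f y"
  by (rule along_linear[OF bounded_linear_minus[OF bounded_linear_ident] assms])

lemma along_cmult:
  fixes f :: "'a::euclidean_space \<Rightarrow> real"
  assumes "smooth_on S f" "y \<in> S"
  shows "along V (\<lambda>y. c * f y) y = c * along V f y"
  by (rule along_linear[OF bounded_linear_mult_right assms])

lemma along_cscaleR:
  assumes "smooth_on S f" "y \<in> S"
  shows "along V (\<lambda>y. c *\<^sub>R f y) y = c *\<^sub>R along V f y"
  by (rule along_linear[OF bounded_linear_scaleR_right assms])

lemma along_divide:
  fixes f g :: "'a::euclidean_space \<Rightarrow> real"
  assumes "smooth_on S f" "smooth_on S g" "y \<in> S" "g y \<noteq> 0"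
  shows "along V (\<lambda>y. f y / g y) y = (along V f y * g y - f y * along V g y) / (g y * g y)"
  using along_eqI[OF has_derivative_divide[OF smooth_on_has_derivative[OF assms(1,3)] smooth_on_has_derivative[OF assms(2,3)] assms(4)]]
    assms(4)
  by (simp add: along_def field_simps)

lemma along_sum:
  assumes "\<And>i. i \<in> I \<Longrightarrow> smooth_on S (f i)" "y \<in> S"
  shows "along V (\<lambda>y. \<Sum>i\<in>I. f i y) y = (\<Sum>i\<in>I. along V (f i) y)"
proof -
  have "((\<lambda>y. \<Sum>i\<in>I. f i y) has_derivative (\<lambda>v. \<Sum>i\<in>I. frechet_derivative (f i) (at y) v)) (at y)"
    using assms by (intro has_derivative_sum smooth_on_has_derivative)
  then have "along V (\<lambda>y. \<Sum>i\<in>I. f i y) y = (\<Sum>i\<in>I. frechet_derivative (f i) (at y) (V y))"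
    by (rule along_eqI)
  then show ?thesis by (simp add: along_def[of V _ y, symmetric])
qed

text \<open>A parametrized hypersurface \<open>X\<close> with unit normal \<open>N\<close> and an orthonormal frame \<open>E\<close> of principal directions.
  The field \<open>V i\<close> on the parameter domain is mapped to \<open>E i\<close> by the differential of \<open>X\<close>, so that
  differentiating a function along \<open>V i\<close> is differentiating it along \<open>E i\<close>.  The last
  assumption says that \<open>E i\<close> is principal with curvature \<open>k i\<close>.\<close>

locale hypersurface_frame =
  fixes S :: "(real^4) set" and X N :: "real^4 \<Rightarrow> real^5"
    and k :: "4 \<Rightarrow> real^4 \<Rightarrow> real" and E :: "4 \<Rightarrow> real^4 \<Rightarrow> real^5"
    and V :: "4 \<Rightarrow> real^4 \<Rightarrow> real^4" and \<epsilon> :: "4 \<Rightarrow> real"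
  assumes open_S [simp, smooth_intros]: "open S"
    and smooth_X [smooth_intros]: "smooth_on S X"
    and smooth_N [smooth_intros]: "smooth_on S N"
    and smooth_k [smooth_intros]: "\<And>i. smooth_on S (k i)"
    and smooth_E [smooth_intros]: "\<And>i. smooth_on S (E i)"
    and smooth_V [smooth_intros]: "\<And>i. smooth_on S (V i)"
    and eps: "\<And>i. \<epsilon> i * \<epsilon> i = 1"
    and E_E: "\<And>i j y. y \<in> S \<Longrightarrow> sprod (E i y) (E j y) = (if i = j then \<epsilon> i else 0)"
    and N_N: "\<And>y. y \<in> S \<Longrightarrow> sprod (N y) (N y) = 1"
    and N_E: "\<And>i y. y \<in> S \<Longrightarrow> sprod (N y) (E i y) = 0"
    and inj_dX: "\<And>y. y \<in> S \<Longrightarrow> inj (frechet_derivative X (at y))"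
    and V_X: "\<And>i y. y \<in> S \<Longrightarrow> along (V i) X y = E i y"
    and V_N: "\<And>i y. y \<in> S \<Longrightarrow> along (V i) N y = - k i y *\<^sub>R E i y"
begin

abbreviation D :: "4 \<Rightarrow> (real^4 \<Rightarrow> 'b::real_normed_vector) \<Rightarrow> real^4 \<Rightarrow> 'b" where
  "D i \<equiv> along (V i)"

text \<open>The coefficients of the Levi-Civita connection, \<open>\<langle>\<nabla> i (E j), E l\<rangle>\<close>: the normal part of the flat
  derivative does not contribute.\<close>

definition b :: "4 \<Rightarrow> 4 \<Rightarrow> 4 \<Rightarrow> real^4 \<Rightarrow> real" where
  "b i j l y = sprod (D i (E j) y) (E l y)"

lemma smooth_b [smooth_intros]: "smooth_on S (b i j l)"
  unfolding b_def[abs_def] by (intro smooth_intros)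

lemma eps_cancel [simp]: "\<epsilon> i * (\<epsilon> i * c) = c" "\<epsilon> i \<noteq> 0"
  using eps[of i] by (auto simp flip: mult.assoc)

lemma E_N: "y \<in> S \<Longrightarrow> sprod (E i y) (N y) = 0"
  using N_E sprod_commute by metis

lemma orthonormal5_five: "y \<in> S \<Longrightarrow> orthonormal5 (tuple5 (E 1 y) (E 2 y) (E 3 y) (E 4 y) (N y)) (tuple5 (\<epsilon> 1) (\<epsilon> 2) (\<epsilon> 3) (\<epsilon> 4) 1)"
  unfolding orthonormal5_def forall_5
  by (simp add: E_E N_N N_E E_N power2_eq_square eps)

lemma expansion:
  assumes "y \<in> S"
  shows "w = (\<Sum>l\<in>UNIV. (\<epsilon> l * sprod w (E l y)) *\<^sub>R E l y) + sprod w (N y) *\<^sub>R N y"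
  using orthonormal5_expansion[OF orthonormal5_five[OF assms], of w]
  by (simp add: sum_5 sum_4)

lemma frame_eqI:
  assumes "y \<in> S" "\<And>l. sprod v (E l y) = sprod w (E l y)" "sprod v (N y) = sprod w (N y)"
  shows "v = w"
  using expansion[OF assms(1), of v] expansion[OF assms(1), of w] assms(2,3) by simp

lemma b_skew: "y \<in> S \<Longrightarrow> b i j l y = - b i l j y"
proof -
  assume y: "y \<in> S"
  have "D i (\<lambda>y. sprod (E j y) (E l y)) y = D i (\<lambda>y. if j = l then \<epsilon> j else 0) y"
    by (rule along_cong[OF open_S y]) (auto simp: E_E intro: smooth_intros)
  then show ?thesis
    using along_sprod[OF smooth_E smooth_E y, of "V i" j l]
    by (simp add: b_def sprod_commute)
qed

lemma b_same [simp]: "y \<in> S \<Longrightarrow> b i j j y = 0"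
  using b_skew[of y i j j] by simp

lemma D_E_N: "y \<in> S \<Longrightarrow> sprod (D i (E j) y) (N y) = (if i = j then \<epsilon> i * k i y else 0)"
proof -
  assume y: "y \<in> S"
  have "D i (\<lambda>y. sprod (E j y) (N y)) y = D i (\<lambda>y. 0) y"
    by (rule along_cong[OF open_S y]) (auto simp: E_N intro: smooth_intros)
  then show ?thesis
    using along_sprod[OF smooth_E smooth_N y, of "V i" j] E_E[OF y, of j i]
    by (simp add: V_N y)
qed

lemma D_E:
  assumes "y \<in> S"
  shows "D i (E j) y = (\<Sum>l\<in>UNIV. (\<epsilon> l * b i j l y) *\<^sub>R E l y) + (if i = j then \<epsilon> i * k i y else 0) *\<^sub>R N y"
  using expansion[OF assms, of "D i (E j) y"] D_E_N[OF assms, of i j] by (simp add: b_def)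

lemma linear_frechet: "smooth_on S f \<Longrightarrow> y \<in> S \<Longrightarrow> linear (frechet_derivative f (at y))"
  using smooth_on_has_derivative has_derivative_linear by blast

text \<open>The bracket of \<open>V i\<close> and \<open>V j\<close> can be read off from its image under the differential of \<open>X\<close>,
  where it is the difference of the two derivatives of frame vectors; their normal parts
  agree because the frame is principal.\<close>

lemma frame_commutator:
  fixes f :: "real^4 \<Rightarrow> 'b::euclidean_space"
  assumes y: "y \<in> S" and f: "smooth_on S f"
  shows "D i (D j f) y - D j (D i f) y = (\<Sum>l\<in>UNIV. (\<epsilon> l * (b i j l y - b j i l y)) *\<^sub>R D l f y)"
proof -
  define u where "u = along (V i) (V j) y - along (V j) (V i) y"
  have comm: "D i (D j g) y - D j (D i g) y = frechet_derivative g (at y) u"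
    if "smooth_on S g" for g :: "real^4 \<Rightarrow> 'c::euclidean_space"
    unfolding u_def by (rule commutator[OF open_S y that smooth_V smooth_V])
  let ?c = "\<lambda>l. \<epsilon> l * (b i j l y - b j i l y)"
  have lin: "frechet_derivative g (at y) (\<Sum>l\<in>UNIV. ?c l *\<^sub>R V l y) = (\<Sum>l\<in>UNIV. ?c l *\<^sub>R D l g y)"
    if "smooth_on S g" for g :: "real^4 \<Rightarrow> 'c::real_normed_vector"
    using linear_frechet[OF that y] by (simp add: linear_sum linear_scale along_def)
  have "D i (D j X) y = D i (E j) y" for i j
    by (rule along_cong[OF open_S y]) (auto simp: V_X intro: smooth_intros)
  then have "frechet_derivative X (at y) u = D i (E j) y - D j (E i) y"
    using comm[OF smooth_X] by simp
  also have "\<dots> = (\<Sum>l\<in>UNIV. ?c l *\<^sub>R D l X y)"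
    unfolding D_E[OF y, of i j] D_E[OF y, of j i]
    by (cases "i = j") (auto simp: V_X y algebra_simps sum_subtractf)
  finally have "frechet_derivative X (at y) u = frechet_derivative X (at y) (\<Sum>l\<in>UNIV. ?c l *\<^sub>R V l y)"
    using lin[OF smooth_X] by simp
  then have "u = (\<Sum>l\<in>UNIV. ?c l *\<^sub>R V l y)" using inj_dX[OF y] by (simp add: inj_eq)
  then show ?thesis using comm[OF f] lin[OF f] by simp
qed

lemma D_D_N: "y \<in> S \<Longrightarrow> D i (D j N) y = - D i (k j) y *\<^sub>R E j y - k j y *\<^sub>R D i (E j) y"
proof -
  assume y: "y \<in> S"
  have "D i (D j N) y = D i (\<lambda>y. - k j y *\<^sub>R E j y) y"
    by (rule along_cong[OF open_S y]) (auto simp: V_N intro: smooth_intros)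
  also have "\<dots> = - (D i (k j) y *\<^sub>R E j y + k j y *\<^sub>R D i (E j) y)"
    using along_scaleR[OF smooth_k smooth_E y, of "V i" j j]
      along_minus[of S "\<lambda>y. k j y *\<^sub>R E j y" y "V i"] y by (simp add: smooth_intros)
  finally show ?thesis by simp
qed

text \<open>The commutator formula applied to the unit normal.\<close>

lemma codazzi:
  assumes y: "y \<in> S" and "i \<noteq> j"
  shows "(if l = i then \<epsilon> i * D j (k i) y else 0) - (if l = j then \<epsilon> j * D i (k j) y else 0) =
     (k j y - k l y) * b i j l y - (k i y - k l y) * b j i l y"
proof -
  have "sprod (D i (D j N) y - D j (D i N) y) (E l y) =
     sprod (\<Sum>m\<in>UNIV. (\<epsilon> m * (b i j m y - b j i m y)) *\<^sub>R D m N y) (E l y)"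
    by (subst frame_commutator[OF y smooth_N]) simp
  also have "\<dots> = - k l y * (b i j l y - b j i l y)"
    by (simp add: sprod_sum_left V_N y E_E if_distrib mult_ac cong: if_cong)
  finally show ?thesis
    by (simp add: D_D_N y E_E b_def[symmetric] algebra_simps split: if_splits)
qed

lemma codazzi_diagonal:
  assumes "y \<in> S" "i \<noteq> j"
  shows "D i (k j) y = (k i y - k j y) * \<epsilon> j * b j i j y"
  using codazzi[OF assms, of j] assms by (simp add: algebra_simps)

lemma codazzi_mixed:
  assumes "y \<in> S" "i \<noteq> j" "l \<noteq> i" "l \<noteq> j"
  shows "(k l y - k j y) * b i j l y = (k l y - k i y) * b j i l y"
  using codazzi[OF assms(1,2), of l] assms by (simp add: algebra_simps)

text \<open>The Laplace operator is the trace of the Hessian, the sum of the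
  \<open>\<epsilon> i (E i (E i G) - (\<nabla> i (E i)) G)\<close>.  The sign in front of the inner sum is positive because
  \<open>b i j i = - b i i j\<close>.\<close>

definition lap :: "(real^4 \<Rightarrow> 'b::real_normed_vector) \<Rightarrow> real^4 \<Rightarrow> 'b" where
  "lap G y = (\<Sum>i\<in>UNIV. \<epsilon> i *\<^sub>R (D i (D i G) y + (\<Sum>j\<in>UNIV. (\<epsilon> j * b i j i y) *\<^sub>R D j G y)))"

definition trS where "trS y = (\<Sum>i\<in>UNIV. k i y)"

lemma smooth_trS [smooth_intros]: "smooth_on S trS"
  unfolding trS_def[abs_def] by (intro smooth_intros)

text \<open>Subtracting the tangential part \<open>\<nabla> i (E i)\<close> leaves only the normal part of the second derivative
  of \<open>X\<close>, which is given by the principal curvature.\<close>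

lemma lap_X:
  assumes y: "y \<in> S"
  shows "lap X y = trS y *\<^sub>R N y"
proof -
  have DD: "D i (D i X) y = D i (E i) y" for i
    by (rule along_cong[OF open_S y]) (auto simp: V_X intro: smooth_intros)
  have "D i (D i X) y + (\<Sum>j\<in>UNIV. (\<epsilon> j * b i j i y) *\<^sub>R D j X y) = (\<epsilon> i * k i y) *\<^sub>R N y" for i
  proof -
    have "(\<Sum>j\<in>UNIV. (\<epsilon> j * b i j i y) *\<^sub>R D j X y) = - (\<Sum>j\<in>UNIV. (\<epsilon> j * b i i j y) *\<^sub>R E j y)"
      using b_skew[OF y, of i _ i] by (simp add: V_X y sum_negf)
    then show ?thesis unfolding DD D_E[OF y, of i i] by simp
  qed
  then show ?thesis unfolding lap_def trS_def by (simp add: scaleR_sum_left)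
qed

text \<open>Besides \<open>S\<close> applied to \<open>grad (tr S)\<close>, the tangential part contains the divergence of \<open>S\<close>; the
  diagonal Codazzi equations turn the latter into the gradient of \<open>tr S\<close>.\<close>

lemma sprod_lap_trS_N:
  assumes y: "y \<in> S"
  shows "sprod (lap (\<lambda>y. trS y *\<^sub>R N y) y) (E l y) = - (2 * k l y + trS y) * D l trS y"
proof -
  let ?G = "\<lambda>y. trS y *\<^sub>R N y"
  have DG: "D i ?G z = D i trS z *\<^sub>R N z + trS z *\<^sub>R D i N z" if "z \<in> S" for i z
    using that by (intro along_scaleR[OF smooth_trS smooth_N])
  have "D i (D i ?G) y = D i (\<lambda>z. D i trS z *\<^sub>R N z + trS z *\<^sub>R D i N z) y" for i
    by (rule along_cong[OF open_S y]) (auto simp: DG intro: smooth_intros)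
  also have "D i (\<lambda>z. D i trS z *\<^sub>R N z + trS z *\<^sub>R D i N z) y =
     (D i (D i trS) y *\<^sub>R N y + D i trS y *\<^sub>R D i N y) + (D i trS y *\<^sub>R D i N y + trS y *\<^sub>R D i (D i N) y)" for i
    using along_add[of S "\<lambda>z. D i trS z *\<^sub>R N z" "\<lambda>z. trS z *\<^sub>R D i N z" y "V i"]
      along_scaleR[of S "D i trS" N y "V i"] along_scaleR[of S trS "D i N" y "V i"] y
    by (simp add: smooth_intros)
  finally have DD2: "D i (D i ?G) y = (D i (D i trS) y *\<^sub>R N y + D i trS y *\<^sub>R D i N y)
      + (D i trS y *\<^sub>R D i N y + trS y *\<^sub>R D i (D i N) y)" for i .
  have DDG: "sprod (D i (D i ?G) y) (E l y) =
     - (if i = l then \<epsilon> l * (2 * D l trS y * k l y + trS y * D l (k l) y) else 0) - trS y * k i y * b i i l y" for i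
    unfolding DD2 D_D_N[OF y] V_N[OF y] sprod_simps by (simp add: y N_E E_E b_def[symmetric] algebra_simps)
  have rest: "sprod (\<Sum>j\<in>UNIV. (\<epsilon> j * b i j i y) *\<^sub>R D j ?G y) (E l y) = trS y * k l y * b i i l y" for i
    using b_skew[OF y, of i i l]
    by (simp add: sprod_sum_left DG y V_N N_E E_E if_distrib mult_ac cong: if_cong)
  have "sprod (lap ?G y) (E l y) = (\<Sum>i\<in>UNIV. \<epsilon> i * (- (if i = l then \<epsilon> l * (2 * D l trS y * k l y + trS y * D l (k l) y) else 0)
      + trS y * (k l y - k i y) * b i i l y))"
    unfolding lap_def
    by (subst sprod_sum_left, rule sum.cong[OF refl]) (simp only: sprod_simps DDG rest algebra_simps)
  also have "\<dots> = (\<Sum>i\<in>UNIV. (if i = l then - (2 * D l trS y * k l y) else 0) - trS y * D l (k i) y)"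
  proof (rule sum.cong[OF refl])
    fix i
    show "\<epsilon> i * (- (if i = l then \<epsilon> l * (2 * D l trS y * k l y + trS y * D l (k l) y) else 0)
      + trS y * (k l y - k i y) * b i i l y) = (if i = l then - (2 * D l trS y * k l y) else 0) - trS y * D l (k i) y"
    proof (cases "i = l")
      case True
      then show ?thesis by (simp add: algebra_simps)
    next
      case False
      then show ?thesis
        unfolding b_skew[OF y, of i i l] codazzi_diagonal[OF y False[symmetric]] by (simp add: algebra_simps)
    qed
  qed
  also have "\<dots> = - (2 * D l trS y * k l y) - trS y * D l trS y"
    using along_sum[of UNIV S k y "V l"] y smooth_k by (simp add: sum_subtractf sum_distrib_left[symmetric] trS_def[abs_def])
  finally show ?thesis by (simp add: algebra_simps)
qed

end

section \<open>The structure equations\<close>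

text \<open>The consequences of the hypotheses on the mean curvature, in terms of \<open>k1 = - 2 H\<close>: the relation
  \<open>trace\<close> is \<open>tr S = 4 H\<close>, and \<open>E 1\<close> is the direction of the gradient of \<open>k1\<close>.\<close>

locale adapted_frame = hypersurface_frame +
  assumes k_nz: "\<And>i y. y \<in> S \<Longrightarrow> k i y \<noteq> 0"
    and k3: "\<And>y. y \<in> S \<Longrightarrow> k 3 y = k 2 y"
    and k12: "\<And>y. y \<in> S \<Longrightarrow> k 1 y \<noteq> k 2 y"
    and k14: "\<And>y. y \<in> S \<Longrightarrow> k 1 y \<noteq> k 4 y"
    and k42: "\<And>y. y \<in> S \<Longrightarrow> k 4 y \<noteq> k 2 y"
    and trace: "\<And>y. y \<in> S \<Longrightarrow> 3 * k 1 y + 2 * k 2 y + k 4 y = 0"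
    and D_k1: "\<And>i y. y \<in> S \<Longrightarrow> i \<noteq> 1 \<Longrightarrow> D i (k 1) y = 0"
    and D1_k1: "\<And>y. y \<in> S \<Longrightarrow> D 1 (k 1) y \<noteq> 0"
begin

lemma k1_neq: "y \<in> S \<Longrightarrow> i \<noteq> 1 \<Longrightarrow> k 1 y \<noteq> k i y"
  using exhaust_4[of i] k12 k14 k3 by auto

lemma b_1_1_i [simp]: "y \<in> S \<Longrightarrow> b 1 1 i y = 0"
  using codazzi_diagonal[of y i 1] D_k1[of y i] k1_neq[of y i] b_skew[of y 1 1 i]
  by (cases "i = 1") auto

lemma b_1_i_1 [simp]: "y \<in> S \<Longrightarrow> b 1 i 1 y = 0"
  using b_skew[of y 1 i 1] by simp

text \<open>The leaves orthogonal to \<open>E 1\<close> are level sets of \<open>k1\<close>, so the brackets of the other frame fields have no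
  component along \<open>E 1\<close>.\<close>

lemma b_i_j_1: 
  assumes y: "y \<in> S" and ij: "i \<noteq> 1" "j \<noteq> 1"
  shows "b i j 1 y = b j i 1 y"
proof -
  have "D i (D j (k 1)) y = D i (\<lambda>_. 0) y" if "j \<noteq> 1" for i j
    by (rule along_cong[OF open_S y]) (use D_k1 that in \<open>auto intro: smooth_intros\<close>)
  then have "(\<Sum>l\<in>UNIV. (\<epsilon> l * (b i j l y - b j i l y)) *\<^sub>R D l (k 1) y) = 0"
    using frame_commutator[OF y smooth_k, of i j 1] ij by simp
  then show ?thesis using D_k1[OF y] D1_k1[OF y] by (simp add: sum_4)
qed

text \<open>Symmetry of the second fundamental form of the leaves and the Codazzi equation are two
  proportionalities between the same coefficients, with different factors since \<open>k4 \<noteq> k2\<close>.\<close>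

lemma b_i_4_1 [simp]:
  assumes y: "y \<in> S" and i: "i = 2 \<or> i = 3"
  shows "b i 4 1 y = 0" "b 4 i 1 y = 0" "b i 1 4 y = 0" "b 4 1 i y = 0"
proof -
  have "(k 1 y - k 4 y) * b i 4 1 y = (k 1 y - k i y) * b 4 i 1 y"
    using i by (intro codazzi_mixed[OF y]) auto
  moreover have "b i 4 1 y = b 4 i 1 y" using i by (intro b_i_j_1[OF y]) auto
  moreover have "k i y \<noteq> k 4 y" using i k42[OF y] k3[OF y] by auto
  ultimately show *: "b i 4 1 y = 0" "b 4 i 1 y = 0" by auto
  then show "b i 1 4 y = 0" "b 4 1 i y = 0"
    using b_skew[OF y, of i 1 4] b_skew[OF y, of 4 1 i] by simp_all
qed

lemma two_three: 
  assumes "{a, c} = {2, 3 :: 4}"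
  shows "a = 2 \<and> c = 3 \<or> a = 3 \<and> c = 2"
  using assms by (auto simp: doubleton_eq_iff)

text \<open>The two directions of the double curvature play symmetric parts.  One side of each Codazzi equation
  involving them vanishes, because \<open>k3 = k2\<close> or by the preceding lemma.\<close>

lemma b_zero [simp]:
  assumes y: "y \<in> S" and ac: "{a, c} = {2, 3 :: 4}"
  shows "b a 1 c y = 0" "b a c 1 y = 0" "b 1 a 4 y = 0" "b 1 4 a y = 0" "b a 4 c y = 0" "b a c 4 y = 0"
    "D a (k c) y = 0"
proof -
  note ac = two_three[OF ac]
  have k: "k a y = k 2 y" "k c y = k 2 y" using ac k3[OF y] by auto
  have "(k c y - k a y) * b 1 a c y = (k c y - k 1 y) * b a 1 c y"
    using ac by (intro codazzi_mixed[OF y]) auto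
  then show 1: "b a 1 c y = 0" using k k12[OF y] by simp
  then show "b a c 1 y = 0" using b_skew[OF y, of a 1 c] by simp
  have "(k 4 y - k a y) * b 1 a 4 y = (k 4 y - k 1 y) * b a 1 4 y"
    using ac by (intro codazzi_mixed[OF y]) auto
  then show 2: "b 1 a 4 y = 0" using k k42[OF y] b_i_4_1(3)[OF y, of a] ac by auto
  then show "b 1 4 a y = 0" using b_skew[OF y, of 1 4 a] by simp
  have "(k c y - k a y) * b 4 a c y = (k c y - k 4 y) * b a 4 c y"
    using ac by (intro codazzi_mixed[OF y]) auto
  then show 3: "b a 4 c y = 0" using k k42[OF y] by simp
  then show "b a c 4 y = 0" using b_skew[OF y, of a c 4] by simp
  have "D a (k c) y = (k a y - k c y) * \<epsilon> c * b c a c y"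
    using ac by (intro codazzi_diagonal[OF y]) auto
  then show "D a (k c) y = 0" using k by simp
qed

lemmas b_zero_23 [simp] = b_zero[OF _ refl]
lemmas b_zero_32 [simp] = b_zero[OF _ insert_commute]

lemma D_k3: "y \<in> S \<Longrightarrow> D i (k 3) y = D i (k 2) y"
  by (rule along_cong[OF open_S]) (auto simp: k3 intro: smooth_intros)

lemma D_k4: 
  assumes y: "y \<in> S"
  shows "D i (k 4) y = - 3 * D i (k 1) y - 2 * D i (k 2) y"
proof -
  have *: "k 4 z = (-3) * k 1 z + (-2) * k 2 z" if "z \<in> S" for z
    using trace[OF that] by linarith
  have "D i (k 4) y = D i (\<lambda>y. (-3) * k 1 y + (-2) * k 2 y) y"
    by (rule along_cong[OF open_S y]) (use * in \<open>auto intro!: smooth_intros\<close>)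
  also have "\<dots> = - 3 * D i (k 1) y - 2 * D i (k 2) y"
    using along_add[of S "\<lambda>y. (-3) * k 1 y" "\<lambda>y. (-2) * k 2 y" y "V i"] y
      along_cmult[OF smooth_k y, of "V i" "-3" 1] along_cmult[OF smooth_k y, of "V i" "-2" 2]
    by (simp add: smooth_intros)
  finally show ?thesis .
qed

lemma Da_k:
  assumes y: "y \<in> S" and a: "a = 2 \<or> a = 3"
  shows "D a (k 2) y = 0" "D a (k 4) y = 0"
proof -
  show 1: "D a (k 2) y = 0"
    using a b_zero_23(7)[OF y] b_zero_32(7)[OF y] D_k3[OF y] by auto
  show "D a (k 4) y = 0" using D_k4[OF y, of a] D_k1[OF y, of a] 1 a by auto
qed

lemma b_4_4_a [simp]:
  assumes y: "y \<in> S" and a: "a = 2 \<or> a = 3"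
  shows "b 4 4 a y = 0" "b 4 a 4 y = 0"
proof -
  have "D a (k 4) y = (k a y - k 4 y) * \<epsilon> 4 * b 4 a 4 y"
    using a by (intro codazzi_diagonal[OF y]) auto
  then show *: "b 4 a 4 y = 0" using Da_k(2)[OF y a] a k42[OF y] k3[OF y] by auto
  then show "b 4 4 a y = 0" using b_skew[OF y, of 4 4 a] by simp
qed

text \<open>By the next lemmas \<open>l2\<close> and \<open>l4\<close> are the eigenvalues of the derivative of \<open>E 1\<close> on the leaves, and \<open>\<mu>\<close> measures how
  \<open>E 4\<close> turns along \<open>E 2\<close> and \<open>E 3\<close>.\<close>

definition l2 where "l2 y = \<epsilon> 2 * b 2 1 2 y"
definition l4 where "l4 y = \<epsilon> 4 * b 4 1 4 y"
definition \<mu> where "\<mu> y = \<epsilon> 2 * b 2 4 2 y"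

lemma smooth_coefficients [smooth_intros]: "smooth_on S l2" "smooth_on S l4" "smooth_on S \<mu>"
  unfolding l2_def[abs_def] l4_def[abs_def] \<mu>_def[abs_def] by (intro smooth_intros)+

lemma D_k:
  assumes y: "y \<in> S"
  shows "D 1 (k 2) y = l2 y * (k 1 y - k 2 y)" "D 1 (k 4) y = l4 y * (k 1 y - k 4 y)"
    "D 4 (k 2) y = \<mu> y * (k 4 y - k 2 y)"
  using codazzi_diagonal[OF y, of 1 2] codazzi_diagonal[OF y, of 1 4] codazzi_diagonal[OF y, of 4 2]
  by (simp_all add: l2_def l4_def \<mu>_def mult_ac)

text \<open>The two diagonal Codazzi equations for \<open>k 2\<close> and \<open>k 3\<close> have the same left-hand sides.\<close>

lemma coefficients_3:
  assumes y: "y \<in> S"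
  shows "\<epsilon> 3 * b 3 1 3 y = l2 y" "\<epsilon> 3 * b 3 4 3 y = \<mu> y"
proof -
  have "(k 1 y - k 2 y) * l2 y = (k 1 y - k 2 y) * (\<epsilon> 3 * b 3 1 3 y)"
    using codazzi_diagonal[OF y, of 1 3] D_k(1)[OF y] D_k3[OF y, of 1] k3[OF y] by (simp add: mult_ac)
  then show "\<epsilon> 3 * b 3 1 3 y = l2 y" using k12[OF y] by simp
  have "(k 4 y - k 2 y) * \<mu> y = (k 4 y - k 2 y) * (\<epsilon> 3 * b 3 4 3 y)"
    using codazzi_diagonal[OF y, of 4 3] D_k(3)[OF y] D_k3[OF y, of 4] k3[OF y] by (simp add: mult_ac)
  then show "\<epsilon> 3 * b 3 4 3 y = \<mu> y" using k42[OF y] by simp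
qed

lemma coefficients:
  assumes y: "y \<in> S" and a: "a = 2 \<or> a = 3"
  shows "\<epsilon> a * b a 1 a y = l2 y" "\<epsilon> a * b a 4 a y = \<mu> y"
  using a coefficients_3[OF y] by (auto simp: l2_def \<mu>_def)

lemma D1_E:
  assumes y: "y \<in> S"
  shows "D 1 (E 1) y = (\<epsilon> 1 * k 1 y) *\<^sub>R N y" "D 1 (E 4) y = 0"
  unfolding D_E[OF y, of 1 1] D_E[OF y, of 1 4] using y
  by (simp_all add: sum_4)

lemma D4_E:
  assumes y: "y \<in> S"
  shows "D 4 (E 1) y = l4 y *\<^sub>R E 4 y"
    "D 4 (E 4) y = \<epsilon> 4 *\<^sub>R (k 4 y *\<^sub>R N y - (\<epsilon> 1 * l4 y) *\<^sub>R E 1 y)"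
  unfolding D_E[OF y, of 4 1] D_E[OF y, of 4 4] using y b_skew[OF y, of 4 4 1]
  by (simp_all add: sum_4 l4_def algebra_simps)

lemma Da_E:
  assumes y: "y \<in> S" and a: "a = 2 \<or> a = 3"
  shows "D a (E 1) y = l2 y *\<^sub>R E a y" "D a (E 4) y = \<mu> y *\<^sub>R E a y"
  unfolding D_E[OF y, of a 1] D_E[OF y, of a 4]
  using a y coefficients[OF y a] b_skew[OF y, of a 1 1] b_skew[OF y, of a 4 4]
  by (auto simp: sum_4)

lemma commutator_1_4:
  fixes g :: "real^4 \<Rightarrow> 'b::euclidean_space"
  assumes y: "y \<in> S" and g: "smooth_on S g"
  shows "D 1 (D 4 g) y - D 4 (D 1 g) y = - l4 y *\<^sub>R D 4 g y"
  unfolding frame_commutator[OF y g]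
  using y
  by (simp add: sum_4 l4_def)

lemma commutator_1_a:
  fixes g :: "real^4 \<Rightarrow> 'b::euclidean_space"
  assumes y: "y \<in> S" and g: "smooth_on S g" and ac: "{a, c} = {2, 3}"
  shows "D 1 (D a g) y - D a (D 1 g) y = (\<epsilon> c * b 1 a c y) *\<^sub>R D c g y - l2 y *\<^sub>R D a g y"
  unfolding frame_commutator[OF y g]
  using y two_three[OF ac] coefficients(1)[OF y, of a] b_zero(1,3)[OF y ac]
  by (auto simp: sum_4)

lemma commutator_4_a:
  fixes g :: "real^4 \<Rightarrow> 'b::euclidean_space"
  assumes y: "y \<in> S" and g: "smooth_on S g" and ac: "{a, c} = {2, 3}"
  shows "D 4 (D a g) y - D a (D 4 g) y = (\<epsilon> c * b 4 a c y) *\<^sub>R D c g y - \<mu> y *\<^sub>R D a g y"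
  unfolding frame_commutator[OF y g]
  using y two_three[OF ac] coefficients(2)[OF y, of a] b_zero(5)[OF y ac]
  by (auto simp: sum_4)

text \<open>The bracket of \<open>E 1\<close> with a field tangent to the leaves is tangent to the leaves.\<close>

lemma leafwise_constant_D1:
  assumes g: "smooth_on S (g :: real^4 \<Rightarrow> real)" and "\<And>i z. z \<in> S \<Longrightarrow> i \<noteq> 1 \<Longrightarrow> D i g z = 0"
    and y: "y \<in> S" and i: "i \<noteq> 1"
  shows "D i (D 1 g) y = 0"
proof -
  have "D 1 (D i g) y = D 1 (\<lambda>_. 0) y"
    by (rule along_cong[OF open_S y]) (use assms in \<open>auto intro: smooth_intros\<close>)
  moreover have "b i 1 1 y = 0" using y by simp
  ultimately show ?thesis
    using frame_commutator[OF y g, of 1 i] assms y by (simp add: sum_4)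
qed

text \<open>The Gauss equations say that the flat connection has no curvature.  Each of those used here is a
  component of the commutator formula applied to the frame vector \<open>E 1\<close>, or to \<open>E 4\<close>
  for the derivative of \<open>\<mu>\<close>.\<close>

lemma D1_l4:
  assumes y: "y \<in> S"
  shows "D 1 l4 y = - (l4 y)\<^sup>2 - \<epsilon> 1 * k 1 y * k 4 y"
proof -
  have "D 1 (D 4 (E 1)) y = D 1 (\<lambda>y. l4 y *\<^sub>R E 4 y) y"
    by (rule along_cong[OF open_S y]) (auto simp: D4_E intro: smooth_intros)
  also have "\<dots> = D 1 l4 y *\<^sub>R E 4 y"
    using along_scaleR[OF smooth_coefficients(2) smooth_E y] by (simp add: D1_E y)
  finally have 1: "D 1 (D 4 (E 1)) y = D 1 l4 y *\<^sub>R E 4 y" .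
  have "D 4 (D 1 (E 1)) y = D 4 (\<lambda>y. (\<epsilon> 1 * k 1 y) *\<^sub>R N y) y"
    by (rule along_cong[OF open_S y]) (auto simp: D1_E intro: smooth_intros)
  also have "\<dots> = - (\<epsilon> 1 * k 1 y * k 4 y) *\<^sub>R E 4 y"
    using along_scaleR[of S "\<lambda>y. \<epsilon> 1 * k 1 y" N y "V 4"] along_cmult[OF smooth_k y, of "V 4" "\<epsilon> 1" 1] y
    by (simp add: smooth_intros V_N D_k1)
  finally have 2: "D 4 (D 1 (E 1)) y = - (\<epsilon> 1 * k 1 y * k 4 y) *\<^sub>R E 4 y" .
  have "sprod (D 1 (D 4 (E 1)) y - D 4 (D 1 (E 1)) y) (E 4 y) = sprod (- l4 y *\<^sub>R D 4 (E 1) y) (E 4 y)"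
    using commutator_1_4[OF y smooth_E] by simp
  then have "(D 1 l4 y + \<epsilon> 1 * k 1 y * k 4 y) * \<epsilon> 4 = - (l4 y)\<^sup>2 * \<epsilon> 4"
    unfolding 1 2 D4_E[OF y] sprod_simps by (simp add: y E_E algebra_simps power2_eq_square)
  then have "D 1 l4 y + \<epsilon> 1 * k 1 y * k 4 y = - (l4 y)\<^sup>2"
    by (simp only: mult_cancel_right eps_cancel simp_thms)
  then show ?thesis by simp
qed

lemma D1_l2:
  assumes y: "y \<in> S"
  shows "D 1 l2 y = - (l2 y)\<^sup>2 - \<epsilon> 1 * k 1 y * k 2 y"
proof -
  have "D 1 (D 2 (E 1)) y = D 1 (\<lambda>y. l2 y *\<^sub>R E 2 y) y"
    by (rule along_cong[OF open_S y]) (auto simp: Da_E intro: smooth_intros)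
  also have "\<dots> = D 1 l2 y *\<^sub>R E 2 y + l2 y *\<^sub>R D 1 (E 2) y"
    using along_scaleR[OF smooth_coefficients(1) smooth_E y] by simp
  finally have 1: "D 1 (D 2 (E 1)) y = D 1 l2 y *\<^sub>R E 2 y + l2 y *\<^sub>R D 1 (E 2) y" .
  have "D 2 (D 1 (E 1)) y = D 2 (\<lambda>y. (\<epsilon> 1 * k 1 y) *\<^sub>R N y) y"
    by (rule along_cong[OF open_S y]) (auto simp: D1_E intro: smooth_intros)
  also have "\<dots> = - (\<epsilon> 1 * k 1 y * k 2 y) *\<^sub>R E 2 y"
    using along_scaleR[of S "\<lambda>y. \<epsilon> 1 * k 1 y" N y "V 2"] along_cmult[OF smooth_k y, of "V 2" "\<epsilon> 1" 1] y
    by (simp add: smooth_intros V_N D_k1)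
  finally have 2: "D 2 (D 1 (E 1)) y = - (\<epsilon> 1 * k 1 y * k 2 y) *\<^sub>R E 2 y" .
  have "sprod (D 1 (D 2 (E 1)) y - D 2 (D 1 (E 1)) y) (E 2 y) =
      sprod ((\<epsilon> 3 * b 1 2 3 y) *\<^sub>R D 3 (E 1) y - l2 y *\<^sub>R D 2 (E 1) y) (E 2 y)"
    using commutator_1_a[OF y smooth_E, of 2 3] by simp
  moreover have "sprod (D 1 (E 2) y) (E 2 y) = 0" using b_same[OF y, of 1 2] by (simp add: b_def)
  moreover have "D 3 (E 1) y = l2 y *\<^sub>R E 3 y" "D 2 (E 1) y = l2 y *\<^sub>R E 2 y" using Da_E(1)[OF y] by auto
  ultimately have "(D 1 l2 y + \<epsilon> 1 * k 1 y * k 2 y) * \<epsilon> 2 = - (l2 y)\<^sup>2 * \<epsilon> 2"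
    unfolding 1 2 by (simp add: y E_E algebra_simps power2_eq_square)
  then have "D 1 l2 y + \<epsilon> 1 * k 1 y * k 2 y = - (l2 y)\<^sup>2"
    by (simp only: mult_cancel_right eps_cancel simp_thms)
  then show ?thesis by simp
qed

lemma gauss_4_a:
  assumes y: "y \<in> S" and ac: "{a, c} = {2, 3}"
  shows "D 4 l2 y = \<mu> y * (l4 y - l2 y)" "D a l4 y = 0"
proof -
  note ac' = two_three[OF ac]
  have "D 4 (D a (E 1)) y = D 4 (\<lambda>y. l2 y *\<^sub>R E a y) y"
    by (rule along_cong[OF open_S y]) (use ac' in \<open>auto simp: Da_E intro: smooth_intros\<close>)
  also have "\<dots> = D 4 l2 y *\<^sub>R E a y + l2 y *\<^sub>R D 4 (E a) y"
    using along_scaleR[OF smooth_coefficients(1) smooth_E y] by simp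
  finally have 1: "D 4 (D a (E 1)) y = D 4 l2 y *\<^sub>R E a y + l2 y *\<^sub>R D 4 (E a) y" .
  have "D a (D 4 (E 1)) y = D a (\<lambda>y. l4 y *\<^sub>R E 4 y) y"
    by (rule along_cong[OF open_S y]) (auto simp: D4_E intro: smooth_intros)
  also have "\<dots> = D a l4 y *\<^sub>R E 4 y + (l4 y * \<mu> y) *\<^sub>R E a y"
    using along_scaleR[OF smooth_coefficients(2) smooth_E y, of "V a" 4] Da_E(2)[OF y, of a] ac' by auto
  finally have 2: "D a (D 4 (E 1)) y = D a l4 y *\<^sub>R E 4 y + (l4 y * \<mu> y) *\<^sub>R E a y" .
  have D_E1: "D c (E 1) y = l2 y *\<^sub>R E c y" "D a (E 1) y = l2 y *\<^sub>R E a y" using Da_E(1)[OF y] ac' by auto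
  have comm: "sprod (D 4 (D a (E 1)) y - D a (D 4 (E 1)) y) (E l y) =
      sprod ((\<epsilon> c * b 4 a c y) *\<^sub>R D c (E 1) y - \<mu> y *\<^sub>R D a (E 1) y) (E l y)" for l
    using commutator_4_a[OF y smooth_E ac] by simp
  have z: "sprod (D 4 (E a) y) (E a y) = 0" "sprod (D 4 (E a) y) (E 4 y) = 0"
    using b_same[OF y, of 4 a] b_4_4_a(2)[OF y, of a] ac' by (auto simp: b_def)
  have "(D 4 l2 y - l4 y * \<mu> y) * \<epsilon> a = - \<mu> y * l2 y * \<epsilon> a"
    using comm[of a] z ac' unfolding 1 2 D_E1 by (auto simp: y E_E algebra_simps)
  then have "D 4 l2 y - l4 y * \<mu> y = - \<mu> y * l2 y"
    by (simp only: mult_cancel_right eps_cancel simp_thms)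
  then show "D 4 l2 y = \<mu> y * (l4 y - l2 y)" by (simp add: algebra_simps)
  show "D a l4 y = 0"
    using comm[of 4] z ac' unfolding 1 2 D_E1 by (auto simp: y E_E algebra_simps)
qed

lemma D4_\<mu>:
  assumes y: "y \<in> S"
  shows "D 4 \<mu> y + (\<mu> y)\<^sup>2 + \<epsilon> 4 * (\<epsilon> 1 * l2 y * l4 y + k 2 y * k 4 y) = 0"
proof -
  have "D 4 (D 2 (E 4)) y = D 4 (\<lambda>y. \<mu> y *\<^sub>R E 2 y) y"
    by (rule along_cong[OF open_S y]) (auto simp: Da_E intro: smooth_intros)
  also have "\<dots> = D 4 \<mu> y *\<^sub>R E 2 y + \<mu> y *\<^sub>R D 4 (E 2) y"
    using along_scaleR[OF smooth_coefficients(3) smooth_E y] by simp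
  finally have 1: "D 4 (D 2 (E 4)) y = D 4 \<mu> y *\<^sub>R E 2 y + \<mu> y *\<^sub>R D 4 (E 2) y" .
  have "D 2 (D 4 (E 4)) y = D 2 (\<lambda>y. \<epsilon> 4 *\<^sub>R (k 4 y *\<^sub>R N y + (- \<epsilon> 1 * l4 y) *\<^sub>R E 1 y)) y"
    by (rule along_cong[OF open_S y]) (auto simp: D4_E intro!: smooth_intros)
  also have "\<dots> = \<epsilon> 4 *\<^sub>R ((D 2 (k 4) y *\<^sub>R N y + k 4 y *\<^sub>R D 2 N y) + ((- \<epsilon> 1 * D 2 l4 y) *\<^sub>R E 1 y + (- \<epsilon> 1 * l4 y) *\<^sub>R D 2 (E 1) y))"
    using along_cscaleR[of S "\<lambda>y. k 4 y *\<^sub>R N y + (- \<epsilon> 1 * l4 y) *\<^sub>R E 1 y" y "V 2" "\<epsilon> 4"]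
      along_add[of S "\<lambda>y. k 4 y *\<^sub>R N y" "\<lambda>y. (- \<epsilon> 1 * l4 y) *\<^sub>R E 1 y" y "V 2"]
      along_scaleR[OF smooth_k smooth_N y, of "V 2" 4]
      along_scaleR[of S "\<lambda>y. - \<epsilon> 1 * l4 y" "E 1" y "V 2"]
      along_cmult[OF smooth_coefficients(2) y, of "V 2" "- \<epsilon> 1"] y
    by (simp add: smooth_intros)
  also have "\<dots> = - (\<epsilon> 4 * (k 4 y * k 2 y + \<epsilon> 1 * l4 y * l2 y)) *\<^sub>R E 2 y"
    using Da_k(2)[OF y, of 2] gauss_4_a(2)[OF y, of 2 3] Da_E(1)[OF y, of 2] V_N[OF y, of 2]
    by (simp add: algebra_simps)
  finally have 2: "D 2 (D 4 (E 4)) y = - (\<epsilon> 4 * (k 4 y * k 2 y + \<epsilon> 1 * l4 y * l2 y)) *\<^sub>R E 2 y" .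
  have "sprod (D 4 (D 2 (E 4)) y - D 2 (D 4 (E 4)) y) (E 2 y) =
      sprod ((\<epsilon> 3 * b 4 2 3 y) *\<^sub>R D 3 (E 4) y - \<mu> y *\<^sub>R D 2 (E 4) y) (E 2 y)"
    using commutator_4_a[OF y smooth_E, of 2 3] by simp
  moreover have "sprod (D 4 (E 2) y) (E 2 y) = 0" using b_same[OF y, of 4 2] by (simp add: b_def)
  moreover have "D 3 (E 4) y = \<mu> y *\<^sub>R E 3 y" "D 2 (E 4) y = \<mu> y *\<^sub>R E 2 y" using Da_E(2)[OF y] by auto
  ultimately have "(D 4 \<mu> y + (\<mu> y)\<^sup>2 + \<epsilon> 4 * (\<epsilon> 1 * l2 y * l4 y + k 2 y * k 4 y)) * \<epsilon> 2 = 0"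
    unfolding 1 2 by (simp add: y E_E algebra_simps power2_eq_square)
  then show ?thesis by simp
qed

lemma Da_l2:
  assumes y: "y \<in> S" and ac: "{a, c} = {2, 3}"
  shows "D a l2 y = 0"
proof -
  note ac' = two_three[OF ac]
  have DD: "D i (D j (E 1)) y = D i l2 y *\<^sub>R E j y + l2 y *\<^sub>R D i (E j) y" if "j = 2 \<or> j = 3" for i j
  proof -
    have "D i (D j (E 1)) y = D i (\<lambda>y. l2 y *\<^sub>R E j y) y"
      by (rule along_cong[OF open_S y]) (use that in \<open>auto simp: Da_E intro: smooth_intros\<close>)
    then show ?thesis using along_scaleR[OF smooth_coefficients(1) smooth_E y] by simp
  qed
  have "sprod (D a (D c (E 1)) y - D c (D a (E 1)) y) (E c y) =
     sprod (\<Sum>l\<in>UNIV. (\<epsilon> l * (b a c l y - b c a l y)) *\<^sub>R D l (E 1) y) (E c y)"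
    by (subst frame_commutator[OF y smooth_E]) simp
  also have "\<dots> = - l2 y * b c a c y"
    using ac' y Da_E(1)[OF y, of 2] Da_E(1)[OF y, of 3] D1_E(1)[OF y] D4_E(1)[OF y]
    by (auto simp: sum_4 E_E N_E algebra_simps)
  finally show ?thesis
    using ac' DD[of a c] DD[of c a] b_same[OF y, of a c] y
    by (auto simp: b_def E_E algebra_simps)
qed

end

subsection \<open>The second curvature is constant along the leaves\<close>

lemma derivative_locally_zero:
  assumes "open U" "y \<in> U" "\<And>z. z \<in> U \<Longrightarrow> g z = 0" "(g has_derivative g') (at y)"
  shows "g' v = 0"
proof -
  have "((\<lambda>_. 0) has_derivative g') (at y)"
    by (rule has_derivative_transform_within_open[OF assms(4,1,2)]) (simp add: assms(3))
  from has_derivative_unique[OF this has_derivative_const] show ?thesis by simp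
qed

text \<open>The elimination steps of the next argument, as statements about real numbers.  At a point, \<open>k, a, b\<close> stand
  for \<open>k1, k2, k4\<close>, \<open>p, q\<close> for \<open>l2, l4\<close>, \<open>K\<close> for \<open>e1 (k1)\<close>, \<open>e\<close> for \<open>\<epsilon>1\<close>, and \<open>da, db, dp, Q\<close> for the
  derivatives of \<open>k2, k4, l2, l4\<close> along \<open>e4\<close>.  The assumption \<open>E1\<close> is the first derivative of the trace relation along
  \<open>e1\<close>, \<open>dE1\<close> its derivative along \<open>e4\<close>, and the premise of the second claim is the derivative
  along \<open>e4\<close> of the second derivative of the trace relation.\<close>

lemma leaf_relation_1:
  fixes k a b p q \<mu> e K Q :: real
  assumes b: "b = - 3 * k - 2 * a"
    and E1: "3 * K + 2 * p * (k - a) + q * (k - b) = 0"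
    and da: "da = - 3 * \<mu> * (k + a)" and dp: "dp = \<mu> * (q - p)" and db: "db = 6 * \<mu> * (k + a)"
    and dE1: "2 * dp * (k - a) - 2 * p * da + Q * (k - b) - q * db = 0"
  shows "Q * (2 * k + a) = 2 * \<mu> * (q - p) * (k + 2 * a)"
    and "2 * (-4 * p * dp * (k - a) + 2 * p\<^sup>2 * da + dp * K - e * k * da * (k - 2 * a))
       + (-4 * q * Q * (k - b) + 2 * q\<^sup>2 * db + Q * K - e * k * db * (k - 2 * b)) = 0 \<Longrightarrow>
      \<mu> * (3 * k * (k + a) * p * (q - p) + 2 * (2 * k + a) * (k + 3 * a) * (q - p)\<^sup>2
        + 9 * e * k * (k + a)\<^sup>2 * (2 * k + a)) = 0"
proof -
  have Q: "Q * (2 * k + a) = 2 * \<mu> * (q - p) * (k + 2 * a)"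
    using dE1 unfolding da dp db b by (simp add: algebra_simps)
  then show "Q * (2 * k + a) = 2 * \<mu> * (q - p) * (k + 2 * a)" .
  assume dE2: "2 * (-4 * p * dp * (k - a) + 2 * p\<^sup>2 * da + dp * K - e * k * da * (k - 2 * a))
       + (-4 * q * Q * (k - b) + 2 * q\<^sup>2 * db + Q * K - e * k * db * (k - 2 * b)) = 0"
  have K: "K = - (2 * p * (k - a) + q * (4 * k + 2 * a)) / 3" using E1 unfolding b by simp
  show "\<mu> * (3 * k * (k + a) * p * (q - p) + 2 * (2 * k + a) * (k + 3 * a) * (q - p)\<^sup>2
        + 9 * e * k * (k + a)\<^sup>2 * (2 * k + a)) = 0"
    using dE2 Q unfolding da dp db b K by algebra
qed

text \<open>Here \<open>r\<close> is \<open>l4 - l2\<close> and \<open>dr\<close> its derivative along \<open>e4\<close>; \<open>R\<close> is the relation just obtained, divided by \<open>\<mu>\<close>,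
  and \<open>dR\<close> its derivative along \<open>e4\<close>.  The products \<open>p * r\<close> can be eliminated between the two.\<close>

lemma leaf_relation_2:
  fixes k a p r \<mu> e dr :: real
  assumes nz: "k \<noteq> 0" "k + a \<noteq> 0" "2 * k + a \<noteq> 0" "\<mu> \<noteq> 0"
    and R: "3 * k * (k + a) * p * r + 2 * (2 * k + a) * (k + 3 * a) * r\<^sup>2 + 9 * e * k * (k + a)\<^sup>2 * (2 * k + a) = 0"
    and da: "da = - 3 * \<mu> * (k + a)" and dp: "dp = \<mu> * r" and dr: "dr * (2 * k + a) = 3 * \<mu> * a * r"
    and dR: "3 * k * da * p * r + 3 * k * (k + a) * dp * r + 3 * k * (k + a) * p * dr
       + 2 * da * (k + 3 * a) * r\<^sup>2 + 6 * (2 * k + a) * da * r\<^sup>2 + 4 * (2 * k + a) * (k + 3 * a) * r * dr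
       + 18 * e * k * (k + a) * da * (2 * k + a) + 9 * e * k * (k + a)\<^sup>2 * da = 0"
  shows "r\<^sup>2 + 3 * e * (k + a)\<^sup>2 = 0"
proof -
  have "k * (k + a) * (2 * k + a) * \<mu> * (r\<^sup>2 + 3 * e * (k + a)\<^sup>2) = 0"
    using R dr dR unfolding da dp by algebra
  then show ?thesis using nz by simp
qed

context adapted_frame begin

lemma D1_trace:
  assumes y: "y \<in> S"
  shows "3 * D 1 (k 1) y + 2 * l2 y * (k 1 y - k 2 y) + l4 y * (k 1 y - k 4 y) = 0"
  using D_k4[OF y, of 1] D_k[OF y] by (simp add: algebra_simps)

lemma D1_D1_trace:
  assumes y: "y \<in> S"
  shows "3 * D 1 (D 1 (k 1)) y
    + 2 * (- 2 * (l2 y)\<^sup>2 * (k 1 y - k 2 y) + l2 y * D 1 (k 1) y - \<epsilon> 1 * k 1 y * k 2 y * (k 1 y - k 2 y))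
    + (- 2 * (l4 y)\<^sup>2 * (k 1 y - k 4 y) + l4 y * D 1 (k 1) y - \<epsilon> 1 * k 1 y * k 4 y * (k 1 y - k 4 y)) = 0"
proof -
  let ?d = "\<lambda>g. frechet_derivative g (at y) :: real^4 \<Rightarrow> real"
  have "((\<lambda>y. 3 * D 1 (k 1) y + 2 * l2 y * (k 1 y - k 2 y) + l4 y * (k 1 y - k 4 y)) has_derivative
     (\<lambda>v. 3 * ?d (D 1 (k 1)) v + 2 * ?d l2 v * (k 1 y - k 2 y) + 2 * l2 y * (?d (k 1) v - ?d (k 2) v)
       + ?d l4 v * (k 1 y - k 4 y) + l4 y * (?d (k 1) v - ?d (k 4) v))) (at y)"
    by (rule derivative_eq_intros smooth_on_has_derivative[OF _ y] smooth_intros refl)+ (simp add: algebra_simps)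
  from derivative_locally_zero[OF open_S y D1_trace this, of "V 1 y"]
  show ?thesis
    unfolding along_def[of "V 1" _ y, symmetric]
    by (simp add: D1_l2 D1_l4 D_k y algebra_simps power2_eq_square)
qed

text \<open>By the trace relation \<open>k1 + k2 = 0\<close> would give \<open>k4 = k2\<close>, and \<open>2 k1 + k2 = 0\<close> would give \<open>k4 = k1\<close>.\<close>

lemma sums_nonzero:
  assumes y: "y \<in> S"
  shows "k 1 y + k 2 y \<noteq> 0" "2 * k 1 y + k 2 y \<noteq> 0" "k 4 y = - 3 * k 1 y - 2 * k 2 y"
  using trace[OF y] k14[OF y] k42[OF y] by auto

text \<open>Since \<open>k1\<close> and its derivatives along \<open>e1\<close> are constant on the leaves, differentiating along \<open>e4\<close> removes the
  highest derivatives of \<open>k1\<close> from the trace relations and leaves algebraic relations.\<close>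

lemma D4_relations:
  assumes y: "y \<in> S"
  shows "D 4 (k 2) y = - 3 * \<mu> y * (k 1 y + k 2 y)" "D 4 (k 4) y = 6 * \<mu> y * (k 1 y + k 2 y)"
    "D 4 l2 y = \<mu> y * (l4 y - l2 y)"
    "D 4 l4 y * (2 * k 1 y + k 2 y) = 2 * \<mu> y * (l4 y - l2 y) * (k 1 y + 2 * k 2 y)"
    "\<mu> y * (3 * k 1 y * (k 1 y + k 2 y) * l2 y * (l4 y - l2 y)
        + 2 * (2 * k 1 y + k 2 y) * (k 1 y + 3 * k 2 y) * (l4 y - l2 y)\<^sup>2
        + 9 * \<epsilon> 1 * k 1 y * (k 1 y + k 2 y)\<^sup>2 * (2 * k 1 y + k 2 y)) = 0"
proof -
  let ?d = "\<lambda>g. frechet_derivative g (at y) :: real^4 \<Rightarrow> real"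
  note b = sums_nonzero(3)[OF y]
  show da: "D 4 (k 2) y = - 3 * \<mu> y * (k 1 y + k 2 y)" using D_k(3)[OF y] b by (simp add: algebra_simps)
  then show db: "D 4 (k 4) y = 6 * \<mu> y * (k 1 y + k 2 y)" using D_k4[OF y, of 4] D_k1[OF y, of 4] by simp
  show dp: "D 4 l2 y = \<mu> y * (l4 y - l2 y)" by (rule gauss_4_a(1)[OF y refl])
  have dK: "D 4 (D 1 (k 1)) y = 0"
    using y by (intro leafwise_constant_D1) (auto simp: D_k1 intro: smooth_intros)
  have dK': "D 4 (D 1 (D 1 (k 1))) y = 0"
    using y by (intro leafwise_constant_D1) (auto simp: D_k1 intro!: smooth_intros leafwise_constant_D1)
  have dk: "D 4 (k 1) y = 0" using D_k1[OF y, of 4] by simp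
  have "((\<lambda>y. 3 * D 1 (k 1) y + 2 * l2 y * (k 1 y - k 2 y) + l4 y * (k 1 y - k 4 y)) has_derivative
     (\<lambda>v. 3 * ?d (D 1 (k 1)) v + 2 * ?d l2 v * (k 1 y - k 2 y) + 2 * l2 y * (?d (k 1) v - ?d (k 2) v)
       + ?d l4 v * (k 1 y - k 4 y) + l4 y * (?d (k 1) v - ?d (k 4) v))) (at y)"
    by (rule derivative_eq_intros smooth_on_has_derivative[OF _ y] smooth_intros refl)+ (simp add: algebra_simps)
  from derivative_locally_zero[OF open_S y D1_trace this, of "V 4 y"]
  have E1: "2 * D 4 l2 y * (k 1 y - k 2 y) - 2 * l2 y * D 4 (k 2) y + D 4 l4 y * (k 1 y - k 4 y) - l4 y * D 4 (k 4) y = 0"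
    unfolding along_def[of "V 4" _ y, symmetric] dK dk by simp
  note rel = leaf_relation_1[OF b D1_trace[OF y] da dp db E1]
  show "D 4 l4 y * (2 * k 1 y + k 2 y) = 2 * \<mu> y * (l4 y - l2 y) * (k 1 y + 2 * k 2 y)" by (rule rel(1))
  have "((\<lambda>y. 3 * D 1 (D 1 (k 1)) y
    + 2 * (- 2 * (l2 y)\<^sup>2 * (k 1 y - k 2 y) + l2 y * D 1 (k 1) y - \<epsilon> 1 * k 1 y * k 2 y * (k 1 y - k 2 y))
    + (- 2 * (l4 y)\<^sup>2 * (k 1 y - k 4 y) + l4 y * D 1 (k 1) y - \<epsilon> 1 * k 1 y * k 4 y * (k 1 y - k 4 y))) has_derivative
    (\<lambda>v. 3 * ?d (D 1 (D 1 (k 1))) v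
    + 2 * (- 4 * l2 y * ?d l2 v * (k 1 y - k 2 y) - 2 * (l2 y)\<^sup>2 * (?d (k 1) v - ?d (k 2) v)
        + ?d l2 v * D 1 (k 1) y + l2 y * ?d (D 1 (k 1)) v
        - \<epsilon> 1 * (?d (k 1) v * k 2 y + k 1 y * ?d (k 2) v) * (k 1 y - k 2 y)
        - \<epsilon> 1 * k 1 y * k 2 y * (?d (k 1) v - ?d (k 2) v))
    + (- 4 * l4 y * ?d l4 v * (k 1 y - k 4 y) - 2 * (l4 y)\<^sup>2 * (?d (k 1) v - ?d (k 4) v)
        + ?d l4 v * D 1 (k 1) y + l4 y * ?d (D 1 (k 1)) v
        - \<epsilon> 1 * (?d (k 1) v * k 4 y + k 1 y * ?d (k 4) v) * (k 1 y - k 4 y)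
        - \<epsilon> 1 * k 1 y * k 4 y * (?d (k 1) v - ?d (k 4) v)))) (at y)"
    by (rule derivative_eq_intros smooth_on_has_derivative[OF _ y] smooth_intros refl)+
       (simp add: algebra_simps power2_eq_square)
  from derivative_locally_zero[OF open_S y D1_D1_trace this, of "V 4 y"]
  have "2 * (-4 * l2 y * D 4 l2 y * (k 1 y - k 2 y) + 2 * (l2 y)\<^sup>2 * D 4 (k 2) y + D 4 l2 y * D 1 (k 1) y
         - \<epsilon> 1 * k 1 y * D 4 (k 2) y * (k 1 y - 2 * k 2 y))
       + (-4 * l4 y * D 4 l4 y * (k 1 y - k 4 y) + 2 * (l4 y)\<^sup>2 * D 4 (k 4) y + D 4 l4 y * D 1 (k 1) y
         - \<epsilon> 1 * k 1 y * D 4 (k 4) y * (k 1 y - 2 * k 4 y)) = 0"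
    unfolding along_def[of "V 4" _ y, symmetric] dK dk dK' by (simp add: algebra_simps)
  then show "\<mu> y * (3 * k 1 y * (k 1 y + k 2 y) * l2 y * (l4 y - l2 y)
        + 2 * (2 * k 1 y + k 2 y) * (k 1 y + 3 * k 2 y) * (l4 y - l2 y)\<^sup>2
        + 9 * \<epsilon> 1 * k 1 y * (k 1 y + k 2 y)\<^sup>2 * (2 * k 1 y + k 2 y)) = 0"
    by (rule rel(2))
qed

text \<open>If \<open>\<mu> \<noteq> 0\<close> at a point, then also nearby, so the relations may be divided by \<open>\<mu>\<close> and differentiated.\<close>

lemma \<mu>_zero:
  assumes "y \<in> S"
  shows "\<mu> y = 0"
proof (rule ccontr)
  assume "\<mu> y \<noteq> 0"
  define U where "U = {z \<in> S. \<mu> z \<noteq> 0}"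
  have "U = S \<inter> \<mu> -` (- {0})" by (auto simp: U_def)
  then have oU: "open U"
    using smooth_on_continuous_on[OF smooth_coefficients(3)] by (simp add: continuous_open_preimage open_Compl)
  have US: "z \<in> S" "\<mu> z \<noteq> 0" if "z \<in> U" for z using that by (auto simp: U_def)
  define r where "r z = l4 z - l2 z" for z
  have smr: "smooth_on S r" unfolding r_def[abs_def] by (intro smooth_intros)
  have dr: "D 4 r z * (2 * k 1 z + k 2 z) = 3 * \<mu> z * k 2 z * r z" if "z \<in> U" for z
  proof -
    have "D 4 r z = D 4 l4 z - D 4 l2 z"
      using along_add[OF smooth_coefficients(2) smooth_on_minus[OF open_S smooth_coefficients(1)] US(1)[OF that], of "V 4"]
        along_minus[OF smooth_coefficients(1) US(1)[OF that], of "V 4"] by (simp add: r_def[abs_def])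
    then show ?thesis
      using D4_relations(3,4)[OF US(1)[OF that]] unfolding r_def by algebra
  qed
  have R1: "3 * k 1 z * (k 1 z + k 2 z) * l2 z * r z + 2 * (2 * k 1 z + k 2 z) * (k 1 z + 3 * k 2 z) * (r z)\<^sup>2
        + 9 * \<epsilon> 1 * k 1 z * (k 1 z + k 2 z)\<^sup>2 * (2 * k 1 z + k 2 z) = 0" if "z \<in> U" for z
    using D4_relations(5)[OF US(1)[OF that]] US(2)[OF that] by (simp add: r_def)
  \<comment> \<open>for \<open>\<epsilon> 1 = 1\<close> this is absurd already; the last step below covers both signs\<close>
  have R2: "(r z)\<^sup>2 + 3 * \<epsilon> 1 * (k 1 z + k 2 z)\<^sup>2 = 0" if z: "z \<in> U" for z
  proof -
    let ?d = "\<lambda>g. frechet_derivative g (at z) :: real^4 \<Rightarrow> real"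
    have "((\<lambda>z. 3 * k 1 z * (k 1 z + k 2 z) * l2 z * r z + 2 * (2 * k 1 z + k 2 z) * (k 1 z + 3 * k 2 z) * (r z)\<^sup>2
        + 9 * \<epsilon> 1 * k 1 z * (k 1 z + k 2 z)\<^sup>2 * (2 * k 1 z + k 2 z)) has_derivative
       (\<lambda>v. 3 * ?d (k 1) v * (k 1 z + k 2 z) * l2 z * r z + 3 * k 1 z * (?d (k 1) v + ?d (k 2) v) * l2 z * r z
         + 3 * k 1 z * (k 1 z + k 2 z) * ?d l2 v * r z + 3 * k 1 z * (k 1 z + k 2 z) * l2 z * ?d r v
         + 2 * (2 * ?d (k 1) v + ?d (k 2) v) * (k 1 z + 3 * k 2 z) * (r z)\<^sup>2
         + 2 * (2 * k 1 z + k 2 z) * (?d (k 1) v + 3 * ?d (k 2) v) * (r z)\<^sup>2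
         + 2 * (2 * k 1 z + k 2 z) * (k 1 z + 3 * k 2 z) * (2 * r z * ?d r v)
         + 9 * \<epsilon> 1 * ?d (k 1) v * (k 1 z + k 2 z)\<^sup>2 * (2 * k 1 z + k 2 z)
         + 9 * \<epsilon> 1 * k 1 z * (2 * (k 1 z + k 2 z) * (?d (k 1) v + ?d (k 2) v)) * (2 * k 1 z + k 2 z)
         + 9 * \<epsilon> 1 * k 1 z * (k 1 z + k 2 z)\<^sup>2 * (2 * ?d (k 1) v + ?d (k 2) v))) (at z)"
      by (rule derivative_eq_intros smooth_on_has_derivative[OF _ US(1)[OF z]] smooth_intros smr refl)+
         (simp add: algebra_simps power2_eq_square)
    from derivative_locally_zero[OF oU z R1 this, of "V 4 z"]
    have dR: "3 * k 1 z * D 4 (k 2) z * l2 z * r z + 3 * k 1 z * (k 1 z + k 2 z) * D 4 l2 z * r z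
       + 3 * k 1 z * (k 1 z + k 2 z) * l2 z * D 4 r z
       + 2 * D 4 (k 2) z * (k 1 z + 3 * k 2 z) * (r z)\<^sup>2 + 6 * (2 * k 1 z + k 2 z) * D 4 (k 2) z * (r z)\<^sup>2
       + 4 * (2 * k 1 z + k 2 z) * (k 1 z + 3 * k 2 z) * r z * D 4 r z
       + 18 * \<epsilon> 1 * k 1 z * (k 1 z + k 2 z) * D 4 (k 2) z * (2 * k 1 z + k 2 z)
       + 9 * \<epsilon> 1 * k 1 z * (k 1 z + k 2 z)\<^sup>2 * D 4 (k 2) z = 0"
      unfolding along_def[of "V 4" _ z, symmetric] using D_k1[OF US(1)[OF z], of 4] by (simp add: algebra_simps)
    show ?thesis
      by (rule leaf_relation_2[OF k_nz[OF US(1)[OF z]] sums_nonzero(1,2)[OF US(1)[OF z]] US(2)[OF z] R1[OF z]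
            D4_relations(1)[OF US(1)[OF z]] _ dr[OF z] dR])
         (simp add: D4_relations(3)[OF US(1)[OF z]] r_def)
  qed
  have yU: "y \<in> U" using assms \<open>\<mu> y \<noteq> 0\<close> by (simp add: U_def)
  let ?d = "\<lambda>g. frechet_derivative g (at y) :: real^4 \<Rightarrow> real"
  have "((\<lambda>z. (r z)\<^sup>2 + 3 * \<epsilon> 1 * (k 1 z + k 2 z)\<^sup>2) has_derivative
     (\<lambda>v. 2 * r y * ?d r v + 6 * \<epsilon> 1 * (k 1 y + k 2 y) * (?d (k 1) v + ?d (k 2) v))) (at y)"
    by (rule derivative_eq_intros smooth_on_has_derivative[OF _ assms] smooth_intros smr refl)+ (simp add: algebra_simps)
  from derivative_locally_zero[OF oU yU R2 this, of "V 4 y"]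
  have d: "2 * r y * D 4 r y + 6 * \<epsilon> 1 * (k 1 y + k 2 y) * (- 3 * \<mu> y * (k 1 y + k 2 y)) = 0"
    unfolding along_def[of "V 4" _ y, symmetric] using D_k1[OF assms, of 4] D4_relations(1)[OF assms] by simp
  have "\<epsilon> 1 * \<mu> y * (k 1 y + k 2 y)^3 = 0"
    using d R2[OF yU] dr[OF yU] by algebra
  then show False using \<open>\<mu> y \<noteq> 0\<close> sums_nonzero(1)[OF assms] by simp
qed

end

section \<open>Leafwise constant functions and local parametrizations\<close>

text \<open>The counterpart of \<open>congruent_near\<close> for an immersion of an open subset of \<open>real^4\<close>: \<open>\<kappa>\<close> is the change from the given coordinates
  to the parameters \<open>(s, t, u, v)\<close> and \<open>h\<close> its inverse.\<close>

definition locally_parametrized ::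
    "(real^4) set \<Rightarrow> (real^4 \<Rightarrow> real^5) \<Rightarrow> real^4 \<Rightarrow> real set \<Rightarrow> (real \<Rightarrow> real \<Rightarrow> real \<Rightarrow> real \<Rightarrow> real^5) \<Rightarrow> bool" where
  "locally_parametrized S X y0 I P \<longleftrightarrow>
     (\<exists>F W (\<kappa> :: real^4 \<Rightarrow> real^4) (h :: real^4 \<Rightarrow> real^4). isometry_E52 F \<and> open W \<and> y0 \<in> W \<and> W \<subseteq> S \<and> open (\<kappa> ` W) \<and>
        smooth_on W \<kappa> \<and> homeomorphism W (\<kappa> ` W) \<kappa> h \<and> smooth_on (\<kappa> ` W) h \<and>
        (\<forall>y\<in>W. \<kappa> y $ 1 \<in> I \<and> F (X y) = P (\<kappa> y $ 1) (\<kappa> y $ 2) (\<kappa> y $ 3) (\<kappa> y $ 4)))"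

lemma along_real_chain:
  fixes g :: "'a::euclidean_space \<Rightarrow> real" and h :: "real \<Rightarrow> real"
  assumes "smooth_on S g" "y \<in> S" "(h has_real_derivative h') (at (g y))"
  shows "along V (\<lambda>y. h (g y)) y = h' * along V g y"
proof -
  have "((\<lambda>y. h (g y)) has_derivative (\<lambda>v. h' * frechet_derivative g (at y) v)) (at y)"
    using has_derivative_compose[OF smooth_on_has_derivative[OF assms(1,2)]] assms(3)
    by (auto simp: has_field_derivative_def)
  then show ?thesis by (simp only: along_eqI) (simp add: along_def)
qed

lemma smooth_on_DERIV:
  fixes \<phi> :: "real \<Rightarrow> real"
  assumes "smooth_on I \<phi>" "x \<in> I"
  shows "(\<phi> has_real_derivative deriv \<phi> x) (at x)"
proof -
  obtain D where "(\<phi> has_real_derivative D) (at x)"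
    using smooth_on_differentiable[OF assms] by (auto simp: real_differentiable_def)
  then show ?thesis by (simp add: DERIV_imp_deriv)
qed

lemma smooth_on_vec4:
  fixes s t u v :: "'a::euclidean_space \<Rightarrow> real"
  assumes "open S" "smooth_on S s" "smooth_on S t" "smooth_on S u" "smooth_on S v"
  shows "smooth_on S (\<lambda>y. vector [s y, t y, u y, v y] :: real^4)"
proof -
  have eq: "(\<lambda>y. vector [s y, t y, u y, v y] :: real^4) =
      (\<lambda>y. \<chi> i. (if i = 1 then s else if i = 2 then t else if i = 3 then u else v) y)"
    by (auto simp add: vec_eq_iff forall_4 vector_def)
  show ?thesis unfolding eq by (rule smooth_on_vec_lambda[OF assms(1)]) (use assms in simp)
qed

lemma vector_5:
  "(vector [a, b, c, d, e] :: real^5) =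
     (\<chi> i. if i = 1 then a else if i = 2 then b else if i = 3 then c else if i = 4 then d else e)"
  by (simp add: vec_eq_iff forall_5 vector_def)

lemma smooth_on_vec5 [smooth_intros]:
  fixes a b c d e :: "'a::euclidean_space \<Rightarrow> real"
  assumes "open S" "smooth_on S a" "smooth_on S b" "smooth_on S c" "smooth_on S d" "smooth_on S e"
  shows "smooth_on S (\<lambda>y. vector [a y, b y, c y, d y, e y] :: real^5)"
proof -
  have eq: "(\<lambda>y. vector [a y, b y, c y, d y, e y] :: real^5) =
      (\<lambda>y. \<chi> i. (if i = 1 then a else if i = 2 then b else if i = 3 then c else if i = 4 then d else e) y)"
    by (auto simp: vector_5 vec_eq_iff)
  show ?thesis unfolding eq by (rule smooth_on_vec_lambda[OF assms(1)]) (use assms in simp)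
qed

text \<open>To exhibit a parametrization it is enough to find smooth functions \<open>\<kappa>\<close> through which the immersion
  factors: then the differential of \<open>\<kappa>\<close> is injective because that of \<open>X\<close> is, and \<open>\<kappa>\<close> is
  a local diffeomorphism by the inverse function theorem.\<close>

lemma locally_parametrizedI:
  fixes \<kappa> :: "real^4 \<Rightarrow> real^4"
  assumes "open U" "y0 \<in> U" "U \<subseteq> S" "smooth_on U \<kappa>" and f: "orthonormal5 f sign5"
    and X: "smooth_on U X" "inj (frechet_derivative X (at y0))"
    and "open Z" "\<And>y. y \<in> U \<Longrightarrow> \<kappa> y \<in> Z" and P: "smooth_on Z (\<lambda>z. P (z $ 1) (z $ 2) (z $ 3) (z $ 4))"
    and eq: "\<And>y. y \<in> U \<Longrightarrow> \<kappa> y $ 1 \<in> I \<and> coords f (X y - c) = P (\<kappa> y $ 1) (\<kappa> y $ 2) (\<kappa> y $ 3) (\<kappa> y $ 4)"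
  shows "locally_parametrized S X y0 I P"
proof -
  let ?P = "\<lambda>z. P (z $ 1) (z $ 2) (z $ 3) (z $ 4)"
  have "inj (frechet_derivative \<kappa> (at y0))"
  proof (subst linear_injective_0[OF has_derivative_linear[OF smooth_on_has_derivative[OF assms(4,2)]]], intro allI impI)
    fix w assume w: "frechet_derivative \<kappa> (at y0) w = 0"
    have hX: "(X has_derivative frechet_derivative X (at y0)) (at y0)"
      using smooth_on_has_derivative[OF X(1) assms(2)] .
    have "bounded_linear (coords f)" using linear_coords by (simp add: linear_conv_bounded_linear)
    then have "((\<lambda>y. coords f (X y - c)) has_derivative (\<lambda>v. coords f (frechet_derivative X (at y0) v))) (at y0)"
      using bounded_linear.has_derivative has_derivative_diff[OF hX has_derivative_const[of c]] by fastforce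
    moreover have "((\<lambda>y. coords f (X y - c)) has_derivative
       (\<lambda>v. frechet_derivative ?P (at (\<kappa> y0)) (frechet_derivative \<kappa> (at y0) v))) (at y0)"
      by (rule has_derivative_transform_within_open[OF has_derivative_compose[OF smooth_on_has_derivative[OF assms(4,2)]
           smooth_on_has_derivative[OF P assms(9)[OF assms(2)]]] assms(1,2)]) (simp add: eq)
    ultimately have "coords f (frechet_derivative X (at y0) w) =
        frechet_derivative ?P (at (\<kappa> y0)) (frechet_derivative \<kappa> (at y0) w)"
      by (rule fun_cong[OF has_derivative_unique])
    also have "\<dots> = 0"
      unfolding w by (rule linear_0[OF has_derivative_linear[OF smooth_on_has_derivative[OF P assms(9)[OF assms(2)]]]])
    finally have "frechet_derivative X (at y0) w = 0" using coords_eq_0[OF f] by simp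
    then show "w = 0" using X(2) linear_injective_0[OF has_derivative_linear[OF hX]] by simp
  qed
  from smooth_inverse_function[OF assms(1,4,2) this] obtain W V h where
    W: "open W" "y0 \<in> W" "W \<subseteq> U" "open V" "homeomorphism W V \<kappa> h" "smooth_on V h" by metis
  have "\<kappa> ` W = V" using W(5) by (simp add: homeomorphism_def)
  then show ?thesis
    unfolding locally_parametrized_def
    using W assms(3) eq smooth_on_subset[OF assms(4) W(3)] isometry_coords[OF f, of c]
    by (intro exI[of _ "\<lambda>w. coords f (w - c)"] exI[of _ W] exI[of _ \<kappa>] exI[of _ h]) auto
qed

context adapted_frame begin

lemma V_span: 
  assumes y: "y \<in> S"
  shows "\<exists>c. v = (\<Sum>i\<in>UNIV. c i *\<^sub>R V i y)"
proof -
  define T where "T c = (\<Sum>i\<in>UNIV. (c $ i) *\<^sub>R V i y)" for c :: "real^4"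
  have lX: "linear (frechet_derivative X (at y))" by (rule linear_frechet[OF smooth_X y])
  have "frechet_derivative X (at y) (T c) = (\<Sum>i\<in>UNIV. (c $ i) *\<^sub>R E i y)" for c
    using V_X[OF y] by (simp add: T_def linear_sum[OF lX] linear_scale[OF lX] along_def)
  then have TE: "sprod (frechet_derivative X (at y) (T c)) (E j y) = c $ j * \<epsilon> j" for c j
    by (simp add: sprod_sum_left E_E y if_distrib cong: if_cong)
  have "linear T" by (auto simp: T_def linear_iff sum.distrib scaleR_add_left scaleR_sum_right)
  moreover have "inj T"
    unfolding linear_injective_0[OF \<open>linear T\<close>]
  proof (intro allI impI)
    fix c assume "T c = 0"
    then have "c $ j * \<epsilon> j = 0" for j using TE[of c j] linear_0[OF lX] by simp
    then show "c = 0" by (simp add: vec_eq_iff)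
  qed
  ultimately have "surj T" by (rule linear_inj_imp_surj)
  then obtain c where "v = T c" by (rule surjE)
  then show ?thesis unfolding T_def by blast
qed

lemma frechet_expand:
  assumes "(g has_derivative g') (at y)"
  shows "g' (\<Sum>i\<in>UNIV. c i *\<^sub>R V i y) = (\<Sum>i\<in>UNIV. c i *\<^sub>R D i g y)"
  using has_derivative_linear[OF assms] along_eqI[OF assms] by (simp add: linear_sum linear_scale)

lemma constant_on_ball:
  fixes g :: "real^4 \<Rightarrow> 'b::euclidean_space"
  assumes "smooth_on U g" "ball y0 r \<subseteq> U" "U \<subseteq> S" "\<And>i y. y \<in> ball y0 r \<Longrightarrow> D i g y = 0" "y \<in> ball y0 r"
  shows "g y = g y0"
proof (rule has_derivative_zero_unique[OF convex_ball, where f=g])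
  fix x assume x: "x \<in> ball y0 r"
  then have g: "(g has_derivative frechet_derivative g (at x)) (at x)"
    using smooth_on_has_derivative[OF assms(1)] assms(2) by blast
  have "frechet_derivative g (at x) v = 0" for v
  proof -
    obtain c where "v = (\<Sum>i\<in>UNIV. c i *\<^sub>R V i x)" using V_span[of x v] assms(2,3) x by blast
    then show ?thesis using frechet_expand[OF g] assms(4)[OF x] by simp
  qed
  then have "frechet_derivative g (at x) = (\<lambda>h. 0)" by auto
  then show "(g has_derivative (\<lambda>h. 0)) (at x within ball y0 r)"
    using g has_derivative_at_withinI by metis
next
  have "r > 0" using assms(5) le_less_trans[OF zero_le_dist] by auto
  then show "y \<in> ball y0 r" "y0 \<in> ball y0 r" using assms(5) by auto
qed

lemma leafwise_dependent:
  fixes g :: "real^4 \<Rightarrow> 'b::real_normed_vector" and s :: "real^4 \<Rightarrow> real"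
  assumes "smooth_on U g" "smooth_on U s" "U \<subseteq> S" "y \<in> U" "D 1 s y \<noteq> 0"
    and "\<And>i. i \<noteq> 1 \<Longrightarrow> D i g y = 0 \<and> D i s y = 0"
  shows "\<exists>c. \<forall>v. frechet_derivative g (at y) v = frechet_derivative s (at y) v *\<^sub>R c"
proof (intro exI allI)
  fix v
  obtain c where c: "v = (\<Sum>i\<in>UNIV. c i *\<^sub>R V i y)" using V_span[of y v] assms(3,4) by blast
  show "frechet_derivative g (at y) v = frechet_derivative s (at y) v *\<^sub>R ((1 / D 1 s y) *\<^sub>R D 1 g y)"
    unfolding c frechet_expand[OF smooth_on_has_derivative[OF assms(1,4)]]
      frechet_expand[OF smooth_on_has_derivative[OF assms(2,4)]]
    using assms(5,6) by (simp add: sum_4)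
qed

text \<open>Both \<open>k1\<close> and \<open>E 1 (k1)\<close> are constant on the leaves, so \<open>E 1 (k1) = G (k1)\<close> with a function \<open>G\<close> without zeros, and the
  wanted function is an antiderivative of \<open>1 / G\<close>, evaluated at \<open>k1\<close>.\<close>

lemma arclength:
  assumes y0: "y0 \<in> S"
  obtains U and s :: "real^4 \<Rightarrow> real" where "open U" "y0 \<in> U" "U \<subseteq> S" "smooth_on U s"
    "\<And>y. y \<in> U \<Longrightarrow> D 1 s y = 1" "\<And>y i. y \<in> U \<Longrightarrow> i \<noteq> 1 \<Longrightarrow> D i s y = 0"
proof -
  have "\<exists>c. \<forall>v. frechet_derivative (D 1 (k 1)) (at y) v = frechet_derivative (k 1) (at y) v *\<^sub>R c"
    if y: "y \<in> S" for y
  proof (rule leafwise_dependent[OF _ smooth_k order_refl y])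
    show "D i (D 1 (k 1)) y = 0 \<and> D i (k 1) y = 0" if "i \<noteq> 1" for i
      using D_k1 that y leafwise_constant_D1[OF smooth_k _ y that] by blast
  qed (use D1_k1 y in \<open>auto intro: smooth_intros\<close>)
  moreover have "frechet_derivative (k 1) (at y0) (V 1 y0) \<noteq> 0"
    using D1_k1[OF y0] by (simp add: along_def)
  ultimately obtain I G U where I: "open I" "is_interval I" and U: "open U" "y0 \<in> U" "U \<subseteq> S" and G: "smooth_on I G"
    and kI: "\<And>y. y \<in> U \<Longrightarrow> k 1 y \<in> I \<and> D 1 (k 1) y = G (k 1 y)" and onto: "\<And>s. s \<in> I \<Longrightarrow> \<exists>y\<in>U. k 1 y = s"
    using functional_dependence[OF open_S y0 smooth_k[of 1] smooth_on_along[OF open_S smooth_k[of 1] smooth_V[of 1]]]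
    by metis
  have G0: "G s \<noteq> 0" if "s \<in> I" for s using onto[OF that] kI D1_k1 U(3) by fastforce
  obtain r where r: "r > 0" "cball (k 1 y0) r \<subseteq> I" using I(1) kI[OF U(2)] open_contains_cball by blast
  define J where "J = {k 1 y0 - r <..< k 1 y0 + r}"
  have J: "{k 1 y0 - r .. k 1 y0 + r} \<subseteq> I" using r(2) by (auto simp: cball_def dist_real_def subset_eq)
  have smG: "smooth_on I (\<lambda>x. 1 / G x)" using G I(1) G0 by (intro smooth_intros) auto
  define H where "H x = integral {k 1 y0 - r .. x} (\<lambda>x. 1 / G x)" for x
  have cont: "continuous_on {k 1 y0 - r .. k 1 y0 + r} (\<lambda>x. 1 / G x)"
    using continuous_on_subset[OF smooth_on_continuous_on[OF smG] J] .
  have H: "(H has_real_derivative 1 / G x) (at x)" if "x \<in> J" for x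
  proof -
    have "(H has_real_derivative 1 / G x) (at x within {k 1 y0 - r .. k 1 y0 + r})"
      unfolding H_def[abs_def] using that by (intro integral_has_real_derivative[OF cont]) (auto simp: J_def)
    then show ?thesis using that by (subst (asm) at_within_interior) (auto simp: J_def)
  qed
  have smH: "smooth_on J H"
    by (rule smooth_onI_real_derivative[OF _ H smooth_on_subset[OF smG]]) (use J in \<open>auto simp: J_def\<close>)
  define U' where "U' = U \<inter> k 1 -` J"
  have oU': "open U'"
    unfolding U'_def using continuous_on_subset[OF smooth_on_continuous_on[OF smooth_k] U(3)] U(1)
    by (intro continuous_open_preimage) (auto simp: J_def)
  have U'S: "U' \<subseteq> S" using U(3) by (auto simp: U'_def)
  have Ds: "D i (\<lambda>y. H (k 1 y)) y = 1 / G (k 1 y) * D i (k 1) y" if "y \<in> U'" for i y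
    by (rule along_real_chain[OF smooth_k _ H]) (use that U'S in \<open>auto simp: U'_def\<close>)
  show ?thesis
  proof (rule that[of U' "\<lambda>y. H (k 1 y)"])
    show "open U'" "U' \<subseteq> S" by (rule oU' U'S)+
    show "y0 \<in> U'" using U(2) r(1) by (simp add: U'_def J_def)
    show "smooth_on U' (\<lambda>y. H (k 1 y))"
      by (rule smooth_on_compose[OF oU' _ smH smooth_on_subset[OF smooth_k U'S]]) (auto simp: J_def U'_def)
    show "D 1 (\<lambda>y. H (k 1 y)) y = 1" if "y \<in> U'" for y
      using Ds[OF that] kI[of y] G0[of "k 1 y"] that by (auto simp: U'_def)
    show "D i (\<lambda>y. H (k 1 y)) y = 0" if "y \<in> U'" "i \<noteq> 1" for i y
      using Ds[OF that(1)] D_k1[of y i] U'S that by auto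
  qed
qed

text \<open>The pair \<open>(f1, f2)\<close> is treated as one function, so that both are functions of the arc length
  on a common interval.  That the interval consists of values of \<open>s\<close> allows statements about \<open>D 1 f1\<close> and
  \<open>D 1 f2\<close> to be transferred to the derivatives of the profile functions.\<close>

lemma profile_curves:
  fixes f1 f2 :: "real^4 \<Rightarrow> real"
  assumes U: "open U" "y0 \<in> U" "U \<subseteq> S" and f: "smooth_on U f1" "smooth_on U f2"
    and leaf: "\<And>y i. y \<in> U \<Longrightarrow> i \<noteq> 1 \<Longrightarrow> D i f1 y = 0 \<and> D i f2 y = 0"
  obtains I \<phi>1 \<phi>2 W and s :: "real^4 \<Rightarrow> real" where "open I" "is_interval I" "open W" "y0 \<in> W" "W \<subseteq> U" "smooth_on W s"
    "smooth_on I \<phi>1" "smooth_on I \<phi>2"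
    "\<And>y. y \<in> W \<Longrightarrow> s y \<in> I \<and> f1 y = \<phi>1 (s y) \<and> f2 y = \<phi>2 (s y)"
    "\<And>\<sigma>. \<sigma> \<in> I \<Longrightarrow> \<exists>y\<in>W. deriv \<phi>1 \<sigma> = D 1 f1 y \<and> deriv \<phi>2 \<sigma> = D 1 f2 y"
proof -
  have "y0 \<in> S" using U by blast
  then obtain U1 and s :: "real^4 \<Rightarrow> real" where s: "open U1" "y0 \<in> U1" "U1 \<subseteq> S" "smooth_on U1 s" "\<And>y. y \<in> U1 \<Longrightarrow> D 1 s y = 1"
    "\<And>y i. y \<in> U1 \<Longrightarrow> i \<noteq> 1 \<Longrightarrow> D i s y = 0"
    using arclength by metis
  define U2 where "U2 = U \<inter> U1"
  have U2: "open U2" "y0 \<in> U2" "U2 \<subseteq> U" "U2 \<subseteq> U1" "U2 \<subseteq> S" using U s by (auto simp: U2_def)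
  define g where "g y = (f1 y, f2 y)" for y
  have f': "smooth_on U2 f1" "smooth_on U2 f2" "smooth_on U2 s"
    using f s(4) U2 smooth_on_subset by blast+
  have smg: "smooth_on U2 g" unfolding g_def by (intro smooth_on_Pair U2 f')
  have Dg: "D i g y = (D i f1 y, D i f2 y)" if "y \<in> U2" for i y
    unfolding g_def along_def
    by (rule frechet_derivative_eqI[OF has_derivative_Pair[OF smooth_on_has_derivative[OF f'(1) that] smooth_on_has_derivative[OF f'(2) that]]])
  have dep: "\<exists>c. \<forall>v. frechet_derivative g (at y) v = frechet_derivative s (at y) v *\<^sub>R c" if "y \<in> U2" for y
  proof (rule leafwise_dependent[OF smg f'(3) U2(5) that])
    show "D 1 s y \<noteq> 0" using s(5)[of y] U2(4) that by auto
    show "D i g y = 0 \<and> D i s y = 0" if "i \<noteq> 1" for i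
      using Dg[OF \<open>y \<in> U2\<close>] leaf[of y i] s(6)[of y i] that \<open>y \<in> U2\<close> U2 by (auto simp: zero_prod_def)
  qed
  have "frechet_derivative s (at y0) (V 1 y0) \<noteq> 0" using s(5)[OF s(2)] by (simp add: along_def)
  from functional_dependence[OF U2(1,2) f'(3) smg this dep]
  obtain I G W where I: "open I" "is_interval I" and W: "open W" "y0 \<in> W" "W \<subseteq> U2" and G: "smooth_on I G"
    and sI: "\<And>y. y \<in> W \<Longrightarrow> s y \<in> I \<and> g y = G (s y)" and onto: "\<And>\<sigma>. \<sigma> \<in> I \<Longrightarrow> \<exists>y\<in>W. s y = \<sigma>"
    by metis
  have \<phi>: "smooth_on I (\<lambda>\<sigma>. fst (G \<sigma>))" "smooth_on I (\<lambda>\<sigma>. snd (G \<sigma>))"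
    using smooth_on_fst[OF I(1) G] smooth_on_snd[OF I(1) G] .
  have der: "deriv \<phi> (s y) = D 1 f y"
    if "smooth_on I \<phi>" "smooth_on U2 f" "\<And>y. y \<in> W \<Longrightarrow> f y = \<phi> (s y)" "y \<in> W" for \<phi> f y
  proof -
    have y: "s y \<in> I" "y \<in> U1" using sI[OF that(4)] that(4) W(3) U2(4) by auto
    have "D 1 (\<lambda>y. \<phi> (s y)) y = deriv \<phi> (s y) * D 1 s y"
      by (rule along_real_chain[OF s(4) y(2) smooth_on_DERIV[OF that(1) y(1)]])
    moreover have "D 1 f y = D 1 (\<lambda>y. \<phi> (s y)) y"
      by (rule along_cong[OF W(1) that(4) smooth_on_subset[OF that(2) W(3)] that(3)])
    ultimately show ?thesis using s(5)[OF y(2)] by simp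
  qed
  show ?thesis
  proof (rule that[OF I W(1,2) _ smooth_on_subset[OF f'(3) W(3)] \<phi>])
    show "W \<subseteq> U" using W(3) U2(3) by blast
    show "s y \<in> I \<and> f1 y = fst (G (s y)) \<and> f2 y = snd (G (s y))" if "y \<in> W" for y
      using sI[OF that] by (simp add: g_def) (metis fst_conv snd_conv)
    fix \<sigma> assume "\<sigma> \<in> I"
    then obtain y where y: "y \<in> W" "s y = \<sigma>" using onto by blast
    have "f1 z = fst (G (s z))" "f2 z = snd (G (s z))" if "z \<in> W" for z
      using sI[OF that] by (simp_all add: g_def) (metis fst_conv, metis snd_conv)
    then show "\<exists>y\<in>W. deriv (\<lambda>\<sigma>. fst (G \<sigma>)) \<sigma> = D 1 f1 y \<and> deriv (\<lambda>\<sigma>. snd (G \<sigma>)) \<sigma> = D 1 f2 y"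
      using der[OF \<phi>(1) f'(1) _ y(1)] der[OF \<phi>(2) f'(2) _ y(1)] y by (intro bexI[OF _ y(1)]) auto
  qed
qed

end

section \<open>The non-degenerate case: orthogonal decomposition\<close>

context adapted_frame begin

lemma Da_E4: "y \<in> S \<Longrightarrow> a = 2 \<or> a = 3 \<Longrightarrow> D a (E 4) y = 0"
  using Da_E(2)[of y a] \<mu>_zero by simp

lemma gauss_24:
  assumes y: "y \<in> S"
  shows "\<epsilon> 1 * l2 y * l4 y + k 2 y * k 4 y = 0"
proof -
  have "D 4 \<mu> y = D 4 (\<lambda>_. 0) y"
    by (rule along_cong[OF open_S y]) (auto simp: \<mu>_zero intro: smooth_intros)
  then show ?thesis using D4_\<mu>[OF y] \<mu>_zero[OF y] by simp
qed

text \<open>With \<open>\<mu> = 0\<close> the derivatives of \<open>k2, k4, l2\<close> and \<open>l4\<close> along \<open>E 4\<close>, all of them multiples of \<open>\<mu>\<close>, vanish as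
  well.\<close>

lemma leafwise:
  assumes y: "y \<in> S" and i: "i \<noteq> 1"
  shows "D i (k 2) y = 0" "D i (k 4) y = 0" "D i l2 y = 0" "D i l4 y = 0"
proof -
  have "D 4 l4 y = 0" using D4_relations(4)[OF y] \<mu>_zero[OF y] sums_nonzero(2)[OF y] by simp
  moreover have "D 2 l4 y = 0" "D 3 l4 y = 0" "D 4 l2 y = 0" "D 2 l2 y = 0" "D 3 l2 y = 0"
    using gauss_4_a[OF y, of 2 3] gauss_4_a[OF y, of 3 2] Da_l2[OF y, of 2 3] Da_l2[OF y, of 3 2] \<mu>_zero[OF y]
    by (simp_all add: insert_commute)
  ultimately show "D i l2 y = 0" "D i l4 y = 0" using i exhaust_4[of i] by auto
  show "D i (k 2) y = 0" "D i (k 4) y = 0"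
    using i exhaust_4[of i] Da_k[OF y, of 2] Da_k[OF y, of 3] D4_relations(1,2)[OF y] \<mu>_zero[OF y] by auto
qed

text \<open>By the Gauss equation \<open>gauss_24\<close> the vectors \<open>C2\<close> and \<open>C4\<close> of the plane spanned by \<open>E 1\<close> and \<open>N\<close>
  are orthogonal; \<open>g2\<close> and \<open>g4\<close> are their scalar squares and \<open>w\<close> is the determinant of their
  coefficients, up to sign.\<close>

definition w where "w y = k 4 y * l2 y - k 2 y * l4 y"
definition g2 where "g2 y = \<epsilon> 1 * (k 2 y)\<^sup>2 + (l2 y)\<^sup>2"
definition g4 where "g4 y = \<epsilon> 1 * (k 4 y)\<^sup>2 + (l4 y)\<^sup>2"
definition C2 where "C2 y = k 2 y *\<^sub>R E 1 y + l2 y *\<^sub>R N y"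
definition C4 where "C4 y = k 4 y *\<^sub>R E 1 y + l4 y *\<^sub>R N y"

lemma smooth_C [smooth_intros]:
  "smooth_on S w" "smooth_on S g2" "smooth_on S g4" "smooth_on S C2" "smooth_on S C4"
  unfolding w_def[abs_def] g2_def[abs_def] g4_def[abs_def] C2_def[abs_def] C4_def[abs_def]
  by (intro smooth_intros)+

lemma eps_sq: "(\<epsilon> i)\<^sup>2 = 1"
  using eps by (simp add: power2_eq_square)

lemma w_relations:
  assumes y: "y \<in> S"
  shows "k 4 y * g2 y = l2 y * w y" "g2 y * g4 y = \<epsilon> 1 * (w y)\<^sup>2"
    "g4 y * l2 y = \<epsilon> 1 * k 4 y * w y" "g2 y * l4 y = - \<epsilon> 1 * k 2 y * w y"
  using gauss_24[OF y] eps_sq[of 1] unfolding w_def g2_def g4_def by algebra+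

lemma D_C:
  assumes y: "y \<in> S"
  shows "D i C2 y = D i (k 2) y *\<^sub>R E 1 y + k 2 y *\<^sub>R D i (E 1) y + (D i l2 y *\<^sub>R N y + l2 y *\<^sub>R D i N y)"
    "D i C4 y = D i (k 4) y *\<^sub>R E 1 y + k 4 y *\<^sub>R D i (E 1) y + (D i l4 y *\<^sub>R N y + l4 y *\<^sub>R D i N y)"
  unfolding C2_def[abs_def] C4_def[abs_def]
  using along_add[of S "\<lambda>y. k 2 y *\<^sub>R E 1 y" "\<lambda>y. l2 y *\<^sub>R N y" y "V i"]
    along_add[of S "\<lambda>y. k 4 y *\<^sub>R E 1 y" "\<lambda>y. l4 y *\<^sub>R N y" y "V i"]
    along_scaleR[OF smooth_k smooth_E y] along_scaleR[OF smooth_coefficients(1) smooth_N y]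
    along_scaleR[OF smooth_coefficients(2) smooth_N y] y
  by (simp_all add: smooth_intros)

lemma D_C_values:
  assumes y: "y \<in> S"
  shows "D 1 C2 y = - l2 y *\<^sub>R C2 y" "D 4 C2 y = - w y *\<^sub>R E 4 y" "a = 2 \<or> a = 3 \<Longrightarrow> D a C2 y = 0"
    "D 1 C4 y = - l4 y *\<^sub>R C4 y" "D 4 C4 y = 0" "a = 2 \<or> a = 3 \<Longrightarrow> D a C4 y = w y *\<^sub>R E a y"
proof -
  show "D 1 C2 y = - l2 y *\<^sub>R C2 y" "D 1 C4 y = - l4 y *\<^sub>R C4 y"
    unfolding D_C[OF y] D_k[OF y] D1_l2[OF y] D1_l4[OF y] D1_E[OF y] V_N[OF y] C2_def C4_def
    by (simp_all add: algebra_simps power2_eq_square flip: scaleR_add_left)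
  show "D 4 C2 y = - w y *\<^sub>R E 4 y" "D 4 C4 y = 0"
    unfolding D_C[OF y] D4_E[OF y] V_N[OF y] w_def using leafwise[OF y, of 4]
    by (simp_all add: algebra_simps flip: scaleR_add_left)
  show "D a C2 y = 0" "D a C4 y = w y *\<^sub>R E a y" if a: "a = 2 \<or> a = 3"
    unfolding D_C[OF y] Da_E(1)[OF y a] V_N[OF y] w_def using leafwise[OF y, of a] a k3[OF y]
    by (auto simp: algebra_simps simp flip: scaleR_add_left)
qed

lemma D1_w: "y \<in> S \<Longrightarrow> D 1 w y = - (l2 y + l4 y) * w y"
  and Di_w: "y \<in> S \<Longrightarrow> i \<noteq> 1 \<Longrightarrow> D i w y = 0"
  and D1_g: "y \<in> S \<Longrightarrow> D 1 g2 y = - 2 * l2 y * g2 y" "y \<in> S \<Longrightarrow> D 1 g4 y = - 2 * l4 y * g4 y"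
  and Di_g: "y \<in> S \<Longrightarrow> i \<noteq> 1 \<Longrightarrow> D i g2 y = 0" "y \<in> S \<Longrightarrow> i \<noteq> 1 \<Longrightarrow> D i g4 y = 0"
proof -
  have Dw: "D i w y = D i (k 4) y * l2 y + k 4 y * D i l2 y - (D i (k 2) y * l4 y + k 2 y * D i l4 y)"
    and Dg2: "D i g2 y = \<epsilon> 1 * (2 * k 2 y * D i (k 2) y) + 2 * l2 y * D i l2 y"
    and Dg4: "D i g4 y = \<epsilon> 1 * (2 * k 4 y * D i (k 4) y) + 2 * l4 y * D i l4 y"
    if y: "y \<in> S" for i y
  proof -
    note h = smooth_on_has_derivative[OF smooth_k[of 2] y] smooth_on_has_derivative[OF smooth_k[of 4] y]
      smooth_on_has_derivative[OF smooth_coefficients(1) y] smooth_on_has_derivative[OF smooth_coefficients(2) y]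
    have "(w has_derivative (\<lambda>v. frechet_derivative (k 4) (at y) v * l2 y + k 4 y * frechet_derivative l2 (at y) v
       - (frechet_derivative (k 2) (at y) v * l4 y + k 2 y * frechet_derivative l4 (at y) v))) (at y)"
      unfolding w_def[abs_def] by (rule derivative_eq_intros h refl)+ (simp add: algebra_simps)
    from along_eqI[OF this] show "D i w y = D i (k 4) y * l2 y + k 4 y * D i l2 y - (D i (k 2) y * l4 y + k 2 y * D i l4 y)"
      by (simp add: along_def)
    have "(g2 has_derivative (\<lambda>v. \<epsilon> 1 * (2 * k 2 y * frechet_derivative (k 2) (at y) v) + 2 * l2 y * frechet_derivative l2 (at y) v)) (at y)"
      unfolding g2_def[abs_def] by (rule derivative_eq_intros h refl)+ (simp add: algebra_simps)
    from along_eqI[OF this] show "D i g2 y = \<epsilon> 1 * (2 * k 2 y * D i (k 2) y) + 2 * l2 y * D i l2 y"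
      by (simp add: along_def)
    have "(g4 has_derivative (\<lambda>v. \<epsilon> 1 * (2 * k 4 y * frechet_derivative (k 4) (at y) v) + 2 * l4 y * frechet_derivative l4 (at y) v)) (at y)"
      unfolding g4_def[abs_def] by (rule derivative_eq_intros h refl)+ (simp add: algebra_simps)
    from along_eqI[OF this] show "D i g4 y = \<epsilon> 1 * (2 * k 4 y * D i (k 4) y) + 2 * l4 y * D i l4 y"
      by (simp add: along_def)
  qed
  show "D 1 w y = - (l2 y + l4 y) * w y" "D 1 g2 y = - 2 * l2 y * g2 y" "D 1 g4 y = - 2 * l4 y * g4 y" if "y \<in> S"
    unfolding Dw[OF that] Dg2[OF that] Dg4[OF that] D_k[OF that] D1_l2[OF that] D1_l4[OF that] w_def g2_def g4_def
    by (simp_all add: algebra_simps power2_eq_square)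
  show "D i w y = 0" "D i g2 y = 0" "D i g4 y = 0" if "y \<in> S" "i \<noteq> 1" for i
    unfolding Dw[OF that(1)] Dg2[OF that(1)] Dg4[OF that(1)] using leafwise[OF that] by simp_all
qed

lemma C_products:
  assumes y: "y \<in> S"
  shows "sprod (C2 y) (C2 y) = g2 y" "sprod (C4 y) (C4 y) = g4 y" "sprod (C2 y) (C4 y) = 0"
    "i \<noteq> 1 \<Longrightarrow> sprod (C2 y) (E i y) = 0" "i \<noteq> 1 \<Longrightarrow> sprod (C4 y) (E i y) = 0"
    "sprod (E 1 y) (C2 y) = \<epsilon> 1 * k 2 y" "sprod (E 1 y) (C4 y) = \<epsilon> 1 * k 4 y"
proof -
  have "\<epsilon> 1 * (\<epsilon> 1 * l2 y * l4 y + k 2 y * k 4 y) = 0" using gauss_24[OF y] by simp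
  then have "\<epsilon> 1 * (k 2 y * k 4 y) + l2 y * l4 y = 0" by (simp add: algebra_simps)
  then show "sprod (C2 y) (C4 y) = 0" by (simp add: C2_def C4_def y E_E N_N N_E E_N mult_ac)
qed (simp_all add: C2_def C4_def g2_def g4_def y E_E N_N N_E E_N power2_eq_square mult_ac)

text \<open>Let \<open>A\<close> and \<open>B\<close> be \<open>C4\<close> and \<open>C2\<close> divided by their lengths \<open>\<rho>4\<close> and \<open>\<rho>2\<close>.  Then \<open>A\<close> moves only along
  \<open>E 2, E 3\<close> and \<open>B\<close> only along \<open>E 4\<close>, so \<open>(B, E 4)\<close> spans a constant plane and \<open>(A, E 2, E 3)\<close> its constant
  orthogonal complement.  The rates at which \<open>A\<close> and \<open>B\<close> turn are \<open>w / \<rho>4\<close> and \<open>- w / \<rho>2\<close>; their reciprocals \<open>f1\<close> and \<open>f2\<close>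
  are the radii that make \<open>X - f1 A - f2 B\<close> constant along the leaves, and it is constant along
  \<open>E 1\<close> because \<open>E 1 = f1' A + f2' B\<close>.\<close>

lemma orthogonal_decomposition:
  assumes y0: "y0 \<in> S" and w0: "w y0 \<noteq> 0"
  obtains U A B f1 f2 c \<eta> \<theta> where
    "open U" "y0 \<in> U" "U \<subseteq> S" "smooth_on U A" "smooth_on U B" "smooth_on U f1" "smooth_on U f2"
    "\<eta> = 1 \<or> \<eta> = -1" "\<theta> = 1 \<or> \<theta> = -1" "\<eta> * \<theta> = \<epsilon> 1" "\<epsilon> 1 = 1 \<Longrightarrow> \<eta> = 1"
    "\<And>y i. y \<in> U \<Longrightarrow> i \<noteq> 1 \<Longrightarrow> D i f1 y = 0 \<and> D i f2 y = 0"
    "\<And>y. y \<in> U \<Longrightarrow> \<eta> * (D 1 f1 y)\<^sup>2 + \<theta> * (D 1 f2 y)\<^sup>2 = \<epsilon> 1"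
    "\<And>y. y \<in> U \<Longrightarrow> X y = c + f1 y *\<^sub>R A y + f2 y *\<^sub>R B y"
    "\<And>y. y \<in> U \<Longrightarrow> sprod (A y) (A y) = \<eta> \<and> sprod (B y) (B y) = \<theta> \<and> sprod (A y) (B y) = 0 \<and>
        sprod (A y) (E 2 y) = 0 \<and> sprod (A y) (E 3 y) = 0 \<and> sprod (A y) (E 4 y) = 0 \<and>
        sprod (B y) (E 2 y) = 0 \<and> sprod (B y) (E 3 y) = 0 \<and> sprod (B y) (E 4 y) = 0"
    "\<And>y. y \<in> U \<Longrightarrow> sprod (A y) (B y0) = 0 \<and> sprod (A y) (E 4 y0) = 0 \<and>
        sprod (B y) (A y0) = 0 \<and> sprod (B y) (E 2 y0) = 0 \<and> sprod (B y) (E 3 y0) = 0"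
proof -
  have g0: "g2 y0 \<noteq> 0" "g4 y0 \<noteq> 0" using w_relations(2)[OF y0] w0 by auto
  define \<eta> where "\<eta> = sgn (g4 y0)"
  define \<theta> where "\<theta> = sgn (g2 y0)"
  have \<eta>: "\<eta> = 1 \<or> \<eta> = -1" "\<eta> * \<eta> = 1" "\<eta> * g4 y0 > 0" using g0 by (auto simp: \<eta>_def sgn_if)
  have \<theta>: "\<theta> = 1 \<or> \<theta> = -1" "\<theta> * \<theta> = 1" "\<theta> * g2 y0 > 0" using g0 by (auto simp: \<theta>_def sgn_if)
  have e1: "\<epsilon> 1 = 1 \<or> \<epsilon> 1 = -1" using eps_sq[of 1] by (simp add: power2_eq_1_iff)
  have \<eta>\<theta>: "\<eta> * \<theta> = \<epsilon> 1"
  proof -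
    have "(w y0)\<^sup>2 > 0" using w0 by simp
    then have "sgn ((w y0)\<^sup>2) = 1" by (rule sgn_pos)
    then have "sgn (g2 y0 * g4 y0) = \<epsilon> 1" using e1 unfolding w_relations(2)[OF y0] sgn_mult by auto
    then show ?thesis by (simp add: \<eta>_def \<theta>_def sgn_mult mult.commute)
  qed
  have \<eta>1: "\<eta> = 1" if "\<epsilon> 1 = 1"
  proof -
    have "g4 y0 > 0" unfolding g4_def that using k_nz[OF y0, of 4] by (simp add: add_pos_nonneg)
    then show ?thesis by (simp add: \<eta>_def)
  qed
  define U where "U = {y \<in> S. \<eta> * g4 y > 0 \<and> \<theta> * g2 y > 0}"
  have sm: "smooth_on S (\<lambda>y. \<eta> * g4 y)" "smooth_on S (\<lambda>y. \<theta> * g2 y)" by (intro smooth_intros)+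
  have "U = (S \<inter> (\<lambda>y. \<eta> * g4 y) -` {0<..}) \<inter> (S \<inter> (\<lambda>y. \<theta> * g2 y) -` {0<..})" by (auto simp: U_def)
  then have oU: "open U"
    using smooth_on_continuous_on[OF sm(1)] smooth_on_continuous_on[OF sm(2)]
    by (simp add: continuous_open_preimage open_Int)
  have US: "y \<in> S" "\<eta> * g4 y > 0" "\<theta> * g2 y > 0" "w y \<noteq> 0" if "y \<in> U" for y
    using that w_relations(2)[of y] by (auto simp: U_def)
  have "y0 \<in> U" using y0 \<eta>(3) \<theta>(3) by (simp add: U_def)
  then obtain r where r: "r > 0" "ball y0 r \<subseteq> U" using oU open_contains_ball by blast
  let ?B = "ball y0 r"
  have sub: "U \<subseteq> S" by (auto simp: U_def)
  note smU = smooth_on_subset[OF _ sub]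
  define \<rho>4 where "\<rho>4 y = sqrt (\<eta> * g4 y)" for y
  define \<rho>2 where "\<rho>2 y = sqrt (\<theta> * g2 y)" for y
  have \<rho>pos: "\<rho>4 y > 0" "\<rho>2 y > 0" if "y \<in> U" for y using US[OF that] by (auto simp: \<rho>4_def \<rho>2_def)
  have \<rho>sq: "\<rho>4 y * \<rho>4 y = \<eta> * g4 y" "\<rho>2 y * \<rho>2 y = \<theta> * g2 y" if "y \<in> U" for y
    using US[OF that] by (auto simp: \<rho>4_def \<rho>2_def)
  have sm\<rho>: "smooth_on U \<rho>4" "smooth_on U \<rho>2"
    unfolding \<rho>4_def[abs_def] \<rho>2_def[abs_def] using US by (auto intro!: smooth_intros oU smU[OF smooth_C(3)] smU[OF smooth_C(2)])
  have D\<rho>: "D i \<rho>4 y = \<eta> * D i g4 y / (2 * \<rho>4 y)" "D i \<rho>2 y = \<theta> * D i g2 y / (2 * \<rho>2 y)" if "y \<in> U" for i y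
  proof -
    have "D i \<rho>4 y = inverse (sqrt (\<eta> * g4 y)) / 2 * D i (\<lambda>y. \<eta> * g4 y) y"
      unfolding \<rho>4_def[abs_def] by (rule along_real_chain[OF sm(1) US(1)[OF that] DERIV_real_sqrt[OF US(2)[OF that]]])
    then show "D i \<rho>4 y = \<eta> * D i g4 y / (2 * \<rho>4 y)"
      using along_cmult[OF smooth_C(3) US(1)[OF that]] by (simp add: \<rho>4_def field_simps)
    have "D i \<rho>2 y = inverse (sqrt (\<theta> * g2 y)) / 2 * D i (\<lambda>y. \<theta> * g2 y) y"
      unfolding \<rho>2_def[abs_def] by (rule along_real_chain[OF sm(2) US(1)[OF that] DERIV_real_sqrt[OF US(3)[OF that]]])
    then show "D i \<rho>2 y = \<theta> * D i g2 y / (2 * \<rho>2 y)"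
      using along_cmult[OF smooth_C(2) US(1)[OF that]] by (simp add: \<rho>2_def field_simps)
  qed
  have D1\<rho>: "D 1 \<rho>4 y = - l4 y * \<rho>4 y" "D 1 \<rho>2 y = - l2 y * \<rho>2 y" if "y \<in> U" for y
  proof -
    have "\<eta> * D 1 g4 y = - 2 * l4 y * (\<rho>4 y * \<rho>4 y)" "\<theta> * D 1 g2 y = - 2 * l2 y * (\<rho>2 y * \<rho>2 y)"
      unfolding \<rho>sq[OF that] D1_g[OF US(1)[OF that]] by simp_all
    then show "D 1 \<rho>4 y = - l4 y * \<rho>4 y" "D 1 \<rho>2 y = - l2 y * \<rho>2 y"
      unfolding D\<rho>[OF that] using \<rho>pos[OF that] by simp_all
  qed
  have Di\<rho>: "D i \<rho>4 y = 0" "D i \<rho>2 y = 0" if "y \<in> U" "i \<noteq> 1" for y i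
    using D\<rho>[OF that(1), of i] Di_g[OF US(1)[OF that(1)] that(2)] by simp_all
  define A where "A y = (1 / \<rho>4 y) *\<^sub>R C4 y" for y
  define B where "B y = (1 / \<rho>2 y) *\<^sub>R C2 y" for y
  have sm_inv: "smooth_on U (\<lambda>y. 1 / \<rho>4 y)" "smooth_on U (\<lambda>y. 1 / \<rho>2 y)"
    using \<rho>pos by (auto intro!: smooth_intros oU sm\<rho> simp: less_imp_neq[symmetric])
  have smAB: "smooth_on U A" "smooth_on U B"
    unfolding A_def[abs_def] B_def[abs_def]
    by (intro smooth_intros oU sm_inv smU[OF smooth_C(5)] smU[OF smooth_C(4)])+
  have D_inv: "D i (\<lambda>y. 1 / \<rho>4 y) y = - D i \<rho>4 y / (\<rho>4 y * \<rho>4 y)" "D i (\<lambda>y. 1 / \<rho>2 y) y = - D i \<rho>2 y / (\<rho>2 y * \<rho>2 y)"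
    if "y \<in> U" for i y
    using along_divide[OF smooth_on_const[OF oU, of 1] sm\<rho>(1) that, of "V i"]
      along_divide[OF smooth_on_const[OF oU, of 1] sm\<rho>(2) that, of "V i"] \<rho>pos[OF that] by simp_all
  have DA: "D i A y = (- D i \<rho>4 y / (\<rho>4 y * \<rho>4 y)) *\<^sub>R C4 y + (1 / \<rho>4 y) *\<^sub>R D i C4 y"
    and DB: "D i B y = (- D i \<rho>2 y / (\<rho>2 y * \<rho>2 y)) *\<^sub>R C2 y + (1 / \<rho>2 y) *\<^sub>R D i C2 y" if "y \<in> U" for i y
    unfolding A_def[abs_def] B_def[abs_def]
    using along_scaleR[OF sm_inv(1) smU[OF smooth_C(5)] that, of "V i"] along_scaleR[OF sm_inv(2) smU[OF smooth_C(4)] that, of "V i"]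
      D_inv[OF that, of i] by simp_all
  have DA_val: "D 1 A y = 0" "D 4 A y = 0" "a = 2 \<or> a = 3 \<Longrightarrow> D a A y = (w y / \<rho>4 y) *\<^sub>R E a y"
    and DB_val: "D 1 B y = 0" "D 4 B y = - (w y / \<rho>2 y) *\<^sub>R E 4 y" "a = 2 \<or> a = 3 \<Longrightarrow> D a B y = 0" if y: "y \<in> U" for a y
  proof -
    show "D 1 A y = 0" "D 1 B y = 0"
      unfolding DA[OF y] DB[OF y] D1\<rho>[OF y] D_C_values[OF US(1)[OF y]] using \<rho>pos[OF y] by simp_all
    show "D 4 A y = 0" "D 4 B y = - (w y / \<rho>2 y) *\<^sub>R E 4 y"
      unfolding DA[OF y] DB[OF y] D_C_values[OF US(1)[OF y]] using Di\<rho>[OF y, of 4] by simp_all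
    show "D a A y = (w y / \<rho>4 y) *\<^sub>R E a y" "D a B y = 0" if a: "a = 2 \<or> a = 3"
      unfolding DA[OF y] DB[OF y] D_C_values(3,6)[OF US(1)[OF y] a] using Di\<rho>[OF y, of a] a by auto
  qed
  have prods: "sprod (A y) (A y) = \<eta> \<and> sprod (B y) (B y) = \<theta> \<and> sprod (A y) (B y) = 0 \<and>
        sprod (A y) (E 2 y) = 0 \<and> sprod (A y) (E 3 y) = 0 \<and> sprod (A y) (E 4 y) = 0 \<and>
        sprod (B y) (E 2 y) = 0 \<and> sprod (B y) (E 3 y) = 0 \<and> sprod (B y) (E 4 y) = 0" if y: "y \<in> U" for y
  proof -
    have "g4 y / (\<rho>4 y * \<rho>4 y) = \<eta>" "g2 y / (\<rho>2 y * \<rho>2 y) = \<theta>"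
      unfolding \<rho>sq[OF y] using \<eta>(1) \<theta>(1) US(2,3)[OF y] by auto
    then show ?thesis
      using C_products[OF US(1)[OF y]] sprod_commute[of "C4 y" "C2 y"] by (simp add: A_def B_def)
  qed
  \<comment> \<open>the orthogonal projection to the plane spanned by \<open>B\<close> and \<open>E 4\<close>\<close>
  define q where "q c y = (\<theta> * sprod c (B y)) *\<^sub>R B y + (\<epsilon> 4 * sprod c (E 4 y)) *\<^sub>R E 4 y" for c y
  have smE4: "smooth_on U (E 4)" by (rule smU[OF smooth_E])
  have smq: "smooth_on U (q c)" for c
    unfolding q_def[abs_def] by (intro smooth_intros oU smAB smE4)
  have Dq: "D i (q c) y = 0" if y: "y \<in> U" for i c y
  proof -
    have S': "y \<in> S" using US(1)[OF y] .
    have sc: "D i (\<lambda>y. \<theta> * sprod c (B y)) y = \<theta> * sprod c (D i B y)"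
      "D i (\<lambda>y. \<epsilon> 4 * sprod c (E 4 y)) y = \<epsilon> 4 * sprod c (D i (E 4) y)"
      using along_cmult[OF smooth_on_sprod[OF oU smooth_on_const[OF oU] smAB(2)] y, of "V i" \<theta> c]
        along_sprod[OF smooth_on_const[OF oU] smAB(2) y, of "V i" c]
        along_cmult[OF smooth_on_sprod[OF oU smooth_on_const[OF oU] smE4] y, of "V i" "\<epsilon> 4" c]
        along_sprod[OF smooth_on_const[OF oU] smE4 y, of "V i" c] by simp_all
    have "D i (q c) y = D i (\<lambda>y. (\<theta> * sprod c (B y)) *\<^sub>R B y) y + D i (\<lambda>y. (\<epsilon> 4 * sprod c (E 4 y)) *\<^sub>R E 4 y) y"
      unfolding q_def[abs_def] by (rule along_add[of U]) (intro smooth_intros oU smAB smE4 y)+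
    also have "\<dots> = ((\<theta> * sprod c (D i B y)) *\<^sub>R B y + (\<theta> * sprod c (B y)) *\<^sub>R D i B y)
       + ((\<epsilon> 4 * sprod c (D i (E 4) y)) *\<^sub>R E 4 y + (\<epsilon> 4 * sprod c (E 4 y)) *\<^sub>R D i (E 4) y)"
      using along_scaleR[of U "\<lambda>y. \<theta> * sprod c (B y)" B y "V i"] along_scaleR[of U "\<lambda>y. \<epsilon> 4 * sprod c (E 4 y)" "E 4" y "V i"]
        sc smAB smE4 oU y by (simp add: smooth_intros)
    finally have Dq': "D i (q c) y = ((\<theta> * sprod c (D i B y)) *\<^sub>R B y + (\<theta> * sprod c (B y)) *\<^sub>R D i B y)
       + ((\<epsilon> 4 * sprod c (D i (E 4) y)) *\<^sub>R E 4 y + (\<epsilon> 4 * sprod c (E 4 y)) *\<^sub>R D i (E 4) y)" .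
    consider "i = 1" | "i = 2 \<or> i = 3" | "i = 4" using exhaust_4[of i] by blast
    then show ?thesis
    proof cases
      case 1
      then show ?thesis using Dq' DB_val(1)[OF y] D1_E(2)[OF S'] by simp
    next
      case 2
      then show ?thesis using Dq' DB_val(3)[OF y 2] Da_E4[OF S' 2] by simp
    next
      case 3
      have g: "g2 y \<noteq> 0" using US(3)[OF y] by auto
      have 1: "k 4 y = w y / g2 y * l2 y" using w_relations(1)[OF S'] g by (simp add: field_simps)
      have "\<epsilon> 1 * l4 y * g2 y = - (w y * k 2 y)"
        using w_relations(4)[OF S'] eps_sq[of 1] by algebra
      then have 2: "\<epsilon> 1 * l4 y = - (w y / g2 y * k 2 y)" using g by (simp add: field_simps)
      have "k 4 y *\<^sub>R N y - (\<epsilon> 1 * l4 y) *\<^sub>R E 1 y = (w y / g2 y) *\<^sub>R C2 y"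
        unfolding 1 2 C2_def by (simp add: scaleR_add_right)
      then have "D 4 (E 4) y = (\<epsilon> 4 * (w y / g2 y)) *\<^sub>R C2 y"
        unfolding D4_E(2)[OF S'] by simp
      also have "C2 y = \<rho>2 y *\<^sub>R B y" using \<rho>pos[OF y] by (simp add: B_def)
      also have "(\<epsilon> 4 * (w y / g2 y)) *\<^sub>R (\<rho>2 y *\<^sub>R B y) = (\<epsilon> 4 * \<theta> * (w y / \<rho>2 y)) *\<^sub>R B y"
      proof -
        have "w y / g2 y * \<rho>2 y = \<theta> * (w y / \<rho>2 y)"
          using \<rho>sq(2)[OF y] \<theta>(2) \<rho>pos[OF y] g by (simp add: field_simps)
        then show ?thesis by (simp only: scaleR_scaleR mult.assoc)
      qed
      finally have E4: "D 4 (E 4) y = (\<epsilon> 4 * \<theta> * (w y / \<rho>2 y)) *\<^sub>R B y" .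
      show ?thesis
        unfolding Dq' unfolding 3 E4 DB_val(2)[OF y] using \<theta>(2) by (simp add: mult_ac)
    qed
  qed
  have q_const: "q c y = q c y0" if "y \<in> ?B" for c y
    using r sub Dq that by (intro constant_on_ball[OF smq r(2) sub]) auto
  have EE0: "\<And>i j. sprod (E i y0) (E j y0) = (if i = j then \<epsilon> i else 0)" using E_E[OF y0] .
  have cross: "sprod (A y) (B y0) = 0 \<and> sprod (A y) (E 4 y0) = 0 \<and>
        sprod (B y) (A y0) = 0 \<and> sprod (B y) (E 2 y0) = 0 \<and> sprod (B y) (E 3 y0) = 0" if y: "y \<in> ?B" for y
  proof -
    have yU: "y \<in> U" using y r(2) by blast
    note p = prods[OF yU] and p0 = prods[OF \<open>y0 \<in> U\<close>]
    have in_plane: "sprod (A y) c = 0" if "q c y0 = c" for c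
    proof -
      have "sprod (A y) (q c y) = 0" using p by (simp add: q_def)
      then show ?thesis using q_const[OF y, of c] that by simp
    qed
    have ortho: "sprod (B y) c = 0" if "q c y0 = 0" for c
    proof -
      have "sprod (q c y) (B y) = 0" using q_const[OF y, of c] that by simp
      then have "\<theta> * sprod c (B y) * \<theta> = 0" using p sprod_commute[of "E 4 y" "B y"] by (simp add: q_def)
      then show ?thesis using \<theta>(2) sprod_commute[of c "B y"] by auto
    qed
    have "q (B y0) y0 = B y0" "q (E 4 y0) y0 = E 4 y0" "q (A y0) y0 = 0" "q (E 2 y0) y0 = 0" "q (E 3 y0) y0 = 0"
      using p0 \<theta>(2) EE0 eps[of 4] sprod_commute[of "E 2 y0" "B y0"] sprod_commute[of "E 3 y0" "B y0"]
        sprod_commute[of "E 4 y0" "B y0"] by (simp_all add: q_def)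
    then show ?thesis using in_plane ortho by blast
  qed
  define f1 where "f1 y = \<rho>4 y / w y" for y
  define f2 where "f2 y = - \<rho>2 y / w y" for y
  have smw: "smooth_on U w" by (rule smU[OF smooth_C(1)])
  have smf: "smooth_on U f1" "smooth_on U f2"
    unfolding f1_def[abs_def] f2_def[abs_def] using US(4) by (auto intro!: smooth_intros oU sm\<rho> smw)
  have Df: "D i f1 y = (D i \<rho>4 y * w y - \<rho>4 y * D i w y) / (w y * w y)"
    "D i f2 y = (- D i \<rho>2 y * w y + \<rho>2 y * D i w y) / (w y * w y)" if "y \<in> U" for i y
    unfolding f1_def[abs_def] f2_def[abs_def]
    using along_divide[OF sm\<rho>(1) smw that US(4)[OF that], of "V i"]
      along_divide[OF smooth_on_minus[OF oU sm\<rho>(2)] smw that US(4)[OF that], of "V i"] along_minus[OF sm\<rho>(2) that, of "V i"]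
    by simp_all
  have leaf: "D i f1 y = 0 \<and> D i f2 y = 0" if "y \<in> U" "i \<noteq> 1" for i y
    using Df[OF that(1), of i] Di\<rho>[OF that] Di_w[OF US(1)[OF that(1)] that(2)] by simp
  have D1f: "D 1 f1 y = \<eta> * \<epsilon> 1 * k 4 y / \<rho>4 y" "D 1 f2 y = \<theta> * \<epsilon> 1 * k 2 y / \<rho>2 y" if y: "y \<in> U" for y
  proof -
    have "D 1 f1 y = \<rho>4 y * l2 y / w y" "D 1 f2 y = - \<rho>2 y * l4 y / w y"
      unfolding Df[OF y] D1\<rho>[OF y] D1_w[OF US(1)[OF y]] using US(4)[OF y] by (simp_all add: field_simps)
    moreover have "\<rho>4 y * l2 y / w y = \<eta> * \<epsilon> 1 * k 4 y / \<rho>4 y"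
    proof (subst frac_eq_eq)
      show "\<rho>4 y * l2 y * \<rho>4 y = \<eta> * \<epsilon> 1 * k 4 y * w y"
        using \<rho>sq(1)[OF y] w_relations(3)[OF US(1)[OF y]] by algebra
    qed (use US(4)[OF y] \<rho>pos[OF y] in simp_all)
    moreover have "- \<rho>2 y * l4 y / w y = \<theta> * \<epsilon> 1 * k 2 y / \<rho>2 y"
    proof (subst frac_eq_eq)
      show "- \<rho>2 y * l4 y * \<rho>2 y = \<theta> * \<epsilon> 1 * k 2 y * w y"
        using \<rho>sq(2)[OF y] w_relations(4)[OF US(1)[OF y]] by algebra
    qed (use US(4)[OF y] \<rho>pos[OF y] in simp_all)
    ultimately show "D 1 f1 y = \<eta> * \<epsilon> 1 * k 4 y / \<rho>4 y" "D 1 f2 y = \<theta> * \<epsilon> 1 * k 2 y / \<rho>2 y" by simp_all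
  qed
  have E1: "E 1 y = D 1 f1 y *\<^sub>R A y + D 1 f2 y *\<^sub>R B y" if y: "y \<in> U" for y
  proof (rule frame_eqI[OF US(1)[OF y]])
    have g: "g4 y \<noteq> 0" "g2 y \<noteq> 0" using US(2,3)[OF y] by auto
    have c: "D 1 f1 y / \<rho>4 y = \<epsilon> 1 * k 4 y / g4 y" "D 1 f2 y / \<rho>2 y = \<epsilon> 1 * k 2 y / g2 y"
      unfolding D1f[OF y] using \<rho>sq[OF y] \<rho>pos[OF y] \<eta>(1) \<theta>(1) g by (auto simp: field_simps)
    have eq: "D 1 f1 y *\<^sub>R A y + D 1 f2 y *\<^sub>R B y = (\<epsilon> 1 * k 4 y / g4 y) *\<^sub>R C4 y + (\<epsilon> 1 * k 2 y / g2 y) *\<^sub>R C2 y"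
      unfolding c[symmetric] by (simp add: A_def B_def)
    have 1: "\<epsilon> 1 * k 4 y / g4 y * k 4 y + \<epsilon> 1 * k 2 y / g2 y * k 2 y = 1"
      "\<epsilon> 1 * k 4 y / g4 y * l4 y + \<epsilon> 1 * k 2 y / g2 y * l2 y = 0"
      using g eps_sq[of 1] gauss_24[OF US(1)[OF y]] unfolding g2_def g4_def by (simp_all add: field_simps) (algebra+)?
    have "D 1 f1 y *\<^sub>R A y + D 1 f2 y *\<^sub>R B y = (\<epsilon> 1 * k 4 y / g4 y * k 4 y + \<epsilon> 1 * k 2 y / g2 y * k 2 y) *\<^sub>R E 1 y
       + (\<epsilon> 1 * k 4 y / g4 y * l4 y + \<epsilon> 1 * k 2 y / g2 y * l2 y) *\<^sub>R N y"
      unfolding eq C2_def C4_def by (simp add: algebra_simps)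
    then have "D 1 f1 y *\<^sub>R A y + D 1 f2 y *\<^sub>R B y = E 1 y" unfolding 1 by simp
    then show "sprod (E 1 y) (E l y) = sprod (D 1 f1 y *\<^sub>R A y + D 1 f2 y *\<^sub>R B y) (E l y)"
      "sprod (E 1 y) (N y) = sprod (D 1 f1 y *\<^sub>R A y + D 1 f2 y *\<^sub>R B y) (N y)" for l by simp_all
  qed
  have norm: "\<eta> * (D 1 f1 y)\<^sup>2 + \<theta> * (D 1 f2 y)\<^sup>2 = \<epsilon> 1" if y: "y \<in> U" for y
    using E_E[OF US(1)[OF y], of 1 1] prods[OF y] sprod_commute[of "B y" "A y"]
    unfolding E1[OF y] by (simp add: power2_eq_square mult_ac)
  define R where "R y = X y - (f1 y *\<^sub>R A y + f2 y *\<^sub>R B y)" for y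
  have smX: "smooth_on U X" by (rule smU[OF smooth_X])
  have smR: "smooth_on U R" unfolding R_def[abs_def] by (intro smooth_intros oU smX smf smAB)
  have DR: "D i R y = 0" if y: "y \<in> U" for i y
  proof -
    have "D i R y = D i X y - ((D i f1 y *\<^sub>R A y + f1 y *\<^sub>R D i A y) + (D i f2 y *\<^sub>R B y + f2 y *\<^sub>R D i B y))"
      unfolding R_def[abs_def] along_def
      by (rule frechet_derivative_eqI, (rule derivative_eq_intros refl smooth_on_has_derivative[OF _ y] smX smf smAB)+)
         (simp add: algebra_simps)
    moreover consider "i = 1" | "i = 2 \<or> i = 3" | "i = 4" using exhaust_4[of i] by blast
    then have "(D i f1 y *\<^sub>R A y + f1 y *\<^sub>R D i A y) + (D i f2 y *\<^sub>R B y + f2 y *\<^sub>R D i B y) = E i y"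
    proof cases
      case 1
      then show ?thesis using E1[OF y] DA_val(1)[OF y] DB_val(1)[OF y] by simp
    next
      case 2
      then have "i \<noteq> 1" by auto
      then show ?thesis
        using leaf[OF y, of i] DA_val(3)[OF y 2] DB_val(3)[OF y 2] \<rho>pos[OF y] US(4)[OF y] by (simp add: f1_def)
    next
      case 3
      then show ?thesis
        using leaf[OF y, of i] DA_val(2)[OF y] DB_val(2)[OF y] \<rho>pos[OF y] US(4)[OF y] by (simp add: f2_def)
    qed
    ultimately show ?thesis using V_X[OF US(1)[OF y], of i] by simp
  qed
  have Rc: "R y = R y0" if "y \<in> ?B" for y
    using r DR that by (intro constant_on_ball[OF smR r(2) sub]) auto
  show ?thesis
  proof (rule that[of ?B A B f1 f2 \<eta> \<theta> "R y0"])
    show "X y = R y0 + f1 y *\<^sub>R A y + f2 y *\<^sub>R B y" if "y \<in> ?B" for y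
      using Rc[OF that] by (simp add: R_def algebra_simps)
  qed (use r \<eta>(1) \<theta>(1) \<eta>\<theta> \<eta>1 sub smAB smf smooth_on_subset[OF _ r(2)] leaf norm prods cross in auto)
qed

end

section \<open>The six families with orthogonal factors\<close>

lemma polar_coordinates:
  fixes x y :: real
  assumes "x > 0"
  shows "sqrt (x\<^sup>2 + y\<^sup>2) * cos (arctan (y / x)) = x" "sqrt (x\<^sup>2 + y\<^sup>2) * sin (arctan (y / x)) = y"
proof -
  have "1 + (y / x)\<^sup>2 = (x\<^sup>2 + y\<^sup>2) / x\<^sup>2" using assms by (simp add: field_simps)
  then have s: "sqrt (1 + (y / x)\<^sup>2) = sqrt (x\<^sup>2 + y\<^sup>2) / x" using assms by (simp add: real_sqrt_divide)
  have "sqrt (x\<^sup>2 + y\<^sup>2) > 0" using assms by (simp add: add_pos_nonneg)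
  then show "sqrt (x\<^sup>2 + y\<^sup>2) * cos (arctan (y / x)) = x" "sqrt (x\<^sup>2 + y\<^sup>2) * sin (arctan (y / x)) = y"
    using assms unfolding cos_arctan sin_arctan s by simp_all
qed

lemma circle_param:
  fixes x y :: real
  assumes "x\<^sup>2 + y\<^sup>2 = 1" "x > 0"
  shows "cos (arctan (y / x)) = x" "sin (arctan (y / x)) = y"
  using polar_coordinates[OF assms(2), of y] assms(1) by simp_all

lemma hyperbola_param:
  fixes x y :: real
  assumes "x\<^sup>2 - y\<^sup>2 = 1" "x > 0"
  shows "cosh (arsinh y) = x" "sinh (arsinh y) = y"
proof -
  have "y\<^sup>2 + 1 = x\<^sup>2" using assms by simp
  then show "cosh (arsinh y) = x" using assms(2) by (simp add: cosh_arsinh_real)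
qed simp

lemma hyperboloid_param:
  fixes x y z :: real
  assumes "x\<^sup>2 - y\<^sup>2 - z\<^sup>2 = 1" "x > 0" "y > 0"
  defines "t \<equiv> arsinh (sqrt (y\<^sup>2 + z\<^sup>2))" and "u \<equiv> arctan (z / y)"
  shows "cosh t = x" "sinh t * cos u = y" "sinh t * sin u = z"
  using hyperbola_param(1)[of x "sqrt (y\<^sup>2 + z\<^sup>2)"] assms(1,2) polar_coordinates[OF assms(3), of z]
  by (simp_all add: t_def u_def)

lemma one_sheet_param:
  fixes x y z :: real
  assumes "- x\<^sup>2 + y\<^sup>2 + z\<^sup>2 = 1" "y > 0"
  defines "t \<equiv> arsinh x" and "u \<equiv> arctan (z / y)"
  shows "sinh t = x" "cosh t * cos u = y" "cosh t * sin u = z"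
proof -
  have "x\<^sup>2 + 1 = y\<^sup>2 + z\<^sup>2" using assms(1) by simp
  then have "cosh t = sqrt (y\<^sup>2 + z\<^sup>2)" by (simp add: t_def cosh_arsinh_real)
  then show "cosh t * cos u = y" "cosh t * sin u = z" using polar_coordinates[OF assms(2)] by (simp_all add: u_def)
qed (simp add: t_def)

lemma sphere_param:
  fixes x y z :: real
  assumes "x\<^sup>2 + y\<^sup>2 + z\<^sup>2 = 1" "y > 0"
  defines "t \<equiv> pi / 2 - arctan (x / sqrt (y\<^sup>2 + z\<^sup>2))" and "u \<equiv> arctan (z / y)"
  shows "cos t = x" "sin t * cos u = y" "sin t * sin u = z"
proof -
  have "sqrt (y\<^sup>2 + z\<^sup>2) > 0" using assms(2) by (simp add: add_pos_nonneg)
  moreover have "(sqrt (y\<^sup>2 + z\<^sup>2))\<^sup>2 + x\<^sup>2 = 1" using assms(1) by simp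
  ultimately have "cos (pi / 2 - t) = sqrt (y\<^sup>2 + z\<^sup>2)" "sin (pi / 2 - t) = x"
    using circle_param[of "sqrt (y\<^sup>2 + z\<^sup>2)" x] by (simp_all add: t_def)
  then have "sin t = sqrt (y\<^sup>2 + z\<^sup>2)" "cos t = x" by (simp_all add: cos_diff sin_diff)
  then show "cos t = x" "sin t * cos u = y" "sin t * sin u = z"
    using polar_coordinates[OF assms(2)] by (simp_all add: u_def)
qed

text \<open>The conclusion of the classification, as a property of the relation that says when a family
  describes the hypersurface.  It is used for immersions of open subsets of \<open>real^4\<close> and for
  hypersurfaces given by an atlas; by monotonicity the first case implies the second.\<close>

definition some_family :: "(real set \<Rightarrow> (real \<Rightarrow> real \<Rightarrow> real \<Rightarrow> real \<Rightarrow> real^5) \<Rightarrow> bool) \<Rightarrow> bool" where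
  "some_family R \<longleftrightarrow> (\<exists>I. open I \<and> is_interval I \<and>
     ((\<exists>\<phi>1 \<phi>2. smooth_on I \<phi>1 \<and> smooth_on I \<phi>2 \<and>
         (((\<forall>s\<in>I. (deriv \<phi>1 s)\<^sup>2 - (deriv \<phi>2 s)\<^sup>2 = 1) \<and> R I (family_i \<phi>1 \<phi>2)) \<or>
          ((\<forall>s\<in>I. (deriv \<phi>1 s)\<^sup>2 - (deriv \<phi>2 s)\<^sup>2 = -1) \<and> R I (family_ii \<phi>1 \<phi>2)) \<or>
          ((\<forall>s\<in>I. (deriv \<phi>1 s)\<^sup>2 - (deriv \<phi>2 s)\<^sup>2 = 1) \<and> R I (family_iii \<phi>1 \<phi>2)) \<or>
          ((\<forall>s\<in>I. (deriv \<phi>1 s)\<^sup>2 + (deriv \<phi>2 s)\<^sup>2 = 1) \<and> R I (family_iv \<phi>1 \<phi>2)) \<or>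
          ((\<forall>s\<in>I. (deriv \<phi>1 s)\<^sup>2 - (deriv \<phi>2 s)\<^sup>2 = -1) \<and> R I (family_v \<phi>1 \<phi>2)) \<or>
          ((\<forall>s\<in>I. (deriv \<phi>1 s)\<^sup>2 + (deriv \<phi>2 s)\<^sup>2 = 1) \<and> R I (family_vi \<phi>1 \<phi>2)))) \<or>
      (\<exists>a \<psi>. a \<noteq> 0 \<and> smooth_on I \<psi> \<and>
         (((\<forall>s\<in>I. 1 - 2 * deriv \<psi> s < 0) \<and> R I (family_vii a \<psi>)) \<or>
          ((\<forall>s\<in>I. 1 + 2 * deriv \<psi> s < 0) \<and> R I (family_viii a \<psi>))))))"

lemma some_family_mono:
  assumes "some_family R" "\<And>I P. R I P \<Longrightarrow> R' I P"
  shows "some_family R'"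
proof -
  have "R I P \<longrightarrow> R' I P" for I P using assms(2) by blast
  then have "some_family R \<longrightarrow> some_family R'"
    unfolding some_family_def by (intro ex_mono conj_mono disj_mono imp_refl)
  then show ?thesis using assms(1) by blast
qed

abbreviation locally_classified :: "(real^4) set \<Rightarrow> (real^4 \<Rightarrow> real^5) \<Rightarrow> real^4 \<Rightarrow> bool" where
  "locally_classified S X y0 \<equiv> some_family (locally_parametrized S X y0)"

text \<open>The situation provided by \<open>orthogonal_decomposition\<close>.  The coordinates are taken with respect to the basis
  \<open>A, E 2, E 3, B, E 4\<close> at the base point \<open>y0\<close>, in which the vectors \<open>A y\<close> and \<open>B y\<close> have
  coefficients \<open>pA, pE 2, pE 3\<close> and \<open>qB, qE\<close> up to sign.\<close>

locale split_frame = adapted_frame +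
  fixes U :: "(real^4) set" and y0 :: "real^4" and A B :: "real^4 \<Rightarrow> real^5" and f1 f2 :: "real^4 \<Rightarrow> real"
    and c :: "real^5" and \<eta> \<theta> :: real
  assumes open_U [simp, smooth_intros]: "open U" and y0U: "y0 \<in> U" and US: "U \<subseteq> S"
    and smooth_split: "smooth_on U A" "smooth_on U B" "smooth_on U f1" "smooth_on U f2"
    and signs: "\<eta> = 1 \<or> \<eta> = -1" "\<theta> = 1 \<or> \<theta> = -1" "\<eta> * \<theta> = \<epsilon> 1" "\<epsilon> 1 = 1 \<Longrightarrow> \<eta> = 1"
    and leaf_f: "\<And>y i. y \<in> U \<Longrightarrow> i \<noteq> 1 \<Longrightarrow> D i f1 y = 0 \<and> D i f2 y = 0"
    and unit_speed: "\<And>y. y \<in> U \<Longrightarrow> \<eta> * (D 1 f1 y)\<^sup>2 + \<theta> * (D 1 f2 y)\<^sup>2 = \<epsilon> 1"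
    and position: "\<And>y. y \<in> U \<Longrightarrow> X y = c + f1 y *\<^sub>R A y + f2 y *\<^sub>R B y"
    and prods: "\<And>y. y \<in> U \<Longrightarrow> sprod (A y) (A y) = \<eta> \<and> sprod (B y) (B y) = \<theta> \<and> sprod (A y) (B y) = 0 \<and>
        sprod (A y) (E 2 y) = 0 \<and> sprod (A y) (E 3 y) = 0 \<and> sprod (A y) (E 4 y) = 0 \<and>
        sprod (B y) (E 2 y) = 0 \<and> sprod (B y) (E 3 y) = 0 \<and> sprod (B y) (E 4 y) = 0"
    and cross: "\<And>y. y \<in> U \<Longrightarrow> sprod (A y) (B y0) = 0 \<and> sprod (A y) (E 4 y0) = 0 \<and>
        sprod (B y) (A y0) = 0 \<and> sprod (B y) (E 2 y0) = 0 \<and> sprod (B y) (E 3 y0) = 0"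
begin

lemma base [simp]:
  "sprod (A y0) (A y0) = \<eta>" "sprod (B y0) (B y0) = \<theta>" "sprod (A y0) (B y0) = 0" "sprod (B y0) (A y0) = 0"
  "sprod (A y0) (E 2 y0) = 0" "sprod (A y0) (E 3 y0) = 0" "sprod (A y0) (E 4 y0) = 0"
  "sprod (B y0) (E 2 y0) = 0" "sprod (B y0) (E 3 y0) = 0" "sprod (B y0) (E 4 y0) = 0"
  "sprod (E 2 y0) (A y0) = 0" "sprod (E 3 y0) (A y0) = 0" "sprod (E 4 y0) (A y0) = 0"
  "sprod (E 2 y0) (B y0) = 0" "sprod (E 3 y0) (B y0) = 0" "sprod (E 4 y0) (B y0) = 0"
  "sprod (E i y0) (E j y0) = (if i = j then \<epsilon> i else 0)"
  using prods[OF y0U] sprod_commute[of "B y0" "A y0"] sprod_commute[of "A y0" "E 2 y0"] sprod_commute[of "A y0" "E 3 y0"]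
    sprod_commute[of "A y0" "E 4 y0"] sprod_commute[of "B y0" "E 2 y0"] sprod_commute[of "B y0" "E 3 y0"]
    sprod_commute[of "B y0" "E 4 y0"] E_E[of y0 i j] y0U US
  by auto

definition pA where "pA y = sprod (A y) (A y0)"
definition pE where "pE i y = sprod (A y) (E i y0)"
definition qB where "qB y = sprod (B y) (B y0)"
definition qE where "qE y = sprod (B y) (E 4 y0)"

lemma smooth_p [smooth_intros]: "smooth_on U pA" "smooth_on U (pE i)" "smooth_on U qB" "smooth_on U qE"
  unfolding pA_def[abs_def] pE_def[abs_def] qB_def[abs_def] qE_def[abs_def]
  by (intro smooth_intros smooth_split)+

lemma p_base [simp]: "pA y0 = \<eta>" "pE 2 y0 = 0" "pE 3 y0 = 0" "qB y0 = \<theta>" "qE y0 = 0"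
  by (simp_all add: pA_def pE_def qB_def qE_def)

lemma eps_cases: "\<epsilon> i = 1 \<or> \<epsilon> i = -1"
  using eps_sq[of i] by (simp add: power2_eq_1_iff)

lemma sign_sq [simp]: "\<eta> * \<eta> = 1" "\<theta> * \<theta> = 1" "\<eta>\<^sup>2 = 1" "\<theta>\<^sup>2 = 1" "\<eta> \<noteq> 0" "\<theta> \<noteq> 0" "(\<epsilon> i)\<^sup>2 = 1" "\<epsilon> i * \<epsilon> i = 1"
  using signs eps_sq eps by auto

lemma sign_cancel [simp]: "\<eta> * (\<eta> * x) = x" "\<theta> * (\<theta> * x) = x"
  using signs by auto

lemma orthonormal5_base: "orthonormal5 (tuple5 (A y0) (E 2 y0) (E 3 y0) (B y0) (E 4 y0)) (tuple5 \<eta> (\<epsilon> 2) (\<epsilon> 3) \<theta> (\<epsilon> 4))"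
  unfolding orthonormal5_def forall_5 by simp

lemma quadrics:
  assumes y: "y \<in> U"
  shows "\<eta> * (pA y)\<^sup>2 + \<epsilon> 2 * (pE 2 y)\<^sup>2 + \<epsilon> 3 * (pE 3 y)\<^sup>2 = \<eta>" "\<theta> * (qB y)\<^sup>2 + \<epsilon> 4 * (qE y)\<^sup>2 = \<theta>"
  using orthonormal5_sprod[OF orthonormal5_base, of "A y" "A y"] orthonormal5_sprod[OF orthonormal5_base, of "B y" "B y"]
    prods[OF y] cross[OF y]
  by (simp_all add: sum_5 pA_def pE_def qB_def qE_def power2_eq_square)

text \<open>The frame and the normal form an orthonormal basis of a space of index 2, so two of the frame vectors
  are time-like.\<close>

lemma sign_product: "\<epsilon> 1 * \<epsilon> 2 * \<epsilon> 3 * \<epsilon> 4 = 1" "\<epsilon> 1 + \<epsilon> 2 + \<epsilon> 3 + \<epsilon> 4 = 0"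
  using orthonormal5_signs[OF orthonormal5_five[of y0]] y0U US by auto

text \<open>The common part of the six cases.  Since \<open>f1\<close> and \<open>f2\<close> depend only on the arc length, it remains to
  find parameters \<open>t, u, v\<close> on the two quadrics.  A family evaluates its profile functions at \<open>s\<close>
  only; this is expressed by replacing them by constant functions with the same value.\<close>

lemma classify:
  fixes fam :: "(real \<Rightarrow> real) \<Rightarrow> (real \<Rightarrow> real) \<Rightarrow> real \<Rightarrow> real \<Rightarrow> real \<Rightarrow> real \<Rightarrow> real^5"
  assumes W: "open W" "y0 \<in> W" "W \<subseteq> U" and F: "orthonormal5 F sign5"
    and tuv: "smooth_on W t" "smooth_on W u" "smooth_on W v"
    and fam: "\<And>\<phi>1 \<phi>2 s t u v. fam \<phi>1 \<phi>2 s t u v = fam (\<lambda>_. \<phi>1 s) (\<lambda>_. \<phi>2 s) 0 t u v"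
    and smfam: "smooth_on UNIV (\<lambda>z::real^5. fam (\<lambda>_. z $ 1) (\<lambda>_. z $ 2) 0 (z $ 3) (z $ 4) (z $ 5))"
    and Pr: "\<And>y. y \<in> W \<Longrightarrow> Pr (D 1 f1 y) (D 1 f2 y)"
    and eq: "\<And>y. y \<in> W \<Longrightarrow> coords F (f1 y *\<^sub>R A y + f2 y *\<^sub>R B y) = fam (\<lambda>_. f1 y) (\<lambda>_. f2 y) 0 (t y) (u y) (v y)"
  shows "\<exists>I \<phi>1 \<phi>2. open I \<and> is_interval I \<and> smooth_on I \<phi>1 \<and> smooth_on I \<phi>2 \<and>
     (\<forall>s\<in>I. Pr (deriv \<phi>1 s) (deriv \<phi>2 s)) \<and> locally_parametrized S X y0 I (fam \<phi>1 \<phi>2)"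
proof -
  have WS: "W \<subseteq> S" using W US by blast
  have leafW: "D i f1 y = 0 \<and> D i f2 y = 0" if "y \<in> W" "i \<noteq> 1" for y i using leaf_f that W by blast
  obtain I \<phi>1 \<phi>2 Z and s :: "real^4 \<Rightarrow> real" where I: "open I" "is_interval I" and Z: "open Z" "y0 \<in> Z" "Z \<subseteq> W"
    and s: "smooth_on Z s" and \<phi>: "smooth_on I \<phi>1" "smooth_on I \<phi>2"
    and sI: "\<And>y. y \<in> Z \<Longrightarrow> s y \<in> I \<and> f1 y = \<phi>1 (s y) \<and> f2 y = \<phi>2 (s y)"
    and onto: "\<And>\<sigma>. \<sigma> \<in> I \<Longrightarrow> \<exists>y\<in>Z. deriv \<phi>1 \<sigma> = D 1 f1 y \<and> deriv \<phi>2 \<sigma> = D 1 f2 y"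
    using profile_curves[OF W(1,2) WS smooth_on_subset[OF smooth_split(3) W(3)] smooth_on_subset[OF smooth_split(4) W(3)] leafW]
    by metis
  define \<kappa> where "\<kappa> y = (vector [s y, t y, u y, v y] :: real^4)" for y
  have \<kappa>: "\<kappa> y $ 1 = s y" "\<kappa> y $ 2 = t y" "\<kappa> y $ 3 = u y" "\<kappa> y $ 4 = v y" for y
    by (simp_all add: \<kappa>_def vector_def)
  have sm\<kappa>: "smooth_on Z \<kappa>"
    unfolding \<kappa>_def[abs_def]
    by (rule smooth_on_vec4[OF Z(1) s smooth_on_subset[OF tuv(1) Z(3)] smooth_on_subset[OF tuv(2) Z(3)] smooth_on_subset[OF tuv(3) Z(3)]])
  let ?Q = "{z::real^4. z $ 1 \<in> I}"
  have oQ: "open ?Q"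
    using continuous_open_preimage[OF continuous_on_subset[OF smooth_on_continuous_on[OF smooth_on_UNIV_component[of 1]]] open_UNIV I(1)]
    by (simp add: vimage_def)
  have smQ: "smooth_on ?Q (\<lambda>z. fam \<phi>1 \<phi>2 (z $ 1) (z $ 2) (z $ 3) (z $ 4))"
  proof -
    have c: "smooth_on ?Q (\<lambda>z. z $ i)" for i by (rule smooth_on_subset[OF smooth_on_UNIV_component]) simp
    have "smooth_on ?Q (\<lambda>z. vector [\<phi>1 (z $ 1), \<phi>2 (z $ 1), z $ 2, z $ 3, z $ 4] :: real^5)"
      by (rule smooth_on_vec5[OF oQ smooth_on_compose[OF oQ I(1) \<phi>(1) c] smooth_on_compose[OF oQ I(1) \<phi>(2) c] c c c]) simp_all
    from smooth_on_compose[OF oQ open_UNIV smfam this]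
    show ?thesis by (subst fam) (simp add: vector_5)
  qed
  have "locally_parametrized S X y0 I (fam \<phi>1 \<phi>2)"
  proof (rule locally_parametrizedI[where f=F and c=c, OF Z(1,2) _ sm\<kappa> F _ inj_dX oQ _ smQ])
    show ZS: "Z \<subseteq> S" using Z WS by blast
    then show "smooth_on Z X" by (rule smooth_on_subset[OF smooth_X])
    show "y0 \<in> S" using ZS Z by blast
    show "\<kappa> y \<in> ?Q" if "y \<in> Z" for y using sI[OF that] by (simp add: \<kappa>)
    show "\<kappa> y $ 1 \<in> I \<and> coords F (X y - c) = fam \<phi>1 \<phi>2 (\<kappa> y $ 1) (\<kappa> y $ 2) (\<kappa> y $ 3) (\<kappa> y $ 4)" if "y \<in> Z" for y
    proof -
      have "y \<in> W" "y \<in> U" using that Z W by auto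
      then have "coords F (X y - c) = fam (\<lambda>_. f1 y) (\<lambda>_. f2 y) 0 (t y) (u y) (v y)"
        using position[of y] eq[of y] by simp
      then show ?thesis unfolding \<kappa> by (subst fam) (use sI[OF that] in simp)
    qed
  qed
  moreover have "Pr (deriv \<phi>1 \<sigma>) (deriv \<phi>2 \<sigma>)" if "\<sigma> \<in> I" for \<sigma>
    using onto[OF that] Pr Z(3) by force
  ultimately show ?thesis using I \<phi> by blast
qed

lemma open_positive:
  assumes "smooth_on U (g :: real^4 \<Rightarrow> real)"
  shows "open {y \<in> U. g y > 0}"
proof -
  have "{y \<in> U. g y > 0} = U \<inter> g -` {0<..}" by auto
  then show ?thesis using continuous_open_preimage[OF smooth_on_continuous_on[OF assms] open_U, of "{0<..}"] by simp
qed

lemma family_smooth: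
  fixes fam :: "(real \<Rightarrow> real) \<Rightarrow> (real \<Rightarrow> real) \<Rightarrow> real \<Rightarrow> real \<Rightarrow> real \<Rightarrow> real \<Rightarrow> real^5"
  assumes "fam \<in> {family_i, family_ii, family_iii, family_iv, family_v, family_vi}"
  shows "fam \<phi>1 \<phi>2 s t u v = fam (\<lambda>_. \<phi>1 s) (\<lambda>_. \<phi>2 s) 0 t u v"
    and "smooth_on UNIV (\<lambda>z::real^5. fam (\<lambda>_. z $ 1) (\<lambda>_. z $ 2) 0 (z $ 3) (z $ 4) (z $ 5))"
  using assms
  by (auto simp: family_i_def family_ii_def family_iii_def family_iv_def family_v_def family_vi_def
      intro!: smooth_intros smooth_on_UNIV_component)

lemma coords_nth: "coords F (\<alpha> *\<^sub>R A y + \<beta> *\<^sub>R B y) $ i = sign5 i * (\<alpha> * sprod (A y) (F i) + \<beta> * sprod (B y) (F i))"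
  by (simp add: coords_def)

lemma cross' [simp]: "y \<in> U \<Longrightarrow> sprod (A y) (B y0) = 0" "y \<in> U \<Longrightarrow> sprod (A y) (E 4 y0) = 0"
    "y \<in> U \<Longrightarrow> sprod (B y) (A y0) = 0" "y \<in> U \<Longrightarrow> sprod (B y) (E 2 y0) = 0" "y \<in> U \<Longrightarrow> sprod (B y) (E 3 y0) = 0"
  using cross by auto

lemma pE_4 [simp]: "y \<in> U \<Longrightarrow> pE 4 y = 0"
  by (simp add: pE_def)

lemma speed: "y \<in> U \<Longrightarrow> (D 1 f1 y)\<^sup>2 + \<eta> * \<theta> * (D 1 f2 y)\<^sup>2 = \<theta>"
proof -
  assume "y \<in> U"
  from unit_speed[OF this] have "\<eta> * (\<eta> * (D 1 f1 y)\<^sup>2 + \<theta> * (D 1 f2 y)\<^sup>2) = \<eta> * (\<eta> * \<theta>)" using signs(3) by simp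
  then show ?thesis by (simp add: algebra_simps flip: mult.assoc)
qed

lemma open_conditions:
  "open {y \<in> U. \<theta> * qB y > 0 \<and> \<eta> * pA y > 0}" "y0 \<in> {y \<in> U. \<theta> * qB y > 0 \<and> \<eta> * pA y > 0}"
proof -
  have "open ({y \<in> U. \<theta> * qB y > 0} \<inter> {y \<in> U. \<eta> * pA y > 0})"
    by (intro open_Int open_positive smooth_intros)
  moreover have "{y \<in> U. \<theta> * qB y > 0} \<inter> {y \<in> U. \<eta> * pA y > 0} = {y \<in> U. \<theta> * qB y > 0 \<and> \<eta> * pA y > 0}" by auto
  ultimately show "open {y \<in> U. \<theta> * qB y > 0 \<and> \<eta> * pA y > 0}" by simp
  show "y0 \<in> {y \<in> U. \<theta> * qB y > 0 \<and> \<eta> * pA y > 0}" using y0U by simp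
qed

text \<open>The parameter on the curve traced by \<open>B\<close>, which is a hyperbola or a circle according to the signs of the
  plane spanned by \<open>B\<close> and \<open>E 4\<close>.\<close>

definition v_hyp where "v_hyp y = arsinh (\<epsilon> 4 * qE y)"
definition v_circ where "v_circ y = arctan ((\<epsilon> 4 * qE y) / (\<theta> * qB y))"

lemma v_hyp:
  assumes "\<epsilon> 4 = - \<theta>" "y \<in> U" "\<theta> * qB y > 0"
  shows "cosh (v_hyp y) = \<theta> * qB y" "sinh (v_hyp y) = \<epsilon> 4 * qE y"
proof -
  have "\<theta> * ((qB y)\<^sup>2 - (qE y)\<^sup>2) = \<theta> * 1" using quadrics(2)[OF assms(2)] assms(1) by (simp add: algebra_simps)
  then have "(\<theta> * qB y)\<^sup>2 - (\<epsilon> 4 * qE y)\<^sup>2 = 1" by (simp add: power_mult_distrib)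
  then show "cosh (v_hyp y) = \<theta> * qB y" "sinh (v_hyp y) = \<epsilon> 4 * qE y"
    using hyperbola_param assms(3) by (simp_all add: v_hyp_def)
qed

lemma v_circ:
  assumes "\<epsilon> 4 = \<theta>" "y \<in> U" "\<theta> * qB y > 0"
  shows "cos (v_circ y) = \<theta> * qB y" "sin (v_circ y) = \<epsilon> 4 * qE y"
proof -
  have "\<theta> * ((qB y)\<^sup>2 + (qE y)\<^sup>2) = \<theta> * 1" using quadrics(2)[OF assms(2)] assms(1) by (simp add: algebra_simps)
  then have "(\<theta> * qB y)\<^sup>2 + (\<epsilon> 4 * qE y)\<^sup>2 = 1" by (simp add: power_mult_distrib)
  from circle_param[OF this assms(3)]
  show "cos (v_circ y) = \<theta> * qB y" "sin (v_circ y) = \<epsilon> 4 * qE y" by (simp_all add: v_circ_def)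
qed

lemma smooth_v:
  assumes "open W" "W \<subseteq> {y \<in> U. \<theta> * qB y > 0 \<and> \<eta> * pA y > 0}"
  shows "smooth_on W v_hyp" "smooth_on W v_circ"
proof -
  have *: "smooth_on W qE" "smooth_on W qB" using assms(2) smooth_p smooth_on_subset by blast+
  show "smooth_on W v_hyp" unfolding v_hyp_def[abs_def] by (intro smooth_intros assms(1) *)
  show "smooth_on W v_circ" unfolding v_circ_def[abs_def]
    by (intro smooth_intros assms(1) *) (use assms(2) in auto)
qed

text \<open>On the two-sheeted hyperboloid the parametrization is by polar coordinates, which are singular at \<open>t = 0\<close>.
  A hyperbolic rotation by the angle 1 moves the base point to \<open>t = 1\<close>, \<open>u = 0\<close>.\<close>

definition boost where "boost = cosh 1 *\<^sub>R A y0 - sinh 1 *\<^sub>R E 2 y0"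
definition boost' where "boost' = cosh 1 *\<^sub>R E 2 y0 - sinh 1 *\<^sub>R A y0"

lemma two_sheets:
  assumes e: "\<epsilon> 2 = - \<eta>" "\<epsilon> 3 = - \<eta>"
  obtains W t u where "open W" "y0 \<in> W" "W \<subseteq> {y \<in> U. \<theta> * qB y > 0 \<and> \<eta> * pA y > 0}" "smooth_on W t" "smooth_on W u"
    "\<And>y. y \<in> W \<Longrightarrow> cosh (t y) = \<eta> * sprod (A y) boost"
    "\<And>y. y \<in> W \<Longrightarrow> sinh (t y) * cos (u y) = \<epsilon> 2 * sprod (A y) boost'"
    "\<And>y. y \<in> W \<Longrightarrow> sinh (t y) * sin (u y) = \<epsilon> 3 * pE 3 y"
proof -
  define z1 where "z1 y = \<eta> * sprod (A y) boost" for y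
  define z2 where "z2 y = \<epsilon> 2 * sprod (A y) boost'" for y
  define z3 where "z3 y = \<epsilon> 3 * pE 3 y" for y
  have sm: "smooth_on U z1" "smooth_on U z2" "smooth_on U z3"
    unfolding z1_def[abs_def] z2_def[abs_def] z3_def[abs_def] by (intro smooth_intros smooth_split)+
  have quad: "(z1 y)\<^sup>2 - (z2 y)\<^sup>2 - (z3 y)\<^sup>2 = 1" if "y \<in> U" for y
  proof -
    have "(z1 y)\<^sup>2 - (z2 y)\<^sup>2 - (z3 y)\<^sup>2 = (sprod (A y) boost)\<^sup>2 - (sprod (A y) boost')\<^sup>2 - (pE 3 y)\<^sup>2"
      by (simp add: z1_def z2_def z3_def power_mult_distrib)
    also have "\<dots> = ((cosh 1)\<^sup>2 - (sinh 1)\<^sup>2) * ((pA y)\<^sup>2 - (pE 2 y)\<^sup>2) - (pE 3 y)\<^sup>2"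
      by (simp add: boost_def boost'_def pA_def pE_def power2_eq_square algebra_simps)
    also have "\<dots> = (pA y)\<^sup>2 - (pE 2 y)\<^sup>2 - (pE 3 y)\<^sup>2" by (simp add: cosh_square_eq)
    also have "\<dots> = 1"
    proof -
      have "\<eta> * ((pA y)\<^sup>2 - (pE 2 y)\<^sup>2 - (pE 3 y)\<^sup>2) = \<eta> * 1" using quadrics(1)[OF that] e by (simp add: algebra_simps)
      then show ?thesis by (simp only: mult_cancel_left sign_sq simp_thms)
    qed
    finally show ?thesis .
  qed
  define W where "W = {y \<in> U. \<theta> * qB y > 0 \<and> \<eta> * pA y > 0} \<inter> ({y \<in> U. z1 y > 0} \<inter> {y \<in> U. z2 y > 0})"
  have oW: "open W" unfolding W_def by (intro open_Int open_conditions open_positive sm)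
  have z0: "z1 y0 = cosh 1" "z2 y0 = sinh 1" by (simp_all add: z1_def z2_def boost_def boost'_def e)
  have y0W: "y0 \<in> W" using open_conditions(2) y0U z0 by (simp add: W_def)
  have WU: "W \<subseteq> U" and pos: "z1 y > 0" "z2 y > 0" if "y \<in> W" for y using that by (auto simp: W_def)
  note smW = smooth_on_subset[OF _ WU[OF y0W]]
  have "(z2 y)\<^sup>2 + (z3 y)\<^sup>2 > 0" if "y \<in> W" for y using pos[OF that] by (simp add: add_pos_nonneg)
  then have smt: "smooth_on W (\<lambda>y. arsinh (sqrt ((z2 y)\<^sup>2 + (z3 y)\<^sup>2)))"
    by (intro smooth_intros oW smW[OF sm(2)] smW[OF sm(3)])
  have smu: "smooth_on W (\<lambda>y. arctan (z3 y / z2 y))"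
    by (intro smooth_intros oW smW[OF sm(2)] smW[OF sm(3)]) (use pos in fastforce)
  show ?thesis
    by (rule that[OF oW y0W _ smt smu])
       (use WU hyperboloid_param[OF quad pos] in \<open>auto simp: W_def z1_def z2_def z3_def\<close>)
qed

text \<open>Polar coordinates are singular at the poles of the sphere; using \<open>E 2\<close> as the axis puts the base
  point on the equator, at \<open>t = pi / 2\<close> and \<open>u = 0\<close>.\<close>

lemma sphere:
  assumes e: "\<eta> = 1" "\<epsilon> 2 = 1" "\<epsilon> 3 = 1"
  obtains W t u where "open W" "y0 \<in> W" "W \<subseteq> {y \<in> U. \<theta> * qB y > 0 \<and> \<eta> * pA y > 0}" "smooth_on W t" "smooth_on W u"
    "\<And>y. y \<in> W \<Longrightarrow> cos (t y) = pE 2 y" "\<And>y. y \<in> W \<Longrightarrow> sin (t y) * cos (u y) = pA y"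
    "\<And>y. y \<in> W \<Longrightarrow> sin (t y) * sin (u y) = pE 3 y"
proof -
  define W where "W = {y \<in> U. \<theta> * qB y > 0 \<and> \<eta> * pA y > 0}"
  have oW: "open W" and y0W: "y0 \<in> W" unfolding W_def by (rule open_conditions)+
  have WU: "W \<subseteq> U" and pos: "pA y > 0" if "y \<in> W" for y using that e by (auto simp: W_def)
  note smW = smooth_on_subset[OF _ WU[OF y0W]]
  have quad: "(pE 2 y)\<^sup>2 + (pA y)\<^sup>2 + (pE 3 y)\<^sup>2 = 1" if "y \<in> W" for y
    using quadrics(1)[of y] subsetD[OF WU[OF that] that] e by simp
  have p: "(pA y)\<^sup>2 + (pE 3 y)\<^sup>2 > 0" if "y \<in> W" for y using pos[OF that] by (simp add: add_pos_nonneg)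
  have smt: "smooth_on W (\<lambda>y. pi / 2 - arctan (pE 2 y / sqrt ((pA y)\<^sup>2 + (pE 3 y)\<^sup>2)))"
    by (intro smooth_intros oW smW[OF smooth_p(1)] smW[OF smooth_p(2)]) (use p pos in fastforce)+
  have smu: "smooth_on W (\<lambda>y. arctan (pE 3 y / pA y))"
    by (intro smooth_intros oW smW[OF smooth_p(1)] smW[OF smooth_p(2)]) (use pos in fastforce)
  show ?thesis
    by (rule that[OF oW y0W _ smt smu]) (use sphere_param[OF quad pos] in \<open>auto simp: W_def\<close>)
qed

lemma one_sheet:
  assumes mp: "{m, p} = {2, 3}" and e: "\<epsilon> m = - \<eta>" "\<epsilon> p = \<eta>"
  obtains W t u where "open W" "y0 \<in> W" "W \<subseteq> {y \<in> U. \<theta> * qB y > 0 \<and> \<eta> * pA y > 0}" "smooth_on W t" "smooth_on W u"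
    "\<And>y. y \<in> W \<Longrightarrow> sinh (t y) = \<epsilon> m * pE m y" "\<And>y. y \<in> W \<Longrightarrow> cosh (t y) * cos (u y) = \<eta> * pA y"
    "\<And>y. y \<in> W \<Longrightarrow> cosh (t y) * sin (u y) = \<epsilon> p * pE p y"
proof -
  define W where "W = {y \<in> U. \<theta> * qB y > 0 \<and> \<eta> * pA y > 0}"
  have oW: "open W" and y0W: "y0 \<in> W" unfolding W_def by (rule open_conditions)+
  have WU: "W \<subseteq> U" and pos: "\<eta> * pA y > 0" if "y \<in> W" for y using that by (auto simp: W_def)
  note smW = smooth_on_subset[OF _ WU[OF y0W]]
  have quad: "- (\<epsilon> m * pE m y)\<^sup>2 + (\<eta> * pA y)\<^sup>2 + (\<epsilon> p * pE p y)\<^sup>2 = 1" if "y \<in> W" for y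
  proof -
    have "y \<in> U" using WU that by blast
    then have "\<eta> * (pA y)\<^sup>2 + \<epsilon> m * (pE m y)\<^sup>2 + \<epsilon> p * (pE p y)\<^sup>2 = \<eta>"
      using quadrics(1)[of y] two_three[OF mp] by auto
    then have "\<eta> * (- (pE m y)\<^sup>2 + (pA y)\<^sup>2 + (pE p y)\<^sup>2) = \<eta> * 1" using e by (simp add: algebra_simps)
    then have "- (pE m y)\<^sup>2 + (pA y)\<^sup>2 + (pE p y)\<^sup>2 = 1" by (simp only: mult_cancel_left sign_sq simp_thms)
    then show ?thesis by (simp add: power_mult_distrib)
  qed
  have smt: "smooth_on W (\<lambda>y. arsinh (\<epsilon> m * pE m y))"
    by (intro smooth_intros oW smW[OF smooth_p(2)])
  have smu: "smooth_on W (\<lambda>y. arctan ((\<epsilon> p * pE p y) / (\<eta> * pA y)))"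
    by (intro smooth_intros oW smW[OF smooth_p(1)] smW[OF smooth_p(2)]) (use pos in fastforce)
  show ?thesis
    by (rule that[OF oW y0W _ smt smu]) (use one_sheet_param[OF quad pos] in \<open>auto simp: W_def\<close>)
qed

lemma in_U: "W \<subseteq> {y \<in> U. \<theta> * qB y > 0 \<and> \<eta> * pA y > 0} \<Longrightarrow> y \<in> W \<Longrightarrow> y \<in> U \<and> \<theta> * qB y > 0"
  by auto

lemma family_eqI:
  fixes x :: "real^5"
  assumes "x $ 1 = a1" "x $ 2 = a2" "x $ 3 = a3" "x $ 4 = a4" "x $ 5 = a5"
  shows "x = vector [a1, a2, a3, a4, a5]"
  using assms by (simp add: vec_eq_iff forall_5 vector_5)

lemmas products = pA_def[symmetric] pE_def[symmetric] qB_def[symmetric] qE_def[symmetric]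

lemma boost_products [simp]:
  assumes "\<epsilon> 2 = - \<eta>"
  shows "sprod boost boost = \<eta>" "sprod boost' boost' = \<epsilon> 2" "sprod boost boost' = 0" "sprod boost' boost = 0"
  using assms hyperbolic_pythagoras[of "1::real"]
  by (simp_all add: boost_def boost'_def power2_eq_square algebra_simps flip: right_diff_distrib)

lemma boost_orthogonal [simp]:
  "sprod boost (E 3 y0) = 0" "sprod (E 3 y0) boost = 0" "sprod boost' (E 3 y0) = 0" "sprod (E 3 y0) boost' = 0"
  "sprod boost (E 4 y0) = 0" "sprod (E 4 y0) boost = 0" "sprod boost' (E 4 y0) = 0" "sprod (E 4 y0) boost' = 0"
  "sprod boost (B y0) = 0" "sprod (B y0) boost = 0" "sprod boost' (B y0) = 0" "sprod (B y0) boost' = 0"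
  "y \<in> U \<Longrightarrow> sprod (B y) boost = 0" "y \<in> U \<Longrightarrow> sprod (B y) boost' = 0"
  by (simp_all add: boost_def boost'_def)

text \<open>In the following cases the orthonormal basis at \<open>y0\<close> is arranged in the order of the coordinates of the
  family, time-like vectors first.\<close>

lemma case_two_sheets:
  assumes e: "\<epsilon> 2 = - \<eta>" "\<epsilon> 3 = - \<eta>"
  shows "locally_classified S X y0"
proof -
  obtain W t u where W: "open W" "y0 \<in> W" and WU: "W \<subseteq> {y \<in> U. \<theta> * qB y > 0 \<and> \<eta> * pA y > 0}"
    and tu: "smooth_on W t" "smooth_on W u"
    and eqs: "\<And>y. y \<in> W \<Longrightarrow> cosh (t y) = \<eta> * sprod (A y) boost"
    "\<And>y. y \<in> W \<Longrightarrow> sinh (t y) * cos (u y) = \<epsilon> 2 * sprod (A y) boost'"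
    "\<And>y. y \<in> W \<Longrightarrow> sinh (t y) * sin (u y) = \<epsilon> 3 * pE 3 y"
    using two_sheets[OF e] by blast
  note inU = in_U[OF WU]
  have WU': "W \<subseteq> U" using inU by blast
  have pr: "\<epsilon> 1 * \<epsilon> 4 = 1" using sign_product(1) e by (simp add: mult_ac)
  show ?thesis
  proof (cases "\<eta> = 1")
    case True
    then have s: "\<epsilon> 1 = \<epsilon> 4" "\<epsilon> 4 = 1" "\<theta> = 1" using pr sign_product(2) e signs(3) eps_cases[of 1] eps_cases[of 4] by auto
    have on: "orthonormal5 (tuple5 boost' (E 3 y0) boost (B y0) (E 4 y0)) sign5"
      unfolding orthonormal5_def forall_5 using True e s by (simp add: sign5_def)
    have "\<exists>I \<phi>1 \<phi>2. open I \<and> is_interval I \<and> smooth_on I \<phi>1 \<and> smooth_on I \<phi>2 \<and>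
       (\<forall>s\<in>I. (deriv \<phi>1 s)\<^sup>2 + (deriv \<phi>2 s)\<^sup>2 = 1) \<and> locally_parametrized S X y0 I (family_vi \<phi>1 \<phi>2)"
    proof (rule classify[where fam=family_vi and Pr="\<lambda>a b. a\<^sup>2 + b\<^sup>2 = 1", OF W WU' on tu smooth_v(2)[OF W(1) WU]
          family_smooth(1)[of family_vi] family_smooth(2)[of family_vi]])
      fix y assume y: "y \<in> W"
      show "(D 1 f1 y)\<^sup>2 + (D 1 f2 y)\<^sup>2 = 1" using speed[of y] inU[OF y] True s by simp
      have v: "cos (v_circ y) = \<theta> * qB y" "sin (v_circ y) = \<epsilon> 4 * qE y"
        using v_circ[of y] inU[OF y] s by auto
      show "coords (tuple5 boost' (E 3 y0) boost (B y0) (E 4 y0)) (f1 y *\<^sub>R A y + f2 y *\<^sub>R B y) =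
          family_vi (\<lambda>_. f1 y) (\<lambda>_. f2 y) 0 (t y) (u y) (v_circ y)"
        unfolding family_vi_def mult.assoc eqs[OF y] v
        by (rule family_eqI) (use inU[OF y] True e s in \<open>simp_all add: coords_nth sign5_def products\<close>)
    qed simp_all
    then show ?thesis unfolding some_family_def by blast
  next
    case False
    then have n: "\<eta> = -1" using signs(1) by simp
    have "\<epsilon> 1 = -1 \<and> \<epsilon> 4 = -1"
      using sign_product(2) e n eps_cases[of 1] eps_cases[of 4] by (elim disjE) simp_all
    then have s: "\<eta> = -1" "\<epsilon> 1 = \<epsilon> 4" "\<epsilon> 4 = -1" "\<theta> = 1" using n signs(3) by simp_all
    have on: "orthonormal5 (tuple5 (E 4 y0) boost boost' (E 3 y0) (B y0)) sign5"
      unfolding orthonormal5_def forall_5 using e s by (simp add: sign5_def)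
    have "\<exists>I \<phi>1 \<phi>2. open I \<and> is_interval I \<and> smooth_on I \<phi>1 \<and> smooth_on I \<phi>2 \<and>
       (\<forall>s\<in>I. (deriv \<phi>1 s)\<^sup>2 - (deriv \<phi>2 s)\<^sup>2 = 1) \<and> locally_parametrized S X y0 I (family_i \<phi>1 \<phi>2)"
    proof (rule classify[where fam=family_i and Pr="\<lambda>a b. a\<^sup>2 - b\<^sup>2 = 1", OF W WU' on tu smooth_v(1)[OF W(1) WU]
          family_smooth(1)[of family_i] family_smooth(2)[of family_i]])
      fix y assume y: "y \<in> W"
      show "(D 1 f1 y)\<^sup>2 - (D 1 f2 y)\<^sup>2 = 1" using speed[of y] inU[OF y] s by simp
      have v: "cosh (v_hyp y) = \<theta> * qB y" "sinh (v_hyp y) = \<epsilon> 4 * qE y"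
        using v_hyp[of y] inU[OF y] s by auto
      show "coords (tuple5 (E 4 y0) boost boost' (E 3 y0) (B y0)) (f1 y *\<^sub>R A y + f2 y *\<^sub>R B y) =
          family_i (\<lambda>_. f1 y) (\<lambda>_. f2 y) 0 (t y) (u y) (v_hyp y)"
        unfolding family_i_def mult.assoc eqs[OF y] v
        by (rule family_eqI) (use inU[OF y] e s in \<open>simp_all add: coords_nth sign5_def products\<close>)
    qed simp_all
    then show ?thesis unfolding some_family_def by blast
  qed
qed

lemma case_sphere:
  assumes e: "\<eta> = 1" "\<epsilon> 2 = 1" "\<epsilon> 3 = 1"
  shows "locally_classified S X y0"
proof -
  obtain W t u where W: "open W" "y0 \<in> W" and WU: "W \<subseteq> {y \<in> U. \<theta> * qB y > 0 \<and> \<eta> * pA y > 0}"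
    and tu: "smooth_on W t" "smooth_on W u"
    and eqs: "\<And>y. y \<in> W \<Longrightarrow> cos (t y) = pE 2 y" "\<And>y. y \<in> W \<Longrightarrow> sin (t y) * cos (u y) = pA y"
    "\<And>y. y \<in> W \<Longrightarrow> sin (t y) * sin (u y) = pE 3 y"
    using sphere[OF e] by blast
  note inU = in_U[OF WU]
  have WU': "W \<subseteq> U" using inU by blast
  have s: "\<epsilon> 1 = -1" "\<epsilon> 4 = -1" "\<theta> = -1"
  proof -
    have "\<epsilon> 1 = -1 \<and> \<epsilon> 4 = -1"
      using sign_product(2) e eps_cases[of 1] eps_cases[of 4] by (elim disjE) simp_all
    then show "\<epsilon> 1 = -1" "\<epsilon> 4 = -1" "\<theta> = -1" using e signs(3) by simp_all
  qed
  have on: "orthonormal5 (tuple5 (B y0) (E 4 y0) (E 2 y0) (A y0) (E 3 y0)) sign5"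
    unfolding orthonormal5_def forall_5 using e s by (simp add: sign5_def)
  have "\<exists>I \<phi>1 \<phi>2. open I \<and> is_interval I \<and> smooth_on I \<phi>1 \<and> smooth_on I \<phi>2 \<and>
     (\<forall>s\<in>I. (deriv \<phi>1 s)\<^sup>2 - (deriv \<phi>2 s)\<^sup>2 = -1) \<and> locally_parametrized S X y0 I (family_ii \<phi>1 \<phi>2)"
  proof (rule classify[where fam=family_ii and Pr="\<lambda>a b. a\<^sup>2 - b\<^sup>2 = -1", OF W WU' on tu smooth_v(2)[OF W(1) WU]
          family_smooth(1)[of family_ii] family_smooth(2)[of family_ii]])
    fix y assume y: "y \<in> W"
    show "(D 1 f1 y)\<^sup>2 - (D 1 f2 y)\<^sup>2 = -1" using speed[of y] inU[OF y] e s by simp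
    have v: "cos (v_circ y) = \<theta> * qB y" "sin (v_circ y) = \<epsilon> 4 * qE y"
      using v_circ[of y] inU[OF y] s by auto
    show "coords (tuple5 (B y0) (E 4 y0) (E 2 y0) (A y0) (E 3 y0)) (f1 y *\<^sub>R A y + f2 y *\<^sub>R B y) =
        family_ii (\<lambda>_. f1 y) (\<lambda>_. f2 y) 0 (t y) (u y) (v_circ y)"
      unfolding family_ii_def mult.assoc eqs[OF y] v
      by (rule family_eqI) (use inU[OF y] e s in \<open>simp_all add: coords_nth sign5_def products\<close>)
  qed simp_all
  then show ?thesis unfolding some_family_def by blast
qed

lemma case_one_sheet:
  assumes mp: "{m, p} = {2, 3}" and e: "\<epsilon> m = - \<eta>" "\<epsilon> p = \<eta>"
  shows "locally_classified S X y0"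
proof -
  obtain W t u where W: "open W" "y0 \<in> W" and WU: "W \<subseteq> {y \<in> U. \<theta> * qB y > 0 \<and> \<eta> * pA y > 0}"
    and tu: "smooth_on W t" "smooth_on W u"
    and eqs: "\<And>y. y \<in> W \<Longrightarrow> sinh (t y) = \<epsilon> m * pE m y" "\<And>y. y \<in> W \<Longrightarrow> cosh (t y) * cos (u y) = \<eta> * pA y"
    "\<And>y. y \<in> W \<Longrightarrow> cosh (t y) * sin (u y) = \<epsilon> p * pE p y"
    using one_sheet[OF mp e] by blast
  note inU = in_U[OF WU]
  have WU': "W \<subseteq> U" using inU by blast
  have mp': "m \<noteq> p" "m \<noteq> 4" "p \<noteq> 4" "4 \<noteq> m" "4 \<noteq> p" "p \<noteq> m" using two_three[OF mp] by auto
  have mpAB [simp]: "sprod (A y0) (E m y0) = 0" "sprod (E m y0) (A y0) = 0" "sprod (A y0) (E p y0) = 0" "sprod (E p y0) (A y0) = 0"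
    "sprod (B y0) (E m y0) = 0" "sprod (E m y0) (B y0) = 0" "sprod (B y0) (E p y0) = 0" "sprod (E p y0) (B y0) = 0"
    using two_three[OF mp] by auto
  have mpB: "sprod (B y) (E m y0) = 0" "sprod (B y) (E p y0) = 0" if "y \<in> U" for y
    using two_three[OF mp] that by auto
  have "\<epsilon> 1 * \<epsilon> m * \<epsilon> p * \<epsilon> 4 = 1" "\<epsilon> 1 + \<epsilon> m + \<epsilon> p + \<epsilon> 4 = 0"
    using sign_product two_three[OF mp] by (auto simp: algebra_simps)
  then have s14: "\<epsilon> 1 = - \<epsilon> 4" using e by simp
  consider (iii) "\<eta> = -1" | (iv) "\<eta> = 1" "\<theta> = 1" | (v) "\<eta> = 1" "\<theta> = -1" using signs(1,2) by auto
  then show ?thesis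
  proof cases
    case iii
    then have "\<epsilon> 1 \<noteq> 1" using signs(4) by auto
    then have "\<epsilon> 1 = -1" using eps_cases[of 1] by simp
    then have s: "\<theta> = 1" "\<epsilon> 4 = 1" using iii signs(3) s14 by simp_all
    have on: "orthonormal5 (tuple5 (E p y0) (A y0) (E m y0) (B y0) (E 4 y0)) sign5"
      unfolding orthonormal5_def forall_5 using e s iii mp' by (simp add: sign5_def)
    have "\<exists>I \<phi>1 \<phi>2. open I \<and> is_interval I \<and> smooth_on I \<phi>1 \<and> smooth_on I \<phi>2 \<and>
       (\<forall>s\<in>I. (deriv \<phi>1 s)\<^sup>2 - (deriv \<phi>2 s)\<^sup>2 = 1) \<and> locally_parametrized S X y0 I (family_iii \<phi>1 \<phi>2)"
    proof (rule classify[where fam=family_iii and Pr="\<lambda>a b. a\<^sup>2 - b\<^sup>2 = 1", OF W WU' on tu smooth_v(2)[OF W(1) WU]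
          family_smooth(1)[of family_iii] family_smooth(2)[of family_iii]])
      fix y assume y: "y \<in> W"
      show "(D 1 f1 y)\<^sup>2 - (D 1 f2 y)\<^sup>2 = 1" using speed[of y] inU[OF y] iii s by simp
      have v: "cos (v_circ y) = \<theta> * qB y" "sin (v_circ y) = \<epsilon> 4 * qE y"
        using v_circ[of y] inU[OF y] s by auto
      show "coords (tuple5 (E p y0) (A y0) (E m y0) (B y0) (E 4 y0)) (f1 y *\<^sub>R A y + f2 y *\<^sub>R B y) =
          family_iii (\<lambda>_. f1 y) (\<lambda>_. f2 y) 0 (t y) (u y) (v_circ y)"
        unfolding family_iii_def mult.assoc eqs[OF y] v
        by (rule family_eqI) (use inU[OF y] iii e s mpB[of y] in \<open>simp_all add: coords_nth sign5_def products\<close>)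
    qed simp_all
    then show ?thesis unfolding some_family_def by blast
  next
    case iv
    then have s: "\<epsilon> 4 = -1" using signs(3) s14 by simp
    have on: "orthonormal5 (tuple5 (E 4 y0) (E m y0) (A y0) (E p y0) (B y0)) sign5"
      unfolding orthonormal5_def forall_5 using e s iv mp' by (simp add: sign5_def)
    have "\<exists>I \<phi>1 \<phi>2. open I \<and> is_interval I \<and> smooth_on I \<phi>1 \<and> smooth_on I \<phi>2 \<and>
       (\<forall>s\<in>I. (deriv \<phi>1 s)\<^sup>2 + (deriv \<phi>2 s)\<^sup>2 = 1) \<and> locally_parametrized S X y0 I (family_iv \<phi>1 \<phi>2)"
    proof (rule classify[where fam=family_iv and Pr="\<lambda>a b. a\<^sup>2 + b\<^sup>2 = 1", OF W WU' on tu smooth_v(1)[OF W(1) WU]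
          family_smooth(1)[of family_iv] family_smooth(2)[of family_iv]])
      fix y assume y: "y \<in> W"
      show "(D 1 f1 y)\<^sup>2 + (D 1 f2 y)\<^sup>2 = 1" using speed[of y] inU[OF y] iv s by simp
      have v: "cosh (v_hyp y) = \<theta> * qB y" "sinh (v_hyp y) = \<epsilon> 4 * qE y"
        using v_hyp[of y] inU[OF y] iv s by auto
      show "coords (tuple5 (E 4 y0) (E m y0) (A y0) (E p y0) (B y0)) (f1 y *\<^sub>R A y + f2 y *\<^sub>R B y) =
          family_iv (\<lambda>_. f1 y) (\<lambda>_. f2 y) 0 (t y) (u y) (v_hyp y)"
        unfolding family_iv_def mult.assoc eqs[OF y] v
        by (rule family_eqI) (use inU[OF y] iv e s mpB[of y] in \<open>simp_all add: coords_nth sign5_def products\<close>)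
    qed simp_all
    then show ?thesis unfolding some_family_def by blast
  next
    case v
    then have s: "\<epsilon> 4 = 1" using signs(3) s14 by simp
    have on: "orthonormal5 (tuple5 (B y0) (E m y0) (A y0) (E p y0) (E 4 y0)) sign5"
      unfolding orthonormal5_def forall_5 using e s v mp' by (simp add: sign5_def)
    have "\<exists>I \<phi>1 \<phi>2. open I \<and> is_interval I \<and> smooth_on I \<phi>1 \<and> smooth_on I \<phi>2 \<and>
       (\<forall>s\<in>I. (deriv \<phi>1 s)\<^sup>2 - (deriv \<phi>2 s)\<^sup>2 = -1) \<and> locally_parametrized S X y0 I (family_v \<phi>1 \<phi>2)"
    proof (rule classify[where fam=family_v and Pr="\<lambda>a b. a\<^sup>2 - b\<^sup>2 = -1", OF W WU' on tu smooth_v(1)[OF W(1) WU]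
          family_smooth(1)[of family_v] family_smooth(2)[of family_v]])
      fix y assume y: "y \<in> W"
      show "(D 1 f1 y)\<^sup>2 - (D 1 f2 y)\<^sup>2 = -1" using speed[of y] inU[OF y] v s by simp
      have v': "cosh (v_hyp y) = \<theta> * qB y" "sinh (v_hyp y) = \<epsilon> 4 * qE y"
        using v_hyp[of y] inU[OF y] v s by auto
      show "coords (tuple5 (B y0) (E m y0) (A y0) (E p y0) (E 4 y0)) (f1 y *\<^sub>R A y + f2 y *\<^sub>R B y) =
          family_v (\<lambda>_. f1 y) (\<lambda>_. f2 y) 0 (t y) (u y) (v_hyp y)"
        unfolding family_v_def mult.assoc eqs[OF y] v'
        by (rule family_eqI) (use inU[OF y] v e s mpB[of y] in \<open>simp_all add: coords_nth sign5_def products\<close>)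
    qed simp_all
    then show ?thesis unfolding some_family_def by blast
  qed
qed

text \<open>The quadric in the 3-space is determined by the sign of \<open>A\<close> relative to those of \<open>E 2\<close> and \<open>E 3\<close>.  A negative
  definite 3-space is impossible: it would force \<open>\<epsilon> 1 = 1\<close> and hence \<open>\<eta> = 1\<close>.\<close>

lemma split_classified: "locally_classified S X y0"
proof -
  have neg: "\<not> (\<epsilon> 2 = -1 \<and> \<epsilon> 3 = -1 \<and> \<eta> = -1)"
  proof
    assume a: "\<epsilon> 2 = -1 \<and> \<epsilon> 3 = -1 \<and> \<eta> = -1"
    then have "\<epsilon> 1 = 1" using sign_product(2) eps_cases[of 1] eps_cases[of 4] by (elim disjE) simp_all
    then show False using signs(4) a by simp
  qed
  consider "\<epsilon> 2 = - \<eta>" "\<epsilon> 3 = - \<eta>" | "\<eta> = 1" "\<epsilon> 2 = 1" "\<epsilon> 3 = 1"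
    | "\<epsilon> 2 = - \<eta>" "\<epsilon> 3 = \<eta>" | "\<epsilon> 3 = - \<eta>" "\<epsilon> 2 = \<eta>"
    using neg signs(1) eps_cases[of 2] eps_cases[of 3] by fastforce
  then show ?thesis
    using case_two_sheets case_sphere case_one_sheet[of 2 3] case_one_sheet[of 3 2] by cases (auto simp: insert_commute)
qed

end

context adapted_frame begin

lemma classified_nondegenerate:
  assumes "y0 \<in> S" "w y0 \<noteq> 0"
  shows "locally_classified S X y0"
proof (rule orthogonal_decomposition[OF assms], goal_cases)
  case (1 U A B f1 f2 c \<eta> \<theta>)
  interpret split_frame S X N k E V \<epsilon> U y0 A B f1 f2 c \<eta> \<theta>
    by unfold_locales (use 1 in auto)
  show ?case by (rule split_classified)
qed

end

section \<open>The degenerate case: a constant null direction\<close>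

context adapted_frame begin

text \<open>The differential of \<open>w\<close> is \<open>w\<close> times a continuous form, so a zero of \<open>w\<close> propagates, as for a linear differential
  equation: on a ball so small that the form has bound \<open>M\<close> and \<open>M r < 1\<close>, the maximum of \<open>\<bar>w\<bar>\<close> is at
  most \<open>M r\<close> times itself.\<close>

lemma w_vanishes_nearby:
  assumes y0: "y0 \<in> S" and w0: "w y0 = 0"
  obtains r where "r > 0" "ball y0 r \<subseteq> S" "\<And>y. y \<in> ball y0 r \<Longrightarrow> w y = 0"
proof -
  \<comment> \<open>\<open>\<epsilon> 1 * sprod (frechet_derivative X (at y) v) (E 1 y)\<close> is the coefficient of \<open>V 1\<close> in \<open>v\<close>\<close>
  define h where "h v y = - (l2 y + l4 y) * (\<epsilon> 1 * sprod (frechet_derivative X (at y) v) (E 1 y))" for v y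
  have fw: "frechet_derivative w (at y) v = h v y * w y" if y: "y \<in> S" for v y
  proof -
    obtain c where c: "v = (\<Sum>i\<in>UNIV. c i *\<^sub>R V i y)" using V_span[OF y, of v] by blast
    have "frechet_derivative X (at y) v = (\<Sum>i\<in>UNIV. c i *\<^sub>R E i y)"
      unfolding c frechet_expand[OF smooth_on_has_derivative[OF smooth_X y]] by (simp add: V_X[OF y])
    then have "sprod (frechet_derivative X (at y) v) (E 1 y) = c 1 * \<epsilon> 1"
      by (simp add: sprod_sum_left E_E y if_distrib cong: if_cong)
    then have "h v y = - (l2 y + l4 y) * c 1" by (simp add: h_def eps)
    moreover have "frechet_derivative w (at y) v = c 1 * D 1 w y"
      unfolding c frechet_expand[OF smooth_on_has_derivative[OF smooth_C(1) y]] using Di_w[OF y] by (simp add: sum_4)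
    ultimately show ?thesis using D1_w[OF y] by simp
  qed
  have smh: "smooth_on S (h v)" for v
    unfolding h_def[abs_def] by (intro smooth_intros smooth_on_frechet_const)
  obtain r0 where r0: "r0 > 0" "cball y0 r0 \<subseteq> S" using y0 open_S open_contains_cball by blast
  have "\<exists>K. \<forall>y\<in>cball y0 r0. \<bar>h v y\<bar> \<le> K" for v
  proof -
    have "compact (h v ` cball y0 r0)"
      by (intro compact_continuous_image continuous_on_subset[OF smooth_on_continuous_on[OF smh] r0(2)] compact_cball)
    then have "bounded (h v ` cball y0 r0)" by (rule compact_imp_bounded)
    then show ?thesis by (auto simp: bounded_iff)
  qed
  then obtain K where K: "\<And>v y. y \<in> cball y0 r0 \<Longrightarrow> \<bar>h v y\<bar> \<le> K v" by metis
  define M where "M = (\<Sum>b\<in>Basis. \<bar>K b\<bar>)"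
  have M0: "M \<ge> 0" by (simp add: M_def sum_nonneg)
  have bound: "\<bar>frechet_derivative w (at y) v\<bar> \<le> (M * \<bar>w y\<bar>) * norm v" if y: "y \<in> cball y0 r0" for v y
  proof -
    have yS: "y \<in> S" using y r0 by blast
    have "frechet_derivative w (at y) v = (\<Sum>b\<in>Basis. (v \<bullet> b) * (h b y * w y))"
      using has_derivative_basis_expansion[OF smooth_on_has_derivative[OF smooth_C(1) yS], of v] by (simp add: fw[OF yS])
    also have "\<bar>\<dots>\<bar> \<le> (\<Sum>b\<in>Basis. \<bar>(v \<bullet> b) * (h b y * w y)\<bar>)" by (rule sum_abs)
    also have "\<dots> \<le> (\<Sum>b\<in>Basis. norm v * (\<bar>K b\<bar> * \<bar>w y\<bar>))"
    proof (rule sum_mono)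
      fix b :: "real^4" assume b: "b \<in> Basis"
      have "\<bar>h b y\<bar> \<le> \<bar>K b\<bar>" using K[OF y, of b] by linarith
      then show "\<bar>(v \<bullet> b) * (h b y * w y)\<bar> \<le> norm v * (\<bar>K b\<bar> * \<bar>w y\<bar>)"
        unfolding abs_mult using Basis_le_norm[OF b, of v] by (intro mult_mono) auto
    qed
    also have "\<dots> = (M * \<bar>w y\<bar>) * norm v" by (simp add: M_def sum_distrib_left sum_distrib_right mult_ac)
    finally show ?thesis .
  qed
  define r where "r = min r0 (1 / (2 * (M + 1)))"
  have r: "r > 0" "r \<le> r0" "M * r < 1"
  proof -
    show "r > 0" "r \<le> r0" using r0 M0 by (auto simp: r_def)
    have "M * r \<le> M * (1 / (2 * (M + 1)))" using M0 by (intro mult_left_mono) (auto simp: r_def)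
    also have "\<dots> < 1" using M0 by (simp add: field_simps)
    finally show "M * r < 1" .
  qed
  have sub: "cball y0 r \<subseteq> cball y0 r0" using r by (auto simp: subset_eq)
  have "continuous_on (cball y0 r) (\<lambda>y. \<bar>w y\<bar>)"
    using continuous_on_subset[OF smooth_on_continuous_on[OF smooth_C(1)]] sub r0(2) by (intro continuous_on_rabs) blast
  then obtain z where z: "z \<in> cball y0 r" "\<And>y. y \<in> cball y0 r \<Longrightarrow> \<bar>w y\<bar> \<le> \<bar>w z\<bar>"
    using continuous_attains_sup[OF compact_cball, of y0 r "\<lambda>y. \<bar>w y\<bar>"] r(1) by auto
  have "norm (w z - w y0) \<le> (M * \<bar>w z\<bar>) * norm (z - y0)"
  proof (rule differentiable_bound[OF convex_cball[of y0 r]])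
    fix y assume y: "y \<in> cball y0 r"
    show "(w has_derivative frechet_derivative w (at y)) (at y within cball y0 r)"
      using smooth_on_has_derivative[OF smooth_C(1)] y sub r0(2) by (blast intro: has_derivative_at_withinI)
    have "\<bar>frechet_derivative w (at y) v\<bar> \<le> (M * \<bar>w z\<bar>) * norm v" for v
      using bound[of y v] y sub z(2)[OF y] M0 by (meson mult_left_mono mult_right_mono norm_ge_zero order_trans subsetD)
    then show "onorm (frechet_derivative w (at y)) \<le> M * \<bar>w z\<bar>"
      using M0 by (intro onorm_bound) auto
  qed (use z(1) r(1) in auto)
  also have "\<dots> \<le> (M * \<bar>w z\<bar>) * r"
    using z(1) M0 by (intro mult_left_mono) (auto simp: dist_norm norm_minus_commute)
  finally have "\<bar>w z\<bar> \<le> (M * r) * \<bar>w z\<bar>" using w0 by (simp add: mult_ac)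
  then have "(1 - M * r) * \<bar>w z\<bar> \<le> 0" by (simp add: algebra_simps)
  then have "\<bar>w z\<bar> = 0" using r(3) by (simp add: mult_le_0_iff)
  then have "w y = 0" if "y \<in> ball y0 r" for y using z(2)[of y] that by auto
  moreover have "ball y0 r \<subseteq> S" using sub r0(2) ball_subset_cball[of y0 r] by blast
  ultimately show ?thesis using that r(1) by blast
qed

text \<open>If \<open>w = 0\<close>, then \<open>g2 = 0\<close>, that is \<open>l2\<^sup>2 = - \<epsilon> 1 k2\<^sup>2\<close> with \<open>k2 \<noteq> 0\<close>; so \<open>\<epsilon> 1 = - 1\<close> and \<open>l2 = \<plusminus> k2\<close>, where the sign
  \<open>\<tau>\<close> is locally constant.\<close>

lemma null_coefficients:
  assumes y0: "y0 \<in> S" and w0: "w y0 = 0"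
  obtains r \<tau> where "r > 0" "ball y0 r \<subseteq> S" "\<tau> * \<tau> = 1" "\<epsilon> 1 = -1"
    "\<And>y. y \<in> ball y0 r \<Longrightarrow> l2 y = \<tau> * k 2 y \<and> l4 y = \<tau> * k 4 y"
proof -
  obtain r0 where r0: "r0 > 0" "ball y0 r0 \<subseteq> S" "\<And>y. y \<in> ball y0 r0 \<Longrightarrow> w y = 0"
    using w_vanishes_nearby[OF assms] by blast
  have eq: "\<epsilon> 1 * (k 2 y)\<^sup>2 + (l2 y)\<^sup>2 = 0" if "y \<in> ball y0 r0" for y
    using w_relations(1)[of y] r0(3)[OF that] k_nz[of y 4] that r0(2) by (auto simp: g2_def)
  have "\<epsilon> 1 = 1 \<or> \<epsilon> 1 = -1" using eps_sq[of 1] by (simp add: power2_eq_1_iff)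
  moreover have "\<epsilon> 1 \<noteq> 1"
    using eq[of y0] r0(1) k_nz[OF y0, of 2] by (auto simp: sum_power2_eq_zero_iff)
  ultimately have e: "\<epsilon> 1 = -1" by simp
  have sq: "l2 y = k 2 y \<or> l2 y = - k 2 y" if "y \<in> ball y0 r0" for y
    using eq[OF that] unfolding e by (simp add: power2_eq_iff)
  define \<tau> where "\<tau> = l2 y0 / k 2 y0"
  have \<tau>: "\<tau> * \<tau> = 1" "\<tau> * l2 y0 * k 2 y0 > 0"
    using sq[of y0] r0(1) k_nz[OF y0, of 2] by (auto simp: \<tau>_def zero_less_mult_iff)
  define U where "U = ball y0 r0 \<inter> (\<lambda>y. \<tau> * l2 y * k 2 y) -` {0<..}"
  have sm: "smooth_on S (\<lambda>y. \<tau> * l2 y * k 2 y)" by (intro smooth_intros)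
  have "open U"
    unfolding U_def using continuous_on_subset[OF smooth_on_continuous_on[OF sm] r0(2)]
    by (intro continuous_open_preimage) auto
  moreover have "y0 \<in> U" using \<tau>(2) r0(1) by (simp add: U_def)
  ultimately obtain r where r: "r > 0" "ball y0 r \<subseteq> U" by (meson open_contains_ball)
  have l: "l2 y = \<tau> * k 2 y \<and> l4 y = \<tau> * k 4 y" if "y \<in> ball y0 r" for y
  proof -
    have y: "y \<in> ball y0 r0" "\<tau> * l2 y * k 2 y > 0" using that r(2) by (auto simp: U_def)
    have "\<tau> = 1 \<or> \<tau> = -1" using \<tau>(1) by (simp add: square_eq_1_iff)
    then have l2: "l2 y = \<tau> * k 2 y" using sq[OF y(1)] y(2) by (auto simp: mult_less_0_iff zero_less_mult_iff)
    have "k 2 y * (\<tau> * k 4 y - l4 y) = 0" using r0(3)[OF y(1)] unfolding w_def l2 by (simp add: algebra_simps)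
    then show ?thesis using k_nz[of y 2] y(1) r0(2) l2 by auto
  qed
  have "ball y0 r \<subseteq> S" using r(2) r0(2) by (auto simp: U_def)
  then show ?thesis using that[OF r(1) _ \<tau>(1) e l] by blast
qed

end

locale null_frame = adapted_frame +
  fixes y0 :: "real^4" and r \<tau> :: real
  assumes r: "r > 0" and ball_S: "ball y0 r \<subseteq> S" and \<tau>: "\<tau> * \<tau> = 1" and e1: "\<epsilon> 1 = -1"
    and null: "\<And>y. y \<in> ball y0 r \<Longrightarrow> l2 y = \<tau> * k 2 y \<and> l4 y = \<tau> * k 4 y"
begin

abbreviation U where "U \<equiv> ball y0 r"

lemma open_ball_U [smooth_intros]: "open U" by simp

lemma y0_U: "y0 \<in> U" using r by simp

lemma U_S: "y \<in> U \<Longrightarrow> y \<in> S" using ball_S by blast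

lemma l_nz: "y \<in> U \<Longrightarrow> l2 y \<noteq> 0" "y \<in> U \<Longrightarrow> l4 y \<noteq> 0" "y \<in> U \<Longrightarrow> l4 y - l2 y \<noteq> 0"
  using null[of y] k_nz[OF U_S, of y] k42[OF U_S, of y] \<tau> by auto

lemma k_eq: 
  assumes "y \<in> U"
  shows "k 2 y = \<tau> * l2 y" "k 4 y = \<tau> * l4 y"
  using null[OF assms] \<tau> by (simp_all flip: mult.assoc)

lemma smooth_restrict: "smooth_on S g \<Longrightarrow> smooth_on U g"
  by (rule smooth_on_subset[OF _ ball_S])

lemmas sm_l = smooth_restrict[OF smooth_coefficients(1)] smooth_restrict[OF smooth_coefficients(2)]

text \<open>The direction of \<open>C\<close> is constant, and \<open>d\<close> is its size relative to a constant null vector: \<open>C = d n\<close> (lemma \<open>C_n\<close>).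
  The function \<open>\<sigma>\<close> is chosen such that \<open>\<sigma> d\<close> and \<open>(\<sigma> - 1) d\<close> are the reciprocals of \<open>l2\<close> and \<open>l4\<close>;
  it becomes the parameter \<open>s\<close>.\<close>

definition d where "d y = 1 / l2 y - 1 / l4 y"
definition \<sigma> where "\<sigma> y = l4 y / (l4 y - l2 y)"
definition C where "C y = E 1 y + \<tau> *\<^sub>R N y"

lemma d_nz: "y \<in> U \<Longrightarrow> d y \<noteq> 0"
  using l_nz[of y] by (simp add: d_def)

lemma smooth_d: "smooth_on U d" "smooth_on U \<sigma>"
  unfolding d_def[abs_def] \<sigma>_def[abs_def] using l_nz by (intro smooth_intros sm_l; blast)+

lemma D_d:
  assumes y: "y \<in> U"
  shows "D 1 d y = - \<tau> * k 1 y * d y" "D 1 \<sigma> y = 1 / d y" "i \<noteq> 1 \<Longrightarrow> D i d y = 0" "i \<noteq> 1 \<Longrightarrow> D i \<sigma> y = 0"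
proof -
  note h = smooth_on_has_derivative[OF sm_l(1) y] smooth_on_has_derivative[OF sm_l(2) y]
  note nz = l_nz[OF y]
  have "(d has_derivative (\<lambda>v. - frechet_derivative l2 (at y) v / (l2 y)\<^sup>2 + frechet_derivative l4 (at y) v / (l4 y)\<^sup>2)) (at y)"
    unfolding d_def[abs_def]
    by (rule derivative_eq_intros h refl nz)+ (simp add: power2_eq_square divide_inverse mult_ac)
  from along_eqI[OF this] have Dd: "D i d y = - D i l2 y / (l2 y)\<^sup>2 + D i l4 y / (l4 y)\<^sup>2" for i
    by (simp add: along_def)
  have "(\<sigma> has_derivative (\<lambda>v. (frechet_derivative l4 (at y) v * (l4 y - l2 y)
      - l4 y * (frechet_derivative l4 (at y) v - frechet_derivative l2 (at y) v)) / ((l4 y - l2 y) * (l4 y - l2 y)))) (at y)"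
    unfolding \<sigma>_def[abs_def]
    by (rule has_derivative_divide'[OF h(2) has_derivative_diff[OF h(2) h(1)] nz(3)])
  from along_eqI[OF this] have D\<sigma>: "D i \<sigma> y = (D i l4 y * (l4 y - l2 y) - l4 y * (D i l4 y - D i l2 y)) / ((l4 y - l2 y) * (l4 y - l2 y))" for i
    by (simp add: along_def)
  have l': "D 1 l2 y = - (l2 y)\<^sup>2 + \<tau> * k 1 y * l2 y" "D 1 l4 y = - (l4 y)\<^sup>2 + \<tau> * k 1 y * l4 y"
    using D1_l2[OF U_S[OF y]] D1_l4[OF U_S[OF y]] k_eq[OF y] e1 by simp_all
  show "D 1 d y = - \<tau> * k 1 y * d y"
    unfolding Dd l' d_def using nz by (simp add: field_simps power2_eq_square)
  have "D 1 \<sigma> y = l2 y * l4 y * (l4 y - l2 y) / ((l4 y - l2 y) * (l4 y - l2 y))"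
    unfolding D\<sigma> l' by (simp add: algebra_simps power2_eq_square)
  also have "\<dots> = l2 y * l4 y / (l4 y - l2 y)" using nz(3) by simp
  also have "\<dots> = 1 / d y"
  proof -
    have "d y = (l4 y - l2 y) / (l2 y * l4 y)" using nz by (simp add: d_def field_simps)
    then show ?thesis by simp
  qed
  finally show "D 1 \<sigma> y = 1 / d y" .
  show "D i d y = 0" "D i \<sigma> y = 0" if "i \<noteq> 1"
    unfolding Dd D\<sigma> using leafwise(3,4)[OF U_S[OF y] that] by simp_all
qed

lemma \<sigma>_d: "y \<in> U \<Longrightarrow> \<sigma> y * (d y * l2 y) = 1" "y \<in> U \<Longrightarrow> (\<sigma> y - 1) * (d y * l4 y) = 1"
  using l_nz[of y] by (simp_all add: d_def \<sigma>_def field_simps)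

lemma D_C:
  assumes y: "y \<in> U"
  shows "D 1 C y = - (\<tau> * k 1 y) *\<^sub>R C y" "i \<noteq> 1 \<Longrightarrow> D i C y = 0"
proof -
  have "D i C y = D i (E 1) y + \<tau> *\<^sub>R D i N y" for i
    unfolding C_def[abs_def]
    using along_add[OF smooth_E[of 1] _ U_S[OF y], of "\<lambda>y. \<tau> *\<^sub>R N y" "V i"] along_cscaleR[OF smooth_N U_S[OF y], of "V i" \<tau>]
    by (simp add: smooth_intros)
  then have DC: "D i C y = D i (E 1) y - (\<tau> * k i y) *\<^sub>R E i y" for i using V_N[OF U_S[OF y], of i] by simp
  show "D 1 C y = - (\<tau> * k 1 y) *\<^sub>R C y"
    unfolding DC D1_E[OF U_S[OF y]] C_def e1 using \<tau> by (simp add: algebra_simps)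
  show "D i C y = 0" if "i \<noteq> 1"
    using exhaust_4[of i] that DC[of i] D4_E(1)[OF U_S[OF y]] Da_E(1)[OF U_S[OF y], of i] null[OF y] k3[OF U_S[OF y]] by auto
qed

text \<open>Two null vectors with product 1, orthogonal to \<open>E 2, E 3, E 4\<close> at the base point.\<close>

definition n where "n = (1 / d y0) *\<^sub>R C y0"
definition m where "m = (d y0 / 2) *\<^sub>R (\<tau> *\<^sub>R N y0 - E 1 y0)"

lemma C_n: "y \<in> U \<Longrightarrow> C y = d y *\<^sub>R n"
proof -
  assume y: "y \<in> U"
  have smC: "smooth_on U C" unfolding C_def[abs_def] by (intro smooth_intros smooth_restrict smooth_E smooth_N)
  have smi: "smooth_on U (\<lambda>y. 1 / d y)" using d_nz by (intro smooth_intros smooth_d) blast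
  have "D i (\<lambda>y. (1 / d y) *\<^sub>R C y) z = 0" if z: "z \<in> U" for i z
  proof -
    have "D i (\<lambda>y. 1 / d y) z = - D i d z / (d z * d z)"
      using along_divide[OF smooth_on_const[OF open_ball_U, of 1] smooth_d(1) z d_nz[OF z], of "V i"] by simp
    then have "D i (\<lambda>y. (1 / d y) *\<^sub>R C y) z = (- D i d z / (d z * d z)) *\<^sub>R C z + (1 / d z) *\<^sub>R D i C z"
      using along_scaleR[OF smi smC z] by simp
    then show ?thesis using D_d(1,3)[OF z] D_C[OF z] d_nz[OF z] by (cases "i = 1") simp_all
  qed
  then have "(1 / d y) *\<^sub>R C y = (1 / d y0) *\<^sub>R C y0"
    using constant_on_ball[of U "\<lambda>y. (1 / d y) *\<^sub>R C y" y0 r y] smi smC y ball_S by (simp add: smooth_intros)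
  then have "d y *\<^sub>R ((1 / d y) *\<^sub>R C y) = d y *\<^sub>R n" by (simp only: n_def)
  then show ?thesis using d_nz[OF y] by simp
qed

lemma base0 [simp]:
  "sprod (E i y0) (E j y0) = (if i = j then \<epsilon> i else 0)" "sprod (N y0) (N y0) = 1"
  "sprod (N y0) (E i y0) = 0" "sprod (E i y0) (N y0) = 0"
  using E_E N_N N_E E_N U_S[OF y0_U] by auto

lemma nm [simp]: "sprod n n = 0" "sprod m m = 0" "sprod n m = 1" "sprod m n = 1"
  "i \<noteq> 1 \<Longrightarrow> sprod n (E i y0) = 0" "i \<noteq> 1 \<Longrightarrow> sprod m (E i y0) = 0"
  "i \<noteq> 1 \<Longrightarrow> sprod (E i y0) n = 0" "i \<noteq> 1 \<Longrightarrow> sprod (E i y0) m = 0"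
  using d_nz[OF y0_U] \<tau> by (auto simp: n_def m_def C_def e1 algebra_simps)

lemma null_expansion:
  "sprod u v = sprod u n * sprod v m + sprod u m * sprod v n
     + \<epsilon> 2 * sprod u (E 2 y0) * sprod v (E 2 y0) + \<epsilon> 3 * sprod u (E 3 y0) * sprod v (E 3 y0)
     + \<epsilon> 4 * sprod u (E 4 y0) * sprod v (E 4 y0)"
proof -
  have nz: "d y0 \<noteq> 0" by (rule d_nz[OF y0_U])
  have "sprod u n * sprod v m + sprod u m * sprod v n =
     - (sprod u (E 1 y0) * sprod v (E 1 y0)) + \<tau> * \<tau> * (sprod u (N y0) * sprod v (N y0))"
    using nz by (simp add: n_def m_def C_def field_simps)
  then show ?thesis
    using orthonormal5_sprod[OF orthonormal5_five[OF U_S[OF y0_U]], of u v] \<tau>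
    by (simp add: sum_5 e1)
qed

lemma sprod_C:
  assumes y: "y \<in> U"
  shows "sprod (E 1 y) n = - 1 / d y" "i \<noteq> 1 \<Longrightarrow> sprod (E i y) n = 0"
    "i \<noteq> 1 \<Longrightarrow> \<tau> * sprod (N y) (E i y0) = - sprod (E 1 y) (E i y0)"
proof -
  have n: "n = (1 / d y) *\<^sub>R C y" using C_n[OF y] d_nz[OF y] by simp
  show "sprod (E 1 y) n = - 1 / d y" "i \<noteq> 1 \<Longrightarrow> sprod (E i y) n = 0"
    unfolding n C_def using E_E[OF U_S[OF y]] E_N[OF U_S[OF y]] e1 by simp_all
  assume "i \<noteq> 1"
  then have "sprod (C y) (E i y0) = 0" using C_n[OF y] by simp
  then show "\<tau> * sprod (N y) (E i y0) = - sprod (E 1 y) (E i y0)" by (simp add: C_def)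
qed

text \<open>The functions \<open>T 2, T 3, T 4\<close> become the parameters \<open>t, u, v\<close>.  The factor \<open>d\<close> makes them constant along
  \<open>E 1\<close> (lemma \<open>D_T\<close>).\<close>

definition T where "T i y = \<epsilon> i * (d y * sprod (E 1 y) (E i y0))"

lemma smooth_T [smooth_intros]: "smooth_on U (T i)"
  unfolding T_def[abs_def] by (intro smooth_intros smooth_d smooth_restrict smooth_E)

lemma D_sprod_const: "smooth_on U g \<Longrightarrow> y \<in> U \<Longrightarrow> D i (\<lambda>y. sprod (g y) c) y = sprod (D i g y) c"
  using along_sprod[of U g "\<lambda>_. c" y "V i"] by (simp add: smooth_intros)

text \<open>The vector \<open>E 4\<close> is constant up to multiples of \<open>n\<close>, since its only non-zero derivative is a multiple of \<open>C\<close>.\<close>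

lemma E4_products:
  assumes y: "y \<in> U"
  shows "i \<noteq> 1 \<Longrightarrow> sprod (E 4 y) (E i y0) = (if i = 4 then \<epsilon> 4 else 0)"
proof -
  assume i: "i \<noteq> 1"
  have "D j (\<lambda>y. sprod (E 4 y) (E i y0)) z = 0" if z: "z \<in> U" for j z
  proof -
    have "D 4 (E 4) z = (\<epsilon> 4 * l4 z) *\<^sub>R C z"
      unfolding D4_E(2)[OF U_S[OF z]] C_def k_eq(2)[OF z] e1 by (simp add: algebra_simps)
    then have "sprod (D 4 (E 4) z) (E i y0) = 0" using C_n[OF z] i by simp
    moreover have "D 1 (E 4) z = 0" "D 2 (E 4) z = 0" "D 3 (E 4) z = 0"
      using D1_E(2)[OF U_S[OF z]] Da_E4[OF U_S[OF z]] by auto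
    ultimately have "sprod (D j (E 4) z) (E i y0) = 0" using exhaust_4[of j] by auto
    then show ?thesis using D_sprod_const[OF smooth_restrict[OF smooth_E] z] by simp
  qed
  then have "sprod (E 4 y) (E i y0) = sprod (E 4 y0) (E i y0)"
    using constant_on_ball[of U "\<lambda>y. sprod (E 4 y) (E i y0)" y0 r y] y ball_S
    by (simp add: smooth_intros smooth_restrict smooth_E)
  then show ?thesis by simp
qed

lemma Ea_E4:
  assumes y: "y \<in> U" and a: "a = 2 \<or> a = 3"
  shows "sprod (E a y) (E 4 y0) = 0"
proof -
  have "a \<noteq> 1" "a \<noteq> 4" using a by auto
  then show ?thesis
    using null_expansion[of "E a y" "E 4 y"] sprod_C(2)[OF y, of a] sprod_C(2)[OF y, of 4] E_E[OF U_S[OF y], of a 4] E4_products[OF y]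
    by simp
qed

lemma D_T:
  assumes y: "y \<in> U" and i: "i \<noteq> 1"
  shows "D 1 (T i) y = 0" "a = 2 \<or> a = 3 \<Longrightarrow> D a (T i) y = \<epsilon> i * (d y * l2 y * sprod (E a y) (E i y0))"
    "D 4 (T i) y = (if i = 4 then d y * l4 y else 0)"
proof -
  have smE: "smooth_on U (E 1)" by (rule smooth_restrict[OF smooth_E])
  have "D j (\<lambda>y. d y * sprod (E 1 y) (E i y0)) y = D j d y * sprod (E 1 y) (E i y0) + d y * sprod (D j (E 1) y) (E i y0)" for j
    using along_mult[of U d "\<lambda>y. sprod (E 1 y) (E i y0)" y "V j"] y D_sprod_const[OF smE y]
    by (simp add: smooth_intros smooth_d smE)
  then have DT: "D j (T i) y = \<epsilon> i * (D j d y * sprod (E 1 y) (E i y0) + d y * sprod (D j (E 1) y) (E i y0))" for j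
    unfolding T_def[abs_def]
    using along_cmult[of U "\<lambda>y. d y * sprod (E 1 y) (E i y0)" y "V j" "\<epsilon> i"] y
    by (simp add: smooth_intros smooth_d smE)
  have "\<tau> * (\<tau> * sprod (N y) (E i y0)) = - \<tau> * sprod (E 1 y) (E i y0)" using sprod_C(3)[OF y i] by simp
  then have N: "sprod (N y) (E i y0) = - \<tau> * sprod (E 1 y) (E i y0)" using \<tau> by (simp flip: mult.assoc)
  show "D 1 (T i) y = 0"
    unfolding DT D_d(1)[OF y] D1_E(1)[OF U_S[OF y]] e1 by (simp add: N)
  show "D a (T i) y = \<epsilon> i * (d y * l2 y * sprod (E a y) (E i y0))" if "a = 2 \<or> a = 3"
    using DT[of a] D_d(3)[OF y, of a] that Da_E(1)[OF U_S[OF y] that] by auto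
  show "D 4 (T i) y = (if i = 4 then d y * l4 y else 0)"
    using DT[of 4] D_d(3)[OF y, of 4] D4_E(1)[OF U_S[OF y]] E4_products[OF y i] by (simp add: eps)
qed

text \<open>Here \<open>\<langle>X y0 - c, n\<rangle> = - \<sigma> y0\<close>, which normalises the first coordinate.\<close>

definition c where "c = X y0 + \<sigma> y0 *\<^sub>R m"

lemma T_y0 [simp]: "i \<noteq> 1 \<Longrightarrow> T i y0 = 0"
  by (simp add: T_def)

lemma smooth_XU: "smooth_on U X" by (rule smooth_restrict[OF smooth_X])

lemma D_X_c: "y \<in> U \<Longrightarrow> D i (\<lambda>y. sprod (X y - c) v) y = sprod (E i y) v"
proof -
  assume y: "y \<in> U"
  have "D i (\<lambda>y. X y - c) y = D i X y"
    using along_add[OF smooth_XU smooth_on_const[OF open_ball_U, of "- c"] y, of "V i"] by simp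
  then show ?thesis
    using D_sprod_const[of "\<lambda>y. X y - c" y i v] y V_X[OF U_S[OF y]] smooth_XU by (simp add: smooth_intros)
qed

lemma equal_on_ball:
  fixes g h :: "real^4 \<Rightarrow> real"
  assumes "smooth_on U g" "smooth_on U h" "\<And>i z. z \<in> U \<Longrightarrow> D i g z = D i h z" "g y0 = h y0" "y \<in> U"
  shows "g y = h y"
proof -
  have "D i (\<lambda>y. g y - h y) z = 0" if "z \<in> U" for i z
    using along_add[of U g "\<lambda>y. - h y" z "V i"] along_minus[of U h z "V i"] assms that by (simp add: smooth_intros)
  then have "g y - h y = g y0 - h y0"
    using constant_on_ball[of U "\<lambda>y. g y - h y" y0 r y] assms ball_S by (simp add: smooth_intros)
  then show ?thesis using assms(4) by simp
qed

lemma smooth_X_c: "smooth_on U (\<lambda>y. sprod (X y - c) v)"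
  using smooth_XU by (intro smooth_intros)

text \<open>Both sides of each equation agree at \<open>y0\<close> and have the same derivatives along the frame, by the choice
  of \<open>\<sigma>\<close>.\<close>

lemma coordinates:
  assumes y: "y \<in> U"
  shows "sprod (X y - c) n = - \<sigma> y"
    "a = 2 \<or> a = 3 \<Longrightarrow> \<epsilon> a * sprod (X y - c) (E a y0) = \<sigma> y * T a y"
    "\<epsilon> 4 * sprod (X y - c) (E 4 y0) = (\<sigma> y - 1) * T 4 y"
proof -
  show "sprod (X y - c) n = - \<sigma> y"
  proof (rule equal_on_ball[OF smooth_X_c _ _ _ y])
    show "D i (\<lambda>y. sprod (X y - c) n) z = D i (\<lambda>y. - \<sigma> y) z" if z: "z \<in> U" for i z
      unfolding D_X_c[OF z] along_minus[OF smooth_d(2) z] using sprod_C(1,2)[OF z] D_d(2,4)[OF z]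
      by (cases "i = 1") simp_all
  qed (auto simp: c_def smooth_intros smooth_d)
  have sm: "smooth_on U (\<lambda>y. \<epsilon> i * sprod (X y - c) v)" for i v
    by (intro smooth_intros smooth_X_c)
  have Dl: "D i (\<lambda>y. \<epsilon> j * sprod (X y - c) v) z = \<epsilon> j * sprod (E i z) v" if "z \<in> U" for i j v z
    using along_cmult[OF smooth_X_c that] D_X_c[OF that] by simp
  have Dr: "D i (\<lambda>y. (\<sigma> y - q) * T j y) z = D i \<sigma> z * T j z + (\<sigma> z - q) * D i (T j) z" if "z \<in> U" for i j q z
  proof -
    have "D i (\<lambda>y. \<sigma> y - q) z = D i \<sigma> z"
      using along_add[OF smooth_d(2) smooth_on_const[OF open_ball_U, of "- q"] that, of "V i"] by simp
    then show ?thesis using along_mult[of U "\<lambda>y. \<sigma> y - q" "T j" z "V i"] that by (simp add: smooth_intros smooth_d)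
  qed
  have smr: "smooth_on U (\<lambda>y. (\<sigma> y - q) * T j y)" for q j by (intro smooth_intros smooth_d)
  show "\<epsilon> a * sprod (X y - c) (E a y0) = \<sigma> y * T a y" if a: "a = 2 \<or> a = 3"
  proof -
    have a1: "a \<noteq> 1" "a \<noteq> 4" using a by auto
    have "\<epsilon> a * sprod (X y - c) (E a y0) = (\<sigma> y - 0) * T a y"
    proof (rule equal_on_ball[OF sm smr _ _ y])
      fix i :: 4 and z assume z: "z \<in> U"
      have s: "\<sigma> z * (d z * l2 z) * x = x" for x using \<sigma>_d(1)[OF z] by simp
      consider "i = 1" | "i = 2 \<or> i = 3" | "i = 4" using exhaust_4[of i] by blast
      then show "D i (\<lambda>y. \<epsilon> a * sprod (X y - c) (E a y0)) z = D i (\<lambda>y. (\<sigma> y - 0) * T a y) z"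
      proof cases
        case 1
        then show ?thesis unfolding Dl[OF z] Dr[OF z] using D_d(2)[OF z] D_T(1)[OF z a1(1)] d_nz[OF z] by (simp add: T_def)
      next
        case 2
        then have "i \<noteq> 1" by auto
        then show ?thesis unfolding Dl[OF z] Dr[OF z] using D_d(4)[OF z, of i] D_T(2)[OF z a1(1) 2] s[of "\<epsilon> a * sprod (E i z) (E a y0)"]
          by (simp add: mult_ac)
      next
        case 3
        then show ?thesis unfolding Dl[OF z] Dr[OF z] using D_d(4)[OF z, of 4] D_T(3)[OF z a1(1)] a1 E4_products[OF z a1(1)] by simp
      qed
    qed (use a1 in \<open>simp add: c_def\<close>)
    then show ?thesis by simp
  qed
  show "\<epsilon> 4 * sprod (X y - c) (E 4 y0) = (\<sigma> y - 1) * T 4 y"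
  proof (rule equal_on_ball[OF sm smr _ _ y])
    fix i :: 4 and z assume z: "z \<in> U"
    consider "i = 1" | "i = 2 \<or> i = 3" | "i = 4" using exhaust_4[of i] by blast
    then show "D i (\<lambda>y. \<epsilon> 4 * sprod (X y - c) (E 4 y0)) z = D i (\<lambda>y. (\<sigma> y - 1) * T 4 y) z"
    proof cases
      case 1
      then show ?thesis unfolding Dl[OF z] Dr[OF z] using D_d(2)[OF z] D_T(1)[OF z, of 4] d_nz[OF z] by (simp add: T_def)
    next
      case 2
      then have "i \<noteq> 1" by auto
      then show ?thesis unfolding Dl[OF z] Dr[OF z] using D_d(4)[OF z, of i] D_T(2)[OF z _ 2, of 4] Ea_E4[OF z 2] by simp
    next
      case 3
      then show ?thesis unfolding Dl[OF z] Dr[OF z] using D_d(4)[OF z, of 4] D_T(3)[OF z, of 4] E4_products[OF z, of 4] \<sigma>_d(2)[OF z]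
        by (simp add: eps)
    qed
  qed (simp add: c_def)
qed

text \<open>The component along \<open>m\<close> of a frame vector is determined by the other components through
  the orthonormality relations.\<close>

lemma sprod_m:
  assumes y: "y \<in> U"
  shows "sprod (E 1 y) m = d y / 2 + (\<epsilon> 2 * (T 2 y)\<^sup>2 + \<epsilon> 3 * (T 3 y)\<^sup>2 + \<epsilon> 4 * (T 4 y)\<^sup>2) / (2 * d y)"
    "a = 2 \<or> a = 3 \<Longrightarrow> sprod (E a y) m = T 2 y * sprod (E a y) (E 2 y0) + T 3 y * sprod (E a y) (E 3 y0)"
    "sprod (E 4 y) m = \<epsilon> 4 * T 4 y"
proof -
  have nz: "d y \<noteq> 0" by (rule d_nz[OF y])
  have T: "\<epsilon> i * sprod (E 1 y) (E i y0) = T i y / d y" for i using nz by (simp add: T_def)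
  have Tsq: "\<epsilon> i * sprod (E 1 y) (E i y0) * sprod (E 1 y) (E i y0) = \<epsilon> i * (T i y)\<^sup>2 / (d y)\<^sup>2" for i
    using nz by (simp add: T_def power2_eq_square)
  have "- 1 = - 2 * sprod (E 1 y) m / d y + (\<epsilon> 2 * (T 2 y)\<^sup>2 + \<epsilon> 3 * (T 3 y)\<^sup>2 + \<epsilon> 4 * (T 4 y)\<^sup>2) / (d y)\<^sup>2"
    using null_expansion[of "E 1 y" "E 1 y"] E_E[OF U_S[OF y], of 1 1] e1 unfolding sprod_C(1)[OF y] Tsq
    by (simp add: add_divide_distrib)
  then have "d y * (2 * (d y * sprod (E 1 y) m)) =
      d y * (d y * d y + (\<epsilon> 2 * (T 2 y)\<^sup>2 + \<epsilon> 3 * (T 3 y)\<^sup>2 + \<epsilon> 4 * (T 4 y)\<^sup>2))"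
    using nz by (simp add: field_simps power2_eq_square)
  then have "2 * (d y * sprod (E 1 y) m) =
      d y * d y + (\<epsilon> 2 * (T 2 y)\<^sup>2 + \<epsilon> 3 * (T 3 y)\<^sup>2 + \<epsilon> 4 * (T 4 y)\<^sup>2)"
    using nz by (simp only: mult_cancel_left simp_thms)
  then show "sprod (E 1 y) m = d y / 2 + (\<epsilon> 2 * (T 2 y)\<^sup>2 + \<epsilon> 3 * (T 3 y)\<^sup>2 + \<epsilon> 4 * (T 4 y)\<^sup>2) / (2 * d y)"
    using nz by (simp add: field_simps)
  have gen: "sprod (E i y) m = T 2 y * sprod (E i y) (E 2 y0) + T 3 y * sprod (E i y) (E 3 y0) + T 4 y * sprod (E i y) (E 4 y0)"
    if "i \<noteq> 1" for i
    using null_expansion[of "E 1 y" "E i y"] E_E[OF U_S[OF y], of 1 i] that nz sprod_C(2)[OF y that]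
    unfolding sprod_C(1)[OF y] T by (simp add: field_simps)
  show "sprod (E a y) m = T 2 y * sprod (E a y) (E 2 y0) + T 3 y * sprod (E a y) (E 3 y0)" if "a = 2 \<or> a = 3"
    using gen[of a] that Ea_E4[OF y that] by auto
  show "sprod (E 4 y) m = \<epsilon> 4 * T 4 y" using gen[of 4] E4_products[OF y] by simp
qed

text \<open>What remains of the coordinate \<open>\<langle>X - c, m\<rangle>\<close> after subtracting its quadratic part is a function of \<open>\<sigma>\<close>.\<close>

definition \<psi> where "\<psi> y = sprod (X y - c) m - \<sigma> y / 2 * (\<epsilon> 2 * (T 2 y)\<^sup>2 + \<epsilon> 3 * (T 3 y)\<^sup>2) - (\<sigma> y - 1) / 2 * (\<epsilon> 4 * (T 4 y)\<^sup>2)"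

lemma smooth_\<psi>: "smooth_on U \<psi>"
  unfolding \<psi>_def[abs_def] by (intro smooth_intros smooth_X_c smooth_d) simp_all

lemma D_\<psi>:
  assumes y: "y \<in> U"
  shows "D 1 \<psi> y = d y / 2" "i \<noteq> 1 \<Longrightarrow> D i \<psi> y = 0"
proof -
  let ?d = "\<lambda>g. frechet_derivative g (at y) :: real^4 \<Rightarrow> real"
  define \<xi> where "\<xi> y = sprod (X y - c) m" for y
  have \<psi>: "\<psi> = (\<lambda>y. \<xi> y - 1 / 2 * (\<sigma> y * (\<epsilon> 2 * (T 2 y)\<^sup>2 + \<epsilon> 3 * (T 3 y)\<^sup>2)) - 1 / 2 * ((\<sigma> y - 1) * (\<epsilon> 4 * (T 4 y)\<^sup>2)))"
    by (simp add: \<psi>_def \<xi>_def fun_eq_iff)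
  have D\<xi>: "D i \<xi> y = sprod (E i y) m" for i
    unfolding \<xi>_def[abs_def] by (rule D_X_c[OF y])
  note h = smooth_on_has_derivative[OF smooth_X_c[of m] y, folded \<xi>_def] smooth_on_has_derivative[OF smooth_d(2) y]
    smooth_on_has_derivative[OF smooth_T[of 2] y] smooth_on_has_derivative[OF smooth_T[of 3] y] smooth_on_has_derivative[OF smooth_T[of 4] y]
  have "(\<psi> has_derivative (\<lambda>v. ?d \<xi> v
     - ?d \<sigma> v / 2 * (\<epsilon> 2 * (T 2 y)\<^sup>2 + \<epsilon> 3 * (T 3 y)\<^sup>2) - \<sigma> y * (\<epsilon> 2 * T 2 y * ?d (T 2) v + \<epsilon> 3 * T 3 y * ?d (T 3) v)
     - ?d \<sigma> v / 2 * (\<epsilon> 4 * (T 4 y)\<^sup>2) - (\<sigma> y - 1) * (\<epsilon> 4 * T 4 y * ?d (T 4) v))) (at y)"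
    unfolding \<psi>
    by (rule derivative_eq_intros h refl)+ (simp add: algebra_simps power2_eq_square)
  from along_eqI[OF this] have D\<psi>: "D i \<psi> y = sprod (E i y) m
     - D i \<sigma> y / 2 * (\<epsilon> 2 * (T 2 y)\<^sup>2 + \<epsilon> 3 * (T 3 y)\<^sup>2) - \<sigma> y * (\<epsilon> 2 * T 2 y * D i (T 2) y + \<epsilon> 3 * T 3 y * D i (T 3) y)
     - D i \<sigma> y / 2 * (\<epsilon> 4 * (T 4 y)\<^sup>2) - (\<sigma> y - 1) * (\<epsilon> 4 * T 4 y * D i (T 4) y)" for i
    unfolding D\<xi>[symmetric] by (simp add: along_def)
  show "D 1 \<psi> y = d y / 2"
    unfolding D\<psi> sprod_m(1)[OF y] D_d(2)[OF y] using D_T(1)[OF y] d_nz[OF y] by (simp add: field_simps)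
  assume i: "i \<noteq> 1"
  then consider "i = 2 \<or> i = 3" | "i = 4" using exhaust_4[of i] by blast
  then show "D i \<psi> y = 0"
  proof cases
    case 1
    have D4: "D i (T 4) y = 0" using D_T(2)[OF y _ 1, of 4] Ea_E4[OF y 1] by simp
    have "\<sigma> y * (\<epsilon> 2 * T 2 y * D i (T 2) y + \<epsilon> 3 * T 3 y * D i (T 3) y) =
       \<sigma> y * (d y * l2 y) * (T 2 y * (\<epsilon> 2 * (\<epsilon> 2 * sprod (E i y) (E 2 y0))) + T 3 y * (\<epsilon> 3 * (\<epsilon> 3 * sprod (E i y) (E 3 y0))))"
      using D_T(2)[OF y _ 1, of 2] D_T(2)[OF y _ 1, of 3] by (simp add: algebra_simps)
    also have "\<dots> = sprod (E i y) m" using \<sigma>_d(1)[OF y] sprod_m(2)[OF y 1] by simp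
    finally show ?thesis unfolding D\<psi> using D_d(4)[OF y i] D4 by simp
  next
    case 2
    have "(\<sigma> y - 1) * (\<epsilon> 4 * T 4 y * (d y * l4 y)) = (\<sigma> y - 1) * (d y * l4 y) * (\<epsilon> 4 * T 4 y)" by (simp add: mult_ac)
    then have "(\<sigma> y - 1) * (\<epsilon> 4 * T 4 y * (d y * l4 y)) = \<epsilon> 4 * T 4 y" using \<sigma>_d(2)[OF y] by simp
    then show ?thesis unfolding D\<psi> using D_d(4)[OF y i] 2 D_T(3)[OF y] sprod_m(3)[OF y] by simp
  qed
qed

text \<open>The derivative of \<open>\<psi>\<close> with respect to \<open>\<sigma>\<close> is \<open>d\<^sup>2 / 2\<close>; its positivity becomes the inequality required of the
  families (vii) and (viii).\<close>

lemma profile_\<psi>: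
  obtains I G W where "open I" "is_interval I" "open W" "y0 \<in> W" "W \<subseteq> U" "smooth_on I G"
    "\<And>y. y \<in> W \<Longrightarrow> \<sigma> y \<in> I \<and> \<psi> y = G (\<sigma> y)" "\<And>s. s \<in> I \<Longrightarrow> deriv G s > 0"
proof -
  have nz: "D 1 \<sigma> y \<noteq> 0" if "y \<in> U" for y using D_d(2)[OF that] d_nz[OF that] by simp
  have dep: "\<exists>c. \<forall>v. frechet_derivative \<psi> (at y) v = frechet_derivative \<sigma> (at y) v *\<^sub>R c" if "y \<in> U" for y
    by (rule leafwise_dependent[OF smooth_\<psi> smooth_d(2) ball_S that nz[OF that]]) (use D_\<psi>(2) D_d(4) that in blast)
  have nz0: "frechet_derivative \<sigma> (at y0) (V 1 y0) \<noteq> 0" using nz[OF y0_U] by (simp add: along_def)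
  obtain I G W where I: "open I" "is_interval I" and W: "open W" "y0 \<in> W" "W \<subseteq> U" and G: "smooth_on I G"
    and sI: "\<And>y. y \<in> W \<Longrightarrow> \<sigma> y \<in> I \<and> \<psi> y = G (\<sigma> y)" and onto: "\<And>s. s \<in> I \<Longrightarrow> \<exists>y\<in>W. \<sigma> y = s"
    by (rule functional_dependence[OF open_ball_U y0_U smooth_d(2) smooth_\<psi> nz0 dep]) (assumption, rule that)
  have "deriv G s > 0" if s: "s \<in> I" for s
  proof -
    obtain y where y: "y \<in> W" "\<sigma> y = s" using onto[OF s] by blast
    then have yU: "y \<in> U" using W(3) by blast
    have "D 1 \<psi> y = D 1 (\<lambda>y. G (\<sigma> y)) y"
      by (rule along_cong[OF W(1) y(1) smooth_on_subset[OF smooth_\<psi> W(3)]]) (use sI in blast)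
    also have "\<dots> = deriv G s * D 1 \<sigma> y"
      by (rule along_real_chain[OF smooth_d(2) yU]) (use smooth_on_DERIV[OF G s] y in simp)
    finally have "deriv G s = (d y)\<^sup>2 / 2"
      unfolding D_\<psi>(1)[OF yU] D_d(2)[OF yU] using d_nz[OF yU] by (simp add: field_simps power2_eq_square)
    moreover have "(d y)\<^sup>2 > 0" using d_nz[OF yU] by simp
    ultimately show ?thesis by linarith
  qed
  then show ?thesis using that[OF I W G sI] by blast
qed

text \<open>For \<open>\<delta> = \<plusminus> 1\<close> these are unit vectors, the first time-like and the second space-like, that span the same plane
  as \<open>n\<close> and \<open>m\<close>; they serve as the first and the last axis.\<close>

definition f1 where "f1 \<delta> = (\<delta> / 2) *\<^sub>R n - \<delta> *\<^sub>R m"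
definition f5 where "f5 \<delta> = (\<delta> / 2) *\<^sub>R n + \<delta> *\<^sub>R m"

lemma null_basis:
  assumes "\<delta> = 1 \<or> \<delta> = -1"
  shows "sprod (f1 \<delta>) (f1 \<delta>) = -1" "sprod (f5 \<delta>) (f5 \<delta>) = 1" "sprod (f1 \<delta>) (f5 \<delta>) = 0" "sprod (f5 \<delta>) (f1 \<delta>) = 0"
    "i \<noteq> 1 \<Longrightarrow> sprod (f1 \<delta>) (E i y0) = 0" "i \<noteq> 1 \<Longrightarrow> sprod (E i y0) (f1 \<delta>) = 0"
    "i \<noteq> 1 \<Longrightarrow> sprod (f5 \<delta>) (E i y0) = 0" "i \<noteq> 1 \<Longrightarrow> sprod (E i y0) (f5 \<delta>) = 0"
    "sprod v (f1 \<delta>) = \<delta> * (sprod v n / 2 - sprod v m)" "sprod v (f5 \<delta>) = \<delta> * (sprod v n / 2 + sprod v m)"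
  using assms(1) by (auto simp: f1_def f5_def algebra_simps)

lemma null_parametrized:
  fixes P :: "real \<Rightarrow> real \<Rightarrow> real \<Rightarrow> real \<Rightarrow> real^5"
  assumes W: "open W" "y0 \<in> W" "W \<subseteq> U" and F: "orthonormal5 F sign5" and I: "open I" "\<And>y. y \<in> W \<Longrightarrow> \<sigma> y \<in> I"
    and P: "smooth_on {z::real^4. z $ 1 \<in> I} (\<lambda>z. P (z $ 1) (z $ 2) (z $ 3) (z $ 4))"
    and eq: "\<And>y. y \<in> W \<Longrightarrow> coords F (X y - c) = P (\<sigma> y) (T i y) (T j y) (T l y)"
  shows "locally_parametrized S X y0 I P"
proof -
  define \<kappa> where "\<kappa> y = (vector [\<sigma> y, T i y, T j y, T l y] :: real^4)" for y
  have \<kappa>: "\<kappa> y $ 1 = \<sigma> y" "\<kappa> y $ 2 = T i y" "\<kappa> y $ 3 = T j y" "\<kappa> y $ 4 = T l y" for y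
    by (simp_all add: \<kappa>_def vector_def)
  note smW = smooth_on_subset[OF _ W(3)]
  have sm\<kappa>: "smooth_on W \<kappa>"
    unfolding \<kappa>_def[abs_def]
    by (rule smooth_on_vec4[OF W(1) smW[OF smooth_d(2)] smW[OF smooth_T] smW[OF smooth_T] smW[OF smooth_T]])
  have oQ: "open {z::real^4. z $ 1 \<in> I}"
    using continuous_open_preimage[OF continuous_on_subset[OF smooth_on_continuous_on[OF smooth_on_UNIV_component[of 1]]] open_UNIV I(1)]
    by (simp add: vimage_def)
  have WS: "W \<subseteq> S" using W(3) ball_S by blast
  show ?thesis
    by (rule locally_parametrizedI[where f=F and c=c, OF W(1,2) WS sm\<kappa> F smooth_on_subset[OF smooth_X WS] inj_dX[OF U_S[OF y0_U]] oQ _ P])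
       (use I(2) eq in \<open>auto simp: \<kappa>\<close>)
qed

lemma smooth_null_family:
  assumes "open I" "smooth_on I G"
  shows "smooth_on {z::real^4. z $ 1 \<in> I} (\<lambda>z. family_vii a G (z $ 1) (z $ 2) (z $ 3) (z $ 4))"
    "smooth_on {z::real^4. z $ 1 \<in> I} (\<lambda>z. family_viii a G (z $ 1) (z $ 2) (z $ 3) (z $ 4))"
proof -
  let ?Q = "{z::real^4. z $ 1 \<in> I}"
  have oQ: "open ?Q"
    using continuous_open_preimage[OF continuous_on_subset[OF smooth_on_continuous_on[OF smooth_on_UNIV_component[of 1]]] open_UNIV assms(1)]
    by (simp add: vimage_def)
  have q: "smooth_on ?Q (\<lambda>z. z $ i)" for i by (rule smooth_on_subset[OF smooth_on_UNIV_component]) simp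
  have G: "smooth_on ?Q (\<lambda>z. G (z $ 1))" by (rule smooth_on_compose[OF oQ assms q]) simp
  show "smooth_on ?Q (\<lambda>z. family_vii a G (z $ 1) (z $ 2) (z $ 3) (z $ 4))"
    "smooth_on ?Q (\<lambda>z. family_viii a G (z $ 1) (z $ 2) (z $ 3) (z $ 4))"
    unfolding family_vii_def family_viii_def by (intro smooth_intros oQ q G; simp)+
qed

lemma coords_minus_nth: "coords F v $ i = sign5 i * sprod v (F i)"
  by (simp add: coords_def)

text \<open>The parameter \<open>v = T 4\<close> enters with the factor \<open>\<sigma> - 1\<close>, and the families contain it with the factors
  \<open>s + 2 a\<close> and \<open>s - 2 a\<close>; so \<open>a\<close> is \<open>- 1/2\<close> or \<open>1/2\<close>.  As \<open>\<epsilon> 1 = - 1\<close>, exactly one of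
  \<open>E 2, E 3, E 4\<close> is time-like: family (vii) arises if it is \<open>E 4\<close>.  The function \<open>\<psi>\<close> of the families
  differs from the present one by a multiple of \<open>s\<close> and a sign, because the first and last axes are
  \<open>f1\<close> and \<open>f5\<close> rather than \<open>n\<close> and \<open>m\<close>.\<close>

lemma null_classified: "locally_classified S X y0"
proof -
  obtain I G W where I: "open I" "is_interval I" and W: "open W" "y0 \<in> W" "W \<subseteq> U" and G: "smooth_on I G"
    and sI: "\<And>y. y \<in> W \<Longrightarrow> \<sigma> y \<in> I \<and> \<psi> y = G (\<sigma> y)" and pos: "\<And>s. s \<in> I \<Longrightarrow> deriv G s > 0"
    by (rule profile_\<psi>) (rule that)
  have sgn: "\<epsilon> i = 1 \<or> \<epsilon> i = -1" for i using eps_sq[of i] by (simp add: power2_eq_1_iff)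
  have sum: "\<epsilon> 2 + \<epsilon> 3 + \<epsilon> 4 = 1"
    using orthonormal5_signs(2)[OF orthonormal5_five[OF U_S[OF y0_U]]] by (simp add: e1)
  have m_coord: "sprod (X y - c) m = G (\<sigma> y) + \<sigma> y / 2 * (\<epsilon> 2 * (T 2 y)\<^sup>2 + \<epsilon> 3 * (T 3 y)\<^sup>2) + (\<sigma> y - 1) / 2 * (\<epsilon> 4 * (T 4 y)\<^sup>2)"
    if "y \<in> W" for y
    using sI[OF that] by (simp add: \<psi>_def)
  have a_coord: "sprod (X y - c) (E a y0) = \<epsilon> a * (\<sigma> y * T a y)" if "y \<in> W" "a = 2 \<or> a = 3" for y a
    using arg_cong[OF coordinates(2)[of y a], of "\<lambda>x. \<epsilon> a * x"] that W(3) by auto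
  have v_coord: "sprod (X y - c) (E 4 y0) = \<epsilon> 4 * ((\<sigma> y - 1) * T 4 y)" if "y \<in> W" for y
    using arg_cong[OF coordinates(3)[of y], of "\<lambda>x. \<epsilon> 4 * x"] that W(3) by auto
  have n_coord: "sprod (X y - c) n = - \<sigma> y" if "y \<in> W" for y
    using coordinates(1)[of y] that W(3) by blast
  have smid: "smooth_on I (\<lambda>s. s / 2)" using I(1) by (intro smooth_intros) auto
  have dG: "((\<lambda>s. G s + s / 2) has_real_derivative deriv G s + 1 / 2) (at s)"
    "((\<lambda>s. - G s - s / 2) has_real_derivative - deriv G s - 1 / 2) (at s)" if "s \<in> I" for s
    using smooth_on_DERIV[OF G that] by (auto intro!: derivative_eq_intros)
  show ?thesis
  proof (cases "\<epsilon> 4 = 1")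
    case False
    then have s: "\<epsilon> 4 = -1" "\<epsilon> 2 = 1" "\<epsilon> 3 = 1"
      using sum sgn[of 2] sgn[of 3] sgn[of 4] by auto
    note nb = null_basis[of 1, simplified]
    have on: "orthonormal5 (tuple5 (f1 1) (E 4 y0) (E 2 y0) (E 3 y0) (f5 1)) sign5"
      unfolding orthonormal5_def forall_5 using s nb by (simp add: sign5_def)
    have smG: "smooth_on I (\<lambda>s. G s + s / 2)" by (intro smooth_on_add I(1) G smid)
    have "locally_parametrized S X y0 I (family_vii (-1/2) (\<lambda>s. G s + s / 2))"
    proof (rule null_parametrized[OF W on I(1) _ smooth_null_family(1)[OF I(1) smG], where i=2 and j=3 and l=4])
      fix y assume y: "y \<in> W"
      show "\<sigma> y \<in> I" using sI[OF y] by simp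
      show "coords (tuple5 (f1 1) (E 4 y0) (E 2 y0) (E 3 y0) (f5 1)) (X y - c) =
         family_vii (-1/2) (\<lambda>s. G s + s / 2) (\<sigma> y) (T 2 y) (T 3 y) (T 4 y)"
        unfolding family_vii_def vec_eq_iff forall_5 vector_5 coords_minus_nth tuple5_simps nb(9,10) n_coord[OF y] m_coord[OF y] v_coord[OF y]
        using a_coord[OF y, of 2] a_coord[OF y, of 3] s by (simp add: sign5_def field_simps)
    qed
    moreover have "1 - 2 * deriv (\<lambda>s. G s + s / 2) s < 0" if "s \<in> I" for s
      using DERIV_imp_deriv[OF dG(1)[OF that]] pos[OF that] by simp
    ultimately show ?thesis
      unfolding some_family_def
      by (intro exI[of _ I] conjI I disjI2 exI[of _ "-1/2 :: real"] exI[of _ "\<lambda>s. G s + s / 2"] disjI1 smG) auto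
  next
    case True
    then have "(\<epsilon> 2 = -1 \<and> \<epsilon> 3 = 1) \<or> (\<epsilon> 3 = -1 \<and> \<epsilon> 2 = 1)"
      using sum sgn[of 2] sgn[of 3] by auto
    then obtain a b where ab: "{a, b} = {2, 3 :: 4}" and s: "\<epsilon> a = -1" "\<epsilon> b = 1"
      using insert_commute[of "3 :: 4" 2 "{}"] by blast
    have ab': "a = 2 \<or> a = 3" "b = 2 \<or> b = 3" "a \<noteq> 1" "b \<noteq> 1" "a \<noteq> 4" "b \<noteq> 4" "4 \<noteq> a" "4 \<noteq> b" "a \<noteq> b" "b \<noteq> a"
      using two_three[OF ab] by auto
    note nb = null_basis[of "-1", simplified]
    have on: "orthonormal5 (tuple5 (f1 (-1)) (E a y0) (E b y0) (E 4 y0) (f5 (-1))) sign5"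
      unfolding orthonormal5_def forall_5 using s True nb ab' by (simp add: sign5_def)
    have smG: "smooth_on I (\<lambda>s. - G s - s / 2)" by (intro smooth_on_diff smooth_on_minus I(1) G smid)
    have "locally_parametrized S X y0 I (family_viii (1/2) (\<lambda>s. - G s - s / 2))"
    proof (rule null_parametrized[OF W on I(1) _ smooth_null_family(2)[OF I(1) smG], where i=a and j=b and l=4])
      fix y assume y: "y \<in> W"
      show "\<sigma> y \<in> I" using sI[OF y] by simp
      have quad: "\<epsilon> 2 * (T 2 y)\<^sup>2 + \<epsilon> 3 * (T 3 y)\<^sup>2 = - (T a y)\<^sup>2 + (T b y)\<^sup>2"
        using two_three[OF ab] s by auto
      show "coords (tuple5 (f1 (-1)) (E a y0) (E b y0) (E 4 y0) (f5 (-1))) (X y - c) =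
         family_viii (1/2) (\<lambda>s. - G s - s / 2) (\<sigma> y) (T a y) (T b y) (T 4 y)"
        unfolding family_viii_def vec_eq_iff forall_5 vector_5 coords_minus_nth tuple5_simps nb(9,10) n_coord[OF y] m_coord[OF y] v_coord[OF y] quad
        using a_coord[OF y ab'(1)] a_coord[OF y ab'(2)] s True by (simp add: sign5_def field_simps)
    qed
    moreover have "1 + 2 * deriv (\<lambda>s. - G s - s / 2) s < 0" if "s \<in> I" for s
      using DERIV_imp_deriv[OF dG(2)[OF that]] pos[OF that] by simp
    ultimately show ?thesis
      unfolding some_family_def
      by (intro exI[of _ I] conjI I disjI2 exI[of _ "1/2 :: real"] exI[of _ "\<lambda>s. - G s - s / 2"] smG) auto
  qed
qed

end

context adapted_frame begin

theorem classified:
  assumes "y0 \<in> S"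
  shows "locally_classified S X y0"
proof (cases "w y0 = 0")
  case True
  show ?thesis
  proof (rule null_coefficients[OF assms True], goal_cases)
    case (1 r \<tau>)
    interpret null_frame S X N k E V \<epsilon> y0 r \<tau>
      by unfold_locales (use 1 in auto)
    show ?case by (rule null_classified)
  qed
next
  case False
  then show ?thesis by (rule classified_nondegenerate[OF assms])
qed

end

section \<open>Passing to a chart\<close>

lemma chartD:
  assumes "chart (U, \<phi>)"
  shows "open U" "open (\<phi> ` U)" "inj_on \<phi> U" "continuous_on U \<phi>" "continuous_on (\<phi> ` U) (inv_into U \<phi>)"
    "q \<in> U \<Longrightarrow> inv_into U \<phi> (\<phi> q) = q" "y \<in> \<phi> ` U \<Longrightarrow> \<phi> (inv_into U \<phi> y) = y" "y \<in> \<phi> ` U \<Longrightarrow> inv_into U \<phi> y \<in> U"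
  using assms unfolding chart_def homeomorphism_def
  by (auto simp: f_inv_into_f inv_into_into intro: inj_on_inverseI)

lemma open_chart_image:
  assumes "chart (U, \<phi>)" "open Q"
  shows "open (\<phi> ` (U \<inter> Q))"
proof -
  note c = chartD[OF assms(1)]
  have "\<phi> ` (U \<inter> Q) = \<phi> ` U \<inter> inv_into U \<phi> -` Q" using c(6,7,8) by (auto simp: image_iff)
  then show ?thesis using continuous_open_preimage[OF c(5,2) assms(2)] by simp
qed

text \<open>Composing the chart with the change of parameters gives a chart of the maximal atlas.\<close>

lemma congruent_near_of_parametrized:
  assumes A: "smooth_atlas A" and UA: "(U, \<phi>) \<in> A" and p: "p \<in> U" and S: "S \<subseteq> \<phi> ` U"
    and par: "locally_parametrized S (x \<circ> inv_into U \<phi>) (\<phi> p) I P"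
  shows "congruent_near A x p I P"
proof -
  let ?\<psi> = "inv_into U \<phi>"
  have ch: "chart (U, \<phi>)" using A UA by (auto simp: smooth_atlas_def)
  note c = chartD[OF ch]
  obtain F W and \<kappa> h :: "real^4 \<Rightarrow> real^4" where F: "isometry_E52 F" and W: "open W" "\<phi> p \<in> W" "W \<subseteq> S" "open (\<kappa> ` W)"
    and \<kappa>: "smooth_on W \<kappa>" and hom: "homeomorphism W (\<kappa> ` W) \<kappa> h" and h: "smooth_on (\<kappa> ` W) h"
    and eq: "\<And>y. y \<in> W \<Longrightarrow> \<kappa> y $ 1 \<in> I \<and> F ((x \<circ> ?\<psi>) y) = P (\<kappa> y $ 1) (\<kappa> y $ 2) (\<kappa> y $ 3) (\<kappa> y $ 4)"
    using par unfolding locally_parametrized_def by metis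
  have W\<phi>: "W \<subseteq> \<phi> ` U" using W(3) S by blast
  define W' where "W' = U \<inter> \<phi> -` W"
  define \<kappa>' where "\<kappa>' = \<kappa> \<circ> \<phi>"
  have oW': "open W'" unfolding W'_def using c(4) c(1) W(1) by (rule continuous_open_preimage)
  have W'U: "W' \<subseteq> U" by (auto simp: W'_def)
  have \<phi>W': "\<phi> ` W' = W" using W\<phi> by (auto simp: W'_def)
  have img: "\<kappa>' ` W' = \<kappa> ` W" unfolding \<kappa>'_def image_comp[symmetric] \<phi>W' ..
  have "homeomorphism W' W \<phi> ?\<psi>"
  proof (rule homeomorphismI)
    show "continuous_on W' \<phi>" "continuous_on W ?\<psi>"
      using continuous_on_subset[OF c(4) W'U] continuous_on_subset[OF c(5) W\<phi>] .
    show "\<phi> ` W' \<subseteq> W" using \<phi>W' by simp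
    show "?\<psi> (\<phi> q) = q" if "q \<in> W'" for q using c(6) W'U that by blast
    show \<phi>\<psi>: "\<phi> (?\<psi> y) = y" if "y \<in> W" for y using c(7) W\<phi> that by blast
    show "?\<psi> ` W \<subseteq> W'" using c(8) W\<phi> \<phi>\<psi> by (auto simp: W'_def)
  qed
  from homeomorphism_compose[OF this hom]
  have hom': "homeomorphism W' (\<kappa>' ` W') \<kappa>' (?\<psi> \<circ> h)" unfolding img unfolding \<kappa>'_def .
  have inv: "inv_into W' \<kappa>' z = ?\<psi> (h z)" if "z \<in> \<kappa>' ` W'" for z
  proof -
    have "?\<psi> (h z) \<in> W'" "\<kappa>' (?\<psi> (h z)) = z" "inj_on \<kappa>' W'"
      using hom' that unfolding homeomorphism_def by (auto intro: inj_on_inverseI)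
    then show ?thesis using inv_into_f_f by metis
  qed
  have "homeomorphism W' (\<kappa>' ` W') \<kappa>' (inv_into W' \<kappa>')"
    using hom' inv unfolding homeomorphism_def by (auto intro: continuous_on_eq)
  then have chart': "chart (W', \<kappa>')" using oW' W(4) by (simp add: chart_def img)
  have comp: "compatible (W', \<kappa>') (Q, \<eta>)" if Q: "(Q, \<eta>) \<in> A" for Q \<eta>
  proof -
    have chQ: "chart (Q, \<eta>)" using A Q by (auto simp: smooth_atlas_def)
    note cQ = chartD[OF chQ]
    have cmp: "smooth_on (\<phi> ` (U \<inter> Q)) (\<eta> \<circ> ?\<psi>)" "smooth_on (\<eta> ` (Q \<inter> U)) (\<phi> \<circ> inv_into Q \<eta>)"
      using A UA Q by (auto simp: smooth_atlas_def compatible_def Int_commute)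
    have o1: "open (\<kappa>' ` (W' \<inter> Q))" by (rule open_chart_image[OF chart' cQ(1)])
    have sub1: "\<kappa>' ` (W' \<inter> Q) \<subseteq> \<kappa> ` W" using img by auto
    have h_in: "h z \<in> \<phi> ` (U \<inter> Q)" if z: "z \<in> \<kappa>' ` (W' \<inter> Q)" for z
    proof -
      obtain q where q: "q \<in> W'" "q \<in> Q" "z = \<kappa> (\<phi> q)" using z by (auto simp: \<kappa>'_def)
      then have "h z = \<phi> q" using hom \<phi>W' by (auto simp: homeomorphism_def)
      then show ?thesis using q W'U by auto
    qed
    have "smooth_on (\<kappa>' ` (W' \<inter> Q)) (\<lambda>z. (\<eta> \<circ> ?\<psi>) (h z))"
      by (rule smooth_on_compose[OF o1 open_chart_image[OF ch cQ(1)] cmp(1) smooth_on_subset[OF h sub1] h_in])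
    then have 1: "smooth_on (\<kappa>' ` (W' \<inter> Q)) (\<eta> \<circ> inv_into W' \<kappa>')"
      by (rule smooth_on_cong[OF o1, rotated]) (use inv in auto)
    have o2: "open (\<eta> ` (W' \<inter> Q))" using open_chart_image[OF chQ oW'] by (simp add: Int_commute)
    have in2: "(\<phi> \<circ> inv_into Q \<eta>) z \<in> W" if "z \<in> \<eta> ` (W' \<inter> Q)" for z
      using that cQ(6) by (auto simp: W'_def)
    have "smooth_on (\<eta> ` (W' \<inter> Q)) (\<lambda>z. \<kappa> ((\<phi> \<circ> inv_into Q \<eta>) z))"
      by (rule smooth_on_compose[OF o2 W(1) \<kappa> smooth_on_subset[OF cmp(2)] in2]) (use W'U in auto)
    then have "smooth_on (\<eta> ` (W' \<inter> Q)) (\<kappa>' \<circ> inv_into Q \<eta>)" by (simp add: \<kappa>'_def comp_def)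
    then show ?thesis using 1 by (simp add: compatible_def)
  qed
  have "U \<subseteq> points A" using UA by (auto simp: points_def)
  then have "smooth_chart A (W', \<kappa>')"
    using chart' comp W'U by (auto simp: smooth_chart_def)
  moreover have "p \<in> W'" using p W(2) by (simp add: W'_def)
  moreover have "\<kappa>' q $ 1 \<in> I \<and> F (x q) = P (\<kappa>' q $ 1) (\<kappa>' q $ 2) (\<kappa>' q $ 3) (\<kappa>' q $ 4)" if "q \<in> W'" for q
    using eq[of "\<phi> q"] that c(6)[of q] by (auto simp: W'_def \<kappa>'_def)
  ultimately show ?thesis unfolding congruent_near_def using F by blast
qed

text \<open>A chart of the atlas, not necessarily the one that \<open>chart_at\<close> selects at its points.\<close>

locale atlas_chart =
  fixes A :: "'m::{t2_space,second_countable_topology} chart4 set" and x :: "'m \<Rightarrow> real^5" and U :: "'m set" and \<phi> :: "'m \<Rightarrow> real^4"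
  assumes atlas: "smooth_atlas A" and UA: "(U, \<phi>) \<in> A"
    and smooth_x: "smooth_map A (points A) x"
    and immersion: "\<And>q. q \<in> points A \<Longrightarrow> inj (differential A x q)"
begin

definition \<psi> where "\<psi> = inv_into U \<phi>"

lemma chart_U: "chart (U, \<phi>)"
  using atlas UA by (auto simp: smooth_atlas_def)

lemma U_points: "U \<subseteq> points A"
  using UA by (auto simp: points_def)

lemmas chart_simps = chartD(6,7,8)[OF chart_U, folded \<psi>_def]

lemma smooth_in_chart: "smooth_map A Q g \<Longrightarrow> smooth_on (\<phi> ` (U \<inter> Q)) (g \<circ> \<psi>)"
  using UA by (auto simp: smooth_map_def \<psi>_def)

text \<open>The derivative at \<open>q\<close> of the change from the chart selected by \<open>chart_at\<close> to \<open>\<phi>\<close>.  All differentials at \<open>q\<close> change by this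
  linear map, so it cancels from derivatives along tangent vectors.\<close>

definition transition :: "'m \<Rightarrow> real^4 \<Rightarrow> real^4" where
  "transition q = (case chart_at A q of (U', \<phi>') \<Rightarrow> frechet_derivative (\<phi> \<circ> inv_into U' \<phi>') (at (\<phi>' q)))"

lemma differential_in_chart:
  fixes g :: "'m \<Rightarrow> 'b::real_normed_vector"
  assumes q: "q \<in> U"
  shows "bij (transition q)"
    and "(g \<circ> \<psi>) differentiable (at (\<phi> q)) \<Longrightarrow> differential A g q = frechet_derivative (g \<circ> \<psi>) (at (\<phi> q)) \<circ> transition q"
proof -
  obtain U' \<phi>' where c': "chart_at A q = (U', \<phi>')" by (cases "chart_at A q") auto
  have "\<exists>c. c \<in> A \<and> q \<in> fst c" using UA q by (intro exI[of _ "(U, \<phi>)"]) auto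
  from someI_ex[OF this] have UA': "(U', \<phi>') \<in> A" "q \<in> U'" using c' by (auto simp: chart_at_def)
  have ch': "chart (U', \<phi>')" using atlas UA' by (auto simp: smooth_atlas_def)
  note c = chartD[OF chart_U] and c'' = chartD[OF ch']
  let ?\<psi>' = "inv_into U' \<phi>'"
  have cmp: "smooth_on (\<phi>' ` (U' \<inter> U)) (\<phi> \<circ> ?\<psi>')" "smooth_on (\<phi> ` (U \<inter> U')) (\<phi>' \<circ> \<psi>)"
    using atlas UA UA' by (auto simp: smooth_atlas_def compatible_def \<psi>_def)
  have o: "open (\<phi>' ` (U' \<inter> U))" "open (\<phi> ` (U \<inter> U'))" 
    using open_chart_image[OF ch' c(1)] open_chart_image[OF chart_U c''(1)] by auto
  have inq: "\<phi>' q \<in> \<phi>' ` (U' \<inter> U)" "\<phi> q \<in> \<phi> ` (U \<inter> U')" using q UA'(2) by auto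
  have T: "((\<phi> \<circ> ?\<psi>') has_derivative transition q) (at (\<phi>' q))"
    using smooth_on_has_derivative[OF cmp(1) inq(1)] by (simp add: transition_def c')
  have T': "((\<phi>' \<circ> \<psi>) has_derivative frechet_derivative (\<phi>' \<circ> \<psi>) (at (\<phi> q))) (at (\<phi> q))"
    using smooth_on_has_derivative[OF cmp(2) inq(2)] .
  have v: "(\<phi> \<circ> ?\<psi>') (\<phi>' q) = \<phi> q" "(\<phi>' \<circ> \<psi>) (\<phi> q) = \<phi>' q" using c''(6)[OF UA'(2)] chart_simps(1)[OF q] by auto
  let ?T' = "frechet_derivative (\<phi>' \<circ> \<psi>) (at (\<phi> q))"
  have "((\<lambda>y. (\<phi>' \<circ> \<psi>) ((\<phi> \<circ> ?\<psi>') y)) has_derivative (\<lambda>v. ?T' (transition q v))) (at (\<phi>' q))"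
    by (rule has_derivative_compose[OF T], unfold v, rule T')
  then have "((\<lambda>y. y) has_derivative (\<lambda>v. ?T' (transition q v))) (at (\<phi>' q))"
    by (rule has_derivative_transform_within_open[OF _ o(1) inq(1)]) (use c''(6) chart_simps(1) in auto)
  then have TT: "?T' (transition q v) = v" for v
    using has_derivative_unique[OF _ has_derivative_ident] by metis
  have "((\<lambda>y. (\<phi> \<circ> ?\<psi>') ((\<phi>' \<circ> \<psi>) y)) has_derivative (\<lambda>v. transition q (?T' v))) (at (\<phi> q))"
    by (rule has_derivative_compose[OF T'], unfold v, rule T)
  then have "((\<lambda>y. y) has_derivative (\<lambda>v. transition q (?T' v))) (at (\<phi> q))"
    by (rule has_derivative_transform_within_open[OF _ o(2) inq(2)]) (use c''(6) chart_simps(1) in auto)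
  then have TT': "transition q (?T' v) = v" for v
    using has_derivative_unique[OF _ has_derivative_ident] by metis
  show "bij (transition q)"
    by (rule bij_betw_byWitness[where f'="?T'"]) (auto simp: TT TT')
  assume "(g \<circ> \<psi>) differentiable (at (\<phi> q))"
  then have "((g \<circ> \<psi>) has_derivative frechet_derivative (g \<circ> \<psi>) (at (\<phi> q))) (at ((\<phi> \<circ> ?\<psi>') (\<phi>' q)))"
    using v by (simp add: frechet_derivative_works)
  from has_derivative_compose[OF T this]
  have "((g \<circ> ?\<psi>') has_derivative (\<lambda>v. frechet_derivative (g \<circ> \<psi>) (at (\<phi> q)) (transition q v))) (at (\<phi>' q))"
    by (rule has_derivative_transform_within_open[OF _ o(1) inq(1)]) (use c''(6) chart_simps(1) in auto)
  then show "differential A g q = frechet_derivative (g \<circ> \<psi>) (at (\<phi> q)) \<circ> transition q"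
    unfolding differential_def c' by (auto simp: fun_eq_iff frechet_derivative_eqI)
qed

lemma smooth_X: "smooth_on (\<phi> ` U) (x \<circ> \<psi>)"
  using smooth_in_chart[OF smooth_x] U_points by (simp add: Int_absorb2)

lemma X_differentiable: "q \<in> U \<Longrightarrow> (x \<circ> \<psi>) differentiable (at (\<phi> q))"
  using smooth_on_differentiable[OF smooth_X] by blast

lemma differential_x: "q \<in> U \<Longrightarrow> differential A x q = frechet_derivative (x \<circ> \<psi>) (at (\<phi> q)) \<circ> transition q"
  using differential_in_chart(2) X_differentiable by blast

lemma tangent_space_in_chart: "q \<in> U \<Longrightarrow> tangent_space A x q = range (frechet_derivative (x \<circ> \<psi>) (at (\<phi> q)))"
  unfolding tangent_space_def differential_x
  by (simp only: image_comp[symmetric] bij_is_surj[OF differential_in_chart(1)])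

lemma inj_in_chart:
  assumes "q \<in> U"
  shows "inj (frechet_derivative (x \<circ> \<psi>) (at (\<phi> q)))"
proof -
  have "inj (frechet_derivative (x \<circ> \<psi>) (at (\<phi> q)) \<circ> transition q)"
    using immersion[of q] assms U_points differential_x[OF assms] by auto
  then have "inj_on (frechet_derivative (x \<circ> \<psi>) (at (\<phi> q))) (range (transition q))" by (rule inj_on_imageI)
  then show ?thesis using bij_is_surj[OF differential_in_chart(1)[OF assms]] by simp
qed

lemma dir_deriv_in_chart:
  assumes q: "q \<in> U" and g: "(g \<circ> \<psi>) differentiable (at (\<phi> q))"
  shows "dir_deriv A x g q (frechet_derivative (x \<circ> \<psi>) (at (\<phi> q)) v) = frechet_derivative (g \<circ> \<psi>) (at (\<phi> q)) v"
proof -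
  obtain u where u: "v = transition q u" using differential_in_chart(1)[OF q] by (metis bij_pointE)
  have "frechet_derivative (x \<circ> \<psi>) (at (\<phi> q)) v = differential A x q u"
    using differential_x[OF q] u by simp
  moreover have "inj (differential A x q)" using immersion q U_points by blast
  ultimately show ?thesis
    using differential_in_chart(2)[OF q g] u by (simp add: dir_deriv_def)
qed

end

text \<open>The coordinate vectors of the \<open>e i\<close> form a basis of the coordinate space, and the trace does not
  depend on the basis.\<close>

lemma tangent_trace_orthonormal:
  fixes dx :: "real^4 \<Rightarrow> real^5" and e :: "4 \<Rightarrow> real^5" and \<epsilon> :: "4 \<Rightarrow> real"
  assumes dx: "linear dx" "inj dx" and e: "\<And>i. e i \<in> range dx"
    and on: "\<And>w. sprod w n = 0 \<Longrightarrow> w = (\<Sum>i\<in>UNIV. (\<epsilon> i * sprod w (e i)) *\<^sub>R e i)"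
    and ind: "\<And>i j. sprod (e i) (e j) = (if i = j then \<epsilon> i else 0)" "\<And>i. \<epsilon> i * \<epsilon> i = 1"
    and L: "linear (L \<circ> dx)" "\<And>u. sprod (L (dx u)) n = 0"
  shows "trace (matrix (inv dx \<circ> L \<circ> dx)) = (\<Sum>i\<in>UNIV. \<epsilon> i * sprod (L (e i)) (e i))"
proof -
  define B where "B i = inv dx (e i)" for i
  have dB: "dx (B i) = e i" for i using e[of i] by (auto simp: B_def f_inv_into_f)
  have inv: "inv dx (dx u) = u" for u using dx(2) by simp
  have inr: "w = dx (\<Sum>i\<in>UNIV. (\<epsilon> i * sprod w (e i)) *\<^sub>R B i)" if "sprod w n = 0" for w
    using on[OF that] by (simp add: linear_sum[OF dx(1)] linear_scale[OF dx(1)] dB)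
  define M where "M = inv dx \<circ> L \<circ> dx"
  have dM: "dx (M u) = L (dx u)" for u
  proof -
    have "L (dx u) \<in> range dx" using inr[OF L(2)[of u]] by (rule range_eqI)
    then show ?thesis by (simp add: M_def f_inv_into_f)
  qed
  have linM: "linear M"
  proof (rule linearI)
    show "M (u + v) = M u + M v" for u v
      by (rule injD[OF dx(2)]) (use linear_add[OF L(1)] linear_add[OF dx(1)] dM in \<open>simp add: comp_def\<close>)
    show "M (c *\<^sub>R u) = c *\<^sub>R M u" for c u
      by (rule injD[OF dx(2)]) (use linear_scale[OF L(1)] linear_scale[OF dx(1)] dM in \<open>simp add: comp_def\<close>)
  qed
  \<comment> \<open>the columns of \<open>P\<close> are the coordinate vectors \<open>B i\<close>; \<open>m\<close> is the matrix of \<open>L\<close> in the basis \<open>e\<close>\<close>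
  define P :: "real^4^4" where "P = (\<chi> r i. B i $ r)"
  define m :: "real^4^4" where "m = (\<chi> i j. \<epsilon> i * sprod (L (e j)) (e i))"
  have MB: "M (B j) = (\<Sum>i\<in>UNIV. (\<epsilon> i * sprod (L (e j)) (e i)) *\<^sub>R B i)" for j
    by (rule injD[OF dx(2)]) (use inr[OF L(2)[of "B j"]] dM dB in simp)
  have "(matrix M ** P) $ r $ j = (P ** m) $ r $ j" for r j
  proof -
    have "(matrix M ** P) $ r $ j = (matrix M *v B j) $ r"
      by (simp add: matrix_matrix_mult_def matrix_vector_mult_def P_def)
    also have "\<dots> = M (B j) $ r" by (simp add: matrix_works linM)
    also have "\<dots> = (P ** m) $ r $ j"
      unfolding MB by (simp add: matrix_matrix_mult_def P_def m_def mult_ac)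
    finally show ?thesis .
  qed
  then have comm: "matrix M ** P = P ** m" by (simp add: vec_eq_iff)
  have Pv: "P *v v = (\<Sum>i\<in>UNIV. (v $ i) *\<^sub>R B i)" for v
    by (simp add: vec_eq_iff matrix_vector_mult_def P_def mult_ac)
  have "inj ((*v) P)"
  proof (rule injI)
    fix u v assume "P *v u = P *v v"
    then have "dx (P *v u) = dx (P *v v)" by simp
    then have "(\<Sum>i\<in>UNIV. (u $ i) *\<^sub>R e i) = (\<Sum>i\<in>UNIV. (v $ i) *\<^sub>R e i)"
      unfolding Pv by (simp add: linear_sum[OF dx(1)] linear_scale[OF dx(1)] dB)
    then have "sprod (\<Sum>i\<in>UNIV. (u $ i) *\<^sub>R e i) (e j) = sprod (\<Sum>i\<in>UNIV. (v $ i) *\<^sub>R e i) (e j)" for j by simp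
    then have uv: "u $ j * \<epsilon> j = v $ j * \<epsilon> j" for j by (simp add: sprod_sum_left ind(1) if_distrib cong: if_cong)
    have "\<epsilon> j \<noteq> 0" for j using ind(2)[of j] by auto
    then have "u $ j = v $ j" for j using uv[of j] by simp
    then show "u = v" by (simp add: vec_eq_iff)
  qed
  then obtain Q where Q: "Q ** P = mat 1" using matrix_left_invertible_injective[of P] by auto
  then have Q': "P ** Q = mat 1" using matrix_left_right_inverse by blast
  have "matrix M = (P ** m) ** Q" unfolding comm[symmetric] by (simp add: matrix_mul_assoc[symmetric] Q')
  then have "trace (matrix M) = trace (Q ** (P ** m))" using trace_mul_sym[of "P ** m" Q] by simp
  also have "\<dots> = trace m" by (simp add: matrix_mul_assoc Q)
  finally show ?thesis by (simp add: M_def trace_def m_def)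
qed

section \<open>Frames and Laplacians in a chart\<close>

text \<open>In the type \<open>4\<close> the numeral \<open>4\<close> denotes zero, so the correspondence with the numbers \<open>1, ..., 4\<close> has to be
  spelled out.\<close>

definition frame_index :: "4 \<Rightarrow> nat" where
  "frame_index i = (if i = 1 then 1 else if i = 2 then 2 else if i = 3 then 3 else 4)"

lemma frame_index: "frame_index i \<in> {1..4}" "i \<noteq> j \<Longrightarrow> frame_index i \<noteq> frame_index j"
  using exhaust_4[of i] exhaust_4[of j] by (auto simp: frame_index_def)

locale framed_chart = atlas_chart A x U \<phi>
  for A :: "'m::{t2_space,second_countable_topology} chart4 set" and x :: "'m \<Rightarrow> real^5" and U :: "'m set" and \<phi> :: "'m \<Rightarrow> real^4" +
  fixes N :: "'m \<Rightarrow> real^5" and e :: "nat \<Rightarrow> 'm \<Rightarrow> real^5" and Q :: "'m set" and k :: "4 \<Rightarrow> 'm \<Rightarrow> real" and p :: 'm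
  assumes smooth_N: "smooth_map A (points A) N"
    and normal: "\<And>q. q \<in> points A \<Longrightarrow> sprod (N q) (N q) = 1 \<and> (\<forall>v\<in>tangent_space A x q. sprod (N q) v = 0)"
    and Q: "open Q" "p \<in> Q" "p \<in> U"
    and frame: "orthonormal_tangent_frame A x Q e"
    and smooth_k: "\<And>i. smooth_map A (points A) (k i)"
    and principal: "\<And>q i. q \<in> Q \<Longrightarrow> shape_op A x N q (e (frame_index i) q) = k i q *\<^sub>R e (frame_index i) q"
begin

text \<open>The frame in the chart, and the domain \<open>S\<close> on which it is considered: the signs of the frame vectors are
  locally constant, and \<open>S\<close> is the part of the chart where they are the same as at \<open>p\<close>.\<close>

definition E where "E i = e (frame_index i) \<circ> \<psi>"
definition \<epsilon> where "\<epsilon> i = sprod (e (frame_index i) p) (e (frame_index i) p)"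
definition S where "S = (\<Inter>i. {y \<in> \<phi> ` (U \<inter> Q). \<epsilon> i * sprod (E i y) (E i y) > 0})"
definition V where "V i y = inv (frechet_derivative (x \<circ> \<psi>) (at y)) (E i y)"

lemma open_UQ: "open (\<phi> ` (U \<inter> Q))"
  by (rule open_chart_image[OF chart_U Q(1)])

lemma smooth_E_UQ: "smooth_on (\<phi> ` (U \<inter> Q)) (E i)"
  using frame frame_index(1)[of i] smooth_in_chart unfolding E_def orthonormal_tangent_frame_def by blast

lemma frame_at:
  assumes "q \<in> Q"
  shows "e (frame_index i) q \<in> tangent_space A x q" "\<bar>sprod (e (frame_index i) q) (e (frame_index i) q)\<bar> = 1"
    "i \<noteq> j \<Longrightarrow> sprod (e (frame_index i) q) (e (frame_index j) q) = 0"
  using frame assms frame_index(1)[of i] frame_index(1)[of j] frame_index(2)[of i j]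
  unfolding orthonormal_tangent_frame_def by blast+

lemma eps_pm: "\<epsilon> i = 1 \<or> \<epsilon> i = -1"
  using frame_at(2)[OF Q(2), of i] by (auto simp: \<epsilon>_def abs_if split: if_splits)

lemma open_S': "open S"
  unfolding S_def
proof (rule open_INT)
  show "\<forall>i\<in>UNIV. open {y \<in> \<phi> ` (U \<inter> Q). \<epsilon> i * sprod (E i y) (E i y) > 0}"
  proof
    fix i
    have "smooth_on (\<phi> ` (U \<inter> Q)) (\<lambda>y. \<epsilon> i * sprod (E i y) (E i y))"
      by (intro smooth_intros open_UQ smooth_E_UQ)
    from continuous_open_preimage[OF smooth_on_continuous_on[OF this] open_UQ open_greaterThan, of 0]
    show "open {y \<in> \<phi> ` (U \<inter> Q). \<epsilon> i * sprod (E i y) (E i y) > 0}"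
      by (rule back_subst[where P="open"]) blast
  qed
qed simp

lemma S_UQ: "S \<subseteq> \<phi> ` (U \<inter> Q)"
  by (auto simp: S_def)

lemma p_S: "\<phi> p \<in> S"
proof -
  have pos_prod: "0 < \<epsilon> i * \<epsilon> i" for i using eps_pm[of i] by auto
  have "E i (\<phi> p) = e (frame_index i) p" for i using chart_simps(1)[OF Q(3)] by (simp add: E_def)
  then show ?thesis using Q eps_pm by (auto simp: S_def \<epsilon>_def[symmetric] intro: pos_prod)
qed

lemma S_point:
  assumes "y \<in> S"
  shows "\<psi> y \<in> U" "\<psi> y \<in> Q" "\<phi> (\<psi> y) = y" "\<psi> y \<in> points A"
  using assms S_UQ chart_simps U_points by force+

lemma smooth_points: "smooth_map A (points A) g \<Longrightarrow> smooth_on S (g \<circ> \<psi>)"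
  using smooth_on_subset[OF smooth_in_chart[of "points A" g], of S] S_UQ U_points by blast

lemma E_in_tangent: "y \<in> S \<Longrightarrow> E i y \<in> range (frechet_derivative (x \<circ> \<psi>) (at y))"
  using frame_at(1)[OF S_point(2), of y i] tangent_space_in_chart[OF S_point(1), of y] S_point(3)[of y] by (simp add: E_def)

lemma E_orthonormal: "y \<in> S \<Longrightarrow> sprod (E i y) (E j y) = (if i = j then \<epsilon> i else 0)"
proof (cases "i = j")
  case True
  assume y: "y \<in> S"
  then have "\<epsilon> i * sprod (E i y) (E i y) > 0" by (auto simp: S_def)
  moreover have "\<bar>sprod (E i y) (E i y)\<bar> = 1" using frame_at(2)[OF S_point(2)[OF y], of i] by (simp add: E_def)
  ultimately show ?thesis using eps_pm[of i] True by auto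
next
  case False
  assume y: "y \<in> S"
  then show ?thesis using frame_at(3)[OF S_point(2)[OF y] False] False by (simp add: E_def)
qed

lemma dX_V: "y \<in> S \<Longrightarrow> frechet_derivative (x \<circ> \<psi>) (at y) (V i y) = E i y"
  unfolding V_def by (rule f_inv_into_f[OF E_in_tangent])

lemma inj_dX': "y \<in> S \<Longrightarrow> inj (frechet_derivative (x \<circ> \<psi>) (at y))"
  using inj_in_chart[OF S_point(1), of y] S_point(3)[of y] by simp

lemma normal_at: "y \<in> S \<Longrightarrow> sprod ((N \<circ> \<psi>) y) ((N \<circ> \<psi>) y) = 1"
  "y \<in> S \<Longrightarrow> sprod ((N \<circ> \<psi>) y) (frechet_derivative (x \<circ> \<psi>) (at y) v) = 0"
  using normal[OF S_point(4), of y] tangent_space_in_chart[OF S_point(1), of y] S_point(3)[of y] by auto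

lemma orthonormal5_frame:
  assumes "y \<in> S"
  shows "orthonormal5 (tuple5 (E 1 y) (E 2 y) (E 3 y) (E 4 y) ((N \<circ> \<psi>) y)) (tuple5 (\<epsilon> 1) (\<epsilon> 2) (\<epsilon> 3) (\<epsilon> 4) 1)"
proof -
  have "sprod (E i y) ((N \<circ> \<psi>) y) = 0" "sprod ((N \<circ> \<psi>) y) (E i y) = 0" for i
    using normal_at(2)[OF assms, of "V i y"] dX_V[OF assms] sprod_commute by metis+
  then show ?thesis
    unfolding orthonormal5_def forall_5 using E_orthonormal[OF assms] normal_at(1)[OF assms] eps_pm
    by (auto simp: power2_eq_1_iff)
qed

text \<open>The components of \<open>V i\<close> solve a linear system whose coefficients are the products of the coordinate
  vector fields with the frame vectors.\<close>

lemma smooth_V': "smooth_on S (V i)"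
proof (rule smooth_on_linear_solution[OF open_S', where b="\<lambda>_. axis i 1"
      and A="\<lambda>y. \<chi> j l. \<epsilon> j * sprod (frechet_derivative (x \<circ> \<psi>) (at y) (axis l 1)) (E j y)"])
  have smX: "smooth_on S (x \<circ> \<psi>)" by (rule smooth_points[OF smooth_x])
  have smE: "smooth_on S (E j)" for j by (rule smooth_on_subset[OF smooth_E_UQ S_UQ])
  show "smooth_on S (\<lambda>y. (\<chi> j l. \<epsilon> j * sprod (frechet_derivative (x \<circ> \<psi>) (at y) (axis l 1)) (E j y)) $ j $ l)" for j l
    by simp (intro smooth_intros open_S' smooth_on_frechet_const[OF smX] smE)
  fix y assume y: "y \<in> S"
  let ?A = "\<chi> j l. \<epsilon> j * sprod (frechet_derivative (x \<circ> \<psi>) (at y) (axis l 1)) (E j y) :: real^4^4"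
  have hX: "((x \<circ> \<psi>) has_derivative frechet_derivative (x \<circ> \<psi>) (at y)) (at y)" by (rule smooth_on_has_derivative[OF smX y])
  note lX = has_derivative_linear[OF hX]
  have Av: "(?A *v v) $ j = \<epsilon> j * sprod (frechet_derivative (x \<circ> \<psi>) (at y) v) (E j y)" for v j
  proof -
    have "v = (\<Sum>l\<in>UNIV. (v $ l) *\<^sub>R axis l 1)" by (simp add: vec_eq_iff axis_def if_distrib cong: if_cong)
    from arg_cong[OF this, of "frechet_derivative (x \<circ> \<psi>) (at y)"]
    have "frechet_derivative (x \<circ> \<psi>) (at y) v = (\<Sum>l\<in>UNIV. (v $ l) *\<^sub>R frechet_derivative (x \<circ> \<psi>) (at y) (axis l 1))"
      unfolding linear_sum[OF lX] linear_scale[OF lX] .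
    then show ?thesis by (simp add: matrix_vector_mult_def sprod_sum_left sum_distrib_left mult_ac)
  qed
  have "inj ((*v) ?A)"
  proof (subst linear_injective_0[OF matrix_vector_mul_linear], intro allI impI)
    fix v assume "?A *v v = 0"
    then have *: "\<epsilon> j * sprod (frechet_derivative (x \<circ> \<psi>) (at y) v) (E j y) = 0" for j using Av[of v j] by simp
    then have 0: "sprod (frechet_derivative (x \<circ> \<psi>) (at y) v) (E j y) = 0" for j
    proof -
      have "\<epsilon> j \<noteq> 0" using eps_pm[of j] by auto
      then show ?thesis using *[of j] by simp
    qed
    have "frechet_derivative (x \<circ> \<psi>) (at y) v = 0"
    proof (rule sprod_eqI[OF orthonormal5_frame[OF y]])
      show "sprod (frechet_derivative (x \<circ> \<psi>) (at y) v) (tuple5 (E 1 y) (E 2 y) (E 3 y) (E 4 y) ((N \<circ> \<psi>) y) i) =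
         sprod 0 (tuple5 (E 1 y) (E 2 y) (E 3 y) (E 4 y) ((N \<circ> \<psi>) y) i)" for i
        using 0 normal_at(2)[OF y, of v] sprod_commute[of "frechet_derivative (x \<circ> \<psi>) (at y) v" "(N \<circ> \<psi>) y"]
        by (simp add: tuple5_def)
    qed
    then show "v = 0" using inj_dX'[OF y] linear_injective_0[OF lX] by blast
  qed
  then have "\<exists>B. B ** ?A = mat 1" using matrix_left_invertible_injective[of ?A] by auto
  then show "det ?A \<noteq> 0" using invertible_det_nz[of ?A] invertible_left_inverse[of ?A] by auto
  have "\<epsilon> i * \<epsilon> i = 1" for i using eps_pm[of i] by auto
  then have "(?A *v V i y) $ j = axis i 1 $ j" for j
    unfolding Av dX_V[OF y] E_orthonormal[OF y] by (simp add: axis_def)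
  then show "?A *v V i y = axis i 1" unfolding vec_eq_iff by blast
qed (intro smooth_intros open_S')

sublocale fr: hypersurface_frame S "x \<circ> \<psi>" "N \<circ> \<psi>" "\<lambda>i. k i \<circ> \<psi>" E V \<epsilon>
proof
  show "open S" by (rule open_S')
  show "smooth_on S (x \<circ> \<psi>)" "smooth_on S (N \<circ> \<psi>)" "smooth_on S (k i \<circ> \<psi>)" for i
    by (rule smooth_points smooth_x smooth_N smooth_k)+
  show "smooth_on S (E i)" for i by (rule smooth_on_subset[OF smooth_E_UQ S_UQ])
  show "smooth_on S (V i)" for i by (rule smooth_V')
  show "\<epsilon> i * \<epsilon> i = 1" for i using eps_pm[of i] by auto
  fix y assume y: "y \<in> S"
  show "sprod (E i y) (E j y) = (if i = j then \<epsilon> i else 0)" for i j by (rule E_orthonormal[OF y])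
  show "sprod ((N \<circ> \<psi>) y) ((N \<circ> \<psi>) y) = 1" by (rule normal_at(1)[OF y])
  show "sprod ((N \<circ> \<psi>) y) (E i y) = 0" for i using normal_at(2)[OF y, of "V i y"] dX_V[OF y] by simp
  show "inj (frechet_derivative (x \<circ> \<psi>) (at y))" by (rule inj_dX'[OF y])
  show "along (V i) (x \<circ> \<psi>) y = E i y" for i using dX_V[OF y] by (simp add: along_def)
  show "along (V i) (N \<circ> \<psi>) y = - (k i \<circ> \<psi>) y *\<^sub>R E i y" for i
  proof -
    have d: "(N \<circ> \<psi>) differentiable (at (\<phi> (\<psi> y)))"
      using smooth_on_differentiable[OF smooth_points[OF smooth_N] y] S_point(3)[OF y] by simp
    have "dir_deriv A x N (\<psi> y) (E i y) = along (V i) (N \<circ> \<psi>) y"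
      using dir_deriv_in_chart[OF S_point(1)[OF y] d, of "V i y"] S_point(3)[OF y] dX_V[OF y] by (simp add: along_def)
    moreover have "shape_op A x N (\<psi> y) (E i y) = k i (\<psi> y) *\<^sub>R E i y"
      using principal[OF S_point(2)[OF y], of i] by (simp add: E_def)
    ultimately have "- along (V i) (N \<circ> \<psi>) y = k i (\<psi> y) *\<^sub>R E i y" by (simp add: shape_op_def)
    from arg_cong[OF this, of uminus] show ?thesis by simp
  qed
qed

lemma dir_deriv_frame:
  assumes y: "y \<in> S" and g: "smooth_on S (g \<circ> \<psi>)"
  shows "dir_deriv A x g (\<psi> y) (frechet_derivative (x \<circ> \<psi>) (at y) v) = frechet_derivative (g \<circ> \<psi>) (at y) v"
    "dir_deriv A x g (\<psi> y) (E i y) = fr.D i (g \<circ> \<psi>) y"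
proof -
  have d: "(g \<circ> \<psi>) differentiable (at (\<phi> (\<psi> y)))"
    using smooth_on_differentiable[OF g y] S_point(3)[OF y] by simp
  show *: "dir_deriv A x g (\<psi> y) (frechet_derivative (x \<circ> \<psi>) (at y) v) = frechet_derivative (g \<circ> \<psi>) (at y) v" for v
    using dir_deriv_in_chart[OF S_point(1)[OF y] d] S_point(3)[OF y] by simp
  show "dir_deriv A x g (\<psi> y) (E i y) = fr.D i (g \<circ> \<psi>) y"
    using *[of "V i y"] dX_V[OF y] by (simp add: along_def)
qed

lemma tangent_space_S: "y \<in> S \<Longrightarrow> tangent_space A x (\<psi> y) = range (frechet_derivative (x \<circ> \<psi>) (at y))"
  using tangent_space_in_chart[OF S_point(1), of y] S_point(3)[of y] by simp

lemma tangent_expansion: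
  assumes y: "y \<in> S"
  shows "v \<in> tangent_space A x (\<psi> y) \<longleftrightarrow> sprod v ((N \<circ> \<psi>) y) = 0"
    "sprod v ((N \<circ> \<psi>) y) = 0 \<Longrightarrow> v = (\<Sum>i\<in>UNIV. (\<epsilon> i * sprod v (E i y)) *\<^sub>R E i y)"
proof -
  show 1: "v = (\<Sum>i\<in>UNIV. (\<epsilon> i * sprod v (E i y)) *\<^sub>R E i y)" if "sprod v ((N \<circ> \<psi>) y) = 0"
    using fr.expansion[OF y, of v] that by simp
  note lX = fr.linear_frechet[OF fr.smooth_X y]
  show "v \<in> tangent_space A x (\<psi> y) \<longleftrightarrow> sprod v ((N \<circ> \<psi>) y) = 0"
  proof
    assume "v \<in> tangent_space A x (\<psi> y)"
    then show "sprod v ((N \<circ> \<psi>) y) = 0"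
      unfolding tangent_space_S[OF y] using normal_at(2)[OF y] sprod_commute[of v "(N \<circ> \<psi>) y"] by auto
  next
    assume "sprod v ((N \<circ> \<psi>) y) = 0"
    then have "v = frechet_derivative (x \<circ> \<psi>) (at y) (\<Sum>i\<in>UNIV. (\<epsilon> i * sprod v (E i y)) *\<^sub>R V i y)"
      using 1 by (simp add: linear_sum[OF lX] linear_scale[OF lX] dX_V[OF y])
    then show "v \<in> tangent_space A x (\<psi> y)" unfolding tangent_space_S[OF y] by (rule range_eqI)
  qed
qed

lemma linear_differential_x:
  assumes y: "y \<in> S"
  shows "linear (differential A x (\<psi> y))"
proof -
  obtain U' \<phi>' where c: "chart_at A (\<psi> y) = (U', \<phi>')" by (cases "chart_at A (\<psi> y)") auto
  have "\<exists>c. c \<in> A \<and> \<psi> y \<in> fst c" using UA S_point(1)[OF y] by (intro exI[of _ "(U, \<phi>)"]) auto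
  from someI_ex[OF this] have UA': "(U', \<phi>') \<in> A" "\<psi> y \<in> U'" using c by (auto simp: chart_at_def)
  have "smooth_on (\<phi>' ` (U' \<inter> points A)) (x \<circ> inv_into U' \<phi>')" using smooth_x UA'(1) by (auto simp: smooth_map_def)
  moreover have "\<phi>' (\<psi> y) \<in> \<phi>' ` (U' \<inter> points A)" using UA'(2) S_point(4)[OF y] by blast
  ultimately show ?thesis
    unfolding differential_def c using smooth_on_has_derivative has_derivative_linear by fastforce
qed

text \<open>The endomorphism need only be linear after composition with the differential of \<open>x\<close>: off the tangent space
  its values are arbitrary, because \<open>dir_deriv\<close> uses an inverse of a map that is not surjective.\<close>

lemma tangent_trace_frame:
  assumes y: "y \<in> S"
    and L: "\<And>v. L (frechet_derivative (x \<circ> \<psi>) (at y) v) = L' v" "linear L'" "\<And>v. sprod (L' v) ((N \<circ> \<psi>) y) = 0"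
  shows "tangent_trace A x (\<psi> y) L = (\<Sum>i\<in>UNIV. \<epsilon> i * sprod (L (E i y)) (E i y))"
  unfolding tangent_trace_def
proof (rule tangent_trace_orthonormal[where n="(N \<circ> \<psi>) y"])
  let ?dx = "differential A x (\<psi> y)"
  have q: "\<psi> y \<in> U" "\<phi> (\<psi> y) = y" by (rule S_point[OF y])+
  have dx: "?dx u = frechet_derivative (x \<circ> \<psi>) (at y) (transition (\<psi> y) u)" for u
    using differential_x[OF q(1)] q(2) by simp
  show lin: "linear ?dx" by (rule linear_differential_x[OF y])
  show "inj ?dx" by (rule immersion[OF S_point(4)[OF y]])
  show "E i y \<in> range ?dx" for i
    using E_in_tangent[OF y, of i] tangent_space_S[OF y] by (simp add: tangent_space_def)
  show "w = (\<Sum>i\<in>UNIV. (\<epsilon> i * sprod w (E i y)) *\<^sub>R E i y)" if "sprod w ((N \<circ> \<psi>) y) = 0" for w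
    by (rule tangent_expansion(2)[OF y that])
  show "sprod (E i y) (E j y) = (if i = j then \<epsilon> i else 0)" for i j by (rule E_orthonormal[OF y])
  show "\<epsilon> i * \<epsilon> i = 1" for i by (rule fr.eps)
  show "sprod (L (?dx u)) ((N \<circ> \<psi>) y) = 0" for u unfolding dx L(1) by (rule L(3))
  note lX = fr.linear_frechet[OF fr.smooth_X y]
  have "linear (transition (\<psi> y))"
  proof (rule linearI)
    show "transition (\<psi> y) (u + v) = transition (\<psi> y) u + transition (\<psi> y) v" for u v
      by (rule injD[OF inj_dX'[OF y]]) (simp add: dx[symmetric] linear_add[OF lX] linear_add[OF lin])
    show "transition (\<psi> y) (c *\<^sub>R u) = c *\<^sub>R transition (\<psi> y) u" for c u
      by (rule injD[OF inj_dX'[OF y]]) (simp add: dx[symmetric] linear_scale[OF lX] linear_scale[OF lin])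
  qed
  then have "linear (L' \<circ> transition (\<psi> y))" using L(2) by (rule linear_compose)
  moreover have "L' \<circ> transition (\<psi> y) = L \<circ> ?dx" by (simp add: fun_eq_iff dx L(1))
  ultimately show "linear (L \<circ> ?dx)" by simp
qed

lemma mean_curv_frame:
  assumes y: "y \<in> S"
  shows "mean_curv A x N (\<psi> y) = 1 / 4 * fr.trS y"
proof -
  let ?L = "\<lambda>v. - frechet_derivative (N \<circ> \<psi>) (at y) v"
  have sh: "shape_op A x N (\<psi> y) (frechet_derivative (x \<circ> \<psi>) (at y) v) = ?L v" for v
    using dir_deriv_frame(1)[OF y fr.smooth_N] by (simp add: shape_op_def)
  have lin: "linear ?L" using fr.linear_frechet[OF fr.smooth_N y] by (simp add: linear_compose_neg)
  have "sprod (?L v) ((N \<circ> \<psi>) y) = 0" for v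
  proof -
    have "((\<lambda>y. sprod ((N \<circ> \<psi>) y) ((N \<circ> \<psi>) y) - 1) has_derivative
       (\<lambda>v. sprod ((N \<circ> \<psi>) y) (frechet_derivative (N \<circ> \<psi>) (at y) v) + sprod (frechet_derivative (N \<circ> \<psi>) (at y) v) ((N \<circ> \<psi>) y) - 0)) (at y)"
      using has_derivative_diff[OF has_derivative_sprod[OF smooth_on_has_derivative[OF fr.smooth_N y] smooth_on_has_derivative[OF fr.smooth_N y]]
          has_derivative_const] by blast
    from derivative_locally_zero[OF open_S' y _ this] fr.N_N
    show ?thesis using sprod_commute[of "(N \<circ> \<psi>) y"] by simp
  qed
  from tangent_trace_frame[OF y sh lin this]
  have "tangent_trace A x (\<psi> y) (shape_op A x N (\<psi> y)) = (\<Sum>i\<in>UNIV. \<epsilon> i * sprod (shape_op A x N (\<psi> y) (E i y)) (E i y))" .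
  also have "\<dots> = (\<Sum>i\<in>UNIV. k i (\<psi> y))"
  proof (rule sum.cong[OF refl])
    fix i
    have "shape_op A x N (\<psi> y) (E i y) = k i (\<psi> y) *\<^sub>R E i y"
      using principal[OF S_point(2)[OF y], of i] by (simp add: E_def)
    then show "\<epsilon> i * sprod (shape_op A x N (\<psi> y) (E i y)) (E i y) = k i (\<psi> y)"
      using fr.E_E[OF y, of i i] fr.eps[of i] by (simp add: mult.left_commute[of "\<epsilon> i"])
  qed
  finally show ?thesis by (simp add: mean_curv_def fr.trS_def)
qed

lemma gradient_frame:
  assumes y: "y \<in> S" and g: "smooth_on S (g \<circ> \<psi>)"
  shows "gradient A x g (\<psi> y) = (\<Sum>i\<in>UNIV. (\<epsilon> i * fr.D i (g \<circ> \<psi>) y) *\<^sub>R E i y)"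
  unfolding gradient_def
proof (rule the_equality)
  let ?v = "\<Sum>i\<in>UNIV. (\<epsilon> i * fr.D i (g \<circ> \<psi>) y) *\<^sub>R E i y"
  have vE: "sprod ?v (E j y) = fr.D j (g \<circ> \<psi>) y" for j
    by (simp add: sprod_sum_left fr.E_E[OF y] if_distrib mult_ac cong: if_cong)
  have vN: "sprod ?v ((N \<circ> \<psi>) y) = 0" using fr.E_N[OF y] by (simp add: sprod_sum_left)
  note lg = fr.linear_frechet[OF g y] and lX = fr.linear_frechet[OF fr.smooth_X y]
  have "sprod ?v w = dir_deriv A x g (\<psi> y) w" if w: "w \<in> tangent_space A x (\<psi> y)" for w
  proof -
    have w_eq: "w = (\<Sum>i\<in>UNIV. (\<epsilon> i * sprod w (E i y)) *\<^sub>R E i y)"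
      using tangent_expansion[OF y] w by blast
    define c where "c i = \<epsilon> i * sprod w (E i y)" for i
    have c: "w = (\<Sum>i\<in>UNIV. c i *\<^sub>R E i y)" unfolding c_def by (rule w_eq)
    then have "w = frechet_derivative (x \<circ> \<psi>) (at y) (\<Sum>i\<in>UNIV. c i *\<^sub>R V i y)"
      by (simp add: linear_sum[OF lX] linear_scale[OF lX] dX_V[OF y])
    then have "dir_deriv A x g (\<psi> y) w = frechet_derivative (g \<circ> \<psi>) (at y) (\<Sum>i\<in>UNIV. c i *\<^sub>R V i y)"
      using dir_deriv_frame(1)[OF y g] by simp
    also have "\<dots> = (\<Sum>i\<in>UNIV. c i * fr.D i (g \<circ> \<psi>) y)"
      by (simp add: linear_sum[OF lg] linear_scale[OF lg] along_def)
    also have "\<dots> = sprod w ?v"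
    proof -
      have "sprod w u = (\<Sum>i\<in>UNIV. c i * sprod (E i y) u)" for u unfolding c by (simp add: sprod_sum_left)
      moreover have "sprod (E i y) ?v = fr.D i (g \<circ> \<psi>) y" for i using vE[of i] sprod_commute[of ?v "E i y"] by simp
      ultimately show ?thesis by presburger
    qed
    finally show ?thesis using sprod_commute[of w ?v] by simp
  qed
  then show "?v \<in> tangent_space A x (\<psi> y) \<and> (\<forall>w\<in>tangent_space A x (\<psi> y). sprod ?v w = dir_deriv A x g (\<psi> y) w)"
    using tangent_expansion(1)[OF y] vN by blast
  fix v assume v: "v \<in> tangent_space A x (\<psi> y) \<and> (\<forall>w\<in>tangent_space A x (\<psi> y). sprod v w = dir_deriv A x g (\<psi> y) w)"
  show "v = ?v"
  proof (rule fr.frame_eqI[OF y])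
    show "sprod v (E l y) = sprod ?v (E l y)" for l
      using v tangent_space_S[OF y] E_in_tangent[OF y, of l] dir_deriv_frame(2)[OF y g, of l] vE[of l] by auto
    show "sprod v ((N \<circ> \<psi>) y) = sprod ?v ((N \<circ> \<psi>) y)" using v tangent_expansion(1)[OF y] vN by simp
  qed
qed

lemma laplace_frame:
  assumes y: "y \<in> S" and g: "smooth_on S (g \<circ> \<psi>)"
  shows "laplace A x N g (\<psi> y) = fr.lap (g \<circ> \<psi>) y"
proof -
  define Y where "Y y = (\<Sum>j\<in>UNIV. (\<epsilon> j * fr.D j (g \<circ> \<psi>) y) *\<^sub>R E j y)" for y
  have smY: "smooth_on S Y" unfolding Y_def[abs_def] by (intro smooth_intros g)
  have eq: "(gradient A x g \<circ> \<psi>) z = Y z" if "z \<in> S" for z using gradient_frame[OF that g] by (simp add: Y_def)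
  have smG: "smooth_on S (gradient A x g \<circ> \<psi>)" by (rule smooth_on_cong[OF open_S' eq[symmetric] smY])
  have DG: "fr.D i (gradient A x g \<circ> \<psi>) y = fr.D i Y y" for i by (rule along_cong[OF open_S' y smG eq])
  let ?L = "\<lambda>v. tangential_part N (\<psi> y) (dir_deriv A x (gradient A x g) (\<psi> y) v)"
  let ?L' = "\<lambda>v. tangential_part N (\<psi> y) (frechet_derivative (gradient A x g \<circ> \<psi>) (at y) v)"
  note lG = fr.linear_frechet[OF smG y]
  have "linear ?L'"
    by (rule linearI) (simp_all add: tangential_part_def linear_add[OF lG] linear_scale[OF lG] algebra_simps)
  then have "tangent_trace A x (\<psi> y) ?L = (\<Sum>i\<in>UNIV. \<epsilon> i * sprod (?L (E i y)) (E i y))"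
    using fr.N_N[OF y] by (intro tangent_trace_frame[OF y, where L'="?L'"]) (simp_all add: dir_deriv_frame(1)[OF y smG] tangential_part_def)
  also have "\<dots> = (\<Sum>i\<in>UNIV. \<epsilon> i * sprod (fr.D i Y y) (E i y))"
    using fr.N_E[OF y] by (simp add: dir_deriv_frame(2)[OF y smG] tangential_part_def DG)
  also have "\<dots> = fr.lap (g \<circ> \<psi>) y"
    unfolding fr.lap_def
  proof (rule sum.cong[OF refl])
    fix i
    have sm1: "smooth_on S (\<lambda>y. \<epsilon> j * fr.D j (g \<circ> \<psi>) y)" for j by (intro smooth_intros g)
    have "fr.D i Y y = (\<Sum>j\<in>UNIV. fr.D i (\<lambda>y. (\<epsilon> j * fr.D j (g \<circ> \<psi>) y) *\<^sub>R E j y) y)"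
      unfolding Y_def[abs_def] by (rule along_sum[of _ S]) (intro smooth_intros sm1 y)+
    also have "\<dots> = (\<Sum>j\<in>UNIV. (\<epsilon> j * fr.D i (fr.D j (g \<circ> \<psi>)) y) *\<^sub>R E j y + (\<epsilon> j * fr.D j (g \<circ> \<psi>) y) *\<^sub>R fr.D i (E j) y)"
    proof (rule sum.cong[OF refl])
      fix j
      have "fr.D i (\<lambda>y. \<epsilon> j * fr.D j (g \<circ> \<psi>) y) y = \<epsilon> j * fr.D i (fr.D j (g \<circ> \<psi>)) y"
        by (rule along_cmult[of S]) (intro smooth_intros g y)+
      then show "fr.D i (\<lambda>y. (\<epsilon> j * fr.D j (g \<circ> \<psi>) y) *\<^sub>R E j y) y =
          (\<epsilon> j * fr.D i (fr.D j (g \<circ> \<psi>)) y) *\<^sub>R E j y + (\<epsilon> j * fr.D j (g \<circ> \<psi>) y) *\<^sub>R fr.D i (E j) y"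
        using along_scaleR[OF sm1 fr.smooth_E y] by simp
    qed
    finally have "sprod (fr.D i Y y) (E i y) = (\<Sum>j\<in>UNIV. (if j = i then fr.D i (fr.D i (g \<circ> \<psi>)) y else 0) + (\<epsilon> j * fr.b i j i y) * fr.D j (g \<circ> \<psi>) y)"
      by (auto simp: sprod_sum_left fr.E_E[OF y] fr.b_def mult_ac intro!: sum.cong)
    then show "\<epsilon> i * sprod (fr.D i Y y) (E i y) = \<epsilon> i *\<^sub>R (fr.D i (fr.D i (g \<circ> \<psi>)) y + (\<Sum>j\<in>UNIV. (\<epsilon> j * fr.b i j i y) *\<^sub>R fr.D j (g \<circ> \<psi>) y))"
      by (simp add: sum.distrib)
  qed
  finally show ?thesis by (simp add: laplace_def divergence_def)
qed

lemma vec_laplace_frame: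
  assumes y: "y \<in> S" and G: "smooth_on S (G \<circ> \<psi>)"
  shows "vec_laplace A x N G (\<psi> y) = fr.lap (G \<circ> \<psi>) y"
proof -
  have nth: "fr.D i (\<lambda>y. h y $ l) z = fr.D i h z $ l" if "smooth_on S h" "z \<in> S" for h :: "real^4 \<Rightarrow> real^5" and i l z
    by (rule along_linear[OF bounded_linear_vec_nth that])
  have "laplace A x N (\<lambda>q. G q $ l) (\<psi> y) = fr.lap (G \<circ> \<psi>) y $ l" for l
  proof -
    have comp: "(\<lambda>q. G q $ l) \<circ> \<psi> = (\<lambda>y. (G \<circ> \<psi>) y $ l)" by (simp add: fun_eq_iff)
    have sm: "smooth_on S ((\<lambda>q. G q $ l) \<circ> \<psi>)" unfolding comp by (intro smooth_intros G)
    have D1: "fr.D i ((\<lambda>q. G q $ l) \<circ> \<psi>) z = fr.D i (G \<circ> \<psi>) z $ l" if "z \<in> S" for i z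
      unfolding comp by (rule nth[OF G that])
    have "fr.D i (fr.D i ((\<lambda>q. G q $ l) \<circ> \<psi>)) y = fr.D i (\<lambda>z. fr.D i (G \<circ> \<psi>) z $ l) y" for i
      by (rule along_cong[OF open_S' y]) (auto intro: smooth_intros sm simp: D1)
    also have "fr.D i (\<lambda>z. fr.D i (G \<circ> \<psi>) z $ l) y = fr.D i (fr.D i (G \<circ> \<psi>)) y $ l" for i
      by (rule nth[OF _ y]) (intro smooth_intros G)
    finally show ?thesis
      using laplace_frame[OF y sm] D1[OF y] by (simp add: fr.lap_def)
  qed
  then show ?thesis by (simp add: vec_laplace_def vec_eq_iff)
qed

text \<open>The components of the bitension field \<open>lap (tr S N)\<close> are given by \<open>sprod_lap_trS_N\<close>.\<close>

lemma biconservative_frame: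
  assumes bic: "biconservative A x N" and y: "y \<in> S"
  shows "(2 * k l (\<psi> y) + fr.trS y) * fr.D l fr.trS y = 0"
proof -
  have eq: "fr.trS z *\<^sub>R (N \<circ> \<psi>) z = (vec_laplace A x N x \<circ> \<psi>) z" if "z \<in> S" for z
    using vec_laplace_frame[OF that fr.smooth_X] fr.lap_X[OF that] by simp
  have smf: "smooth_on S (\<lambda>z. fr.trS z *\<^sub>R (N \<circ> \<psi>) z)" by (intro smooth_intros)
  have sm: "smooth_on S (vec_laplace A x N x \<circ> \<psi>)" by (rule smooth_on_cong[OF open_S' eq smf])
  have Deq: "fr.D i (vec_laplace A x N x \<circ> \<psi>) z = fr.D i (\<lambda>z. fr.trS z *\<^sub>R (N \<circ> \<psi>) z) z" if "z \<in> S" for i z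
    by (rule along_cong[OF open_S' that smf eq, symmetric])
  have DDeq: "fr.D i (fr.D i (vec_laplace A x N x \<circ> \<psi>)) y = fr.D i (fr.D i (\<lambda>z. fr.trS z *\<^sub>R (N \<circ> \<psi>) z)) y" for i
    by (rule along_cong[OF open_S' y _ Deq]) (intro smooth_intros sm)
  have "fr.lap (vec_laplace A x N x \<circ> \<psi>) y = fr.lap (\<lambda>z. fr.trS z *\<^sub>R (N \<circ> \<psi>) z) y"
    unfolding fr.lap_def DDeq Deq[OF y] ..
  then have lap: "vec_laplace A x N (vec_laplace A x N x) (\<psi> y) = fr.lap (\<lambda>z. fr.trS z *\<^sub>R (N \<circ> \<psi>) z) y"
    using vec_laplace_frame[OF y sm] by simp
  have "tangential_part N (\<psi> y) (fr.lap (\<lambda>z. fr.trS z *\<^sub>R (N \<circ> \<psi>) z) y) = 0"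
    using bic S_point(4)[OF y] unfolding lap[symmetric] biconservative_def by blast
  then have "sprod (tangential_part N (\<psi> y) (fr.lap (\<lambda>z. fr.trS z *\<^sub>R (N \<circ> \<psi>) z) y)) (E l y) = 0" by simp
  then have "sprod (fr.lap (\<lambda>z. fr.trS z *\<^sub>R (N \<circ> \<psi>) z) y) (E l y) = 0"
    using fr.N_E[OF y, of l] by (simp add: tangential_part_def)
  then show ?thesis unfolding fr.sprod_lap_trS_N[OF y] by (auto simp: add_eq_0_iff)
qed

end

section \<open>The classification\<close>

theorem theorem3p14:
  fixes A :: "'m::{t2_space,second_countable_topology} chart4 set"
    and x N :: "'m \<Rightarrow> real^5"
    and k1 k2 k4 :: "'m \<Rightarrow> real"
  assumes hyp: "oriented_hypersurface_index2 A x N"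
    and bic: "biconservative A x N"
    and grad: "\<And>p. p \<in> points A \<Longrightarrow>
          gradient A x (mean_curv A x N) p \<noteq> 0 \<and> \<not> lightlike (gradient A x (mean_curv A x N) p)"
    and k_smooth: "smooth_map A (points A) k1" "smooth_map A (points A) k2"
          "smooth_map A (points A) k4"
    and k_nonzero: "\<And>p. p \<in> points A \<Longrightarrow> k1 p \<noteq> 0 \<and> k2 p \<noteq> 0 \<and> k4 p \<noteq> 0"
    and k_distinct: "\<And>p. p \<in> points A \<Longrightarrow> k1 p \<noteq> k2 p \<and> k1 p \<noteq> k4 p \<and> k4 p \<noteq> k2 p"
    and frame: "\<And>p. p \<in> points A \<Longrightarrow>
          \<exists>W e. open W \<and> p \<in> W \<and> W \<subseteq> points A \<and>
            orthonormal_tangent_frame A x W e \<and>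
            (\<forall>q\<in>W. e 1 q = gradient A x (mean_curv A x N) q /\<^sub>R pnorm (gradient A x (mean_curv A x N) q) \<and>
              shape_op A x N q (e 1 q) = k1 q *\<^sub>R e 1 q \<and>
              shape_op A x N q (e 2 q) = k2 q *\<^sub>R e 2 q \<and>
              shape_op A x N q (e 3 q) = k2 q *\<^sub>R e 3 q \<and>
              shape_op A x N q (e 4 q) = k4 q *\<^sub>R e 4 q)"
  shows "\<forall>p\<in>points A. \<exists>I. open I \<and> is_interval I \<and>
     ((\<exists>\<phi>1 \<phi>2. smooth_on I \<phi>1 \<and> smooth_on I \<phi>2 \<and>
         (((\<forall>s\<in>I. (deriv \<phi>1 s)\<^sup>2 - (deriv \<phi>2 s)\<^sup>2 = 1) \<and> congruent_near A x p I (family_i \<phi>1 \<phi>2)) \<or>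
          ((\<forall>s\<in>I. (deriv \<phi>1 s)\<^sup>2 - (deriv \<phi>2 s)\<^sup>2 = -1) \<and> congruent_near A x p I (family_ii \<phi>1 \<phi>2)) \<or>
          ((\<forall>s\<in>I. (deriv \<phi>1 s)\<^sup>2 - (deriv \<phi>2 s)\<^sup>2 = 1) \<and> congruent_near A x p I (family_iii \<phi>1 \<phi>2)) \<or>
          ((\<forall>s\<in>I. (deriv \<phi>1 s)\<^sup>2 + (deriv \<phi>2 s)\<^sup>2 = 1) \<and> congruent_near A x p I (family_iv \<phi>1 \<phi>2)) \<or>
          ((\<forall>s\<in>I. (deriv \<phi>1 s)\<^sup>2 - (deriv \<phi>2 s)\<^sup>2 = -1) \<and> congruent_near A x p I (family_v \<phi>1 \<phi>2)) \<or>
          ((\<forall>s\<in>I. (deriv \<phi>1 s)\<^sup>2 + (deriv \<phi>2 s)\<^sup>2 = 1) \<and> congruent_near A x p I (family_vi \<phi>1 \<phi>2)))) \<or>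
      (\<exists>a \<psi>. a \<noteq> 0 \<and> smooth_on I \<psi> \<and>
         (((\<forall>s\<in>I. 1 - 2 * deriv \<psi> s < 0) \<and> congruent_near A x p I (family_vii a \<psi>)) \<or>
          ((\<forall>s\<in>I. 1 + 2 * deriv \<psi> s < 0) \<and> congruent_near A x p I (family_viii a \<psi>)))))"
proof -
  have "some_family (congruent_near A x p)" if p: "p \<in> points A" for p
  proof -
    obtain U \<phi> where UA: "(U, \<phi>) \<in> A" "p \<in> U" using p by (auto simp: points_def)
    obtain Q e where Q: "open Q" "p \<in> Q" "Q \<subseteq> points A" and fr: "orthonormal_tangent_frame A x Q e"
      and e1: "\<And>q. q \<in> Q \<Longrightarrow> e 1 q = gradient A x (mean_curv A x N) q /\<^sub>R pnorm (gradient A x (mean_curv A x N) q)"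
      and sh: "\<And>q. q \<in> Q \<Longrightarrow> shape_op A x N q (e 1 q) = k1 q *\<^sub>R e 1 q \<and> shape_op A x N q (e 2 q) = k2 q *\<^sub>R e 2 q \<and>
                shape_op A x N q (e 3 q) = k2 q *\<^sub>R e 3 q \<and> shape_op A x N q (e 4 q) = k4 q *\<^sub>R e 4 q"
      using frame[OF p] by metis
    define k where "k i = (if i = (1::4) then k1 else if i = 4 then k4 else k2)" for i
    have k_simps [simp]: "k 1 = k1" "k 2 = k2" "k 3 = k2" "k 4 = k4" by (simp_all add: k_def)
    note hyp' = hyp[unfolded oriented_hypersurface_index2_def]
    interpret framed_chart A x U \<phi> N e Q k p
    proof
      show "smooth_map A (points A) (k i)" for i using k_smooth by (simp add: k_def)
      show "shape_op A x N q (e (frame_index i) q) = k i q *\<^sub>R e (frame_index i) q" if "q \<in> Q" for q i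
        using sh[OF that] exhaust_4[of i] by (auto simp: frame_index_def k_def)
    qed (use hyp' UA Q fr in auto)
    have E1: "E 1 y = gradient A x (mean_curv A x N) (\<psi> y) /\<^sub>R pnorm (gradient A x (mean_curv A x N) (\<psi> y))" if "y \<in> S" for y
      using e1[OF S_point(2)[OF that]] by (simp add: E_def frame_index_def)
    have smf4: "smooth_on S (\<lambda>y. 1 / 4 * fr.trS y)" by (intro smooth_intros)
    have smH: "smooth_on S (mean_curv A x N \<circ> \<psi>)"
      by (rule smooth_on_cong[OF open_S' _ smf4]) (simp add: mean_curv_frame)
    have DH: "fr.D i (mean_curv A x N \<circ> \<psi>) y = 1 / 4 * fr.D i fr.trS y" if "y \<in> S" for i y
    proof -
      have "fr.D i (mean_curv A x N \<circ> \<psi>) y = fr.D i (\<lambda>y. 1 / 4 * fr.trS y) y"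
        by (rule along_cong[OF open_S' that smH]) (simp add: mean_curv_frame)
      then show ?thesis by (simp only: along_cmult[OF fr.smooth_trS that])
    qed
    have Da: "fr.D i fr.trS y = 0" if y: "y \<in> S" and i: "i \<noteq> 1" for i y
    proof -
      let ?g = "gradient A x (mean_curv A x N) (\<psi> y)"
      have "pnorm ?g \<noteq> 0" using E1[OF y] fr.E_E[OF y, of 1 1] by auto
      then have "?g = pnorm ?g *\<^sub>R E 1 y" using E1[OF y] by simp
      then have "sprod ?g (E i y) = 0" using fr.E_E[OF y, of 1 i] i by (metis mult_zero_right sprod_simps(5))
      moreover have "sprod ?g (E i y) = fr.D i (mean_curv A x N \<circ> \<psi>) y"
        unfolding gradient_frame[OF y smH] by (simp add: sprod_sum_left fr.E_E[OF y] if_distrib mult_ac cong: if_cong)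
      ultimately show ?thesis using DH[OF y] by simp
    qed
    have D1: "fr.D 1 fr.trS y \<noteq> 0" if y: "y \<in> S" for y
    proof
      assume "fr.D 1 fr.trS y = 0"
      then have "fr.D i (mean_curv A x N \<circ> \<psi>) y = 0" for i
        unfolding DH[OF y] using Da[OF y, of i] by (cases "i = 1") auto
      then have "gradient A x (mean_curv A x N) (\<psi> y) = 0" unfolding gradient_frame[OF y smH] by simp
      then show False using grad[OF S_point(4)[OF y]] by simp
    qed
    \<comment> \<open>the derivative of the trace along \<open>E 1\<close> does not vanish, so the other factor does\<close>
    have trS_k1: "fr.trS y = - 2 * k1 (\<psi> y)" if y: "y \<in> S" for y
      using biconservative_frame[OF bic y, of 1] D1[OF y] by simp
    have Dk1: "fr.D i (k1 \<circ> \<psi>) y = - 1 / 2 * fr.D i fr.trS y" if y: "y \<in> S" for i y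
    proof -
      have "fr.D i (k1 \<circ> \<psi>) y = fr.D i (\<lambda>y. - 1 / 2 * fr.trS y) y"
        by (rule along_cong[OF open_S' y]) (use fr.smooth_k[of 1] trS_k1 in auto)
      then show ?thesis by (simp only: along_cmult[OF fr.smooth_trS y])
    qed
    interpret ad: adapted_frame S "x \<circ> \<psi>" "N \<circ> \<psi>" "\<lambda>i. k i \<circ> \<psi>" E V \<epsilon>
    proof
      fix y assume y: "y \<in> S"
      note q = S_point(4)[OF y]
      show "(k i \<circ> \<psi>) y \<noteq> 0" for i using k_nonzero[OF q] by (simp add: k_def)
      show "(k 3 \<circ> \<psi>) y = (k 2 \<circ> \<psi>) y" "(k 1 \<circ> \<psi>) y \<noteq> (k 2 \<circ> \<psi>) y" "(k 1 \<circ> \<psi>) y \<noteq> (k 4 \<circ> \<psi>) y"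
        "(k 4 \<circ> \<psi>) y \<noteq> (k 2 \<circ> \<psi>) y" using k_distinct[OF q] by simp_all
      show "3 * (k 1 \<circ> \<psi>) y + 2 * (k 2 \<circ> \<psi>) y + (k 4 \<circ> \<psi>) y = 0"
        using trS_k1[OF y] by (simp add: fr.trS_def sum_4)
      show "fr.D i (k 1 \<circ> \<psi>) y = 0" if "i \<noteq> 1" for i using Dk1[OF y] Da[OF y that] by simp
      show "fr.D 1 (k 1 \<circ> \<psi>) y \<noteq> 0" using Dk1[OF y] D1[OF y] by simp
    qed
    have "S \<subseteq> \<phi> ` U" using S_UQ by auto
    then have cong: "congruent_near A x p I P" if "locally_parametrized S (x \<circ> \<psi>) (\<phi> p) I P" for I P
      using congruent_near_of_parametrized[OF atlas UA(1) Q(3) _ that[unfolded \<psi>_def]] by blast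
    show ?thesis by (rule some_family_mono[OF ad.classified[OF p_S] cong])
  qed
  then show ?thesis unfolding some_family_def by blast
qed

end
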